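(* Let $n\geq 3$ and $p\geq 1$ be integers. For all real numbers $k_1\in[0,n-1)$ and $k_2\in(-\infty,0]$, the connected sum of $p$ copies of $S^1\times S^{n-1}$ admits locally conformally flat metrics $g_1$ and $g_2$ such that $\mathrm{Ein}(g_1)>k_1$ and $\mathrm{ein}(g_2)<k_2$.
   Context: For a Riemannian metric $g$ on a closed connected $n$-manifold $M$ and $k\in\mathbb{R}$, set $\mathrm{Ein}_k(g):=\mathrm{Scal}\,g-k\,\mathrm{Ric}$, where $\mathrm{Ric}$ and $\mathrm{Scal}$ are the Ricci and scalar curvatures of $g$; $\mathrm{Ein}_k(g)>0$ means this symmetric 2-tensor is positive definite at every point. If the scalar curvature of $g$ is positive everywhere, $\mathrm{Ein}(g):=\sup\{k\in(0,n): \mathrm{Ein}_k(g)>0\}$; otherwise $\mathrm{Ein}(g):=0$. If the scalar curvature of $g$ is positive everywhere, $\mathrm{ein}(g):=\inf\{k<0: \mathrm{Ein}_k(g)>0\}$, with $\mathrm{ein}(g)=-\infty$ if this set is unbounded below; otherwise $\mathrm{ein}(g):=0$. *)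

theory Defs
  imports "HOL-Analysis.Analysis"
begin

section \<open>Smooth maps between open subsets of normed spaces\<close>

text \<open>On an open subset of a finite-dimensional space, a differentiable map all of whose
  directional derivatives are of class \<open>C\<^sup>k\<close> is exactly a map of class \<open>C\<^sup>k\<^sup>+\<^sup>1\<close>.\<close>

primrec Ck_on :: "nat \<Rightarrow> 'a::real_normed_vector set \<Rightarrow> ('a \<Rightarrow> 'b::real_normed_vector) \<Rightarrow> bool"
where
  "Ck_on 0 S f \<longleftrightarrow> continuous_on S f"
| "Ck_on (Suc k) S f \<longleftrightarrow> (\<forall>x\<in>S. f differentiable (at x)) \<and>
     (\<forall>v. Ck_on k S (\<lambda>x. frechet_derivative f (at x) v))"

definition smooth_on :: "'a::real_normed_vector set \<Rightarrow> ('a \<Rightarrow> 'b::real_normed_vector) \<Rightarrow> bool"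
where
  "smooth_on S f \<longleftrightarrow> (\<forall>k. Ck_on k S f)"

definition jacobian :: "(real^'n \<Rightarrow> real^'m) \<Rightarrow> real^'n \<Rightarrow> real^'n^'m" where
  "jacobian f x = matrix (frechet_derivative f (at x))"

definition partial :: "'n::finite \<Rightarrow> (real^'n \<Rightarrow> real) \<Rightarrow> real^'n \<Rightarrow> real" where
  "partial i f x = frechet_derivative f (at x) (axis i 1)"


section \<open>Closed manifolds\<close>

type_synonym ('a, 'n) chart = "'a set \<times> ('a \<Rightarrow> real^'n)"

record ('a, 'n::finite) manifold =
  top_of :: "'a topology"
  atlas :: "('a, 'n) chart set"

definition is_chart :: "'a topology \<Rightarrow> ('a, 'n::finite) chart \<Rightarrow> bool" where
  "is_chart X = (\<lambda>(U, \<phi>). openin X U \<and> open (\<phi> ` U) \<and>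
     homeomorphic_map (subtopology X U) (top_of_set (\<phi> ` U)) \<phi>)"

definition transition :: "('a, 'n::finite) chart \<Rightarrow> ('a, 'n) chart \<Rightarrow> real^'n \<Rightarrow> real^'n" where
  "transition c d = snd d \<circ> inv_into (fst c) (snd c)"

text \<open>Second countability is automatic for a compact space covered by charts.\<close>

definition closed_connected_manifold :: "('a, 'n::finite) manifold \<Rightarrow> bool" where
  "closed_connected_manifold M \<longleftrightarrow>
     Hausdorff_space (top_of M) \<and> compact_space (top_of M) \<and> connected_space (top_of M) \<and>
     (\<forall>c\<in>atlas M. is_chart (top_of M) c) \<and>
     (\<Union>c\<in>atlas M. fst c) = topspace (top_of M) \<and>
     (\<forall>c\<in>atlas M. \<forall>d\<in>atlas M. smooth_on (snd c ` (fst c \<inter> fst d)) (transition c d))"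


section \<open>Riemannian metrics and their curvature\<close>

text \<open>A symmetric 2-tensor field is given by its component matrices in the charts of the atlas:
  \<open>g c x\<close> is the matrix at the point with coordinates \<open>x\<close> in the chart \<open>c\<close>.\<close>

type_synonym ('a, 'n) tensor2 = "('a, 'n) chart \<Rightarrow> real^'n \<Rightarrow> real^'n^'n"

definition pos_def :: "real^'n^'n \<Rightarrow> bool" where
  "pos_def A \<longleftrightarrow> transpose A = A \<and> (\<forall>v. v \<noteq> 0 \<longrightarrow> v \<bullet> (A *v v) > 0)"

definition pos_tensor :: "('a, 'n::finite) manifold \<Rightarrow> ('a, 'n) tensor2 \<Rightarrow> bool" where
  "pos_tensor M T \<longleftrightarrow> (\<forall>c\<in>atlas M. \<forall>x\<in>snd c ` fst c. pos_def (T c x))"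

definition riemannian_metric :: "('a, 'n::finite) manifold \<Rightarrow> ('a, 'n) tensor2 \<Rightarrow> bool" where
  "riemannian_metric M g \<longleftrightarrow>
     closed_connected_manifold M \<and>
     (\<forall>c\<in>atlas M. smooth_on (snd c ` fst c) (g c)) \<and>
     pos_tensor M g \<and>
     (\<forall>c\<in>atlas M. \<forall>d\<in>atlas M. \<forall>x\<in>snd c ` (fst c \<inter> fst d).
        g c x = transpose (jacobian (transition c d) x) ** g d (transition c d x)
                  ** jacobian (transition c d) x)"

text \<open>The following are local: \<open>h\<close> is the component matrix of a metric in one chart.
  \<open>christoffel h k i j\<close> is \<open>\<Gamma>\<^sup>k\<^sub>i\<^sub>j\<close>, and \<open>riemann h l k i j\<close> is the coefficient of \<open>\<partial>\<^sub>l\<close> in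
  \<open>R(\<partial>\<^sub>i, \<partial>\<^sub>j)\<partial>\<^sub>k\<close> where \<open>R(X, Y) = [\<nabla>\<^sub>X, \<nabla>\<^sub>Y] - \<nabla>\<^bsub>[X,Y]\<^esub>\<close>.
  The Ricci tensor is \<open>Ric(Y, Z) = tr (X \<mapsto> R(X, Y)Z)\<close>, which is positive on round spheres.\<close>

definition christoffel ::
  "(real^'n \<Rightarrow> real^'n^'n) \<Rightarrow> 'n::finite \<Rightarrow> 'n \<Rightarrow> 'n \<Rightarrow> real^'n \<Rightarrow> real" where
  "christoffel h k i j x =
     1/2 * (\<Sum>l\<in>UNIV. matrix_inv (h x) $ k $ l *
       (partial i (\<lambda>y. h y $ j $ l) x + partial j (\<lambda>y. h y $ i $ l) x
        - partial l (\<lambda>y. h y $ i $ j) x))"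

definition riemann ::
  "(real^'n \<Rightarrow> real^'n^'n) \<Rightarrow> 'n::finite \<Rightarrow> 'n \<Rightarrow> 'n \<Rightarrow> 'n \<Rightarrow> real^'n \<Rightarrow> real" where
  "riemann h l k i j x =
     partial i (christoffel h l j k) x - partial j (christoffel h l i k) x
     + (\<Sum>m\<in>UNIV. christoffel h l i m x * christoffel h m j k x
                  - christoffel h l j m x * christoffel h m i k x)"

definition ricci :: "(real^'n::finite \<Rightarrow> real^'n^'n) \<Rightarrow> real^'n \<Rightarrow> real^'n^'n" where
  "ricci h x = (\<chi> j k. \<Sum>i\<in>UNIV. riemann h i k i j x)"

definition scal :: "(real^'n::finite \<Rightarrow> real^'n^'n) \<Rightarrow> real^'n \<Rightarrow> real" where
  "scal h x = (\<Sum>j\<in>UNIV. \<Sum>k\<in>UNIV. matrix_inv (h x) $ j $ k * ricci h x $ j $ k)"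

definition Ein_tensor :: "real \<Rightarrow> ('a, 'n::finite) tensor2 \<Rightarrow> ('a, 'n) tensor2" where
  "Ein_tensor k g c x = scal (g c) x *\<^sub>R g c x - k *\<^sub>R ricci (g c) x"

definition pos_scal :: "('a, 'n::finite) manifold \<Rightarrow> ('a, 'n) tensor2 \<Rightarrow> bool" where
  "pos_scal M g \<longleftrightarrow> (\<forall>c\<in>atlas M. \<forall>x\<in>snd c ` fst c. scal (g c) x > 0)"

definition Ein_sup :: "('a, 'n::finite) manifold \<Rightarrow> ('a, 'n) tensor2 \<Rightarrow> real" where
  "Ein_sup M g = (if pos_scal M g
     then Sup {k. 0 < k \<and> k < real CARD('n) \<and> pos_tensor M (Ein_tensor k g)} else 0)"

definition ein_inf :: "('a, 'n::finite) manifold \<Rightarrow> ('a, 'n) tensor2 \<Rightarrow> ereal" where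
  "ein_inf M g = (if pos_scal M g
     then Inf (ereal ` {k. k < 0 \<and> pos_tensor M (Ein_tensor k g)}) else 0)"

text \<open>Every point has a neighbourhood \<open>W\<close> (read in a chart) on which \<open>g = e\<^sup>2\<^sup>f F\<^sup>*g\<^sub>0\<close> for a
  diffeomorphism \<open>F\<close> onto an open subset of Euclidean space \<open>(\<real>\<^sup>n, g\<^sub>0)\<close> and a smooth \<open>f\<close>.\<close>

definition locally_conformally_flat ::
  "('a, 'n::finite) manifold \<Rightarrow> ('a, 'n) tensor2 \<Rightarrow> bool" where
  "locally_conformally_flat M g \<longleftrightarrow>
     (\<forall>c\<in>atlas M. \<forall>x\<in>snd c ` fst c. \<exists>W (F :: real^'n \<Rightarrow> real^'n) (f :: real^'n \<Rightarrow> real).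
        open W \<and> x \<in> W \<and> W \<subseteq> snd c ` fst c \<and>
        inj_on F W \<and> open (F ` W) \<and> smooth_on W F \<and> smooth_on (F ` W) (inv_into W F) \<and>
        smooth_on W f \<and>
        (\<forall>y\<in>W. g c y = exp (2 * f y) *\<^sub>R (transpose (jacobian F y) ** jacobian F y)))"


section \<open>The product of a circle and a sphere\<close>

text \<open>The map \<open>polar\<close> is the composition of the diffeomorphism \<open>x \<mapsto> (ln |x|, x / |x|)\<close> from
  \<open>\<real>\<^sup>n - {0}\<close> onto \<open>\<real> \<times> S\<^sup>n\<^sup>-\<^sup>1\<close> with the covering map \<open>(t, y) \<mapsto> (e\<^sup>i\<^sup>t, y)\<close>. It is therefore a
  local diffeomorphism onto \<open>S\<^sup>1 \<times> S\<^sup>n\<^sup>-\<^sup>1\<close>, and its local inverses form an atlas of the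
  product smooth structure.\<close>

definition polar :: "real^'n \<Rightarrow> complex \<times> (real^'n)" where
  "polar x = (cis (ln (norm x)), x /\<^sub>R norm x)"

definition S1xS :: "(complex \<times> (real^'n), 'n::finite) manifold" where
  "S1xS = \<lparr> top_of = top_of_set (sphere 0 1 \<times> sphere 0 1),
            atlas = {(polar ` V, inv_into V polar) | V. open V \<and> 0 \<notin> V \<and> inj_on polar V} \<rparr>"


section \<open>Connected sums\<close>

text \<open>Let \<open>M1\<close> and \<open>M2\<close> have disjoint underlying sets, and let \<open>i1\<close> and \<open>i2\<close> embed the open ball of
  radius 2 about the origin into them. The connected sum is obtained from
  \<open>M1 - i1(cball 0 (1/2))\<close> and \<open>M2 - i2(cball 0 (1/2))\<close> by identifying \<open>i1 v\<close> with
  \<open>i2 (v / |v|\<^sup>2)\<close> whenever \<open>1/2 < |v| < 2\<close>. Instead of equivalence classes, the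
  representatives outside \<open>i1(cball 0 1)\<close> and outside \<open>i2(ball 0 1)\<close> are used as points;
  \<open>into1\<close> and \<open>into2\<close> are the resulting maps of the two pieces into the connected sum. Its
  topology is the final (gluing) topology, and its charts come from those of the pieces.\<close>

definition inversion :: "real^'n \<Rightarrow> real^'n" where
  "inversion v = v /\<^sub>R (norm v)\<^sup>2"

context
  fixes M1 :: "('a, 'n::finite) manifold" and i1 :: "real^'n \<Rightarrow> 'a"
    and M2 :: "('a, 'n) manifold" and i2 :: "real^'n \<Rightarrow> 'a"
begin

definition piece1 :: "'a set" where
  "piece1 = topspace (top_of M1) - i1 ` cball 0 (1/2)"

definition piece2 :: "'a set" where
  "piece2 = topspace (top_of M2) - i2 ` cball 0 (1/2)"

definition csum_points :: "'a set" where
  "csum_points =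
     (topspace (top_of M1) - i1 ` cball 0 1) \<union> (topspace (top_of M2) - i2 ` ball 0 1)"

definition into1 :: "'a \<Rightarrow> 'a" where
  "into1 m = (if m \<in> i1 ` cball 0 1 then i2 (inversion (inv_into (ball 0 2) i1 m)) else m)"

definition into2 :: "'a \<Rightarrow> 'a" where
  "into2 m = (if m \<in> i2 ` ball 0 1 then i1 (inversion (inv_into (ball 0 2) i2 m)) else m)"

definition csum_open :: "'a set \<Rightarrow> bool" where
  "csum_open W \<longleftrightarrow> W \<subseteq> csum_points \<and>
     openin (top_of M1) {m \<in> piece1. into1 m \<in> W} \<and>
     openin (top_of M2) {m \<in> piece2. into2 m \<in> W}"

lemma istopology_csum_open: "istopology csum_open"
proof -
  have int: "{m \<in> P. j m \<in> S \<inter> T} = {m \<in> P. j m \<in> S} \<inter> {m \<in> P. j m \<in> T}"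
    for P S T and j :: "'a \<Rightarrow> 'a" by auto
  have un: "{m \<in> P. j m \<in> \<Union>\<K>} = (\<Union>S\<in>\<K>. {m \<in> P. j m \<in> S})"
    for P \<K> and j :: "'a \<Rightarrow> 'a" by auto
  show ?thesis
    unfolding istopology_def csum_open_def int un by blast
qed

definition connected_sum :: "('a, 'n) manifold" where
  "connected_sum =
     \<lparr> top_of = topology csum_open,
       atlas = (\<lambda>(U, \<phi>). (into1 ` (U \<inter> piece1), \<phi> \<circ> inv_into piece1 into1)) ` atlas M1 \<union>
               (\<lambda>(U, \<phi>). (into2 ` (U \<inter> piece2), \<phi> \<circ> inv_into piece2 into2)) ` atlas M2 \<rparr>"

end

definition copy :: "nat \<Rightarrow> ('a, 'n::finite) manifold \<Rightarrow> (nat \<times> 'a, 'n) manifold" where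
  "copy j M = \<lparr> top_of = prod_topology (discrete_topology {j}) (top_of M),
                atlas = (\<lambda>(U, \<phi>). ({j} \<times> U, \<phi> \<circ> snd)) ` atlas M \<rparr>"

text \<open>Two disjoint discs in \<open>S\<^sup>1 \<times> S\<^sup>n\<^sup>-\<^sup>1\<close>: the images under \<open>polar\<close> of the balls of radius
  \<open>1/2\<close> about \<open>(1,\<dots>,1)\<close> and \<open>(-1,\<dots>,-1)\<close>, on whose union \<open>polar\<close> is injective. Since
  \<open>S\<^sup>1 \<times> S\<^sup>n\<^sup>-\<^sup>1\<close> is connected and has an orientation-reversing diffeomorphism, the choice of
  discs does not affect the diffeomorphism type of the connected sums below.\<close>

definition disc_out :: "real^'n \<Rightarrow> complex \<times> (real^'n)" where
  "disc_out v = polar (vec 1 + v /\<^sub>R 4)"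

definition disc_in :: "real^'n \<Rightarrow> complex \<times> (real^'n)" where
  "disc_in v = polar (- vec 1 + v /\<^sub>R 4)"

text \<open>\<open>csum_upto m\<close> is the connected sum of the \<open>m + 1\<close> copies of \<open>S\<^sup>1 \<times> S\<^sup>n\<^sup>-\<^sup>1\<close> numbered from
  \<open>0\<close> to \<open>m\<close>; the next copy is attached at the outgoing disc of the last one.\<close>

primrec csum_upto :: "nat \<Rightarrow> (nat \<times> complex \<times> (real^'n), 'n::finite) manifold" where
  "csum_upto 0 = copy 0 S1xS"
| "csum_upto (Suc m) =
     connected_sum (csum_upto m) (\<lambda>v. (m, disc_out v))
                   (copy (Suc m) S1xS) (\<lambda>v. (Suc m, disc_in v))"

text \<open>The connected sum of \<open>p\<close> copies, meaningful for \<open>p \<ge> 1\<close>.\<close>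

definition csum_S1xS :: "nat \<Rightarrow> (nat \<times> complex \<times> (real^'n), 'n::finite) manifold" where
  "csum_S1xS p = csum_upto (p - 1)"

end

theory Submission
  imports Defs
begin

text \<open>A single metric serves for \<open>g1\<close> and \<open>g2\<close>: a tensor field \<open>G\<close> on \<open>\<real>\<^sup>n - {0}\<close> that is invariant
  under multiplication by \<open>e\<^sup>2\<^sup>\<pi>\<close> and under the inversions that glue consecutive copies of
  \<open>S\<^sup>1 \<times> S\<^sup>n\<^sup>-\<^sup>1\<close>, so that it has the same component matrix in all charts of the connected sum.
  Near every point \<open>G\<close> is the pullback, by a local diffeomorphism, of one model metric
  \<open>hN = U(|z|\<^sup>2)\<^sup>-\<^sup>2 I\<close> on \<open>\<real>\<^sup>n\<close>, so local conformal flatness is clear and curvature conditions need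
  to be checked for \<open>hN\<close> only. The model consists of two punctured round spheres joined by a neck
  whose radial sectional curvatures are at least \<open>- \<epsilon>\<close> times the tangential ones, which makes
  \<open>Ein\<^sub>k\<close> positive for any given \<open>k < n - 1\<close> if \<open>\<epsilon>\<close> is small; the inversion exchanges the two spheres.
  A round sphere is homogeneous, so half of the neck can be attached to it about \<open>0\<close> and \<open>\<infinity>\<close> (to
  close up the circle) as well as about the centres of the two discs (to form the connected sum).\<close>

section \<open>Calculus of smooth maps\<close>

text \<open>The definitions prescribe the homothety factor e^(2 pi), coordinate discs of radius 1/2
  about a = \<open>vec 1\<close> and -a, and the gluing map v -> v/|v|^2 in the coordinates v = 4 (x
  - a) and v = 4 (x + a). The neck does not fit these data conformally: to join two spheres its
  radius needs a minimum, so its radial curvature is negative somewhere, and keeping that above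
  -\<epsilon> times the tangential one makes its logarithmic length grow like 1/\<epsilon>. The
  model is therefore pulled back by non-conformal local diffeomorphisms: radial stretchings and
  cut-off Moebius maps. Conformal flatness survives, as its definition admits any local
  diffeomorphism to Euclidean space; the curvature conditions survive by naturality, which is
  derived from the coordinate formulas. The bound n - 1 is that of the cylinder R x S^(n-1), where
  Ein_k has on the sphere factor the eigenvalue n - 1 - k up to a positive constant. The discs in
  the first and the last copy that are never glued do no harm: there the second sphere of the model,
  with its centre filled in, caps off the neck.\<close>

lemma Ck_on_cong:
  assumes "open S" "\<And>x. x \<in> S \<Longrightarrow> f x = g x" "Ck_on k S f"
  shows "Ck_on k S g"
  using assms(2,3)
proof (induction k arbitrary: f g)
  case 0
  then show ?case by (metis Ck_on.simps(1) continuous_on_cong)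
next
  case (Suc k)
  have d: "(g has_derivative frechet_derivative f (at x)) (at x)" if "x \<in> S" for x
    using Suc.prems that assms(1)
    by (metis Ck_on.simps(2) frechet_derivative_works has_derivative_transform_within_open)
  have "frechet_derivative g (at x) = frechet_derivative f (at x)" if "x \<in> S" for x
    using d[OF that] frechet_derivative_at by fastforce
  then have "Ck_on k S (\<lambda>x. frechet_derivative g (at x) v)" for v
    using Suc.IH[of "\<lambda>x. frechet_derivative f (at x) v" "\<lambda>x. frechet_derivative g (at x) v"] Suc.prems(2)
    by simp
  then show ?case using d by (auto simp: differentiable_def)
qed

text \<open>Uniqueness of derivatives lets an explicit formula stand in for
  \<open>frechet_derivative\<close>. Closure properties then become inductions on k in which the
  derivative is again built from functions of the same kind.\<close>

lemma Ck_on_SucI: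
  assumes "open S" "\<And>x. x \<in> S \<Longrightarrow> (f has_derivative f' x) (at x)" "\<And>v. Ck_on k S (\<lambda>x. f' x v)"
  shows "Ck_on (Suc k) S f"
proof -
  have "f' x = frechet_derivative f (at x)" if "x \<in> S" for x
    using frechet_derivative_at assms(2) that by blast
  then have "Ck_on k S (\<lambda>x. frechet_derivative f (at x) v)" for v
    using Ck_on_cong[OF assms(1) _ assms(3)[of v]] by simp
  then show ?thesis using assms(2) by (auto simp: differentiable_def)
qed

lemma Ck_on_SucD:
  assumes "Ck_on (Suc k) S f" "x \<in> S"
  shows "(f has_derivative frechet_derivative f (at x)) (at x)"
  using assms by (simp add: frechet_derivative_works)

lemma Ck_on_Suc_imp: "Ck_on (Suc k) S f \<Longrightarrow> Ck_on k S f"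
proof (induction k arbitrary: f)
  case 0
  then show ?case
    by (auto intro!: continuous_at_imp_continuous_on differentiable_imp_continuous_within)
next
  case (Suc k)
  then show ?case by (metis Ck_on.simps(2))
qed

lemma Ck_on_subset: "Ck_on k S f \<Longrightarrow> T \<subseteq> S \<Longrightarrow> Ck_on k T f"
  by (induction k arbitrary: f) (auto intro: continuous_on_subset)

text \<open>Derivatives are taken in the ambient space, so no openness of \<open>S\<close> is asked.
  Transition maps can thus be treated pointwise, without a separate argument that their domain is
  open.\<close>

lemma Ck_on_local:
  assumes "\<And>x. x \<in> S \<Longrightarrow> \<exists>W. open W \<and> x \<in> W \<and> Ck_on k W f"
  shows "Ck_on k S f"
  using assms
proof (induction k arbitrary: f)
  case 0
  have "isCont f x" if "x \<in> S" for x
    using 0[OF that] by (auto simp: continuous_on_eq_continuous_at)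
  then show ?case by (simp add: continuous_at_imp_continuous_on)
next
  case (Suc k)
  have "f differentiable (at x)" if "x \<in> S" for x
    using Suc.prems[OF that] by auto
  moreover have "Ck_on k S (\<lambda>x. frechet_derivative f (at x) v)" for v
  proof (rule Suc.IH)
    fix x assume "x \<in> S"
    then show "\<exists>W. open W \<and> x \<in> W \<and> Ck_on k W (\<lambda>x. frechet_derivative f (at x) v)"
      using Suc.prems[of x] by auto
  qed
  ultimately show ?case by auto
qed

lemma Ck_on_const: "Ck_on k S (\<lambda>x. c)"
  by (induction k arbitrary: c) auto

lemma Ck_on_bounded_linear:
  assumes "open S" "bounded_linear L" "Ck_on k S f"
  shows "Ck_on k S (\<lambda>x. L (f x))"
  using assms(3)
proof (induction k arbitrary: f)
  case 0
  then show ?case using assms(2) by (simp add: bounded_linear.continuous_on)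
next
  case (Suc k)
  show ?case
  proof (rule Ck_on_SucI[OF assms(1)])
    show "((\<lambda>x. L (f x)) has_derivative (\<lambda>v. L (frechet_derivative f (at x) v))) (at x)"
      if "x \<in> S" for x
      using bounded_linear.has_derivative[OF assms(2) Ck_on_SucD[OF Suc.prems that]] .
  qed (use Suc in auto)
qed

lemma Ck_on_add:
  assumes "open S" "Ck_on k S f" "Ck_on k S g"
  shows "Ck_on k S (\<lambda>x. f x + g x)"
  using assms(2,3)
proof (induction k arbitrary: f g)
  case 0
  then show ?case by (auto intro: continuous_intros)
next
  case (Suc k)
  show ?case
  proof (rule Ck_on_SucI[OF assms(1)])
    show "((\<lambda>x. f x + g x) has_derivative
        (\<lambda>v. frechet_derivative f (at x) v + frechet_derivative g (at x) v)) (at x)"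
      if "x \<in> S" for x
      using Suc.prems that by (intro has_derivative_add Ck_on_SucD)
  qed (use Suc in auto)
qed

lemma Ck_on_sum:
  assumes "open S" "\<And>i. i \<in> I \<Longrightarrow> Ck_on k S (f i)"
  shows "Ck_on k S (\<lambda>x. \<Sum>i\<in>I. f i x)"
  using assms(2)
  by (induction I rule: infinite_finite_induct) (auto intro: Ck_on_const Ck_on_add[OF assms(1)])

lemma Ck_on_bounded_bilinear:
  assumes "open S" "bounded_bilinear b" "Ck_on k S f" "Ck_on k S g"
  shows "Ck_on k S (\<lambda>x. b (f x) (g x))"
  using assms(3,4)
proof (induction k arbitrary: f g)
  case 0
  then show ?case using assms(2) by (simp add: bounded_bilinear.continuous_on)
next
  case (Suc k)
  show ?case
  proof (rule Ck_on_SucI[OF assms(1)])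
    show "((\<lambda>x. b (f x) (g x)) has_derivative
        (\<lambda>v. b (f x) (frechet_derivative g (at x) v) + b (frechet_derivative f (at x) v) (g x))) (at x)"
      if "x \<in> S" for x
      using Suc.prems that by (intro bounded_bilinear.FDERIV[OF assms(2)] Ck_on_SucD)
    show "Ck_on k S (\<lambda>x. b (f x) (frechet_derivative g (at x) v) + b (frechet_derivative f (at x) v) (g x))" for v
      using Suc.prems by (intro Ck_on_add assms Suc.IH Ck_on_Suc_imp[of k S f] Ck_on_Suc_imp[of k S g]) auto
  qed
qed

text \<open>The direction \<open>?f' x v\<close> in which \<open>g\<close> is differentiated moves
  with x. Expanding it in a basis turns the chain rule into a sum of products, to which the
  induction hypothesis and the bilinear rule apply.\<close>

lemma Ck_on_compose:
  fixes f :: "'a::real_normed_vector \<Rightarrow> 'b::euclidean_space"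
  assumes "open S" "open T" "f ` S \<subseteq> T" "Ck_on k S f" "Ck_on k T g"
  shows "Ck_on k S (\<lambda>x. g (f x))"
  using assms(4,5)
proof (induction k arbitrary: g)
  case 0
  then show ?case using assms(3) by (auto intro: continuous_on_compose2)
next
  case (Suc k)
  let ?f' = "\<lambda>x. frechet_derivative f (at x)" and ?g' = "\<lambda>x. frechet_derivative g (at x)"
  have lin: "?g' (f x) w = (\<Sum>b\<in>Basis. (w \<bullet> b) *\<^sub>R ?g' (f x) b)" if "x \<in> S" for x w
  proof -
    have l: "linear (?g' (f x))"
      using Suc.prems(2) that assms(3) by (auto intro!: linear_frechet_derivative)
    have "?g' (f x) w = ?g' (f x) (\<Sum>b\<in>Basis. (w \<bullet> b) *\<^sub>R b)"
      by (simp add: euclidean_representation)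
    also have "\<dots> = (\<Sum>b\<in>Basis. (w \<bullet> b) *\<^sub>R ?g' (f x) b)"
      by (simp add: linear_sum[OF l] linear_cmul[OF l])
    finally show ?thesis .
  qed
  show ?case
  proof (rule Ck_on_SucI[OF assms(1)])
    show "((\<lambda>x. g (f x)) has_derivative (\<lambda>v. ?g' (f x) (?f' x v))) (at x)" if "x \<in> S" for x
    proof -
      have "f x \<in> T" using that assms(3) by blast
      from diff_chain_at[OF Ck_on_SucD[OF Suc.prems(1) that] Ck_on_SucD[OF Suc.prems(2) this]]
      show ?thesis unfolding o_def .
    qed
    show "Ck_on k S (\<lambda>x. ?g' (f x) (?f' x v))" for v
    proof (rule Ck_on_cong[OF assms(1)])
      show "Ck_on k S (\<lambda>x. \<Sum>b\<in>Basis. (?f' x v \<bullet> b) *\<^sub>R ?g' (f x) b)"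
      proof (rule Ck_on_sum[OF assms(1)])
        fix b :: 'b
        have "Ck_on k S (\<lambda>x. ?f' x v \<bullet> b)"
          using Suc.prems(1) by (intro Ck_on_bounded_linear[OF assms(1) bounded_linear_inner_left]) simp
        moreover have "Ck_on k S (\<lambda>x. ?g' (f x) b)"
          by (rule Suc.IH[OF Ck_on_Suc_imp[OF Suc.prems(1)]]) (use Suc.prems(2) in simp)
        ultimately show "Ck_on k S (\<lambda>x. (?f' x v \<bullet> b) *\<^sub>R ?g' (f x) b)"
          by (rule Ck_on_bounded_bilinear[OF assms(1) bounded_bilinear_scaleR])
      qed
    qed (use lin in auto)
  qed
qed

section \<open>Closure properties of smooth functions\<close>

lemma smooth_on_const: "smooth_on S (\<lambda>x. c)"
  by (simp add: smooth_on_def Ck_on_const)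

lemma smooth_on_cong:
  "open S \<Longrightarrow> (\<And>x. x \<in> S \<Longrightarrow> f x = g x) \<Longrightarrow> smooth_on S f \<Longrightarrow> smooth_on S g"
  using Ck_on_cong[of S f g] by (simp add: smooth_on_def)

lemma smooth_on_subset: "smooth_on S f \<Longrightarrow> T \<subseteq> S \<Longrightarrow> smooth_on T f"
  using Ck_on_subset[of _ S f T] by (simp add: smooth_on_def)

lemma smooth_on_local:
  "(\<And>x. x \<in> S \<Longrightarrow> \<exists>W. open W \<and> x \<in> W \<and> smooth_on W f) \<Longrightarrow> smooth_on S f"
  unfolding smooth_on_def by (intro allI Ck_on_local) blast

lemma smooth_on_linear_comp:
  "open S \<Longrightarrow> bounded_linear L \<Longrightarrow> smooth_on S f \<Longrightarrow> smooth_on S (\<lambda>x. L (f x))"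
  by (simp add: smooth_on_def Ck_on_bounded_linear)

lemma smooth_on_bilinear_comp:
  "open S \<Longrightarrow> bounded_bilinear b \<Longrightarrow> smooth_on S f \<Longrightarrow> smooth_on S g
    \<Longrightarrow> smooth_on S (\<lambda>x. b (f x) (g x))"
  by (simp add: smooth_on_def Ck_on_bounded_bilinear)

lemma smooth_on_add:
  "open S \<Longrightarrow> smooth_on S f \<Longrightarrow> smooth_on S g \<Longrightarrow> smooth_on S (\<lambda>x. f x + g x)"
  by (simp add: smooth_on_def Ck_on_add)

lemma smooth_on_sum:
  "open S \<Longrightarrow> (\<And>i. i \<in> I \<Longrightarrow> smooth_on S (f i)) \<Longrightarrow> smooth_on S (\<lambda>x. \<Sum>i\<in>I. f i x)"
  by (simp add: smooth_on_def Ck_on_sum)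

lemma smooth_on_compose:
  fixes f :: "'a::real_normed_vector \<Rightarrow> 'b::euclidean_space"
  shows "open S \<Longrightarrow> open T \<Longrightarrow> f ` S \<subseteq> T \<Longrightarrow> smooth_on S f \<Longrightarrow> smooth_on T g
    \<Longrightarrow> smooth_on S (\<lambda>x. g (f x))"
  using Ck_on_compose[of S T f _ g] by (simp add: smooth_on_def)

lemma smooth_onD:
  assumes "smooth_on S f" "x \<in> S"
  shows "(f has_derivative frechet_derivative f (at x)) (at x)"
  using Ck_on_SucD[OF assms(1)[unfolded smooth_on_def, rule_format] assms(2)] .

lemma smooth_on_differentiable: "smooth_on S f \<Longrightarrow> x \<in> S \<Longrightarrow> f differentiable (at x)"
  by (rule differentiableI[OF smooth_onD])

lemma smooth_on_frechet_derivative: "smooth_on S f \<Longrightarrow> smooth_on S (\<lambda>x. frechet_derivative f (at x) v)"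
  unfolding smooth_on_def
proof
  fix k assume "\<forall>k. Ck_on k S f"
  then have "Ck_on (Suc k) S f" by blast
  then show "Ck_on k S (\<lambda>x. frechet_derivative f (at x) v)" by simp
qed

lemma smooth_on_continuous: "smooth_on S f \<Longrightarrow> continuous_on S f"
  using Ck_on.simps(1)[of S f] by (auto simp: smooth_on_def simp del: Ck_on.simps)

lemma smooth_on_linear:
  assumes "open S" "bounded_linear L" shows "smooth_on S L"
proof -
  have "Ck_on k S (\<lambda>x. x)" for k
  proof (cases k)
    case (Suc j)
    show ?thesis unfolding Suc
      by (rule Ck_on_SucI[OF assms(1)]) (auto intro: has_derivative_ident Ck_on_const)
  qed auto
  then have "smooth_on S (\<lambda>x. x)" by (simp add: smooth_on_def)
  from smooth_on_linear_comp[OF assms this] show ?thesis .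
qed

lemma smooth_on_ident: "open S \<Longrightarrow> smooth_on S (\<lambda>x. x)"
  using smooth_on_linear bounded_linear_ident by blast

lemma smooth_on_mult:
  fixes f g :: "'a::real_normed_vector \<Rightarrow> real"
  shows "open S \<Longrightarrow> smooth_on S f \<Longrightarrow> smooth_on S g \<Longrightarrow> smooth_on S (\<lambda>x. f x * g x)"
  by (rule smooth_on_bilinear_comp[OF _ bounded_bilinear_mult])

lemma smooth_on_scaleR:
  "open S \<Longrightarrow> smooth_on S f \<Longrightarrow> smooth_on S g \<Longrightarrow> smooth_on S (\<lambda>x. f x *\<^sub>R g x)"
  by (rule smooth_on_bilinear_comp[OF _ bounded_bilinear_scaleR])

lemma smooth_on_inner:
  "open S \<Longrightarrow> smooth_on S f \<Longrightarrow> smooth_on S g \<Longrightarrow> smooth_on S (\<lambda>x. f x \<bullet> g x)"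
  by (rule smooth_on_bilinear_comp[OF _ bounded_bilinear_inner])

lemma smooth_on_minus: "open S \<Longrightarrow> smooth_on S f \<Longrightarrow> smooth_on S (\<lambda>x. - f x)"
  by (rule smooth_on_linear_comp) (auto intro: bounded_linear_minus bounded_linear_ident)

lemma smooth_on_diff:
  "open S \<Longrightarrow> smooth_on S f \<Longrightarrow> smooth_on S g \<Longrightarrow> smooth_on S (\<lambda>x. f x - g x)"
  using smooth_on_add[of S f "\<lambda>x. - g x"] smooth_on_minus[of S g] by simp

lemma smooth_on_prod:
  fixes f :: "'i \<Rightarrow> 'a::real_normed_vector \<Rightarrow> real"
  assumes "open S" "\<And>i. i \<in> I \<Longrightarrow> smooth_on S (f i)"
  shows "smooth_on S (\<lambda>x. \<Prod>i\<in>I. f i x)"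
  using assms(2)
  by (induction I rule: infinite_finite_induct) (auto intro: smooth_on_const smooth_on_mult[OF assms(1)])

lemma smooth_on_vec:
  fixes f :: "'n::finite \<Rightarrow> 'a::real_normed_vector \<Rightarrow> 'b::euclidean_space"
  assumes "open S" "\<And>i. smooth_on S (f i)"
  shows "smooth_on S (\<lambda>x. \<chi> i. f i x)"
proof -
  have "bounded_linear (axis i :: 'b \<Rightarrow> 'b^'n)" for i
    by (intro linear_conv_bounded_linear[THEN iffD1] linearI)
      (auto simp: axis_def vec_eq_iff)
  then have "smooth_on S (\<lambda>x. \<Sum>i\<in>UNIV. axis i (f i x))"
    by (intro smooth_on_sum smooth_on_linear_comp[where L = "axis _"] assms)
  moreover have "(\<Sum>i\<in>UNIV. axis i (f i x)) = (\<chi> i. f i x)" for x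
    by (simp add: vec_eq_iff axis_def if_distrib[of "\<lambda>t. t $ _"] sum.delta' cong: if_cong)
  ultimately show ?thesis by simp
qed

lemma smooth_on_nth:
  "open S \<Longrightarrow> smooth_on S f \<Longrightarrow> smooth_on S (\<lambda>x. f x $ i)"
  by (rule smooth_on_linear_comp[OF _ bounded_linear_vec_nth])

lemma bounded_bilinear_matrix_vector:
  "bounded_bilinear (\<lambda>(A::real^'n^'m) x. A *v x)"
  by (subst bilinear_conv_bounded_bilinear[symmetric])
    (simp add: bilinear_def linear_iff vec_eq_iff matrix_vector_mult_def sum.distrib
      sum_distrib_left algebra_simps)

lemma bounded_bilinear_matrix_matrix:
  "bounded_bilinear (\<lambda>(A::real^'n^'m) (B::real^'k^'n). A ** B)"
  by (subst bilinear_conv_bounded_bilinear[symmetric])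
    (simp add: bilinear_def linear_iff vec_eq_iff matrix_matrix_mult_def sum.distrib
      sum_distrib_left algebra_simps)

lemma bounded_linear_transpose: "bounded_linear (transpose :: real^'n^'m \<Rightarrow> real^'m^'n)"
  by (intro linear_conv_bounded_linear[THEN iffD1] linearI) (auto simp: transpose_def vec_eq_iff)

lemma smooth_on_matrix_vector:
  "open S \<Longrightarrow> smooth_on S A \<Longrightarrow> smooth_on S x \<Longrightarrow> smooth_on S (\<lambda>y. A y *v (x y :: real^'n))"
  by (rule smooth_on_bilinear_comp[OF _ bounded_bilinear_matrix_vector])

lemma smooth_on_matrix_matrix:
  "open S \<Longrightarrow> smooth_on S A \<Longrightarrow> smooth_on S B \<Longrightarrow> smooth_on S (\<lambda>y. (A y :: real^'n^'m) ** B y)"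
  by (rule smooth_on_bilinear_comp[OF _ bounded_bilinear_matrix_matrix])

lemma smooth_on_transpose:
  "open S \<Longrightarrow> smooth_on S A \<Longrightarrow> smooth_on S (\<lambda>y. transpose (A y :: real^'n^'m))"
  by (rule smooth_on_linear_comp[OF _ bounded_linear_transpose])

lemma smooth_on_real_derivI:
  fixes f :: "real \<Rightarrow> real"
  assumes "open S" "\<And>x. x \<in> S \<Longrightarrow> (f has_real_derivative f' x) (at x)" "smooth_on S f'"
  shows "smooth_on S f"
proof -
  have "Ck_on k S f" for k
  proof (cases k)
    case 0
    then show ?thesis using assms(2)
      by (auto intro!: continuous_at_imp_continuous_on DERIV_isCont)
  next
    case (Suc j)
    show ?thesis unfolding Suc
    proof (rule Ck_on_SucI[OF assms(1)])
      show "(f has_derivative (\<lambda>v. v * f' x)) (at x)" if "x \<in> S" for x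
        using assms(2)[OF that] by (simp add: has_field_derivative_def mult_commute_abs)
      have "smooth_on S (\<lambda>x. v * f' x)" for v
        by (intro smooth_on_mult assms smooth_on_const)
      then show "Ck_on j S (\<lambda>x. v * f' x)" for v
        unfolding smooth_on_def by blast
    qed
  qed
  then show ?thesis by (simp add: smooth_on_def)
qed

lemma smooth_on_real_deriv:
  fixes f :: "real \<Rightarrow> real"
  assumes "open S" "smooth_on S f"
  shows "\<And>x. x \<in> S \<Longrightarrow> (f has_real_derivative deriv f x) (at x)" "smooth_on S (deriv f)"
proof -
  show d: "(f has_real_derivative deriv f x) (at x)" if "x \<in> S" for x
    using smooth_on_differentiable[OF assms(2) that] by (simp add: DERIV_deriv_iff_real_differentiable)
  have "frechet_derivative f (at x) 1 = deriv f x" if "x \<in> S" for x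
    using frechet_derivative_at[OF d[OF that, unfolded has_field_derivative_def]] by (metis mult.right_neutral)
  then show "smooth_on S (deriv f)"
    using smooth_on_cong[OF assms(1) _ smooth_on_frechet_derivative[OF assms(2), of 1]] by simp
qed

text \<open>A family of functions closed under differentiation up to smooth operations: each member
  \<open>f\<close> of class \<open>C\<^sup>k\<close> has derivative obtained from \<open>f\<close> itself, so \<open>C\<^sup>k\<close> bootstraps.\<close>

lemma smooth_on_bootstrap:
  fixes f :: "real \<Rightarrow> real"
  assumes "open S" "\<And>x. x \<in> S \<Longrightarrow> (f has_real_derivative f' x) (at x)"
    and "\<And>k. Ck_on k S f \<Longrightarrow> Ck_on k S f'"
  shows "smooth_on S f"
proof -
  have "Ck_on k S f" for k
  proof (induction k)
    case 0
    then show ?case using assms(2) by (auto intro!: continuous_at_imp_continuous_on DERIV_isCont)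
  next
    case (Suc k)
    show ?case
    proof (rule Ck_on_SucI[OF assms(1)])
      show "(f has_derivative (\<lambda>v. v * f' x)) (at x)" if "x \<in> S" for x
        using assms(2)[OF that] by (simp add: has_field_derivative_def mult_commute_abs)
      show "Ck_on k S (\<lambda>x. v * f' x)" for v
        by (intro Ck_on_bounded_linear[OF assms(1) bounded_linear_mult_right] assms(3)[OF Suc.IH])
    qed
  qed
  then show ?thesis by (simp add: smooth_on_def)
qed

lemma smooth_on_inverse_real: "smooth_on (- {0::real}) inverse"
proof (rule smooth_on_bootstrap)
  show "open (- {0::real})" by auto
  then show "Ck_on k (- {0}) (\<lambda>x::real. - (inverse x * inverse x))" if "Ck_on k (- {0}) (inverse::real\<Rightarrow>real)" for k
    using that by (intro Ck_on_bounded_linear[OF _ bounded_linear_minus[OF bounded_linear_ident]]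
         Ck_on_bounded_bilinear[OF _ bounded_bilinear_mult])
qed (auto intro!: derivative_eq_intros)

lemma smooth_on_exp_real: "smooth_on (UNIV::real set) exp"
  by (rule smooth_on_bootstrap[where f' = exp]) (auto intro!: derivative_eq_intros)

lemma smooth_on_ln_real: "smooth_on {0::real<..} ln"
  by (rule smooth_on_real_derivI[where f' = inverse])
    (auto intro!: derivative_eq_intros smooth_on_subset[OF smooth_on_inverse_real] simp: divide_inverse)

lemma smooth_on_inverse:
  fixes f :: "'a::real_normed_vector \<Rightarrow> real"
  shows "open S \<Longrightarrow> smooth_on S f \<Longrightarrow> (\<And>x. x \<in> S \<Longrightarrow> f x \<noteq> 0) \<Longrightarrow> smooth_on S (\<lambda>x. inverse (f x))"
  by (rule smooth_on_compose[OF _ _ _ _ smooth_on_inverse_real]) auto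

lemma smooth_on_divide:
  fixes f g :: "'a::real_normed_vector \<Rightarrow> real"
  shows "open S \<Longrightarrow> smooth_on S f \<Longrightarrow> smooth_on S g \<Longrightarrow> (\<And>x. x \<in> S \<Longrightarrow> g x \<noteq> 0) \<Longrightarrow> smooth_on S (\<lambda>x. f x / g x)"
  unfolding divide_inverse by (intro smooth_on_mult smooth_on_inverse)

lemma smooth_on_exp:
  fixes f :: "'a::real_normed_vector \<Rightarrow> real"
  shows "open S \<Longrightarrow> smooth_on S f \<Longrightarrow> smooth_on S (\<lambda>x. exp (f x))"
  by (rule smooth_on_compose[OF _ _ _ _ smooth_on_exp_real]) auto

lemma smooth_on_ln:
  fixes f :: "'a::real_normed_vector \<Rightarrow> real"
  shows "open S \<Longrightarrow> smooth_on S f \<Longrightarrow> (\<And>x. x \<in> S \<Longrightarrow> f x > 0) \<Longrightarrow> smooth_on S (\<lambda>x. ln (f x))"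
  by (rule smooth_on_compose[OF _ _ _ _ smooth_on_ln_real]) auto

lemma smooth_on_power:
  fixes f :: "'a::real_normed_vector \<Rightarrow> real"
  shows "open S \<Longrightarrow> smooth_on S f \<Longrightarrow> smooth_on S (\<lambda>x. f x ^ m)"
  by (induction m) (auto intro: smooth_on_const smooth_on_mult)

text \<open>The norm is avoided by ln |f| = ln (f \<bullet> f) / 2.\<close>

lemma smooth_on_ln_norm:
  fixes f :: "'a::real_normed_vector \<Rightarrow> 'b::euclidean_space"
  assumes "open S" "smooth_on S f" "\<And>x. x \<in> S \<Longrightarrow> f x \<noteq> 0"
  shows "smooth_on S (\<lambda>x. ln (norm (f x)))"
proof -
  have "smooth_on S (\<lambda>x. ln (f x \<bullet> f x) / 2)"
    using assms by (intro smooth_on_divide smooth_on_ln smooth_on_inner smooth_on_const) auto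
  moreover have "ln (f x \<bullet> f x) / 2 = ln (norm (f x))" if "x \<in> S" for x
    using assms(3)[OF that] by (simp add: dot_square_norm ln_realpow)
  ultimately show ?thesis by (rule smooth_on_cong[OF assms(1), rotated])
qed

section \<open>Smooth matrix-valued functions and Jacobians\<close>

lemma smooth_on_det:
  fixes A :: "'a::real_normed_vector \<Rightarrow> real^'n^'n"
  assumes "open S" "smooth_on S A"
  shows "smooth_on S (\<lambda>x. det (A x))"
  unfolding det_def
  using assms by (intro smooth_on_sum smooth_on_mult smooth_on_const smooth_on_prod smooth_on_nth)

lemma matrix_inv_mult:
  fixes A :: "real^'n^'n"
  assumes "det A \<noteq> 0"
  shows "A ** matrix_inv A = mat 1" "matrix_inv A ** A = mat 1"
proof -
  have "\<exists>B. A ** B = mat 1 \<and> B ** A = mat 1"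
    using assms invertible_det_nz invertible_def by blast
  from someI_ex[OF this] show "A ** matrix_inv A = mat 1" "matrix_inv A ** A = mat 1"
    by (auto simp: matrix_inv_def)
qed

lemma matrix_inv_unique:
  fixes A :: "real^'n^'n"
  assumes "A ** B = mat 1"
  shows "matrix_inv A = B"
proof -
  have "det A \<noteq> 0" using assms invertible_det_nz invertible_right_inverse by blast
  then show ?thesis
    by (metis assms matrix_inv_mult(2) matrix_mul_assoc matrix_mul_lid matrix_mul_rid)
qed

text \<open>By Cramer's rule the entries of the inverse are quotients of determinants.\<close>

lemma smooth_on_matrix_inv:
  fixes A :: "'a::real_normed_vector \<Rightarrow> real^'n^'n"
  assumes "open S" "smooth_on S A" "\<And>x. x \<in> S \<Longrightarrow> det (A x) \<noteq> 0"
  shows "smooth_on S (\<lambda>x. matrix_inv (A x))"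
proof -
  let ?c = "\<lambda>x k l. det (\<chi> i j. if j = k then axis l 1 $ i else A x $ i $ j) / det (A x)"
  have num: "smooth_on S (\<lambda>x. \<chi> i j. if j = k then axis l 1 $ i else A x $ i $ j)" for k l
  proof (intro smooth_on_vec assms)
    show "smooth_on S (\<lambda>x. if j = k then axis l 1 $ i else A x $ i $ j)" for i j
      using assms by (cases "j = k") (auto intro: smooth_on_const smooth_on_nth)
  qed
  have "smooth_on S (\<lambda>x. ?c x k l)" for k l
    by (rule smooth_on_divide[OF assms(1) smooth_on_det[OF assms(1) num] smooth_on_det[OF assms(1,2)] assms(3)])
  then have "smooth_on S (\<lambda>x. \<chi> k l. ?c x k l)"
    by (intro smooth_on_vec assms(1))
  moreover have "(\<chi> k l. ?c x k l) = matrix_inv (A x)" if "x \<in> S" for x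
  proof -
    have "A x *v (matrix_inv (A x) *v axis l 1) = axis l 1" for l
      using matrix_inv_mult(1)[OF assms(3)[OF that]] by (simp add: matrix_vector_mul_assoc)
    then have "matrix_inv (A x) *v axis l 1 = (\<chi> k. ?c x k l)" for l
      using cramer[OF assms(3)[OF that], of "matrix_inv (A x) *v axis l 1" "axis l 1"] by simp
    moreover have "matrix_inv (A x) $ k $ l = (matrix_inv (A x) *v axis l 1) $ k" for k l
      by (simp add: matrix_vector_mult_basis column_def)
    ultimately have "matrix_inv (A x) $ k $ l = ?c x k l" for k l
      by simp
    then show ?thesis by (simp add: vec_eq_iff)
  qed
  ultimately show ?thesis by (rule smooth_on_cong[OF assms(1), rotated])
qed

lemma smooth_on_jacobian:
  assumes "open S" "smooth_on S f"
  shows "smooth_on S (jacobian f)"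
proof -
  have "jacobian f = (\<lambda>x. \<chi> i j. frechet_derivative f (at x) (axis j 1) $ i)"
    by (simp add: jacobian_def matrix_def fun_eq_iff)
  then show ?thesis
    using assms by (simp add: smooth_on_vec smooth_on_nth smooth_on_frechet_derivative)
qed

lemma jacobian_mult:
  "f differentiable (at x) \<Longrightarrow> jacobian f x *v v = frechet_derivative f (at x) v"
  unfolding jacobian_def by (simp add: linear_frechet_derivative)

lemma jacobian_eqI:
  assumes "(f has_derivative (*v) A) (at x)" shows "jacobian f x = A"
  using frechet_derivative_at[OF assms] unfolding jacobian_def by (metis matrix_of_matrix_vector_mul)

lemma jacobian_has_derivative:
  assumes "f differentiable (at x)" shows "(f has_derivative (*v) (jacobian f x)) (at x)"
proof -
  have "(*v) (jacobian f x) = frechet_derivative f (at x)"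
    using jacobian_mult[OF assms] by blast
  then show ?thesis using assms by (simp add: frechet_derivative_works)
qed

lemma jacobian_compose:
  assumes "f differentiable (at x)" "g differentiable (at (f x))"
  shows "jacobian (\<lambda>y. g (f y)) x = jacobian g (f x) ** jacobian f x"
proof (rule jacobian_eqI)
  show "((\<lambda>y. g (f y)) has_derivative (*v) (jacobian g (f x) ** jacobian f x)) (at x)"
    using diff_chain_at[OF jacobian_has_derivative[OF assms(1)] jacobian_has_derivative[OF assms(2)]]
    by (simp add: o_def matrix_vector_mul_assoc)
qed


section \<open>Symmetry of second derivatives\<close>

text \<open>The mean value theorem is applied twice to the second difference over the parallelogram
  spanned by h X and h Y: along X to the difference of two opposite sides, then along Y to the
  X-derivative.\<close>

lemma second_difference_mvt:
  fixes f :: "'a::real_normed_vector \<Rightarrow> real"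
  assumes "h > 0"
    and seg: "\<And>s t. 0 \<le> s \<Longrightarrow> s \<le> h \<Longrightarrow> 0 \<le> t \<Longrightarrow> t \<le> h \<Longrightarrow> x + s *\<^sub>R X + t *\<^sub>R Y \<in> S"
    and d1: "\<And>y. y \<in> S \<Longrightarrow> (f has_derivative f' y) (at y)"
    and d2: "\<And>y. y \<in> S \<Longrightarrow> ((\<lambda>z. f' z X) has_derivative g y) (at y)"
  shows "\<exists>s t. 0 < s \<and> s < h \<and> 0 < t \<and> t < h \<and>
    f (x + h *\<^sub>R X + h *\<^sub>R Y) - f (x + h *\<^sub>R X) - f (x + h *\<^sub>R Y) + f x
      = h\<^sup>2 * g (x + s *\<^sub>R X + t *\<^sub>R Y) Y"
proof -
  let ?p = "\<lambda>s. f (x + s *\<^sub>R X + h *\<^sub>R Y) - f (x + s *\<^sub>R X + 0 *\<^sub>R Y)"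
  let ?q = "\<lambda>s. f' (x + s *\<^sub>R X + h *\<^sub>R Y) X - f' (x + s *\<^sub>R X + 0 *\<^sub>R Y) X"
  have dX: "((\<lambda>s. f (x + s *\<^sub>R X + t *\<^sub>R Y)) has_real_derivative f' (x + s *\<^sub>R X + t *\<^sub>R Y) X) (at s)"
    if "0 \<le> s" "s \<le> h" "0 \<le> t" "t \<le> h" for s t
  proof -
    have l: "((\<lambda>s. x + s *\<^sub>R X + t *\<^sub>R Y) has_derivative (\<lambda>r. r *\<^sub>R X)) (at s)"
      by (auto intro!: derivative_eq_intros)
    have "linear (f' (x + s *\<^sub>R X + t *\<^sub>R Y))"
      using d1[OF seg[OF that]] has_derivative_linear by blast
    then have "f' (x + s *\<^sub>R X + t *\<^sub>R Y) (r *\<^sub>R X) = r * f' (x + s *\<^sub>R X + t *\<^sub>R Y) X" for r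
      by (simp add: linear_cmul)
    then show ?thesis
      using diff_chain_at[OF l d1[OF seg[OF that]]]
      by (simp add: o_def has_field_derivative_def mult_commute_abs)
  qed
  have dY: "((\<lambda>t. f' (x + s *\<^sub>R X + t *\<^sub>R Y) X) has_real_derivative g (x + s *\<^sub>R X + t *\<^sub>R Y) Y) (at t)"
    if "0 \<le> s" "s \<le> h" "0 \<le> t" "t \<le> h" for s t
  proof -
    have l: "((\<lambda>t. x + s *\<^sub>R X + t *\<^sub>R Y) has_derivative (\<lambda>r. r *\<^sub>R Y)) (at t)"
      by (auto intro!: derivative_eq_intros)
    have "linear (g (x + s *\<^sub>R X + t *\<^sub>R Y))"
      using d2[OF seg[OF that]] has_derivative_linear by blast
    then have "g (x + s *\<^sub>R X + t *\<^sub>R Y) (r *\<^sub>R Y) = r * g (x + s *\<^sub>R X + t *\<^sub>R Y) Y" for r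
      by (simp add: linear_cmul)
    then show ?thesis
      using diff_chain_at[OF l d2[OF seg[OF that]]]
      by (simp add: o_def has_field_derivative_def mult_commute_abs)
  qed
  have "\<exists>s. 0 < s \<and> s < h \<and> ?p h - ?p 0 = (h - 0) * ?q s"
    using assms(1) by (intro MVT2 DERIV_diff dX) auto
  then obtain s where s: "0 < s" "s < h" "?p h - ?p 0 = h * ?q s" by auto
  have "\<exists>t. 0 < t \<and> t < h \<and> f' (x + s *\<^sub>R X + h *\<^sub>R Y) X - f' (x + s *\<^sub>R X + 0 *\<^sub>R Y) X
      = (h - 0) * g (x + s *\<^sub>R X + t *\<^sub>R Y) Y"
    using assms(1) s by (intro MVT2[where f = "\<lambda>t. f' (x + s *\<^sub>R X + t *\<^sub>R Y) X"] dY) auto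
  then obtain t where t: "0 < t" "t < h" "?q s = h * g (x + s *\<^sub>R X + t *\<^sub>R Y) Y" by auto
  have "?p h - ?p 0 = h\<^sup>2 * g (x + s *\<^sub>R X + t *\<^sub>R Y) Y"
    using s(3) t(3) by (simp add: power2_eq_square)
  then show ?thesis using s t by (intro exI[of _ s] exI[of _ t]) (simp add: algebra_simps)
qed

text \<open>The second difference does not change when X and Y are exchanged, so one iterated
  derivative at some point near x equals the other one at another point near x. By continuity the
  two cannot differ at x.\<close>

lemma second_derivative_symmetric_real:
  fixes f :: "'a::real_normed_vector \<Rightarrow> real"
  assumes "open S" "smooth_on S f" "x \<in> S"
  shows "frechet_derivative (\<lambda>y. frechet_derivative f (at y) X) (at x) Y
       = frechet_derivative (\<lambda>y. frechet_derivative f (at y) Y) (at x) X"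
proof (rule ccontr)
  define D where "D = (\<lambda>X Y y. frechet_derivative (\<lambda>y. frechet_derivative f (at y) X) (at y) Y)"
  assume "\<not> ?thesis"
  then have pos: "\<bar>D X Y x - D Y X x\<bar> / 2 > 0" (is "?e > 0") by (simp add: D_def)
  have cont: "continuous_on S (D X Y)" for X Y
    unfolding D_def by (intro smooth_on_continuous smooth_on_frechet_derivative assms)
  have near: "\<exists>d>0. \<forall>y. dist y x < d \<longrightarrow> \<bar>D X Y y - D X Y x\<bar> < ?e" for X Y
    using cont[of X Y] assms(1,3) pos
    by (metis continuous_on_eq_continuous_at continuous_at_eps_delta dist_commute dist_real_def)
  obtain d1 where d1: "d1 > 0" "\<And>y. dist y x < d1 \<Longrightarrow> \<bar>D X Y y - D X Y x\<bar> < ?e" using near by blast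
  obtain d2 where d2: "d2 > 0" "\<And>y. dist y x < d2 \<Longrightarrow> \<bar>D Y X y - D Y X x\<bar> < ?e" using near by blast
  obtain d3 where d3: "d3 > 0" "ball x d3 \<subseteq> S" using assms openE by blast
  define d where "d = min d1 (min d2 d3)"
  have d: "d > 0" using d1 d2 d3 by (simp add: d_def)
  \<comment> \<open>Keeps the parallelogram within d/2 of x; the summand 1 covers X = Y = 0.\<close>
  define h where "h = d / (2 * (norm X + norm Y + 1))"
  have n1: "0 < norm X + norm Y + 1" by (smt (verit) norm_ge_zero)
  have h: "h > 0" unfolding h_def using d n1 by simp
  have small: "dist (x + s *\<^sub>R X + t *\<^sub>R Y) x < d" if "0 \<le> s" "s \<le> h" "0 \<le> t" "t \<le> h" for s t
  proof -
    have "dist (x + s *\<^sub>R X + t *\<^sub>R Y) x = norm (s *\<^sub>R X + t *\<^sub>R Y)"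
      by (simp add: dist_norm algebra_simps)
    also have "\<dots> \<le> s * norm X + t * norm Y"
      using norm_triangle_ineq[of "s *\<^sub>R X" "t *\<^sub>R Y"] that by simp
    also have "\<dots> \<le> h * norm X + h * norm Y"
      using that by (intro add_mono mult_right_mono) auto
    also have "\<dots> \<le> h * (norm X + norm Y + 1)" using h by (simp add: algebra_simps)
    also have "\<dots> = d / 2" unfolding h_def using n1 by (simp add: divide_simps)
    finally show ?thesis using d by simp
  qed
  then have inS: "x + s *\<^sub>R X + t *\<^sub>R Y \<in> S" if "0 \<le> s" "s \<le> h" "0 \<le> t" "t \<le> h" for s t
    using d3(2) that by (force simp: d_def dist_commute)
  then have inS': "x + s *\<^sub>R Y + t *\<^sub>R X \<in> S" if "0 \<le> s" "s \<le> h" "0 \<le> t" "t \<le> h" for s t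
    using inS[of t s] that by (simp add: add.assoc add.commute[of "s *\<^sub>R Y"])
  have e1: "(f has_derivative frechet_derivative f (at y)) (at y)" if "y \<in> S" for y
    by (rule smooth_onD[OF assms(2) that])
  have e2: "((\<lambda>y. frechet_derivative f (at y) X) has_derivative (\<lambda>Y. D X Y y)) (at y)" if "y \<in> S" for X y
    unfolding D_def by (rule smooth_onD[OF smooth_on_frechet_derivative[OF assms(2)] that])
  obtain s t where 1: "0 < s" "s < h" "0 < t" "t < h"
    "f (x + h *\<^sub>R X + h *\<^sub>R Y) - f (x + h *\<^sub>R X) - f (x + h *\<^sub>R Y) + f x = h\<^sup>2 * D X Y (x + s *\<^sub>R X + t *\<^sub>R Y)"
    using second_difference_mvt[OF h inS e1 e2] by blast
  obtain s' t' where 2: "0 < s'" "s' < h" "0 < t'" "t' < h"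
    "f (x + h *\<^sub>R Y + h *\<^sub>R X) - f (x + h *\<^sub>R Y) - f (x + h *\<^sub>R X) + f x = h\<^sup>2 * D Y X (x + s' *\<^sub>R Y + t' *\<^sub>R X)"
    using second_difference_mvt[OF h inS' e1 e2] by blast
  have "f (x + h *\<^sub>R Y + h *\<^sub>R X) = f (x + h *\<^sub>R X + h *\<^sub>R Y)" by (simp add: add_ac)
  then have "h\<^sup>2 * D X Y (x + s *\<^sub>R X + t *\<^sub>R Y) = h\<^sup>2 * D Y X (x + s' *\<^sub>R Y + t' *\<^sub>R X)"
    using 1(5) 2(5) by linarith
  then have eq: "D X Y (x + s *\<^sub>R X + t *\<^sub>R Y) = D Y X (x + s' *\<^sub>R Y + t' *\<^sub>R X)"
    using h by simp
  have "dist (x + s *\<^sub>R X + t *\<^sub>R Y) x < d1" using small[of s t] 1 by (simp add: d_def)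
  moreover have "dist (x + s' *\<^sub>R Y + t' *\<^sub>R X) x < d2"
    using small[of t' s'] 2 by (simp add: d_def add.assoc add.commute[of "s' *\<^sub>R Y"])
  ultimately show False using d1(2) d2(2) eq by (smt (verit) field_sum_of_halves)
qed

lemma frechet_derivative_linear_comp:
  assumes "bounded_linear L" "f differentiable (at x)"
  shows "frechet_derivative (\<lambda>y. L (f y)) (at x) v = L (frechet_derivative f (at x) v)"
proof -
  have "((\<lambda>y. L (f y)) has_derivative (\<lambda>v. L (frechet_derivative f (at x) v))) (at x)"
    using assms by (intro bounded_linear.has_derivative[OF assms(1)]) (simp add: frechet_derivative_works)
  from frechet_derivative_at[OF this] show ?thesis by metis
qed

lemma second_derivative_symmetric:
  fixes f :: "'a::real_normed_vector \<Rightarrow> 'b::euclidean_space"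
  assumes "open S" "smooth_on S f" "x \<in> S"
  shows "frechet_derivative (\<lambda>y. frechet_derivative f (at y) X) (at x) Y
       = frechet_derivative (\<lambda>y. frechet_derivative f (at y) Y) (at x) X"
proof (rule euclidean_eqI)
  fix b :: 'b
  have sm: "smooth_on S (\<lambda>y. f y \<bullet> b)"
    by (rule smooth_on_linear_comp[OF assms(1) bounded_linear_inner_left assms(2)])
  have 1: "frechet_derivative (\<lambda>y. f y \<bullet> b) (at y) X = frechet_derivative f (at y) X \<bullet> b" if "y \<in> S" for X y
    by (rule frechet_derivative_linear_comp[OF bounded_linear_inner_left smooth_on_differentiable[OF assms(2) that]])
  have 2: "frechet_derivative (\<lambda>y. frechet_derivative f (at y) X) (at x) Y \<bullet> b
      = frechet_derivative (\<lambda>y. frechet_derivative (\<lambda>y. f y \<bullet> b) (at y) X) (at x) Y" for X Y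
  proof -
    have d: "(\<lambda>y. frechet_derivative f (at y) X) differentiable (at x)"
      by (rule smooth_on_differentiable[OF smooth_on_frechet_derivative[OF assms(2)] assms(3)])
    have d': "(\<lambda>y. frechet_derivative f (at y) X \<bullet> b) differentiable (at x)"
      by (rule smooth_on_differentiable[OF smooth_on_linear_comp[OF assms(1) bounded_linear_inner_left
            smooth_on_frechet_derivative[OF assms(2)]] assms(3)])
    have "frechet_derivative (\<lambda>y. frechet_derivative f (at y) X) (at x) Y \<bullet> b
        = frechet_derivative (\<lambda>y. frechet_derivative f (at y) X \<bullet> b) (at x) Y"
      by (rule frechet_derivative_linear_comp[OF bounded_linear_inner_left d, symmetric])
    also have "\<dots> = frechet_derivative (\<lambda>y. frechet_derivative (\<lambda>y. f y \<bullet> b) (at y) X) (at x) Y"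
      using frechet_derivative_transform_within_open[OF d' assms(1,3)] 1 by metis
    finally show ?thesis .
  qed
  show "frechet_derivative (\<lambda>y. frechet_derivative f (at y) X) (at x) Y \<bullet> b
      = frechet_derivative (\<lambda>y. frechet_derivative f (at y) Y) (at x) X \<bullet> b"
    unfolding 2 by (rule second_derivative_symmetric_real[OF assms(1) sm assms(3)])
qed

section \<open>Smooth inverse functions\<close>

text \<open>The inverse function theorem yields a differentiable local inverse g whose derivative at
  y is the inverse matrix of the Jacobian of f at g y. If g is of class C^k, so is this expression,
  hence g is of class C^(k+1).\<close>

lemma smooth_inverse_function:
  fixes f :: "real^'n \<Rightarrow> real^'n"
  assumes "open S" "smooth_on S f" "x \<in> S" "det (jacobian f x) \<noteq> 0"
  shows "\<exists>W. open W \<and> x \<in> W \<and> W \<subseteq> S \<and> inj_on f W \<and> open (f ` W) \<and> smooth_on (f ` W) (inv_into W f)"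
proof -
  let ?J = "\<lambda>y. Blinfun ((*v) (jacobian f y))"
  have ap: "blinfun_apply (?J y) = (*v) (jacobian f y)" for y
    by (rule bounded_linear_Blinfun_apply) simp
  define S' where "S' = {y \<in> S. det (jacobian f y) \<noteq> 0}"
  have opS': "open S'"
  proof -
    have "continuous_on S (\<lambda>y. det (jacobian f y))"
      by (intro smooth_on_continuous smooth_on_det smooth_on_jacobian assms)
    moreover have "S' = S \<inter> (\<lambda>y. det (jacobian f y)) -` (- {0})" by (auto simp: S'_def)
    ultimately show ?thesis by (metis assms(1) continuous_on_open_vimage open_Compl closed_singleton Int_commute)
  qed
  have S'S: "S' \<subseteq> S" and xS': "x \<in> S'" using assms by (auto simp: S'_def)
  have sm: "smooth_on S' f" using assms(2) S'S by (rule smooth_on_subset)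
  have der: "(f has_derivative (*v) (jacobian f y)) (at y)" if "y \<in> S'" for y
    by (rule jacobian_has_derivative[OF smooth_on_differentiable[OF sm that]])
  have contJ: "continuous_on S' ?J"
  proof (rule continuous_on_blinfun_componentwise)
    fix i :: "real^'n"
    show "continuous_on S' (\<lambda>y. blinfun_apply (?J y) i)"
      unfolding ap by (intro smooth_on_continuous smooth_on_matrix_vector smooth_on_jacobian smooth_on_const opS' sm)
  qed
  let ?inv = "Blinfun ((*v) (matrix_inv (jacobian f x)))"
  have inv: "?inv o\<^sub>L ?J x = id_blinfun"
  proof (rule blinfun_eqI)
    fix v
    have "blinfun_apply ?inv = (*v) (matrix_inv (jacobian f x))"
      by (rule bounded_linear_Blinfun_apply) simp
    then show "blinfun_apply (?inv o\<^sub>L ?J x) v = blinfun_apply id_blinfun v"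
      by (simp add: ap matrix_vector_mul_assoc matrix_inv_mult(2)[OF assms(4)])
  qed
  obtain W V g g' where W: "open W" "W \<subseteq> S'" "x \<in> W" "open V" "f x \<in> V" "homeomorphism W V f g"
    and g: "\<And>y. y \<in> V \<Longrightarrow> (g has_derivative (g' y)) (at y)"
    "\<And>y. y \<in> V \<Longrightarrow> g' y = inv (blinfun_apply (?J (g y)))"
  proof (rule inverse_function_theorem[OF opS' _ contJ xS' inv])
    show "(f has_derivative blinfun_apply (?J y)) (at y)" if "y \<in> S'" for y
      unfolding ap by (rule der[OF that])
  qed (rule that)
  have fW: "f ` W = V" and gV: "g ` V = W" and gf: "\<And>y. y \<in> W \<Longrightarrow> g (f y) = y"
    using W(6) by (auto simp: homeomorphism_def)
  have injf: "inj_on f W" using gf by (metis inj_onI)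
  have g'eq: "g' y = (*v) (matrix_inv (jacobian f (g y)))" if "y \<in> V" for y
  proof -
    have "g y \<in> S'" using that gV W(2) by auto
    then have d: "det (jacobian f (g y)) \<noteq> 0" by (simp add: S'_def)
    show ?thesis unfolding g(2)[OF that] ap
      by (rule inv_unique_comp)
        (auto simp: fun_eq_iff matrix_vector_mul_assoc matrix_inv_mult[OF d])
  qed
  have "Ck_on k V g" for k
  proof (induction k)
    case 0
    show ?case using W(6) by (simp add: homeomorphism_def)
  next
    case (Suc k)
    show ?case
    proof (rule Ck_on_SucI[OF W(4) g(1)])
      fix v
      have "smooth_on S' (\<lambda>y. matrix_inv (jacobian f y) *v v)"
        by (intro smooth_on_matrix_vector smooth_on_matrix_inv smooth_on_jacobian smooth_on_const opS' sm)
          (simp add: S'_def)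
      then have "Ck_on k V (\<lambda>y. matrix_inv (jacobian f (g y)) *v v)"
        using Ck_on_compose[OF W(4) opS' _ Suc.IH, of "\<lambda>y. matrix_inv (jacobian f y) *v v"] gV W(2)
        by (simp add: smooth_on_def)
      then show "Ck_on k V (\<lambda>y. g' y v)"
        using Ck_on_cong[OF W(4)] g'eq by (smt (verit, best))
    qed
  qed
  then have "smooth_on V g" by (simp add: smooth_on_def)
  moreover have "g y = inv_into W f y" if "y \<in> V" for y
    using that fW gf injf by (metis imageE inv_into_f_f)
  ultimately have "smooth_on V (inv_into W f)"
    using smooth_on_cong[OF W(4)] by blast
  then show ?thesis using W injf fW S'S by (intro exI[of _ W]) auto
qed

section \<open>Curvature of pulled back metrics\<close>

definition pullback :: "(real^'n \<Rightarrow> real^'n) \<Rightarrow> (real^'n \<Rightarrow> real^'n^'n) \<Rightarrow> real^'n \<Rightarrow> real^'n^'n" where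
  "pullback F h x = transpose (jacobian F x) ** h (F x) ** jacobian F x"

text \<open>The Christoffel symbols as a vector-valued bilinear map \<Gamma>(X, Y); with it the
  transformation laws can be computed without indices.\<close>

definition chr :: "(real^'n::finite \<Rightarrow> real^'n^'n) \<Rightarrow> real^'n \<Rightarrow> real^'n \<Rightarrow> real^'n \<Rightarrow> real^'n" where
  "chr h x X Y = (\<chi> k. \<Sum>i\<in>UNIV. \<Sum>j\<in>UNIV. christoffel h k i j x * X $ i * Y $ j)"

definition metric_on :: "(real^'n) set \<Rightarrow> (real^'n \<Rightarrow> real^'n^'n) \<Rightarrow> bool" where
  "metric_on W h \<longleftrightarrow> open W \<and> smooth_on W h \<and> (\<forall>x\<in>W. transpose (h x) = h x \<and> det (h x) \<noteq> 0)"

lemma sum_rotate3: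
  "(\<Sum>l\<in>A. \<Sum>i\<in>B. \<Sum>j\<in>C. f l i j) = (\<Sum>i\<in>B. \<Sum>j\<in>C. \<Sum>l\<in>A. (f l i j :: 'a::comm_monoid_add))"
  by (subst sum.swap, rule sum.cong[OF refl], rule sum.swap)

lemma vec_sum_axis: "(\<Sum>i\<in>UNIV. X $ i *\<^sub>R axis i 1) = (X :: real^'n)"
  by (simp add: vec_eq_iff axis_def if_distrib[of "\<lambda>t. _ * t"] sum.delta' cong: if_cong)

lemma linear_sum_axis:
  assumes "linear L" shows "L X = (\<Sum>i\<in>UNIV. X $ i *\<^sub>R L (axis i (1::real)))"
proof -
  have "L X = L (\<Sum>i\<in>UNIV. X $ i *\<^sub>R axis i 1)" by (simp only: vec_sum_axis)
  also have "\<dots> = (\<Sum>i\<in>UNIV. X $ i *\<^sub>R L (axis i 1))"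
    by (simp add: linear_sum[OF assms] linear_cmul[OF assms])
  finally show ?thesis .
qed

lemma trilinear_sum:
  fixes L :: "real^'n \<Rightarrow> real^'n^'n"
  assumes "linear L"
  shows "Y \<bullet> (L X *v Z) = (\<Sum>i\<in>UNIV. \<Sum>j\<in>UNIV. \<Sum>l\<in>UNIV. X $ i * Y $ j * Z $ l * L (axis i 1) $ j $ l)"
proof -
  have "L X $ j $ l = (\<Sum>i\<in>UNIV. X $ i * L (axis i 1) $ j $ l)" for j l
    by (subst linear_sum_axis[OF assms]) simp
  then have "Y \<bullet> (L X *v Z) = (\<Sum>j\<in>UNIV. \<Sum>l\<in>UNIV. \<Sum>i\<in>UNIV. X $ i * Y $ j * Z $ l * L (axis i 1) $ j $ l)"
    by (simp add: inner_vec_def matrix_vector_mult_def sum_distrib_left sum_distrib_right mult_ac)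
  also have "\<dots> = (\<Sum>i\<in>UNIV. \<Sum>j\<in>UNIV. \<Sum>l\<in>UNIV. X $ i * Y $ j * Z $ l * L (axis i 1) $ j $ l)"
    by (rule sum_rotate3[symmetric])
  finally show ?thesis .
qed

lemma metric_onD:
  assumes "metric_on W h" "x \<in> W"
  shows "open W" "smooth_on W h" "transpose (h x) = h x" "det (h x) \<noteq> 0" "h differentiable (at x)"
    "linear (frechet_derivative h (at x))"
  using assms smooth_on_differentiable linear_frechet_derivative unfolding metric_on_def by blast+

lemma partial_nth:
  fixes h :: "real^'n::finite \<Rightarrow> real^'n^'n"
  assumes "h differentiable (at x)"
  shows "partial i (\<lambda>y. h y $ j $ l) x = frechet_derivative h (at x) (axis i 1) $ j $ l"
proof -
  have "bounded_linear (\<lambda>A::real^'n^'n. A $ j $ l)"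
    by (intro bounded_linear_compose[OF bounded_linear_vec_nth bounded_linear_vec_nth])
  from frechet_derivative_linear_comp[OF this assms] show ?thesis by (simp add: partial_def)
qed

text \<open>The Koszul formula for constant vector fields: pairing with a further vector Z through
  the metric removes the inverse matrix from the Christoffel symbols.\<close>

lemma chr_koszul:
  assumes "metric_on W h" "x \<in> W"
  shows "Z \<bullet> (h x *v chr h x X Y) = 1/2 * (Y \<bullet> (frechet_derivative h (at x) X *v Z)
     + X \<bullet> (frechet_derivative h (at x) Y *v Z) - X \<bullet> (frechet_derivative h (at x) Z *v Y))"
proof -
  note m = metric_onD[OF assms]
  let ?D = "\<lambda>i. frechet_derivative h (at x) (axis i 1)"
  define c where "c = (\<lambda>l i j. 1/2 * (?D i $ j $ l + ?D j $ i $ l - ?D l $ i $ j))"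
  define w where "w = (\<chi> l. \<Sum>i\<in>UNIV. \<Sum>j\<in>UNIV. c l i j * X $ i * Y $ j)"
  have ch: "christoffel h k i j x = (\<Sum>l\<in>UNIV. matrix_inv (h x) $ k $ l * c l i j)" for k i j
    unfolding christoffel_def c_def partial_nth[OF m(5)] by (simp add: sum_distrib_left mult_ac)
  have "chr h x X Y = matrix_inv (h x) *v w"
  proof (rule vec_eq_iff[THEN iffD2], rule allI)
    fix k
    have "(matrix_inv (h x) *v w) $ k = (\<Sum>l\<in>UNIV. \<Sum>i\<in>UNIV. \<Sum>j\<in>UNIV. matrix_inv (h x) $ k $ l * c l i j * X $ i * Y $ j)"
      by (simp add: matrix_vector_mult_def w_def sum_distrib_left mult.assoc)
    also have "\<dots> = (\<Sum>i\<in>UNIV. \<Sum>j\<in>UNIV. \<Sum>l\<in>UNIV. matrix_inv (h x) $ k $ l * c l i j * X $ i * Y $ j)"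
      by (rule sum_rotate3)
    also have "\<dots> = chr h x X Y $ k"
      by (simp add: chr_def ch sum_distrib_right)
    finally show "chr h x X Y $ k = (matrix_inv (h x) *v w) $ k" by simp
  qed
  then have "h x *v chr h x X Y = w"
    by (simp add: matrix_vector_mul_assoc matrix_inv_mult[OF m(4)])
  then have "Z \<bullet> (h x *v chr h x X Y) = (\<Sum>l\<in>UNIV. \<Sum>i\<in>UNIV. \<Sum>j\<in>UNIV. X $ i * Y $ j * Z $ l * c l i j)"
    by (simp add: inner_vec_def w_def sum_distrib_left mult_ac)
  also have "\<dots> = (\<Sum>i\<in>UNIV. \<Sum>j\<in>UNIV. \<Sum>l\<in>UNIV. X $ i * Y $ j * Z $ l * c l i j)"
    by (rule sum_rotate3)
  finally have 0: "Z \<bullet> (h x *v chr h x X Y) = (\<Sum>i\<in>UNIV. \<Sum>j\<in>UNIV. \<Sum>l\<in>UNIV. X $ i * Y $ j * Z $ l * c l i j)" .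
  have 1: "Y \<bullet> (frechet_derivative h (at x) X *v Z) = (\<Sum>i\<in>UNIV. \<Sum>j\<in>UNIV. \<Sum>l\<in>UNIV. X $ i * Y $ j * Z $ l * ?D i $ j $ l)"
    by (rule trilinear_sum[OF m(6)])
  have "X \<bullet> (frechet_derivative h (at x) Y *v Z) = (\<Sum>j\<in>UNIV. \<Sum>i\<in>UNIV. \<Sum>l\<in>UNIV. Y $ j * X $ i * Z $ l * ?D j $ i $ l)"
    by (rule trilinear_sum[OF m(6)])
  also have "\<dots> = (\<Sum>i\<in>UNIV. \<Sum>j\<in>UNIV. \<Sum>l\<in>UNIV. X $ i * Y $ j * Z $ l * ?D j $ i $ l)"
    by (subst sum.swap) (simp add: mult_ac)
  finally have 2: "X \<bullet> (frechet_derivative h (at x) Y *v Z) = (\<Sum>i\<in>UNIV. \<Sum>j\<in>UNIV. \<Sum>l\<in>UNIV. X $ i * Y $ j * Z $ l * ?D j $ i $ l)" .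
  have "X \<bullet> (frechet_derivative h (at x) Z *v Y) = (\<Sum>l\<in>UNIV. \<Sum>i\<in>UNIV. \<Sum>j\<in>UNIV. Z $ l * X $ i * Y $ j * ?D l $ i $ j)"
    by (rule trilinear_sum[OF m(6)])
  also have "\<dots> = (\<Sum>i\<in>UNIV. \<Sum>j\<in>UNIV. \<Sum>l\<in>UNIV. X $ i * Y $ j * Z $ l * ?D l $ i $ j)"
    by (subst sum_rotate3) (simp add: mult_ac)
  finally have 3: "X \<bullet> (frechet_derivative h (at x) Z *v Y) = (\<Sum>i\<in>UNIV. \<Sum>j\<in>UNIV. \<Sum>l\<in>UNIV. X $ i * Y $ j * Z $ l * ?D l $ i $ j)" .
  show ?thesis unfolding 0 1 2 3
    by (simp add: c_def sum.distrib[symmetric] sum_subtractf[symmetric] sum_distrib_left algebra_simps)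
qed

text \<open>Since the metric is nondegenerate, the Koszul formula characterises the connection; a
  guessed formula for it need only be checked against this identity.\<close>

lemma chr_unique:
  assumes "metric_on W h" "x \<in> W"
    and "\<And>Z. Z \<bullet> (h x *v V) = 1/2 * (Y \<bullet> (frechet_derivative h (at x) X *v Z)
     + X \<bullet> (frechet_derivative h (at x) Y *v Z) - X \<bullet> (frechet_derivative h (at x) Z *v Y))"
  shows "chr h x X Y = V"
proof -
  have "Z \<bullet> (h x *v chr h x X Y - h x *v V) = 0" for Z
    by (simp add: inner_diff_right chr_koszul[OF assms(1,2)] assms(3))
  then have "h x *v chr h x X Y = h x *v V"
    by (metis inner_eq_zero_iff right_minus_eq)
  then have "matrix_inv (h x) *v (h x *v chr h x X Y) = matrix_inv (h x) *v (h x *v V)" by simp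
  then show ?thesis
    by (simp add: matrix_vector_mul_assoc matrix_inv_mult[OF metric_onD(4)[OF assms(1,2)]])
qed

lemma chr_add_right: "chr h x X (Y + Y') = chr h x X Y + chr h x X Y'"
  and chr_add_left: "chr h x (X + X') Y = chr h x X Y + chr h x X' Y"
  and chr_scale_right: "chr h x X (r *\<^sub>R Y) = r *\<^sub>R chr h x X Y"
  and chr_scale_left: "chr h x (r *\<^sub>R X) Y = r *\<^sub>R chr h x X Y"
  by (simp_all add: chr_def vec_eq_iff sum.distrib sum_distrib_left algebra_simps)

lemma chr_linear: "linear (chr h x X)" "linear (\<lambda>X. chr h x X Y)"
  by (auto intro!: linearI simp: chr_add_right chr_add_left chr_scale_right chr_scale_left)

lemma chr_expand:
  "chr h x X Y = (\<Sum>i\<in>UNIV. \<Sum>j\<in>UNIV. (X $ i * Y $ j) *\<^sub>R chr h x (axis i 1) (axis j 1))"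
proof -
  have "chr h x X Y = (\<Sum>i\<in>UNIV. X $ i *\<^sub>R chr h x (axis i 1) Y)"
    by (rule linear_sum_axis[OF chr_linear(2)])
  also have "\<dots> = (\<Sum>i\<in>UNIV. X $ i *\<^sub>R (\<Sum>j\<in>UNIV. Y $ j *\<^sub>R chr h x (axis i 1) (axis j 1)))"
    by (subst linear_sum_axis[OF chr_linear(1)]) simp
  finally show ?thesis by (simp add: scaleR_sum_right)
qed

lemma chr_axis_nth: "chr h x (axis i 1) V $ l = (\<Sum>m\<in>UNIV. christoffel h l i m x * V $ m)"
  by (simp add: chr_def axis_def if_distrib[of "\<lambda>t. _ * t"] if_distrib[of "\<lambda>t. t * _"] sum.delta'
      sum.swap[of _ UNIV UNIV] cong: if_cong)

lemma chr_axis_axis: "chr h x (axis i 1) (axis j 1) $ k = christoffel h k i j x"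
  unfolding chr_axis_nth by (simp add: axis_def if_distrib[of "\<lambda>t. _ * t"] cong: if_cong)

lemma smooth_on_chr:
  fixes h :: "real^'n::finite \<Rightarrow> real^'n^'n"
  assumes "metric_on W h"
  shows "smooth_on W (\<lambda>x. chr h x X Y)"
proof -
  have W: "open W" "smooth_on W h" "\<And>x. x \<in> W \<Longrightarrow> det (h x) \<noteq> 0"
    using assms by (auto simp: metric_on_def)
  have p: "smooth_on W (partial i (\<lambda>y. h y $ j $ l))" for i j l
    unfolding partial_def[abs_def] by (intro smooth_on_frechet_derivative smooth_on_nth W)
  have "smooth_on W (christoffel h k i j)" for k i j
    unfolding christoffel_def[abs_def]
    by (intro smooth_on_mult smooth_on_sum smooth_on_const smooth_on_add smooth_on_diff p
        smooth_on_nth smooth_on_matrix_inv W)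
  then show ?thesis
    unfolding chr_def by (intro smooth_on_vec smooth_on_sum smooth_on_mult smooth_on_const W)
qed

text \<open>The derivative of \<Gamma>(X, Y) in direction V for constant X and Y, written over the
  basis so that bilinearity in X and Y is immediate.\<close>

definition dchr :: "(real^'n::finite \<Rightarrow> real^'n^'n) \<Rightarrow> real^'n \<Rightarrow> real^'n \<Rightarrow> real^'n \<Rightarrow> real^'n \<Rightarrow> real^'n" where
  "dchr h x V X Y = (\<Sum>i\<in>UNIV. \<Sum>j\<in>UNIV. (X $ i * Y $ j) *\<^sub>R
     frechet_derivative (\<lambda>y. chr h y (axis i 1) (axis j 1)) (at x) V)"

text \<open>R(X, Y)Z for constant vector fields, whose brackets vanish.\<close>

definition riem :: "(real^'n::finite \<Rightarrow> real^'n^'n) \<Rightarrow> real^'n \<Rightarrow> real^'n \<Rightarrow> real^'n \<Rightarrow> real^'n \<Rightarrow> real^'n" where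
  "riem h x X Y Z = dchr h x X Y Z - dchr h x Y X Z + chr h x X (chr h x Y Z) - chr h x Y (chr h x X Z)"

definition ric :: "(real^'n::finite \<Rightarrow> real^'n^'n) \<Rightarrow> real^'n \<Rightarrow> real^'n \<Rightarrow> real^'n \<Rightarrow> real" where
  "ric h x Y Z = (\<Sum>i\<in>UNIV. riem h x (axis i 1) Y Z $ i)"

text \<open>Product rule for \<Gamma> with moving base point and moving arguments. The map
  \<open>\<phi>\<close> is kept general because the transformation law involves \<Gamma> at F y
  applied to Jacobian images.\<close>

lemma chr_has_derivative:
  assumes "metric_on W h" "\<phi> x \<in> W" "(\<phi> has_derivative \<phi>') (at x)"
    "(a has_derivative a') (at x)" "(b has_derivative b') (at x)"
  shows "((\<lambda>y. chr h (\<phi> y) (a y) (b y)) has_derivative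
    (\<lambda>V. dchr h (\<phi> x) (\<phi>' V) (a x) (b x) + chr h (\<phi> x) (a' V) (b x) + chr h (\<phi> x) (a x) (b' V))) (at x)"
proof -
  let ?e = "\<lambda>i j y. chr h y (axis i 1) (axis j 1)"
  have e: "((\<lambda>y. ?e i j (\<phi> y)) has_derivative (\<lambda>V. frechet_derivative (?e i j) (at (\<phi> x)) (\<phi>' V))) (at x)" for i j
    using diff_chain_at[OF assms(3) smooth_onD[OF smooth_on_chr[OF assms(1)] assms(2)]]
    unfolding o_def .
  have ab: "((\<lambda>y. a y $ i * b y $ j) has_derivative (\<lambda>V. a x $ i * b' V $ j + a' V $ i * b x $ j)) (at x)" for i j
    by (intro has_derivative_mult bounded_linear.has_derivative[OF bounded_linear_vec_nth] assms)
  have "((\<lambda>y. \<Sum>i\<in>UNIV. \<Sum>j\<in>UNIV. (a y $ i * b y $ j) *\<^sub>R ?e i j (\<phi> y)) has_derivative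
    (\<lambda>V. \<Sum>i\<in>UNIV. \<Sum>j\<in>UNIV. (a x $ i * b x $ j) *\<^sub>R frechet_derivative (?e i j) (at (\<phi> x)) (\<phi>' V)
        + (a x $ i * b' V $ j + a' V $ i * b x $ j) *\<^sub>R ?e i j (\<phi> x))) (at x)"
    by (intro has_derivative_sum has_derivative_scaleR ab e)
  moreover have "(\<Sum>i\<in>UNIV. \<Sum>j\<in>UNIV. (a x $ i * b x $ j) *\<^sub>R frechet_derivative (?e i j) (at (\<phi> x)) (\<phi>' V)
        + (a x $ i * b' V $ j + a' V $ i * b x $ j) *\<^sub>R ?e i j (\<phi> x))
     = dchr h (\<phi> x) (\<phi>' V) (a x) (b x) + chr h (\<phi> x) (a' V) (b x) + chr h (\<phi> x) (a x) (b' V)" for V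
    unfolding chr_expand[of h "\<phi> x" "a' V"] chr_expand[of h "\<phi> x" "a x"] dchr_def
    by (simp add: sum.distrib scaleR_add_left)
  moreover have "(\<lambda>y. \<Sum>i\<in>UNIV. \<Sum>j\<in>UNIV. (a y $ i * b y $ j) *\<^sub>R ?e i j (\<phi> y)) = (\<lambda>y. chr h (\<phi> y) (a y) (b y))"
    by (intro ext chr_expand[symmetric])
  ultimately show ?thesis by simp
qed

lemma chr_has_derivative_const:
  assumes "metric_on W h" "x \<in> W"
  shows "((\<lambda>y. chr h y X Y) has_derivative (\<lambda>V. dchr h x V X Y)) (at x)"
proof -
  have z: "chr h x 0 Y = 0" "chr h x X 0 = 0" by (simp_all add: chr_def vec_eq_iff)
  show ?thesis
    using chr_has_derivative[OF assms(1) _ has_derivative_ident has_derivative_const has_derivative_const, of x X Y] assms(2)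
    by (simp add: z)
qed

lemma dchr_linear1:
  assumes "metric_on W h" "x \<in> W" shows "linear (\<lambda>V. dchr h x V X Y)"
  using chr_has_derivative_const[OF assms] has_derivative_linear by blast

lemma dchr_linear2: "linear (\<lambda>X. dchr h x V X Y)" and dchr_linear3: "linear (\<lambda>Y. dchr h x V X Y)"
  by (auto intro!: linearI simp: dchr_def sum.distrib scaleR_add_left scaleR_sum_right algebra_simps)

lemma riem_linear:
  assumes "metric_on W h" "x \<in> W"
  shows "linear (\<lambda>X. riem h x X Y Z)" "linear (\<lambda>Y. riem h x X Y Z)" "linear (\<lambda>Z. riem h x X Y Z)"
  unfolding riem_def
  by (intro linear_compose_sub linear_compose_add dchr_linear1[OF assms] dchr_linear2 dchr_linear3
      chr_linear linear_compose[OF chr_linear(2) chr_linear(1), unfolded o_def]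
      linear_compose[OF chr_linear(1) chr_linear(1), unfolded o_def])+

lemma riemann_eq_riem:
  assumes "metric_on W h" "x \<in> W"
  shows "riemann h l k i j x = riem h x (axis i 1) (axis j 1) (axis k 1) $ l"
proof -
  have p: "partial i (christoffel h l j k) x = dchr h x (axis i 1) (axis j 1) (axis k 1) $ l" for i j k l
  proof -
    have "((\<lambda>y. chr h y (axis j 1) (axis k 1) $ l) has_derivative (\<lambda>V. dchr h x V (axis j 1) (axis k 1) $ l)) (at x)"
      by (intro bounded_linear.has_derivative[OF bounded_linear_vec_nth] chr_has_derivative_const[OF assms])
    then show ?thesis
      unfolding partial_def chr_axis_axis using frechet_derivative_at by metis
  qed
  have "chr h x (axis i 1) (chr h x X Y) $ l = (\<Sum>m\<in>UNIV. christoffel h l i m x * chr h x X Y $ m)" for i l X Y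
    by (rule chr_axis_nth)
  then show ?thesis
    by (simp add: riemann_def p riem_def chr_axis_axis sum_subtractf)
qed

lemma ricci_eq_ric:
  assumes "metric_on W h" "x \<in> W"
  shows "ricci h x $ j $ k = ric h x (axis j 1) (axis k 1)"
  by (simp add: ricci_def ric_def riemann_eq_riem[OF assms])

lemma ric_linear:
  assumes "metric_on W h" "x \<in> W"
  shows "linear (\<lambda>Y. ric h x Y Z)" "linear (\<lambda>Z. ric h x Y Z)"
proof -
  have n: "linear (\<lambda>v::real^'n. v $ i)" for i by (auto intro!: linearI)
  show "linear (\<lambda>Y. ric h x Y Z)" "linear (\<lambda>Z. ric h x Y Z)"
    unfolding ric_def
    by (intro linear_compose_sum ballI linear_compose[OF riem_linear(2)[OF assms] n, unfolded o_def]
       linear_compose[OF riem_linear(3)[OF assms] n, unfolded o_def])+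
qed

lemma inner_ricci:
  assumes "metric_on W h" "x \<in> W"
  shows "Y \<bullet> (ricci h x *v Z) = ric h x Y Z"
proof -
  have "ric h x Y Z = (\<Sum>j\<in>UNIV. Y $ j * (\<Sum>k\<in>UNIV. Z $ k * ric h x (axis j 1) (axis k 1)))"
    by (subst linear_sum_axis[OF ric_linear(1)[OF assms]], subst linear_sum_axis[OF ric_linear(2)[OF assms]]) simp
  also have "\<dots> = Y \<bullet> (ricci h x *v Z)"
    by (simp add: inner_vec_def matrix_vector_mult_def ricci_eq_ric[OF assms] mult.commute)
  finally show ?thesis by simp
qed

lemma matrix_nth_inner: "(A::real^'n^'n) $ j $ k = axis j 1 \<bullet> (A *v axis k 1)"
  by (simp add: matrix_vector_mult_basis column_def inner_axis')

lemma matrix_eqI_inner: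
  assumes "\<And>X Y. X \<bullet> (A *v Y) = X \<bullet> (B *v Y)" shows "A = (B::real^'n^'n)"
  using assms by (simp add: vec_eq_iff matrix_nth_inner)

lemma inner_pullback: "X \<bullet> (pullback F h x *v Y) = (jacobian F x *v X) \<bullet> (h (F x) *v (jacobian F x *v Y))"
  unfolding pullback_def
  by (simp add: matrix_vector_mul_assoc[symmetric]) (metis dot_lmul_matrix inner_commute transpose_matrix_vector transpose_transpose)

section \<open>Naturality of curvature under local diffeomorphisms\<close>

locale pullback_metric =
  fixes W V :: "(real^'n::finite) set" and F :: "real^'n \<Rightarrow> real^'n" and g h :: "real^'n \<Rightarrow> real^'n^'n"
  assumes oW: "open W" and smF: "smooth_on W F" and FV: "F ` W \<subseteq> V" and mg: "metric_on V g"
    and detJ: "\<And>x. x \<in> W \<Longrightarrow> det (jacobian F x) \<noteq> 0"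
    and h: "\<And>x. x \<in> W \<Longrightarrow> h x = pullback F g x"
begin

abbreviation "J \<equiv> jacobian F"
abbreviation "J' x \<equiv> frechet_derivative (jacobian F) (at x)"

lemma smJ: "smooth_on W J" by (rule smooth_on_jacobian[OF oW smF])

lemma mh: "metric_on W h"
proof -
  have "smooth_on W (\<lambda>x. g (F x))"
    using mg by (intro smooth_on_compose[OF oW _ FV smF]) (auto simp: metric_on_def)
  then have "smooth_on W (pullback F g)"
    unfolding pullback_def[abs_def] by (intro smooth_on_matrix_matrix smooth_on_transpose smJ oW)
  then have "smooth_on W h" by (rule smooth_on_cong[OF oW, rotated]) (simp add: h)
  moreover have "transpose (h x) = h x \<and> det (h x) \<noteq> 0" if "x \<in> W" for x
  proof -
    have "F x \<in> V" using that FV by blast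
    note g = metric_onD[OF mg this]
    show ?thesis using g(3,4) detJ[OF that]
      by (simp add: h[OF that] pullback_def det_mul matrix_transpose_mul matrix_mul_assoc)
  qed
  ultimately show ?thesis by (simp add: metric_on_def oW)
qed

lemma FD: "x \<in> W \<Longrightarrow> (F has_derivative (*v) (J x)) (at x)"
  by (rule jacobian_has_derivative[OF smooth_on_differentiable[OF smF]])

lemma JD: "x \<in> W \<Longrightarrow> (J has_derivative J' x) (at x)"
  by (rule smooth_onD[OF smJ])

lemma JvD: 
  assumes "x \<in> W" "(v has_derivative v') (at x)"
  shows "((\<lambda>y. J y *v v y) has_derivative (\<lambda>Z. J x *v v' Z + J' x Z *v v x)) (at x)"
  by (rule bounded_bilinear.FDERIV[OF bounded_bilinear_matrix_vector JD[OF assms(1)] assms(2)])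

lemma JXD: "x \<in> W \<Longrightarrow> ((\<lambda>y. J y *v X) has_derivative (\<lambda>Z. J' x Z *v X)) (at x)"
  using JvD[OF _ has_derivative_const] by simp

text \<open>\<open>J' x Z *v X\<close> is the second derivative of \<open>F\<close> in the
  directions Z and X.\<close>

lemma hessian_symmetric:
  assumes "x \<in> W" shows "J' x Z *v X = J' x X *v Z"
proof -
  have "frechet_derivative (\<lambda>y. frechet_derivative F (at y) X) (at x) Z = J' x Z *v X" for X Z
  proof -
    have "((\<lambda>y. frechet_derivative F (at y) X) has_derivative (\<lambda>Z. J' x Z *v X)) (at x)"
      by (rule has_derivative_transform_within_open[OF JXD[OF assms] oW assms])
        (simp add: jacobian_mult smooth_on_differentiable[OF smF])
    then show ?thesis using frechet_derivative_at by metis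
  qed
  then show ?thesis using second_derivative_symmetric[OF oW smF assms, of X Z] by simp
qed

lemma third_derivative_symmetric:
  assumes "x \<in> W"
  shows "frechet_derivative (\<lambda>y. J' y X) (at x) Z = frechet_derivative (\<lambda>y. J' y Z) (at x) X"
  by (rule second_derivative_symmetric[OF oW smJ assms])

text \<open>Product rule for the identity h(X, Y) = g(J X, J Y): the outer terms differentiate the
  Jacobians, the middle one the metric along F.\<close>

lemma inner_dh:
  assumes "x \<in> W"
  shows "X \<bullet> (frechet_derivative h (at x) Z *v Y) =
     (J' x Z *v X) \<bullet> (g (F x) *v (J x *v Y))
     + (J x *v X) \<bullet> (frechet_derivative g (at (F x)) (J x *v Z) *v (J x *v Y))
     + (J x *v X) \<bullet> (g (F x) *v (J' x Z *v Y))"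
proof -
  have FxV: "F x \<in> V" using assms FV by blast
  have gD: "((\<lambda>y. g (F y)) has_derivative (\<lambda>Z. frechet_derivative g (at (F x)) (J x *v Z))) (at x)"
    using diff_chain_at[OF FD[OF assms] smooth_onD[OF metric_onD(2)[OF mg FxV] FxV]] unfolding o_def .
  have 1: "((\<lambda>y. X \<bullet> (h y *v Y)) has_derivative (\<lambda>Z. X \<bullet> (frechet_derivative h (at x) Z *v Y))) (at x)"
    using bounded_bilinear.FDERIV[OF bounded_bilinear_matrix_vector
        smooth_onD[OF metric_onD(2)[OF mh assms] assms] has_derivative_const[of Y]]
    by (intro bounded_linear.has_derivative[OF bounded_linear_inner_right]) simp
  have "((\<lambda>y. (J y *v X) \<bullet> (g (F y) *v (J y *v Y))) has_derivative
      (\<lambda>Z. (J x *v X) \<bullet> (g (F x) *v (J' x Z *v Y) + frechet_derivative g (at (F x)) (J x *v Z) *v (J x *v Y))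
        + (J' x Z *v X) \<bullet> (g (F x) *v (J x *v Y)))) (at x)"
    by (intro has_derivative_inner JXD assms bounded_bilinear.FDERIV[OF bounded_bilinear_matrix_vector gD])
  then have 2: "((\<lambda>y. X \<bullet> (h y *v Y)) has_derivative
      (\<lambda>Z. (J x *v X) \<bullet> (g (F x) *v (J' x Z *v Y) + frechet_derivative g (at (F x)) (J x *v Z) *v (J x *v Y))
        + (J' x Z *v X) \<bullet> (g (F x) *v (J x *v Y)))) (at x)"
    by (rule has_derivative_transform_within_open[OF _ oW assms]) (simp add: h inner_pullback)
  show ?thesis using fun_cong[OF has_derivative_unique[OF 1 2], of Z] by (simp add: inner_add_right)
qed

text \<open>The inhomogeneous transformation law of a connection. It is obtained by checking the
  Koszul formula for the vector that solves it for \<open>chr h x X Y\<close>.\<close>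

lemma chr_pullback:
  assumes "x \<in> W"
  shows "J x *v chr h x X Y = J' x X *v Y + chr g (F x) (J x *v X) (J x *v Y)"
proof -
  have FxV: "F x \<in> V" using assms FV by blast
  let ?R = "J' x X *v Y + chr g (F x) (J x *v X) (J x *v Y)"
  have JJ: "J x *v (matrix_inv (J x) *v v) = v" for v
    by (simp add: matrix_vector_mul_assoc matrix_inv_mult[OF detJ[OF assms]])
  have sym: "a \<bullet> (g (F x) *v b) = b \<bullet> (g (F x) *v a)" for a b
    by (metis dot_lmul_matrix inner_commute metric_onD(3)[OF mg FxV] transpose_matrix_vector)
  have "chr h x X Y = matrix_inv (J x) *v ?R"
  proof (rule chr_unique[OF mh assms])
    fix Z
    have "Z \<bullet> (h x *v (matrix_inv (J x) *v ?R)) = (J x *v Z) \<bullet> (g (F x) *v ?R)"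
      by (simp add: h[OF assms] inner_pullback JJ)
    also have "\<dots> = (J x *v Z) \<bullet> (g (F x) *v (J' x X *v Y))
       + (J x *v Z) \<bullet> (g (F x) *v chr g (F x) (J x *v X) (J x *v Y))"
      by (simp add: vec.add inner_add_right)
    finally have "Z \<bullet> (h x *v (matrix_inv (J x) *v ?R)) = \<dots>" .
    then show "Z \<bullet> (h x *v (matrix_inv (J x) *v ?R)) = 1/2 * (Y \<bullet> (frechet_derivative h (at x) X *v Z)
     + X \<bullet> (frechet_derivative h (at x) Y *v Z) - X \<bullet> (frechet_derivative h (at x) Z *v Y))"
      \<comment> \<open>The three derivatives of h contribute six terms with second derivatives of
        F. By the two symmetries four of them cancel and the remaining two agree, leaving J Z paired
        with the second derivative in X and Y.\<close>
      unfolding inner_dh[OF assms] chr_koszul[OF mg FxV]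
      using sym[of "J x *v Y" "J' x X *v Z"] sym[of "J x *v Z" "J' x X *v Y"]
        hessian_symmetric[OF assms, of X Z] hessian_symmetric[OF assms, of X Y] hessian_symmetric[OF assms, of Y Z]
      by (simp add: algebra_simps)
  qed
  then show ?thesis by (simp add: JJ)
qed

lemma dchr_pullback:
  assumes "x \<in> W"
  shows "J x *v dchr h x Z X Y + J' x Z *v chr h x X Y =
    frechet_derivative (\<lambda>y. J' y X) (at x) Z *v Y + dchr g (F x) (J x *v Z) (J x *v X) (J x *v Y)
    + chr g (F x) (J' x Z *v X) (J x *v Y) + chr g (F x) (J x *v X) (J' x Z *v Y)"
proof -
  have FxV: "F x \<in> V" using assms FV by blast
  have 1: "((\<lambda>y. J y *v chr h y X Y) has_derivative (\<lambda>Z. J x *v dchr h x Z X Y + J' x Z *v chr h x X Y)) (at x)"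
    by (rule JvD[OF assms chr_has_derivative_const[OF mh assms]])
  have "((\<lambda>y. J' y X) has_derivative (\<lambda>Z. frechet_derivative (\<lambda>y. J' y X) (at x) Z)) (at x)"
    by (rule smooth_onD[OF smooth_on_frechet_derivative[OF smJ] assms])
  from bounded_bilinear.FDERIV[OF bounded_bilinear_matrix_vector this has_derivative_const[of Y]]
  have a: "((\<lambda>y. J' y X *v Y) has_derivative (\<lambda>Z. frechet_derivative (\<lambda>y. J' y X) (at x) Z *v Y)) (at x)"
    by simp
  have "((\<lambda>y. J' y X *v Y + chr g (F y) (J y *v X) (J y *v Y)) has_derivative
    (\<lambda>Z. frechet_derivative (\<lambda>y. J' y X) (at x) Z *v Y + (dchr g (F x) (J x *v Z) (J x *v X) (J x *v Y)
    + chr g (F x) (J' x Z *v X) (J x *v Y) + chr g (F x) (J x *v X) (J' x Z *v Y)))) (at x)"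
    by (intro has_derivative_add a chr_has_derivative[where \<phi> = F and x = x, OF mg FxV] FD JXD assms)
  then have 2: "((\<lambda>y. J y *v chr h y X Y) has_derivative
    (\<lambda>Z. frechet_derivative (\<lambda>y. J' y X) (at x) Z *v Y + (dchr g (F x) (J x *v Z) (J x *v X) (J x *v Y)
    + chr g (F x) (J' x Z *v X) (J x *v Y) + chr g (F x) (J x *v X) (J' x Z *v Y)))) (at x)"
    by (rule has_derivative_transform_within_open[OF _ oW assms]) (simp add: chr_pullback)
  show ?thesis using fun_cong[OF has_derivative_unique[OF 1 2], of Z] by (simp add: add.assoc)
qed

text \<open>Antisymmetrising the differentiated transformation law in X and Y removes the third
  derivatives of F by Schwarz; the terms with second derivatives cancel against those produced by
  the products of Christoffel symbols.\<close>

lemma riem_pullback: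
  assumes "x \<in> W"
  shows "J x *v riem h x X Y Z = riem g (F x) (J x *v X) (J x *v Y) (J x *v Z)"
proof -
  have 1: "J x *v dchr h x X Y Z = frechet_derivative (\<lambda>y. J' y Y) (at x) X *v Z + dchr g (F x) (J x *v X) (J x *v Y) (J x *v Z)
    + chr g (F x) (J' x X *v Y) (J x *v Z) + chr g (F x) (J x *v Y) (J' x X *v Z) - J' x X *v chr h x Y Z" for X Y
    using dchr_pullback[OF assms, of X Y Z] by (simp add: algebra_simps)
  have 2: "J x *v chr h x X (chr h x Y Z) = J' x X *v chr h x Y Z + chr g (F x) (J x *v X) (J' x Y *v Z)
     + chr g (F x) (J x *v X) (chr g (F x) (J x *v Y) (J x *v Z))" for X Y
    by (simp add: chr_pullback[OF assms] chr_add_right add.assoc)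
  show ?thesis
    unfolding riem_def vec.diff vec.add 1 2
    using third_derivative_symmetric[OF assms, of X Y] hessian_symmetric[OF assms, of X Y]
    by (simp add: algebra_simps)
qed

text \<open>The endomorphism X -> R(X, Y)Z of h is conjugate by J to that of g, and the trace does
  not change under conjugation.\<close>

lemma ric_pullback:
  assumes "x \<in> W"
  shows "ric h x Y Z = ric g (F x) (J x *v Y) (J x *v Z)"
proof -
  have FxV: "F x \<in> V" using assms FV by blast
  define M where "M = matrix (\<lambda>X. riem g (F x) X (J x *v Y) (J x *v Z))"
  have M: "M *v X = riem g (F x) X (J x *v Y) (J x *v Z)" for X
    unfolding M_def using riem_linear(1)[OF mg FxV] by simp
  have tr: "trace A = (\<Sum>i\<in>UNIV. (A *v axis i 1) $ i)" for A :: "real^'n^'n"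
    by (simp add: trace_def matrix_vector_mult_basis column_def)
  have "riem h x X Y Z = (matrix_inv (J x) ** (M ** J x)) *v X" for X
  proof -
    have "matrix_inv (J x) *v (J x *v riem h x X Y Z) = matrix_inv (J x) *v (M *v (J x *v X))"
      by (simp add: riem_pullback[OF assms] M)
    then show ?thesis by (simp add: matrix_vector_mul_assoc matrix_inv_mult[OF detJ[OF assms]])
  qed
  then have "ric h x Y Z = trace (matrix_inv (J x) ** (M ** J x))"
    by (simp add: ric_def tr)
  also have "\<dots> = trace M"
    by (subst trace_mul_sym) (simp add: matrix_mul_assoc[symmetric] matrix_inv_mult[OF detJ[OF assms]])
  also have "\<dots> = ric g (F x) (J x *v Y) (J x *v Z)"
    by (simp add: tr M ric_def)
  finally show ?thesis .
qed

lemma ricci_pullback: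
  assumes "x \<in> W" shows "ricci h x = pullback F (ricci g) x"
proof (rule matrix_eqI_inner)
  have FxV: "F x \<in> V" using assms FV by blast
  show "X \<bullet> (ricci h x *v Y) = X \<bullet> (pullback F (ricci g) x *v Y)" for X Y
    by (simp add: inner_pullback inner_ricci[OF mh assms] inner_ricci[OF mg FxV] ric_pullback[OF assms])
qed

lemma scal_trace: "scal k x = trace (matrix_inv (k x) ** transpose (ricci k x))"
  by (simp add: scal_def trace_def matrix_matrix_mult_def transpose_def)

lemma scal_pullback:
  assumes "x \<in> W" shows "scal h x = scal g (F x)"
proof -
  have FxV: "F x \<in> V" using assms FV by blast
  note d = matrix_inv_mult[OF detJ[OF assms]] and dg = matrix_inv_mult[OF metric_onD(4)[OF mg FxV]]
  let ?A = "matrix_inv (J x)" and ?G = "matrix_inv (g (F x))"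
  have tA: "transpose (J x) ** transpose ?A = mat 1"
    by (metis d(2) matrix_transpose_mul transpose_mat)
  have tA': "transpose ?A ** transpose (J x) = mat 1"
    by (metis d(1) matrix_transpose_mul transpose_mat)
  have "h x ** (?A ** ?G ** transpose ?A) = transpose (J x) ** (g (F x) ** ((J x ** ?A) ** ?G)) ** transpose ?A"
    by (simp add: h[OF assms] pullback_def matrix_mul_assoc)
  also have "\<dots> = mat 1" by (simp add: d dg tA)
  finally have inv: "matrix_inv (h x) = ?A ** ?G ** transpose ?A" by (rule matrix_inv_unique)
  have "scal h x = trace (?A ** (?G ** ((transpose ?A ** transpose (J x)) ** transpose (ricci g (F x)) ** J x)))"
    by (simp add: scal_trace inv ricci_pullback[OF assms] pullback_def matrix_transpose_mul matrix_mul_assoc)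
  also have "\<dots> = trace (?A ** (?G ** transpose (ricci g (F x)) ** J x))"
    by (simp add: tA' matrix_mul_assoc)
  also have "\<dots> = trace (?G ** transpose (ricci g (F x)))"
    by (subst trace_mul_sym) (simp add: matrix_mul_assoc[symmetric] d)
  finally show ?thesis by (simp add: scal_trace)
qed

lemma pos_def_ein_pullback:
  assumes "x \<in> W" "pos_def (scal g (F x) *\<^sub>R g (F x) - k *\<^sub>R ricci g (F x))"
  shows "pos_def (scal h x *\<^sub>R h x - k *\<^sub>R ricci h x)"
proof -
  let ?E = "scal g (F x) *\<^sub>R g (F x) - k *\<^sub>R ricci g (F x)"
  have eq: "scal h x *\<^sub>R h x - k *\<^sub>R ricci h x = pullback F (\<lambda>_. ?E) x"
  proof (rule matrix_eqI_inner)
    show "X \<bullet> ((scal h x *\<^sub>R h x - k *\<^sub>R ricci h x) *v Y) = X \<bullet> (pullback F (\<lambda>_. ?E) x *v Y)" for X Y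
      by (simp add: matrix_vector_mult_diff_rdistrib scaleR_matrix_vector_assoc[symmetric] inner_diff_right
         inner_pullback ricci_pullback[OF assms(1)] scal_pullback[OF assms(1)] h[OF assms(1)])
  qed
  have "J x *v v \<noteq> 0" if "v \<noteq> 0" for v
    using that detJ[OF assms(1)]
    by (metis matrix_inv_mult(2) matrix_vector_mul_assoc matrix_vector_mul_lid matrix_vector_mult_0_right)
  then have "v \<bullet> (pullback F (\<lambda>_. ?E) x *v v) > 0" if "v \<noteq> 0" for v
    using assms(2) that unfolding inner_pullback pos_def_def by blast
  moreover have "transpose (pullback F (\<lambda>_. ?E) x) = pullback F (\<lambda>_. ?E) x"
    using assms(2) by (simp add: pullback_def matrix_transpose_mul matrix_mul_assoc pos_def_def)
  ultimately show ?thesis unfolding eq pos_def_def by blast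
qed

end

lemma frechet_derivative_cong:
  assumes "open S" "x \<in> S" "\<And>y. y \<in> S \<Longrightarrow> f y = g y"
  shows "frechet_derivative f (at x) = frechet_derivative g (at x)"
proof -
  have "(f has_derivative D) (at x) \<longleftrightarrow> (g has_derivative D) (at x)" for D
    using has_derivative_transform_within_open[OF _ assms(1,2)] assms(3) by metis
  then show ?thesis by (simp add: frechet_derivative_def)
qed

section \<open>Curvature of radially symmetric conformally flat metrics\<close>

text \<open>If c = e^(2f), the last hypothesis says that P is the Euclidean gradient of f at x. The
  formula is verified through the Koszul identity.\<close>

lemma chr_conformal:
  assumes "metric_on W h" "x \<in> W" "\<And>y. y \<in> W \<Longrightarrow> h y = c y *\<^sub>R mat 1"
    "(c has_derivative (\<lambda>Z. 2 * c x * (P \<bullet> Z))) (at x)"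
  shows "chr h x X Y = (P \<bullet> X) *\<^sub>R Y + (P \<bullet> Y) *\<^sub>R X - (X \<bullet> Y) *\<^sub>R P"
proof (rule chr_unique[OF assms(1,2)])
  fix Z
  have "((\<lambda>y. c y *\<^sub>R (mat 1 :: real^'a^'a)) has_derivative (\<lambda>Z. (2 * c x * (P \<bullet> Z)) *\<^sub>R mat 1)) (at x)"
    using has_derivative_scaleR[OF assms(4) has_derivative_const[of "mat 1"]] by simp
  then have "(h has_derivative (\<lambda>Z. (2 * c x * (P \<bullet> Z)) *\<^sub>R mat 1)) (at x)"
    by (rule has_derivative_transform_within_open[OF _ metric_onD(1)[OF assms(1,2)] assms(2)]) (simp add: assms(3))
  then have D: "frechet_derivative h (at x) = (\<lambda>Z. (2 * c x * (P \<bullet> Z)) *\<^sub>R mat 1)"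
    using frechet_derivative_at by metis
  show "Z \<bullet> (h x *v ((P \<bullet> X) *\<^sub>R Y + (P \<bullet> Y) *\<^sub>R X - (X \<bullet> Y) *\<^sub>R P)) = 1/2 * (Y \<bullet> (frechet_derivative h (at x) X *v Z)
     + X \<bullet> (frechet_derivative h (at x) Y *v Z) - X \<bullet> (frechet_derivative h (at x) Z *v Y))"
    unfolding D assms(3)[OF assms(2)]
    by (simp add: scaleR_matrix_vector_assoc[symmetric] inner_simps algebra_simps inner_commute)
qed


lemma scaleR_mat_mult: "(a *\<^sub>R mat 1) ** B = a *\<^sub>R (B :: real^'n^'m)"
  by (simp add: vec_eq_iff matrix_matrix_mult_def mat_def if_distrib[of "\<lambda>t. t * _"]
      if_distrib[of "\<lambda>t. _ * t"] cong: if_cong)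

locale radial_conformal =
  fixes U :: "real \<Rightarrow> real" and h :: "real^'n::finite \<Rightarrow> real^'n^'n"
  assumes smU: "smooth_on UNIV U" and Upos: "\<And>r. r \<ge> 0 \<Longrightarrow> U r > 0"
    and h: "\<And>x. h x = (1 / (U (x \<bullet> x))\<^sup>2) *\<^sub>R mat 1"
begin

text \<open>For h = e^(2f) I with f = - ln U(|x|^2), the gradient of f at x is q(|x|^2) x;
  \<open>q'\<close> is the derivative of \<open>q\<close>.\<close>

definition "q r = - 2 * deriv U r / U r"
definition "q' r = - 2 * deriv (deriv U) r / U r + 2 * (deriv U r)\<^sup>2 / (U r)\<^sup>2"

lemma U_deriv: "(U has_real_derivative deriv U r) (at r)"
  and dU_deriv: "(deriv U has_real_derivative deriv (deriv U) r) (at r)"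
  using smooth_on_real_deriv[OF open_UNIV smU] smooth_on_real_deriv[OF open_UNIV] by blast+

lemma q_deriv: "r \<ge> 0 \<Longrightarrow> (q has_real_derivative q' r) (at r)"
  unfolding q_def q'_def using Upos[of r]
  by (auto intro!: derivative_eq_intros U_deriv dU_deriv simp: field_simps power2_eq_square)

lemma sq_deriv: "((\<lambda>x::real^'n. x \<bullet> x) has_derivative (\<lambda>Z. 2 * (x \<bullet> Z))) (at x)"
  by (auto intro!: derivative_eq_intros simp: inner_commute)

lemma smooth_h: "smooth_on UNIV h"
proof -
  have "smooth_on UNIV (\<lambda>x::real^'n. U (x \<bullet> x))"
    by (intro smooth_on_compose[OF _ _ _ _ smU] smooth_on_inner smooth_on_ident) auto
  then have "smooth_on UNIV (\<lambda>x::real^'n. (1 / (U (x \<bullet> x))\<^sup>2) *\<^sub>R (mat 1 :: real^'n^'n))"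
    using Upos by (intro smooth_on_scaleR smooth_on_divide smooth_on_power smooth_on_const)
      (auto simp: less_imp_neq[symmetric])
  then show ?thesis by (rule smooth_on_cong[OF open_UNIV, rotated]) (simp add: h)
qed

lemma metric_h: "metric_on UNIV h"
proof -
  have "det (h x) \<noteq> 0" for x
  proof -
    have "h x ** ((U (x \<bullet> x))\<^sup>2 *\<^sub>R mat 1) = mat 1"
      using Upos[of "x \<bullet> x"]
      by (simp add: h scaleR_mat_mult less_imp_neq[symmetric])
    then show ?thesis using invertible_det_nz invertible_right_inverse by blast
  qed
  then show ?thesis
    by (simp add: metric_on_def smooth_h) (simp add: h transpose_scalar transpose_mat)
qed

lemma chr_h: "chr h x X Y = q (x \<bullet> x) *\<^sub>R ((x \<bullet> X) *\<^sub>R Y + (x \<bullet> Y) *\<^sub>R X - (X \<bullet> Y) *\<^sub>R x)"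
proof -
  let ?c = "\<lambda>x. 1 / (U (x \<bullet> x))\<^sup>2"
  have U: "U (x \<bullet> x) > 0" by (rule Upos) simp
  have U': "((\<lambda>r. 1 / (U r)\<^sup>2) has_real_derivative (- 2 * deriv U r / (U r)^3)) (at r)" if "r \<ge> 0" for r
    using Upos[OF that] by (auto intro!: derivative_eq_intros U_deriv simp: field_simps power2_eq_square power3_eq_cube)
  have "((\<lambda>y::real^'n. 1 / (U (y \<bullet> y))\<^sup>2) has_derivative (\<lambda>Z. (- 2 * deriv U (x \<bullet> x) / (U (x \<bullet> x))^3) * (2 * (x \<bullet> Z)))) (at x)"
    using diff_chain_at[OF sq_deriv U'[unfolded has_field_derivative_def]] unfolding o_def by auto
  moreover have "(- 2 * deriv U (x \<bullet> x) / (U (x \<bullet> x))^3) * (2 * (x \<bullet> Z)) = 2 * ?c x * ((q (x \<bullet> x) *\<^sub>R x) \<bullet> Z)" for Z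
    using U by (simp add: q_def field_simps power2_eq_square power3_eq_cube)
  ultimately have "(?c has_derivative (\<lambda>Z. 2 * ?c x * ((q (x \<bullet> x) *\<^sub>R x) \<bullet> Z))) (at x)" by simp
  from chr_conformal[OF metric_h UNIV_I h this] show ?thesis
    by (simp add: algebra_simps)
qed

lemma dchr_h:
  "dchr h x V X Y = (2 * q' (x \<bullet> x) * (x \<bullet> V)) *\<^sub>R ((x \<bullet> X) *\<^sub>R Y + (x \<bullet> Y) *\<^sub>R X - (X \<bullet> Y) *\<^sub>R x)
    + q (x \<bullet> x) *\<^sub>R ((V \<bullet> X) *\<^sub>R Y + (V \<bullet> Y) *\<^sub>R X - (X \<bullet> Y) *\<^sub>R V)"
proof -
  have qd: "((\<lambda>y::real^'n. q (y \<bullet> y)) has_derivative (\<lambda>Z. q' (x \<bullet> x) * (2 * (x \<bullet> Z)))) (at x)"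
    using diff_chain_at[OF sq_deriv q_deriv[unfolded has_field_derivative_def]] unfolding o_def by auto
  have "((\<lambda>y. (y \<bullet> X) *\<^sub>R Y + (y \<bullet> Y) *\<^sub>R X - (X \<bullet> Y) *\<^sub>R y) has_derivative
      (\<lambda>V. (V \<bullet> X) *\<^sub>R Y + (V \<bullet> Y) *\<^sub>R X - (X \<bullet> Y) *\<^sub>R V)) (at x)"
    by (auto intro!: derivative_eq_intros)
  from has_derivative_scaleR[OF qd this]
  have "((\<lambda>y. chr h y X Y) has_derivative
    (\<lambda>V. q (x \<bullet> x) *\<^sub>R ((V \<bullet> X) *\<^sub>R Y + (V \<bullet> Y) *\<^sub>R X - (X \<bullet> Y) *\<^sub>R V)
       + (q' (x \<bullet> x) * (2 * (x \<bullet> V))) *\<^sub>R ((x \<bullet> X) *\<^sub>R Y + (x \<bullet> Y) *\<^sub>R X - (X \<bullet> Y) *\<^sub>R x))) (at x)"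
    by (simp add: chr_h)
  from fun_cong[OF has_derivative_unique[OF this chr_has_derivative_const[OF metric_h UNIV_I]], of V]
  show ?thesis by (simp add: mult_ac add.commute)
qed

text \<open>The i-th diagonal entry of the curvature endomorphism is a combination of products of
  coordinates of x, Y and Z with coefficients that do not depend on i, so summing over i only
  produces inner products and the dimension.\<close>

lemma ric_h:
  fixes x Y Z :: "real^'n"
  defines "\<rho> \<equiv> x \<bullet> x" and "n \<equiv> real CARD('n)"
  shows "ric h x Y Z = (n - 2) * ((q \<rho>)\<^sup>2 - 2 * q' \<rho>) * (x \<bullet> Y) * (x \<bullet> Z)
    - (2 * q' \<rho> * \<rho> + (2 * n - 2) * q \<rho> + (n - 2) * (q \<rho>)\<^sup>2 * \<rho>) * (Y \<bullet> Z)"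
proof -
  define Q r a b s where "Q = q \<rho>" "r = 2 * q' \<rho>" "a = x \<bullet> Y" "b = x \<bullet> Z" "s = Y \<bullet> Z"
  note d = this
  have sy: "Y \<bullet> x = a" "Z \<bullet> x = b" "Z \<bullet> Y = s" by (simp_all add: d inner_commute)
  have ax: "axis i 1 \<bullet> v = v $ i" "v \<bullet> axis i 1 = v $ i" "(axis i (1::real) :: real^'n) $ i = 1" for i and v :: "real^'n"
    by (simp_all add: inner_axis inner_axis')
  have comp: "riem h x (axis i 1) Y Z $ i =
     (- r * a * b - Q * s - Q * s + Q\<^sup>2 * (a * b - s * \<rho>))
     + (x $ i * x $ i) * (Q\<^sup>2 * s - r * s)
     + (x $ i * Y $ i) * (r * b - Q\<^sup>2 * b) + (x $ i * Z $ i) * (r * a - Q\<^sup>2 * a)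
     + (Y $ i * Z $ i) * (2 * Q + Q\<^sup>2 * \<rho>)" for i
    unfolding riem_def dchr_h chr_h
    by (simp add: ax d(3,4,5)[symmetric] sy inner_simps d(1,2)[symmetric] \<rho>_def[symmetric])
      (simp add: algebra_simps power2_eq_square)
  have inn: "(\<Sum>i\<in>UNIV. u $ i * v $ i) = u \<bullet> v" for u v :: "real^'n" by (simp add: inner_vec_def)
  have "ric h x Y Z = n * (- r * a * b - Q * s - Q * s + Q\<^sup>2 * (a * b - s * \<rho>))
     + \<rho> * (Q\<^sup>2 * s - r * s) + a * (r * b - Q\<^sup>2 * b) + b * (r * a - Q\<^sup>2 * a) + s * (2 * Q + Q\<^sup>2 * \<rho>)"
    unfolding ric_def comp sum.distrib sum_distrib_right[symmetric] inn
    by (simp add: n_def \<rho>_def[symmetric] d(3,4,5)[symmetric] distrib_left)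
  then show ?thesis
    by (simp add: d(3,4,5)[symmetric] d(1,2)[symmetric]) (simp add: algebra_simps power2_eq_square d(1,2))
qed

text \<open>In terms of \<open>U\<close>: with \<open>b = 4U'(U - \<rho>U')\<close> and \<open>e = 4UU''\<close> the sectional curvatures of the
  warped product are \<open>b\<close> (tangentially) and \<open>b + \<rho>e\<close> (radially).\<close>

lemma pos_def_ein:
  fixes x :: "real^'n" and k \<epsilon> :: real
  defines "n \<equiv> real CARD('n)" and "\<rho> \<equiv> x \<bullet> x"
  assumes n: "n > 2" and \<epsilon>: "\<epsilon> > 0" and k: "k < n - 1" "\<epsilon> * (2 * n - 2 - k) < (n - 2) * (n - 1 - k)" "\<epsilon> * (2 - k) < n - 2"
    and b: "deriv U \<rho> * (U \<rho> - \<rho> * deriv U \<rho>) > 0" and e: "deriv (deriv U) \<rho> \<le> 0"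
    and be: "\<rho> * U \<rho> * deriv (deriv U) \<rho> \<ge> - (1 + \<epsilon>) * (deriv U \<rho> * (U \<rho> - \<rho> * deriv U \<rho>))"
  shows "pos_def (scal h x *\<^sub>R h x - k *\<^sub>R ricci h x)"
proof -
  define u where "u = U \<rho>"
  have \<rho>0: "\<rho> \<ge> 0" by (simp add: \<rho>_def)
  have u: "u > 0" using Upos \<rho>0 by (simp add: u_def)
  define B E where "B = 4 * (deriv U \<rho> * (u - \<rho> * deriv U \<rho>))" and "E = 4 * (u * deriv (deriv U) \<rho>)"
  have B: "B > 0" using b by (simp add: B_def u_def)
  have E: "E \<le> 0" using e u by (simp add: E_def mult_nonneg_nonpos)
  have BE: "\<rho> * E \<ge> - (1 + \<epsilon>) * B" using be by (simp add: B_def E_def u_def algebra_simps)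
  let ?A = "((n - 1) * B + \<rho> * E) / u\<^sup>2" and ?B = "(n - 2) * E / u\<^sup>2"
  have A: "- (2 * q' \<rho> * \<rho> + (2 * n - 2) * q \<rho> + (n - 2) * (q \<rho>)\<^sup>2 * \<rho>) = ?A"
    using u by (simp add: q_def q'_def B_def E_def u_def[symmetric] field_simps power2_eq_square)
  have Bq: "(n - 2) * ((q \<rho>)\<^sup>2 - 2 * q' \<rho>) = ?B"
    using u by (simp add: q_def q'_def E_def u_def[symmetric] field_simps power2_eq_square)
  have ric: "ric h x Y Z = ?B * (x \<bullet> Y) * (x \<bullet> Z) + ?A * (Y \<bullet> Z)" for Y Z
  proof -
    have "ric h x Y Z = ((n - 2) * ((q \<rho>)\<^sup>2 - 2 * q' \<rho>)) * (x \<bullet> Y) * (x \<bullet> Z)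
      + - (2 * q' \<rho> * \<rho> + (2 * n - 2) * q \<rho> + (n - 2) * (q \<rho>)\<^sup>2 * \<rho>) * (Y \<bullet> Z)"
      by (simp only: ric_h n_def \<rho>_def diff_conv_add_uminus minus_mult_left)
    then show ?thesis unfolding A Bq .
  qed
  have hx: "h x = (1 / u\<^sup>2) *\<^sub>R mat 1" by (simp add: h u_def \<rho>_def)
  have inv: "matrix_inv (h x) = u\<^sup>2 *\<^sub>R mat 1"
    by (rule matrix_inv_unique) (use u in \<open>simp add: hx scaleR_mat_mult\<close>)
  have "scal h x = (\<Sum>j\<in>UNIV. u\<^sup>2 * ricci h x $ j $ j)"
    by (simp add: scal_def inv mat_def if_distrib[of "\<lambda>t. t * _"] if_distrib[of "\<lambda>t. _ * t"] cong: if_cong)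
  also have "\<dots> = u\<^sup>2 * (?B * \<rho> + n * ?A)"
  proof -
    have "(\<Sum>j\<in>UNIV. ric h x (axis j 1) (axis j 1)) = ?B * (\<Sum>j\<in>UNIV. x $ j * x $ j) + n * ?A"
      by (simp add: ric inner_axis sum.distrib sum_distrib_left n_def mult.assoc)
    then show ?thesis
      by (simp add: ricci_eq_ric[OF metric_h UNIV_I] sum_distrib_left[symmetric] \<rho>_def inner_vec_def)
  qed
  finally have scal_eq: "scal h x = u\<^sup>2 * (?B * \<rho> + n * ?A)" .
  have scal: "scal h x = (n - 2) * E * \<rho> + n * ((n - 1) * B + \<rho> * E)"
  proof -
    have "w * (s / w * \<rho> + n * (t / w)) = s * \<rho> + n * t" if "w \<noteq> 0" for w s t
      using that by (simp add: field_simps)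
    from this[of "u\<^sup>2"] show ?thesis using u scal_eq by simp
  qed
  have "v \<bullet> ((scal h x *\<^sub>R h x - k *\<^sub>R ricci h x) *v v) > 0" if v: "v \<noteq> 0" for v
  proof -
    define t where "t = (x \<bullet> v)\<^sup>2"
    have t: "0 \<le> t" "t \<le> \<rho> * (v \<bullet> v)"
      using Cauchy_Schwarz_ineq[of x v] by (simp_all add: t_def \<rho>_def)
    have v0: "v \<bullet> v > 0" using v by simp
    have "v \<bullet> ((scal h x *\<^sub>R h x - k *\<^sub>R ricci h x) *v v) = scal h x * ((1 / u\<^sup>2) * (v \<bullet> v)) - k * ric h x v v"
      by (simp add: matrix_vector_mult_diff_rdistrib scaleR_matrix_vector_assoc[symmetric] inner_diff_right
          inner_ricci[OF metric_h UNIV_I] hx)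
    also have "\<dots> = (((n - k) * (n - 1) * B + (2 * n - 2 - k) * (\<rho> * E)) * (v \<bullet> v) - k * (n - 2) * E * t) / u\<^sup>2"
      unfolding scal ric t_def using u by (simp add: field_simps power2_eq_square)
    finally have eq: "v \<bullet> ((scal h x *\<^sub>R h x - k *\<^sub>R ricci h x) *v v) =
       (((n - k) * (n - 1) * B + (2 * n - 2 - k) * (\<rho> * E)) * (v \<bullet> v) - k * (n - 2) * E * t) / u\<^sup>2" .
    \<comment> \<open>The eigenvalue of Ein_k relative to h on vectors orthogonal to x. In the
      extreme case \<rho> E = -(1 + \<epsilon>) B it equals (n-2)(n-1-k) - \<epsilon>(2n-2-k) times
      B; for \<epsilon> = 0 this is the cylinder, which explains the bound on k.\<close>
    have sph: "(n - k) * (n - 1) * B + (2 * n - 2 - k) * (\<rho> * E) > 0"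
    proof -
      have "(2 * n - 2 - k) * (\<rho> * E) \<ge> (2 * n - 2 - k) * (- (1 + \<epsilon>) * B)"
        using BE k n by (intro mult_left_mono) auto
      moreover have "(n - k) * (n - 1) * B + (2 * n - 2 - k) * (- (1 + \<epsilon>) * B)
          = ((n - 2) * (n - 1 - k) - \<epsilon> * (2 * n - 2 - k)) * B" by (simp add: algebra_simps)
      moreover have "\<dots> > 0" using k B by simp
      ultimately show ?thesis by linarith
    qed
    \<comment> \<open>Times n - 1, this is the eigenvalue in the direction of x. Only for k < 2 does
      a negative \<rho> E lower it, which is the case controlled by the second bound on
      \<epsilon>.\<close>
    have rad: "(n - k) * B + (2 - k) * (\<rho> * E) > 0"
    proof (cases "k \<ge> 2")
      case True
      have "\<rho> * E \<le> 0" using E \<rho>0 by (simp add: mult_nonneg_nonpos)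
      then have "(2 - k) * (\<rho> * E) \<ge> 0" using True by (simp add: mult_nonpos_nonpos)
      moreover have "(n - k) * B > 0" using k B by simp
      ultimately show ?thesis by linarith
    next
      case False
      have "(2 - k) * (\<rho> * E) \<ge> (2 - k) * (- (1 + \<epsilon>) * B)"
        using BE False by (intro mult_left_mono) auto
      moreover have "(n - k) * B + (2 - k) * (- (1 + \<epsilon>) * B) = ((n - 2) - \<epsilon> * (2 - k)) * B"
        by (simp add: algebra_simps)
      moreover have "\<dots> > 0" using k B by simp
      ultimately show ?thesis by linarith
    qed
    have "((n - k) * (n - 1) * B + (2 * n - 2 - k) * (\<rho> * E)) * (v \<bullet> v) - k * (n - 2) * E * t > 0"
    proof (cases "k \<ge> 0")
      case True
      have "k * (n - 2) * (- E) * t \<ge> 0" using True n E t by (intro mult_nonneg_nonneg) auto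
      moreover have "((n - k) * (n - 1) * B + (2 * n - 2 - k) * (\<rho> * E)) * (v \<bullet> v) > 0" using sph v0 by simp
      ultimately show ?thesis by (simp add: algebra_simps)
    next
      case False
      \<comment> \<open>For negative k the term with t lowers the form, most of all when v is
        parallel to x. Replacing t by its Cauchy-Schwarz bound leaves a multiple of the radial
        eigenvalue.\<close>
      have "(- k) * (n - 2) * (- E) * t \<le> (- k) * (n - 2) * (- E) * (\<rho> * (v \<bullet> v))"
        using False n E t by (intro mult_left_mono) (auto intro!: mult_nonneg_nonneg simp: mult_nonpos_nonpos mult_nonneg_nonpos mult_nonpos_nonneg)
      moreover have "((n - k) * (n - 1) * B + (2 * n - 2 - k) * (\<rho> * E)) * (v \<bullet> v) - (- k) * (n - 2) * (- E) * (\<rho> * (v \<bullet> v))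
         = (n - 1) * ((n - k) * B + (2 - k) * (\<rho> * E)) * (v \<bullet> v)" by (simp add: algebra_simps)
      moreover have "\<dots> > 0" using rad n v0 by simp
      ultimately show ?thesis by (simp add: algebra_simps)
    qed
    then show ?thesis unfolding eq using u by simp
  qed
  moreover have "transpose (scal h x *\<^sub>R h x - k *\<^sub>R ricci h x) = scal h x *\<^sub>R h x - k *\<^sub>R ricci h x"
  proof -
    have "ricci h x $ i $ j = ricci h x $ j $ i" for i j
      by (simp add: ricci_eq_ric[OF metric_h UNIV_I] ric inner_commute mult_ac)
    then show ?thesis by (simp add: vec_eq_iff transpose_def hx mat_def)
  qed
  ultimately show ?thesis by (simp add: pos_def_def)
qed

text \<open>For k = 0 the tensor Ein_k is the scalar curvature times the metric, so its positivity
  is that of the scalar curvature.\<close>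

lemma scal_pos:
  fixes x :: "real^'n" and \<epsilon> :: real
  defines "n \<equiv> real CARD('n)" and "\<rho> \<equiv> x \<bullet> x"
  assumes n: "n > 2" and \<epsilon>: "\<epsilon> > 0" "\<epsilon> * (2 * n - 2) < (n - 2) * (n - 1)" "\<epsilon> * 2 < n - 2"
    and b: "deriv U \<rho> * (U \<rho> - \<rho> * deriv U \<rho>) > 0" and e: "deriv (deriv U) \<rho> \<le> 0"
    and be: "\<rho> * U \<rho> * deriv (deriv U) \<rho> \<ge> - (1 + \<epsilon>) * (deriv U \<rho> * (U \<rho> - \<rho> * deriv U \<rho>))"
  shows "scal h x > 0"
proof -
  have "pos_def (scal h x *\<^sub>R h x - 0 *\<^sub>R ricci h x)"
    using assms by (intro pos_def_ein) auto
  then have "axis (undefined::'n) 1 \<bullet> ((scal h x *\<^sub>R h x) *v axis undefined 1) > 0"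
    by (simp add: pos_def_def)
  then have "scal h x * (1 / (U (x \<bullet> x))\<^sup>2) > 0"
    by (simp add: h scaleR_matrix_vector_assoc[symmetric] inner_axis_axis)
  then show ?thesis by (simp add: zero_less_mult_iff zero_less_divide_iff)
qed

end

section \<open>Manifolds with a pseudogroup of local isometries\<close>

definition local_isometry :: "(real^'n \<Rightarrow> real^'n^'n) \<Rightarrow> (real^'n) set \<Rightarrow> (real^'n \<Rightarrow> real^'n) \<Rightarrow> bool" where
  "local_isometry G W \<sigma> \<longleftrightarrow> open W \<and> smooth_on W \<sigma> \<and> (\<forall>x\<in>W. G x = pullback \<sigma> G x)"

lemma pullback_compose:
  assumes "f differentiable (at x)" "g differentiable (at (f x))"
  shows "pullback (\<lambda>y. g (f y)) h x = pullback f (pullback g h) x"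
  by (simp add: pullback_def jacobian_compose[OF assms] matrix_transpose_mul matrix_mul_assoc)

lemma pullback_cong_fun:
  assumes "open S" "x \<in> S" "\<And>y. y \<in> S \<Longrightarrow> f y = g y"
  shows "pullback f h x = pullback g h x"
  using frechet_derivative_cong[OF assms] assms(2,3) by (simp add: pullback_def jacobian_def)

lemma local_isometry_compose:
  assumes "local_isometry G W \<sigma>" "local_isometry G W' \<tau>"
  shows "local_isometry G (W \<inter> \<sigma> -` W') (\<lambda>x. \<tau> (\<sigma> x))"
proof -
  have s: "open W" "smooth_on W \<sigma>" "\<And>x. x \<in> W \<Longrightarrow> G x = pullback \<sigma> G x"
    and t: "open W'" "smooth_on W' \<tau>" "\<And>x. x \<in> W' \<Longrightarrow> G x = pullback \<tau> G x"
    using assms by (auto simp: local_isometry_def)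
  have o: "open (W \<inter> \<sigma> -` W')"
    using continuous_open_preimage[OF smooth_on_continuous[OF s(2)] s(1) t(1)] .
  have "smooth_on (W \<inter> \<sigma> -` W') (\<lambda>x. \<tau> (\<sigma> x))"
    by (rule smooth_on_compose[OF o t(1) _ smooth_on_subset[OF s(2)] t(2)]) auto
  moreover have "G x = pullback (\<lambda>x. \<tau> (\<sigma> x)) G x" if "x \<in> W \<inter> \<sigma> -` W'" for x
  proof -
    have "pullback (\<lambda>x. \<tau> (\<sigma> x)) G x = pullback \<sigma> (pullback \<tau> G) x"
      using that by (intro pullback_compose smooth_on_differentiable[OF s(2)] smooth_on_differentiable[OF t(2)]) auto
    also have "\<dots> = pullback \<sigma> G x" using t(3)[of "\<sigma> x"] that by (simp add: pullback_def)
    finally show ?thesis using s(3) that by simp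
  qed
  ultimately show ?thesis using o by (simp add: local_isometry_def)
qed

text \<open>A directed condition on germs: near each common point the change of coordinates from c
  to d is given by a local isometry of G. The set \<open>W\<close> is to be so small that every
  point of the domain of c with coordinates in it also lies in the domain of d, so overlaps need no
  separate treatment.\<close>

definition compat :: "(real^'n \<Rightarrow> real^'n^'n) \<Rightarrow> ('a, 'n) chart \<Rightarrow> ('a, 'n) chart \<Rightarrow> bool" where
  "compat G c d \<longleftrightarrow> (\<forall>p\<in>fst c \<inter> fst d. \<exists>W \<sigma>. local_isometry G W \<sigma> \<and> snd c p \<in> W \<and>
     (\<forall>q\<in>fst c. snd c q \<in> W \<longrightarrow> q \<in> fst d \<and> snd d q = \<sigma> (snd c q)))"

text \<open>The invariant that survives connected sums. The last clause keeps all coordinates in the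
  region where G is meaningful.\<close>

definition isom_manifold :: "(real^'n::finite \<Rightarrow> real^'n^'n) \<Rightarrow> ('a, 'n) manifold \<Rightarrow> bool" where
  "isom_manifold G M \<longleftrightarrow>
     Hausdorff_space (top_of M) \<and> compact_space (top_of M) \<and> connected_space (top_of M) \<and>
     (\<forall>c\<in>atlas M. is_chart (top_of M) c) \<and>
     (\<Union>c\<in>atlas M. fst c) = topspace (top_of M) \<and>
     (\<forall>c\<in>atlas M. \<forall>d\<in>atlas M. compat G c d) \<and>
     (\<forall>c\<in>atlas M. 0 \<notin> snd c ` fst c)"

text \<open>Since domain and image are open, the homeomorphism can be expressed by open sets of the
  two ambient spaces; in this form charts are easily pushed into a glued space.\<close>

lemma is_chart_iff:
  "is_chart X (U, \<phi>) \<longleftrightarrow> openin X U \<and> inj_on \<phi> U \<and> (\<forall>V. openin X V \<and> V \<subseteq> U \<longrightarrow> open (\<phi> ` V)) \<and>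
     (\<forall>W. open W \<longrightarrow> openin X {p \<in> U. \<phi> p \<in> W})" (is "?L \<longleftrightarrow> ?R")
proof
  assume ?L
  then have oU: "openin X U" and oI: "open (\<phi> ` U)" and h: "homeomorphic_map (subtopology X U) (top_of_set (\<phi> ` U)) \<phi>"
    by (auto simp: is_chart_def)
  have ts: "topspace (subtopology X U) = U" using openin_subset[OF oU] by auto
  have e: "continuous_map (subtopology X U) (top_of_set (\<phi> ` U)) \<phi>" "open_map (subtopology X U) (top_of_set (\<phi> ` U)) \<phi>"
    "inj_on \<phi> U"
    using h unfolding homeomorphic_eq_everything_map ts by auto
  have "open (\<phi> ` V)" if "openin X V" "V \<subseteq> U" for V
  proof -
    have "openin (subtopology X U) V" using that oU by (simp add: openin_open_subtopology)
    then have "openin (top_of_set (\<phi> ` U)) (\<phi> ` V)" using e(2) by (simp add: open_map_def)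
    then show ?thesis using oI openin_open_trans by blast
  qed
  moreover have "openin X {p \<in> U. \<phi> p \<in> W}" if "open W" for W
  proof -
    have "openin (top_of_set (\<phi> ` U)) (\<phi> ` U \<inter> W)" using that by (simp add: openin_open_Int)
    then have "openin (subtopology X U) {p \<in> U. \<phi> p \<in> \<phi> ` U \<inter> W}"
      using e(1) unfolding continuous_map ts by blast
    moreover have "{p \<in> U. \<phi> p \<in> \<phi> ` U \<inter> W} = {p \<in> U. \<phi> p \<in> W}" by auto
    ultimately show ?thesis using oU by (simp add: openin_open_subtopology)
  qed
  ultimately show ?R using oU e(3) by blast
next
  assume R: ?R
  then have oU: "openin X U" and oI: "open (\<phi> ` U)" by auto
  have ts: "topspace (subtopology X U) = U" using openin_subset[OF oU] by auto
  have "homeomorphic_map (subtopology X U) (top_of_set (\<phi> ` U)) \<phi>"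
  proof (rule bijective_open_imp_homeomorphic_map)
    show "continuous_map (subtopology X U) (top_of_set (\<phi> ` U)) \<phi>"
      unfolding continuous_map ts
    proof (intro conjI allI impI)
      fix V assume "openin (top_of_set (\<phi> ` U)) V"
      then have "open V" using oI openin_open_trans by blast
      then show "openin (subtopology X U) {x \<in> U. \<phi> x \<in> V}"
        using R oU by (simp add: openin_open_subtopology)
    qed simp
    show "open_map (subtopology X U) (top_of_set (\<phi> ` U)) \<phi>"
      unfolding open_map_def
    proof (intro allI impI)
      fix V assume "openin (subtopology X U) V"
      then have "openin X V" "V \<subseteq> U" using oU by (auto simp: openin_open_subtopology)
      then show "openin (top_of_set (\<phi> ` U)) (\<phi> ` V)"
        using R by (simp add: open_openin_trans image_mono)
    qed
  qed (use R ts in auto)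
  then show ?L using oU oI by (simp add: is_chart_def)
qed

lemma isom_manifold_transition:
  assumes "isom_manifold G M" "c \<in> atlas M" "d \<in> atlas M" "x \<in> snd c ` (fst c \<inter> fst d)"
  shows "\<exists>W. open W \<and> x \<in> W \<and> smooth_on W (transition c d)" "G x = pullback (transition c d) G x"
proof -
  obtain p where p: "p \<in> fst c \<inter> fst d" "x = snd c p" using assms(4) by blast
  have "compat G c d" and ch: "is_chart (top_of M) (fst c, snd c)" using assms by (auto simp: isom_manifold_def)
  then obtain W \<sigma> where W: "local_isometry G W \<sigma>" "x \<in> W"
    "\<And>q. q \<in> fst c \<Longrightarrow> snd c q \<in> W \<Longrightarrow> q \<in> fst d \<and> snd d q = \<sigma> (snd c q)"
    using p unfolding compat_def by metis
  have inj: "inj_on (snd c) (fst c)" and o: "open (snd c ` fst c)"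
    using ch[unfolded is_chart_iff] by auto
  let ?W = "W \<inter> snd c ` fst c"
  have oW: "open ?W" using W(1) o by (auto simp: local_isometry_def)
  have xW: "x \<in> ?W" using W(2) p by auto
  have eq: "\<sigma> y = transition c d y" if "y \<in> ?W" for y
    using that W(3) by (auto simp: transition_def inv_into_f_f[OF inj])
  have "smooth_on ?W \<sigma>" using W(1) by (auto simp: local_isometry_def intro: smooth_on_subset)
  then have "smooth_on ?W (transition c d)" by (rule smooth_on_cong[OF oW, rotated]) (rule eq)
  then show "\<exists>W. open W \<and> x \<in> W \<and> smooth_on W (transition c d)" using oW xW by blast
  have "G x = pullback \<sigma> G x" using W by (simp add: local_isometry_def)
  also have "\<dots> = pullback (transition c d) G x" by (rule pullback_cong_fun[OF oW xW eq])
  finally show "G x = pullback (transition c d) G x" .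
qed

lemma isom_manifold_closed_connected:
  assumes "isom_manifold G M" shows "closed_connected_manifold M"
proof -
  have "smooth_on (snd c ` (fst c \<inter> fst d)) (transition c d)" if "c \<in> atlas M" "d \<in> atlas M" for c d
    by (rule smooth_on_local) (rule isom_manifold_transition(1)[OF assms that])
  then show ?thesis using assms by (simp add: closed_connected_manifold_def isom_manifold_def)
qed

lemma isom_manifold_riemannian_metric:
  assumes "isom_manifold G M" "smooth_on (- {0}) G" "\<And>x. x \<noteq> 0 \<Longrightarrow> pos_def (G x)"
  shows "riemannian_metric M (\<lambda>c. G)"
proof -
  have z: "snd c ` fst c \<subseteq> - {0}" if "c \<in> atlas M" for c
    using assms(1) that by (auto simp: isom_manifold_def)
  show ?thesis
    unfolding riemannian_metric_def pos_tensor_def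
  proof (intro conjI ballI)
    show "closed_connected_manifold M" by (rule isom_manifold_closed_connected[OF assms(1)])
    show "smooth_on (snd c ` fst c) G" if "c \<in> atlas M" for c
      by (rule smooth_on_subset[OF assms(2) z[OF that]])
    show "pos_def (G x)" if "c \<in> atlas M" "x \<in> snd c ` fst c" for c x
      using z[OF that(1)] that(2) by (intro assms(3)) auto
    show "G x = transpose (jacobian (transition c d) x) ** G (transition c d x) ** jacobian (transition c d) x"
      if "c \<in> atlas M" "d \<in> atlas M" "x \<in> snd c ` (fst c \<inter> fst d)" for c d x
      using isom_manifold_transition(2)[OF assms(1) that] by (simp add: pullback_def)
  qed
qed

subsection \<open>Gluing along an annulus\<close>

lemma norm_inversion: "norm (inversion v) = 1 / norm v"
  by (cases "v = 0") (auto simp: inversion_def power2_eq_square field_simps)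

lemma inversion_inversion: "v \<noteq> 0 \<Longrightarrow> inversion (inversion v) = v"
  by (simp add: inversion_def[of "inversion v"] norm_inversion power_divide) (simp add: inversion_def)

lemma continuous_on_inversion: "continuous_on (- {0}) inversion"
  unfolding inversion_def by (intro continuous_intros) auto

definition annulus :: "(real^'n) set" where "annulus = {v. 1/2 < norm v \<and> norm v < 2}"

lemma open_annulus: "open (annulus :: (real^'n) set)"
proof -
  have eq: "(annulus :: (real^'n) set) = ball 0 2 - cball 0 (1/2)" by (auto simp: annulus_def)
  show ?thesis unfolding eq by (intro open_Diff open_ball closed_cball)
qed

lemma inversion_annulus: "inversion v \<in> annulus \<longleftrightarrow> v \<in> annulus"
proof (cases "v = 0")
  case True
  then show ?thesis by (simp add: inversion_def)
next
  case False
  then show ?thesis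
    using zero_less_norm_iff[of v] by (auto simp: annulus_def norm_inversion less_divide_eq divide_less_eq)
qed

lemma annulus_nonzero: "v \<in> annulus \<Longrightarrow> v \<noteq> 0"
  by (auto simp: annulus_def)

lemma annulus_ball: "v \<in> annulus \<Longrightarrow> v \<in> ball 0 2"
  by (auto simp: annulus_def)

lemma open_inversion_preimage:
  assumes "open S" shows "open {v \<in> annulus. inversion v \<in> S}"
proof -
  have "continuous_on annulus inversion"
    by (rule continuous_on_subset[OF continuous_on_inversion]) (auto dest: annulus_nonzero)
  from continuous_open_preimage[OF this open_annulus assms]
  show ?thesis by (simp add: vimage_def Int_def conj_commute)
qed

text \<open>One side of a connected sum: \<open>P\<close> is the manifold minus a closed disc. The
  assumptions \<open>injI\<close> and \<open>iopen\<close> say that \<open>i\<close> is a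
  homeomorphism of the ball onto an open set.\<close>

locale glue_half =
  fixes X :: "'a topology" and P :: "'a set" and i :: "real^'n::finite \<Rightarrow> 'a"
  assumes P: "P = topspace X - i ` cball 0 (1/2)"
    and isub: "i ` ball 0 2 \<subseteq> topspace X"
    and injI: "inj_on i (ball 0 2)"
    and iopen: "\<And>S. S \<subseteq> ball 0 2 \<Longrightarrow> openin X (i ` S) \<longleftrightarrow> open S"
    and haus: "Hausdorff_space X" and comp: "compact_space X" and conn: "connected_space X"
begin

lemma icont: "continuous_map (top_of_set (ball 0 2)) X i"
  unfolding continuous_map
proof (intro conjI allI impI)
  fix V assume V: "openin X V"
  have "openin X (i ` ball 0 2)" using iopen[of "ball 0 2"] by simp
  then have "openin X (V \<inter> i ` ball 0 2)" using V by blast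
  moreover have "V \<inter> i ` ball 0 2 = i ` {v \<in> ball 0 2. i v \<in> V}" by auto
  ultimately have "open {v \<in> ball 0 2. i v \<in> V}" using iopen[of "{v \<in> ball 0 2. i v \<in> V}"] by force
  then show "openin (top_of_set (ball 0 2)) {x \<in> topspace (top_of_set (ball 0 2)). i x \<in> V}"
    by (auto simp: openin_open_eq)
qed (use isub in simp)

lemma closed_ball_image:
  assumes "r < 2" shows "closedin X (i ` cball 0 r)"
proof -
  have "compactin (top_of_set (ball 0 2)) (cball (0::real^'n) r)"
    using assms compact_cball[of "0::real^'n" r] by (auto simp: compactin_subtopology)
  then show ?thesis using image_compactin icont compactin_imp_closedin[OF haus] by blast
qed

lemma open_P: "openin X P"
  unfolding P using closed_ball_image[of "1/2"] by (intro openin_diff) auto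

lemma i_in_P:
  assumes "v \<in> ball 0 2" shows "i v \<in> P \<longleftrightarrow> norm v > 1/2"
proof
  assume "i v \<in> P" then show "norm v > 1/2" by (auto simp: P not_le[symmetric])
next
  assume n: "norm v > 1/2"
  have "i v \<notin> i ` cball 0 (1/2)"
  proof
    assume "i v \<in> i ` cball 0 (1/2)"
    then obtain w where w: "norm w \<le> 1/2" "i v = i w" by auto
    then have "v = w" using inj_onD[OF injI, of v w] assms by auto
    then show False using n w by simp
  qed
  then show "i v \<in> P" using isub assms by (auto simp: P)
qed

lemma annulus_in_P: "v \<in> annulus \<Longrightarrow> i v \<in> P"
  using i_in_P[of v] by (auto simp: annulus_def)

text \<open>In dimension at least 2 the annulus around the removed disc is connected, so a splitting
  of \<open>P\<close> has it on one side. Adding the disc to that side would split the whole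
  space.\<close>

lemma connected_P:
  assumes "CARD('n) \<ge> 2" shows "connectedin X P"
proof -
  have Psub: "P \<subseteq> topspace X" by (auto simp: P)
  have "connected (annulus :: (real^'n) set)"
    using connected_annulus(1)[of "1/2" "0::real^'n" 2] assms by (simp add: annulus_def)
  then have "connectedin (top_of_set (ball 0 2)) (annulus :: (real^'n) set)"
    by (auto simp: connectedin_subtopology annulus_def)
  then have cA: "connectedin X (i ` annulus)" using connectedin_continuous_map_image[OF icont] by blast
  have AP: "i ` annulus \<subseteq> P" using annulus_in_P by blast
  have main: False if E: "openin X E1" "openin X E2" "P \<subseteq> E1 \<union> E2" "E1 \<inter> E2 \<inter> P = {}"
    "E1 \<inter> P \<noteq> {}" "E2 \<inter> P \<noteq> {}" "i ` annulus \<subseteq> E1" for E1 E2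
  proof -
    let ?B1 = "(E1 \<inter> P) \<union> i ` ball 0 2" and ?B2 = "E2 \<inter> P"
    have o: "openin X ?B1" "openin X ?B2" using E open_P iopen[of "ball 0 2"] by auto
    have un: "?B1 \<union> ?B2 = topspace X"
    proof
      show "?B1 \<union> ?B2 \<subseteq> topspace X" using Psub isub by auto
      have "topspace X = P \<union> i ` cball 0 (1/2)" using isub by (auto simp: P)
      also have "\<dots> \<subseteq> P \<union> i ` ball 0 2" by (intro Un_mono image_mono) auto
      also have "\<dots> \<subseteq> ?B1 \<union> ?B2" using E(3) by auto
      finally show "topspace X \<subseteq> ?B1 \<union> ?B2" .
    qed
    have "i v \<notin> ?B2" if "v \<in> ball 0 2" for v
    proof
      assume v: "i v \<in> ?B2"
      then have "v \<in> annulus" using i_in_P[OF that] that by (auto simp: annulus_def)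
      then show False using v E(4,7) by auto
    qed
    then have disj: "?B1 \<inter> ?B2 = {}" using E(4) by auto
    show False using conn o un disj E(5,6) unfolding connected_space_eq by blast
  qed
  show ?thesis
    unfolding connectedin
  proof (intro conjI Psub notI)
    assume "\<exists>E1 E2. openin X E1 \<and> openin X E2 \<and> P \<subseteq> E1 \<union> E2 \<and> E1 \<inter> E2 \<inter> P = {} \<and> E1 \<inter> P \<noteq> {} \<and> E2 \<inter> P \<noteq> {}"
    then obtain E1 E2 where E: "openin X E1" "openin X E2" "P \<subseteq> E1 \<union> E2" "E1 \<inter> E2 \<inter> P = {}"
      "E1 \<inter> P \<noteq> {}" "E2 \<inter> P \<noteq> {}" by blast
    have "i ` annulus \<subseteq> E1 \<union> E2" "E1 \<inter> E2 \<inter> i ` annulus = {}" using E AP by auto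
    then have "E1 \<inter> i ` annulus = {} \<or> E2 \<inter> i ` annulus = {}"
      using connectedinD[OF cA E(1,2)] by blast
    then have "i ` annulus \<subseteq> E2 \<or> i ` annulus \<subseteq> E1" using E(3) AP by blast
    then show False
    proof
      assume "i ` annulus \<subseteq> E2"
      then show False using main[of E2 E1] E by (simp add: Un_commute Int_commute Int_left_commute)
    next
      assume "i ` annulus \<subseteq> E1" then show False using main[of E1 E2] E by simp
    qed
  qed
qed

end

section \<open>Topology of the glued space\<close>

text \<open>An abstract form of the connected sum in which both sides have equal rights, in contrast
  to the choice of representatives in the definition: \<open>rel\<close> describes the identified
  points, and \<open>Y\<close> carries the final topology for \<open>e1\<close> and
  \<open>e2\<close>.\<close>

locale glue = h1: glue_half X1 P1 i1 + h2: glue_half X2 P2 i2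
  for X1 X2 :: "'a topology" and P1 P2 :: "'a set" and i1 i2 :: "real^'n::finite \<Rightarrow> 'a" +
  fixes e1 e2 :: "'a \<Rightarrow> 'b" and Y :: "'b topology"
  assumes inj1: "inj_on e1 P1" and inj2: "inj_on e2 P2"
    and rel: "\<And>m m'. m \<in> P1 \<Longrightarrow> m' \<in> P2 \<Longrightarrow> e1 m = e2 m' \<longleftrightarrow> (\<exists>v\<in>annulus. m = i1 v \<and> m' = i2 (inversion v))"
    and Y: "\<And>W. openin Y W \<longleftrightarrow> W \<subseteq> e1 ` P1 \<union> e2 ` P2 \<and> openin X1 {m \<in> P1. e1 m \<in> W} \<and> openin X2 {m \<in> P2. e2 m \<in> W}"
begin

text \<open>Inversion is an involution of the annulus, so the sides can be exchanged and it is
  enough to prove facts about the first one.\<close>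

lemma swap: "glue X2 X1 P2 P1 i2 i1 e2 e1 Y"
proof unfold_locales
  show "e2 m = e1 m' \<longleftrightarrow> (\<exists>v\<in>annulus. m = i2 v \<and> m' = i1 (inversion v))" if "m \<in> P2" "m' \<in> P1" for m m'
  proof -
    have "(\<exists>v\<in>annulus. m' = i1 v \<and> m = i2 (inversion v)) \<longleftrightarrow> (\<exists>v\<in>annulus. m = i2 v \<and> m' = i1 (inversion v))"
      using inversion_annulus inversion_inversion annulus_nonzero by metis
    then show ?thesis using rel[OF that(2,1)] by metis
  qed
  show "openin Y W \<longleftrightarrow> W \<subseteq> e2 ` P2 \<union> e1 ` P1 \<and> openin X2 {m \<in> P2. e2 m \<in> W} \<and> openin X1 {m \<in> P1. e1 m \<in> W}" for W
    using Y[of W] by (auto simp: Un_commute)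
qed (rule inj1 inj2)+

lemma overlap: "v \<in> annulus \<Longrightarrow> e1 (i1 v) = e2 (i2 (inversion v))"
  using rel[of "i1 v" "i2 (inversion v)"] h1.annulus_in_P h2.annulus_in_P inversion_annulus by blast

text \<open>Openness in \<open>Y\<close> is tested on both pieces. On the second piece the preimage
  is the part of V in the annulus carried over by inversion, which is open.\<close>

lemma open_map1:
  assumes "openin X1 V" "V \<subseteq> P1" shows "openin Y (e1 ` V)"
  unfolding Y
proof (intro conjI)
  show "e1 ` V \<subseteq> e1 ` P1 \<union> e2 ` P2" using assms by blast
  have "{m \<in> P1. e1 m \<in> e1 ` V} = V" using assms(2) inj_onD[OF inj1] by blast
  then show "openin X1 {m \<in> P1. e1 m \<in> e1 ` V}" using assms by simp
  let ?S = "{v \<in> ball 0 2. i1 v \<in> V}" and ?T = "{w \<in> annulus. inversion w \<in> {v \<in> ball 0 2. i1 v \<in> V}}"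
  have "open ?S"
    using h1.icont assms(1) unfolding continuous_map by (auto simp: openin_open_eq)
  then have oT: "open ?T" by (rule open_inversion_preimage)
  have eqT: "{m \<in> P2. e2 m \<in> e1 ` V} = i2 ` ?T"
  proof (intro set_eqI iffI)
    fix m assume "m \<in> {m \<in> P2. e2 m \<in> e1 ` V}"
    then obtain m' where m: "m \<in> P2" "m' \<in> V" "e1 m' = e2 m" by auto
    then obtain v where v: "v \<in> annulus" "m' = i1 v" "m = i2 (inversion v)" using rel[of m' m] assms(2) by blast
    have "v \<in> ball 0 2" using annulus_ball v(1) .
    then have "inversion v \<in> ?T"
      using m v by (simp add: inversion_annulus inversion_inversion annulus_nonzero)
    then show "m \<in> i2 ` ?T" using v by blast
  next
    fix m assume "m \<in> i2 ` ?T"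
    then obtain w where w: "w \<in> annulus" "i1 (inversion w) \<in> V" "m = i2 w" by auto
    have m: "m \<in> P2" using w h2.annulus_in_P by blast
    have "e1 (i1 (inversion w)) = e2 m"
      using overlap[of "inversion w"] w by (simp add: inversion_annulus inversion_inversion annulus_nonzero)
    then show "m \<in> {m \<in> P2. e2 m \<in> e1 ` V}" using m w(2) by force
  qed
  show "openin X2 {m \<in> P2. e2 m \<in> e1 ` V}"
  proof -
    have "?T \<subseteq> ball 0 2" by (auto simp: annulus_def)
    from h2.iopen[OF this] show ?thesis using oT eqT by simp
  qed
qed

lemma topspace_Y: "topspace Y = e1 ` P1 \<union> e2 ` P2"
proof
  show "topspace Y \<subseteq> e1 ` P1 \<union> e2 ` P2" using Y[of "topspace Y"] by simp
  have "openin Y (e1 ` P1)" using open_map1[OF h1.open_P] by simp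
  moreover have "openin Y (e2 ` P2)" using glue.open_map1[OF swap h2.open_P] by simp
  ultimately show "e1 ` P1 \<union> e2 ` P2 \<subseteq> topspace Y" by (simp add: openin_subset)
qed

lemma cont1: "continuous_map (subtopology X1 P1) Y e1"
proof -
  have ts: "topspace (subtopology X1 P1) = P1" using openin_subset[OF h1.open_P] by auto
  show ?thesis unfolding continuous_map ts
    using Y h1.open_P by (auto simp: topspace_Y openin_open_subtopology)
qed

lemma separate1:
  assumes "p \<in> e1 ` P1" "q \<in> e1 ` P1" "p \<noteq> q"
  shows "\<exists>U V. openin Y U \<and> openin Y V \<and> p \<in> U \<and> q \<in> V \<and> disjnt U V"
proof -
  obtain m m' where m: "m \<in> P1" "m' \<in> P1" "p = e1 m" "q = e1 m'" using assms by auto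
  then have "m \<noteq> m'" "m \<in> topspace X1" "m' \<in> topspace X1" using assms(3) by (auto simp: h1.P)
  then obtain U V where U: "openin X1 U" "openin X1 V" "m \<in> U" "m' \<in> V" "disjnt U V"
    using h1.haus unfolding Hausdorff_space_def by metis
  have "openin Y (e1 ` (U \<inter> P1))" "openin Y (e1 ` (V \<inter> P1))"
    using U h1.open_P by (auto intro!: open_map1)
  moreover have "disjnt (e1 ` (U \<inter> P1)) (e1 ` (V \<inter> P1))"
    using U(5) inj_onD[OF inj1] unfolding disjnt_iff by blast
  moreover have "p \<in> e1 ` (U \<inter> P1)" "q \<in> e1 ` (V \<inter> P1)" using m U by auto
  ultimately show ?thesis by blast
qed

lemma outside1:
  assumes "p \<in> e1 ` P1" "p \<notin> e2 ` P2"
  shows "p \<in> e1 ` (topspace X1 - i1 ` cball 0 1)"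
proof -
  obtain m where m: "m \<in> P1" "p = e1 m" using assms by auto
  have "m \<notin> i1 ` cball 0 1"
  proof
    assume "m \<in> i1 ` cball 0 1"
    then obtain v where v: "norm v \<le> 1" "m = i1 v" by auto
    then have "v \<in> ball 0 2" by auto
    then have "v \<in> annulus" using h1.i_in_P[of v] m v by (auto simp: annulus_def)
    then show False using overlap m v assms(2) h2.annulus_in_P inversion_annulus by blast
  qed
  then show ?thesis using m by (auto simp: h1.P)
qed

lemma collar1: "openin X1 (topspace X1 - i1 ` cball 0 1)" "topspace X1 - i1 ` cball 0 1 \<subseteq> P1"
  using h1.closed_ball_image[of 1] by (auto intro!: openin_diff simp: h1.P)

text \<open>The parts of both pieces beyond the unit sphere |v| = 1 are open and have disjoint
  images: identified points have inverse norms, which cannot both exceed 1.\<close>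

lemma separate12:
  assumes "p \<in> e1 ` P1" "p \<notin> e2 ` P2" "q \<in> e2 ` P2" "q \<notin> e1 ` P1"
  shows "\<exists>U V. openin Y U \<and> openin Y V \<and> p \<in> U \<and> q \<in> V \<and> disjnt U V"
proof -
  let ?U = "e1 ` (topspace X1 - i1 ` cball 0 1)" and ?V = "e2 ` (topspace X2 - i2 ` cball 0 1)"
  have "openin Y ?U" "openin Y ?V"
    using open_map1[OF collar1] glue.open_map1[OF swap glue.collar1[OF swap]] by auto
  moreover have "p \<in> ?U" "q \<in> ?V" using outside1[OF assms(1,2)] glue.outside1[OF swap assms(3,4)] by auto
  moreover have "disjnt ?U ?V"
  proof -
    have False if h: "m \<in> topspace X1 - i1 ` cball 0 1" "m' \<in> topspace X2 - i2 ` cball 0 1" "e1 m = e2 m'" for m m'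
    proof -
      have "m \<in> P1" "m' \<in> P2" using h(1,2) collar1(2) glue.collar1(2)[OF swap] by auto
      then obtain v where v: "v \<in> annulus" "m = i1 v" "m' = i2 (inversion v)" using rel h(3) by blast
      then have "norm v > 1" "norm (inversion v) > 1" using h(1,2) by (auto simp: image_iff not_le[symmetric])
      then show False by (auto simp: norm_inversion less_divide_eq split: if_splits)
    qed
    then show ?thesis unfolding disjnt_iff by blast
  qed
  ultimately show ?thesis by blast
qed

lemma Hausdorff_Y: "Hausdorff_space Y"
  unfolding Hausdorff_space_def topspace_Y
proof (intro allI impI, elim conjE)
  fix p q assume p: "p \<in> e1 ` P1 \<union> e2 ` P2" "q \<in> e1 ` P1 \<union> e2 ` P2" "p \<noteq> q"
  consider "p \<in> e1 ` P1" "q \<in> e1 ` P1" | "p \<in> e2 ` P2" "q \<in> e2 ` P2"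
    | "p \<in> e1 ` P1" "p \<notin> e2 ` P2" "q \<in> e2 ` P2" "q \<notin> e1 ` P1"
    | "q \<in> e1 ` P1" "q \<notin> e2 ` P2" "p \<in> e2 ` P2" "p \<notin> e1 ` P1" using p by blast
  then show "\<exists>U V. openin Y U \<and> openin Y V \<and> p \<in> U \<and> q \<in> V \<and> disjnt U V"
  proof cases
    case 1 then show ?thesis by (rule separate1[OF _ _ p(3)])
  next
    case 2 then show ?thesis by (rule glue.separate1[OF swap _ _ p(3)])
  next
    case 3 then show ?thesis by (rule separate12)
  next
    case 4 show ?thesis by (rule glue.separate12[OF swap 4(3,4,1,2)])
  qed
qed

text \<open>Cutting along |v| = 1 on both sides leaves two compact sets whose images cover the glued
  space.\<close>

lemma compact1: "compactin Y (e1 ` (topspace X1 - i1 ` ball 0 1))"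
proof -
  have "openin X1 (i1 ` ball 0 1)" using h1.iopen[of "ball 0 1"] by (simp add: subset_ball)
  then have "closedin X1 (topspace X1 - i1 ` ball 0 1)" by blast
  then have "compactin X1 (topspace X1 - i1 ` ball 0 1)" using h1.comp closedin_compact_space by blast
  moreover have "topspace X1 - i1 ` ball 0 1 \<subseteq> P1" unfolding h1.P by (intro Diff_mono image_mono) auto
  ultimately have "compactin (subtopology X1 P1) (topspace X1 - i1 ` ball 0 1)" by (simp add: compactin_subtopology)
  then show ?thesis using image_compactin cont1 by blast
qed

lemma cover1:
  assumes "p \<in> e1 ` P1"
  shows "p \<in> e1 ` (topspace X1 - i1 ` ball 0 1) \<union> e2 ` (topspace X2 - i2 ` ball 0 1)"
proof -
  obtain m where m: "m \<in> P1" "p = e1 m" using assms by auto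
  show ?thesis
  proof (cases "m \<in> i1 ` ball 0 1")
    case True
    then obtain v where v: "norm v < 1" "m = i1 v" by auto
    then have "v \<in> ball 0 2" by auto
    then have va: "v \<in> annulus" using h1.i_in_P[of v] m v by (auto simp: annulus_def)
    have "norm (inversion v) > 1" using v(1) annulus_nonzero[OF va] by (simp add: norm_inversion)
    have "i2 (inversion v) \<notin> i2 ` ball 0 1"
    proof
      assume "i2 (inversion v) \<in> i2 ` ball 0 1"
      then obtain w where w: "norm w < 1" "i2 (inversion v) = i2 w" by auto
      then have "inversion v = w"
        using inj_onD[OF h2.injI, of "inversion v" w] annulus_ball va inversion_annulus by auto
      then show False using w \<open>norm (inversion v) > 1\<close> by simp
    qed
    moreover have "i2 (inversion v) \<in> topspace X2" using h2.annulus_in_P va inversion_annulus by (auto simp: h2.P)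
    ultimately show ?thesis using overlap[OF va] m v by auto
  next
    case False
    then show ?thesis using m by (auto simp: h1.P)
  qed
qed

lemma compact_Y: "compact_space Y"
proof -
  have "topspace Y = e1 ` (topspace X1 - i1 ` ball 0 1) \<union> e2 ` (topspace X2 - i2 ` ball 0 1)"
  proof
    show "topspace Y \<subseteq> e1 ` (topspace X1 - i1 ` ball 0 1) \<union> e2 ` (topspace X2 - i2 ` ball 0 1)"
      using cover1 glue.cover1[OF swap] unfolding topspace_Y by blast
    show "e1 ` (topspace X1 - i1 ` ball 0 1) \<union> e2 ` (topspace X2 - i2 ` ball 0 1) \<subseteq> topspace Y"
      using compact1 glue.compact1[OF swap] compactin_subset_topspace by blast
  qed
  then show ?thesis
    using compactin_Un[OF compact1 glue.compact1[OF swap]] by (simp add: compact_space_def)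
qed

lemma connected_Y:
  assumes "CARD('n) \<ge> 2" shows "connected_space Y"
proof -
  have "connectedin (subtopology X1 P1) P1" using h1.connected_P[OF assms] by (simp add: connectedin_subtopology)
  then have 1: "connectedin Y (e1 ` P1)" using connectedin_continuous_map_image[OF cont1] by blast
  have "connectedin (subtopology X2 P2) P2" using h2.connected_P[OF assms] by (simp add: connectedin_subtopology)
  then have 2: "connectedin Y (e2 ` P2)" using connectedin_continuous_map_image[OF glue.cont1[OF swap]] by blast
  have "axis undefined 1 \<in> (annulus :: (real^'n) set)" by (simp add: annulus_def)
  then have "e1 ` P1 \<inter> e2 ` P2 \<noteq> {}"
    using overlap h1.annulus_in_P h2.annulus_in_P inversion_annulus by blast
  then show ?thesis using connectedin_Un[OF 1 2] by (simp add: topspace_Y flip: connectedin_topspace)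
qed

section \<open>Charts of the glued space\<close>

abbreviation "push1 \<equiv> (\<lambda>(U, \<phi>). (e1 ` (U \<inter> P1), \<phi> \<circ> inv_into P1 e1)) :: ('a, 'n) chart \<Rightarrow> ('b, 'n) chart"
abbreviation "push2 \<equiv> (\<lambda>(U, \<phi>). (e2 ` (U \<inter> P2), \<phi> \<circ> inv_into P2 e2)) :: ('a, 'n) chart \<Rightarrow> ('b, 'n) chart"

lemma inv1: "m \<in> P1 \<Longrightarrow> inv_into P1 e1 (e1 m) = m"
  by (rule inv_into_f_f[OF inj1])

lemma chart1:
  assumes "is_chart X1 c" shows "is_chart Y (push1 c)"
proof -
  obtain U \<phi> where c: "c = (U, \<phi>)" by (cases c)
  have ch: "openin X1 U" "inj_on \<phi> U" "\<And>V. openin X1 V \<Longrightarrow> V \<subseteq> U \<Longrightarrow> open (\<phi> ` V)"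
    "\<And>W. open W \<Longrightarrow> openin X1 {p \<in> U. \<phi> p \<in> W}" using assms by (auto simp: c is_chart_iff)
  have "is_chart Y (e1 ` (U \<inter> P1), \<phi> \<circ> inv_into P1 e1)"
    unfolding is_chart_iff
  proof (intro conjI allI impI)
    show "openin Y (e1 ` (U \<inter> P1))" using ch(1) h1.open_P by (intro open_map1) auto
    show "inj_on (\<phi> \<circ> inv_into P1 e1) (e1 ` (U \<inter> P1))"
      by (rule inj_onI) (auto simp: inv1 dest: inj_onD[OF ch(2)])
  next
    fix V assume V: "openin Y V \<and> V \<subseteq> e1 ` (U \<inter> P1)"
    have "(\<phi> \<circ> inv_into P1 e1) ` V = \<phi> ` {m \<in> P1. e1 m \<in> V}"
    proof (intro set_eqI iffI)
      fix x assume "x \<in> (\<phi> \<circ> inv_into P1 e1) ` V"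
      then obtain y where y: "y \<in> V" "x = \<phi> (inv_into P1 e1 y)" by auto
      then obtain m where "m \<in> P1" "y = e1 m" using V by auto
      then show "x \<in> \<phi> ` {m \<in> P1. e1 m \<in> V}" using y inv1[of m] by (intro image_eqI[of _ _ m]) auto
    next
      fix x assume "x \<in> \<phi> ` {m \<in> P1. e1 m \<in> V}"
      then obtain m where "m \<in> P1" "e1 m \<in> V" "x = \<phi> m" by auto
      then show "x \<in> (\<phi> \<circ> inv_into P1 e1) ` V" using inv1[of m] by (intro image_eqI[of _ _ "e1 m"]) auto
    qed
    moreover have "{m \<in> P1. e1 m \<in> V} \<subseteq> U" using V inj_onD[OF inj1] by blast
    moreover have "openin X1 {m \<in> P1. e1 m \<in> V}" using V Y by blast
    ultimately show "open ((\<phi> \<circ> inv_into P1 e1) ` V)" using ch(3) by simp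
  next
    fix W :: "(real^'n) set" assume "open W"
    then have "openin Y (e1 ` ({p \<in> U. \<phi> p \<in> W} \<inter> P1))"
      using ch(4) h1.open_P by (intro open_map1) auto
    moreover have "{p \<in> e1 ` (U \<inter> P1). (\<phi> \<circ> inv_into P1 e1) p \<in> W} = e1 ` ({p \<in> U. \<phi> p \<in> W} \<inter> P1)"
      by (auto simp: inv1)
    ultimately show "openin Y {p \<in> e1 ` (U \<inter> P1). (\<phi> \<circ> inv_into P1 e1) p \<in> W}" by simp
  qed
  then show ?thesis by (simp add: c)
qed

lemma compat1:
  assumes "compat G c d" shows "compat G (push1 c) (push1 d)"
proof -
  obtain U \<phi> U' \<phi>' where cd: "c = (U, \<phi>)" "d = (U', \<phi>')" by (cases c, cases d)
  show ?thesis
    unfolding compat_def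
  proof
    fix p assume "p \<in> fst (push1 c) \<inter> fst (push1 d)"
    then obtain m m' where m: "m \<in> U" "m \<in> P1" "m' \<in> U'" "m' \<in> P1" "p = e1 m" "e1 m = e1 m'" by (auto simp: cd)
    then have mm: "m' = m" using inj_onD[OF inj1] by blast
    then obtain W \<sigma> where W: "local_isometry G W \<sigma>" "\<phi> m \<in> W"
      "\<And>q. q \<in> U \<Longrightarrow> \<phi> q \<in> W \<Longrightarrow> q \<in> U' \<and> \<phi>' q = \<sigma> (\<phi> q)"
      using assms m unfolding compat_def cd by fastforce
    show "\<exists>W \<sigma>. local_isometry G W \<sigma> \<and> snd (push1 c) p \<in> W \<and>
      (\<forall>q\<in>fst (push1 c). snd (push1 c) q \<in> W \<longrightarrow> q \<in> fst (push1 d) \<and> snd (push1 d) q = \<sigma> (snd (push1 c) q))"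
      using W m(1,2,5) by (intro exI[of _ W] exI[of _ \<sigma>]) (auto simp: cd inv1)
  qed
qed

text \<open>The change of coordinates across the gluing factors into three isometries: from c to the
  disc chart \<open>c1\<close>, then \<gamma>, which is the gluing map written in disc coordinates,
  then from the disc chart \<open>c2\<close> to d.\<close>

lemma compat12:
  assumes "compat G c c1" "compat G c2 d" "fst c \<subseteq> topspace X1" "fst d \<subseteq> topspace X2"
    and c1: "fst c1 = i1 ` ball 0 2" "\<And>v. v \<in> ball 0 2 \<Longrightarrow> snd c1 (i1 v) = a1 + v /\<^sub>R 4"
    and c2: "fst c2 = i2 ` ball 0 2" "\<And>v. v \<in> ball 0 2 \<Longrightarrow> snd c2 (i2 v) = a2 + v /\<^sub>R 4"
    and \<gamma>: "local_isometry G ((\<lambda>v. a1 + v /\<^sub>R 4) ` annulus) \<gamma>"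
       "\<And>v. v \<in> annulus \<Longrightarrow> \<gamma> (a1 + v /\<^sub>R 4) = a2 + inversion v /\<^sub>R 4"
  shows "compat G (push1 c) (push2 d)"
proof -
  obtain U \<phi> U' \<phi>' where cd: "c = (U, \<phi>)" "d = (U', \<phi>')" by (cases c, cases d)
  show ?thesis
    unfolding compat_def
  proof
    fix p assume "p \<in> fst (push1 c) \<inter> fst (push2 d)"
    then obtain m m' where m: "m \<in> U" "m \<in> P1" "m' \<in> U'" "m' \<in> P2" "p = e1 m" "e1 m = e2 m'" by (auto simp: cd)
    then obtain v where v: "v \<in> annulus" "m = i1 v" "m' = i2 (inversion v)" using rel by blast
    have vb: "v \<in> ball 0 2" "inversion v \<in> ball 0 2" using v annulus_ball inversion_annulus by blast+
    have "m \<in> fst c \<inter> fst c1" using m v vb by (auto simp: c1 cd)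
    then obtain W \<sigma> where W: "local_isometry G W \<sigma>" "\<phi> m \<in> W"
      "\<And>q. q \<in> U \<Longrightarrow> \<phi> q \<in> W \<Longrightarrow> q \<in> fst c1 \<and> snd c1 q = \<sigma> (\<phi> q)"
      using assms(1) unfolding compat_def cd by fastforce
    have "m' \<in> fst c2 \<inter> fst d" using m v vb by (auto simp: c2 cd)
    then obtain W' \<sigma>' where W': "local_isometry G W' \<sigma>'" "snd c2 m' \<in> W'"
      "\<And>q. q \<in> fst c2 \<Longrightarrow> snd c2 q \<in> W' \<Longrightarrow> q \<in> U' \<and> \<phi>' q = \<sigma>' (snd c2 q)"
      using assms(2) unfolding compat_def cd by fastforce
    let ?A = "(\<lambda>v. a1 + v /\<^sub>R 4) ` annulus"
    let ?V = "(W \<inter> \<sigma> -` ?A) \<inter> (\<lambda>x. \<gamma> (\<sigma> x)) -` W'"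
    have iso: "local_isometry G ?V (\<lambda>x. \<sigma>' (\<gamma> (\<sigma> x)))"
      by (rule local_isometry_compose[OF local_isometry_compose[OF W(1) \<gamma>(1)] W'(1)])
    have sm: "\<sigma> (\<phi> m) = a1 + v /\<^sub>R 4" using W(3)[OF m(1) W(2)] c1(2)[OF vb(1)] v by simp
    have inV: "\<phi> m \<in> ?V"
      using W(2) sm v W'(2) c2(2)[OF vb(2)] \<gamma>(2)[OF v(1)] by auto
    have key: "q \<in> e2 ` (U' \<inter> P2) \<and> \<phi>' (inv_into P2 e2 q) = \<sigma>' (\<gamma> (\<sigma> (\<phi> (inv_into P1 e1 q))))"
      if q: "q \<in> e1 ` (U \<inter> P1)" "\<phi> (inv_into P1 e1 q) \<in> ?V" for q
    proof -
      obtain k where k: "k \<in> U" "k \<in> P1" "q = e1 k" using q by auto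
      have kV: "\<phi> k \<in> W" "\<gamma> (\<sigma> (\<phi> k)) \<in> W'" using q k by (auto simp: inv1)
      obtain u where u: "u \<in> ball 0 2" "k = i1 u" "\<sigma> (\<phi> k) = a1 + u /\<^sub>R 4"
        using W(3)[OF k(1) kV(1)] c1 by auto
      have ua: "u \<in> annulus" using h1.i_in_P[OF u(1)] k u by (auto simp: annulus_def)
      have ub: "inversion u \<in> ball 0 2" using ua annulus_ball inversion_annulus by blast
      have g: "\<gamma> (\<sigma> (\<phi> k)) = snd c2 (i2 (inversion u))" using \<gamma>(2)[OF ua] u c2(2)[OF ub] by simp
      have k': "i2 (inversion u) \<in> U'" "\<phi>' (i2 (inversion u)) = \<sigma>' (\<gamma> (\<sigma> (\<phi> k)))"
        using W'(3)[of "i2 (inversion u)"] kV g c2(1) ub by auto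
      have P: "i2 (inversion u) \<in> P2" using h2.annulus_in_P ua inversion_annulus by blast
      have "q = e2 (i2 (inversion u))" using overlap[OF ua] k u by simp
      then have "inv_into P2 e2 q = i2 (inversion u)" using glue.inv1[OF swap P] by simp
      moreover have "inv_into P1 e1 q = k" using inv1 k by simp
      ultimately show ?thesis using k' P \<open>q = e2 _\<close> by simp
    qed
    have ip: "inv_into P1 e1 p = m" using inv1[OF m(2)] m(5) by simp
    show "\<exists>W \<sigma>. local_isometry G W \<sigma> \<and> snd (push1 c) p \<in> W \<and>
      (\<forall>q\<in>fst (push1 c). snd (push1 c) q \<in> W \<longrightarrow> q \<in> fst (push2 d) \<and> snd (push2 d) q = \<sigma> (snd (push1 c) q))"
      using iso inV key by (intro exI[of _ ?V] exI[of _ "\<lambda>x. \<sigma>' (\<gamma> (\<sigma> x))"]) (simp add: cd ip)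
  qed
qed

end

subsection \<open>Connected sums\<close>

lemma isom_manifoldD:
  assumes "isom_manifold G M"
  shows "Hausdorff_space (top_of M)" "compact_space (top_of M)" "connected_space (top_of M)"
    "\<And>c. c \<in> atlas M \<Longrightarrow> is_chart (top_of M) c" "(\<Union>c\<in>atlas M. fst c) = topspace (top_of M)"
    "\<And>c d. c \<in> atlas M \<Longrightarrow> d \<in> atlas M \<Longrightarrow> compat G c d"
    "\<And>c. c \<in> atlas M \<Longrightarrow> 0 \<notin> snd c ` fst c"
  using assms by (auto simp: isom_manifold_def)

lemma open_quarter_iff: "open ((\<lambda>v. a + v /\<^sub>R 4) ` S) \<longleftrightarrow> open (S :: (real^'n) set)"
proof
  assume "open ((\<lambda>v. a + v /\<^sub>R 4) ` S)"
  then have "open ((\<lambda>x. (- 4) *\<^sub>R a + 4 *\<^sub>R x) ` (\<lambda>v. a + v /\<^sub>R 4) ` S)" by (rule open_affinity) simp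
  then show "open S" by (simp add: image_image scaleR_add_right)
next
  assume "open S"
  then show "open ((\<lambda>v. a + v /\<^sub>R 4) ` S)" by (rule open_affinity) simp
qed

lemma norm_inversion_iff:
  assumes "v \<noteq> 0"
  shows "norm (inversion v) < 1 \<longleftrightarrow> 1 < norm v" "norm (inversion v) \<le> 1 \<longleftrightarrow> 1 \<le> norm v"
  using assms by (simp_all add: norm_inversion divide_less_eq_1 divide_le_eq_1)

text \<open>In the chart c the embedding \<open>i\<close> becomes the affine map v -> a + v/4, so it
  inherits injectivity and openness from it.\<close>

lemma glue_half_disc:
  fixes i :: "real^'n::finite \<Rightarrow> 'a"
  assumes "isom_manifold G M" "c \<in> atlas M" "fst c = i ` ball 0 2"
    "\<And>v. v \<in> ball 0 2 \<Longrightarrow> snd c (i v) = a + v /\<^sub>R 4"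
  shows "glue_half (top_of M) (topspace (top_of M) - i ` cball 0 (1/2)) i"
proof
  have ch: "is_chart (top_of M) (fst c, snd c)" using isom_manifoldD(4)[OF assms(1,2)] by simp
  note c = ch[unfolded is_chart_iff assms(3)]
  show "i ` ball 0 2 \<subseteq> topspace (top_of M)" by (rule openin_subset[OF conjunct1[OF c]])
  show inj: "inj_on i (ball 0 2)"
  proof (rule inj_onI)
    fix v w assume "v \<in> ball 0 2" "w \<in> ball 0 2" "i v = i w"
    then have "a + v /\<^sub>R 4 = a + w /\<^sub>R 4" using assms(4) by metis
    then show "v = w" by simp
  qed
  show "openin (top_of M) (i ` S) \<longleftrightarrow> open S" if S: "S \<subseteq> ball 0 2" for S
  proof
    have im: "snd c ` i ` S = (\<lambda>v. a + v /\<^sub>R 4) ` S"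
      using assms(4) S by (auto simp: image_image subset_iff intro!: image_cong)
    assume "openin (top_of M) (i ` S)"
    then have "open (snd c ` i ` S)" using c S by (simp add: image_mono)
    then show "open S" unfolding im open_quarter_iff .
  next
    assume "open S"
    then have "openin (top_of M) {p \<in> i ` ball 0 2. snd c p \<in> (\<lambda>v. a + v /\<^sub>R 4) ` S}"
      using c by (simp only: open_quarter_iff)
    moreover have "{p \<in> i ` ball 0 2. snd c p \<in> (\<lambda>v. a + v /\<^sub>R 4) ` S} = i ` S"
    proof (intro set_eqI iffI)
      fix p assume "p \<in> {p \<in> i ` ball 0 2. snd c p \<in> (\<lambda>v. a + v /\<^sub>R 4) ` S}"
      then obtain v w where v: "v \<in> ball 0 2" "p = i v" "w \<in> S" "snd c p = a + w /\<^sub>R 4" by blast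
      then have "a + v /\<^sub>R 4 = a + w /\<^sub>R 4" using assms(4)[of v] by simp
      then show "p \<in> i ` S" using v by simp
    next
      fix p assume "p \<in> i ` S"
      then obtain v where v: "v \<in> S" "p = i v" by blast
      then have "v \<in> ball 0 2" using S by blast
      then show "p \<in> {p \<in> i ` ball 0 2. snd c p \<in> (\<lambda>v. a + v /\<^sub>R 4) ` S}"
        using v assms(4)[of v] by auto
    qed
    ultimately show "openin (top_of M) (i ` S)" by simp
  qed
qed (use isom_manifoldD[OF assms(1)] in auto)

context glue_half
begin

lemma i_eq_iff: "v \<in> ball 0 2 \<Longrightarrow> w \<in> ball 0 2 \<Longrightarrow> i v = i w \<longleftrightarrow> v = w"
  using injI by (auto simp: inj_on_def)

lemma i_mem_iff: "S \<subseteq> ball 0 2 \<Longrightarrow> v \<in> ball 0 2 \<Longrightarrow> i v \<in> i ` S \<longleftrightarrow> v \<in> S"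
  by (rule inj_on_image_mem_iff[OF injI])

lemma i_inv: "v \<in> ball 0 2 \<Longrightarrow> inv_into (ball 0 2) i (i v) = v"
  by (rule inv_into_f_f[OF injI])

lemma i_top: "v \<in> ball 0 2 \<Longrightarrow> i v \<in> topspace X"
  using isub by blast

end

text \<open>Identified points are represented in the first manifold where |v| > 1 and in the second
  one otherwise, so the separating sphere belongs to the second; hence \<open>cball\<close> in one
  and \<open>ball\<close> in the other clause of the definitions.\<close>

lemma glue_connected_sum:
  fixes M1 M2 :: "('a, 'n::finite) manifold"
  assumes h1: "glue_half (top_of M1) (topspace (top_of M1) - i1 ` cball 0 (1/2)) i1"
    and h2: "glue_half (top_of M2) (topspace (top_of M2) - i2 ` cball 0 (1/2)) i2"
    and disj: "topspace (top_of M1) \<inter> topspace (top_of M2) = {}"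
  shows "glue (top_of M1) (top_of M2) (piece1 M1 i1) (piece2 M2 i2) i1 i2 (into1 i1 i2) (into2 i1 i2)
    (topology (csum_open M1 i1 M2 i2))"
proof -
  interpret h1: glue_half "top_of M1" "piece1 M1 i1" i1 using h1 by (simp add: piece1_def)
  interpret h2: glue_half "top_of M2" "piece2 M2 i2" i2 using h2 by (simp add: piece2_def)
  have b1: "cball 0 1 \<subseteq> ball (0::real^'n) 2" "ball 0 1 \<subseteq> ball (0::real^'n) 2" by auto
  have into1_in: "into1 i1 i2 (i1 v) = i2 (inversion v)" if "v \<in> ball 0 2" "norm v \<le> 1" for v
    using that h1.i_mem_iff[OF b1(1), of v] h1.i_inv[of v] by (simp add: into1_def)
  have into1_out: "into1 i1 i2 m = m" if "m \<notin> i1 ` cball 0 1" for m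
    using that by (simp add: into1_def)
  have into2_in: "into2 i1 i2 (i2 v) = i1 (inversion v)" if "v \<in> ball 0 2" "norm v < 1" for v
    using that h2.i_mem_iff[OF b1(2), of v] h2.i_inv[of v] by (simp add: into2_def)
  have into2_out: "into2 i1 i2 m = m" if "m \<notin> i2 ` ball 0 1" for m
    using that by (simp add: into2_def)
  \<comment> \<open>A point of the first piece either lies in the half |v| \<le> 1 of the annulus
    and moves to the second manifold, or it stays. As the underlying sets are disjoint, the image
    reveals which case holds.\<close>
  have c1: "(\<exists>v\<in>annulus. m = i1 v \<and> norm v \<le> 1 \<and> into1 i1 i2 m = i2 (inversion v) \<and> into1 i1 i2 m \<in> topspace (top_of M2))
      \<or> (m \<notin> i1 ` cball 0 1 \<and> into1 i1 i2 m = m \<and> m \<in> topspace (top_of M1))" if "m \<in> piece1 M1 i1" for m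
  proof (cases "m \<in> i1 ` cball 0 1")
    case True
    then obtain v where v: "norm v \<le> 1" "m = i1 v" by auto
    then have "v \<in> ball 0 2" by auto
    then have va: "v \<in> annulus" using h1.i_in_P[of v] that v by (auto simp: annulus_def)
    then show ?thesis
      using v into1_in[OF \<open>v \<in> ball 0 2\<close>] h2.i_top[OF annulus_ball] inversion_annulus by auto
  next
    case False
    then show ?thesis using into1_out that by (auto simp: h1.P)
  qed
  have c2: "(\<exists>v\<in>annulus. m = i2 v \<and> norm v < 1 \<and> into2 i1 i2 m = i1 (inversion v) \<and> into2 i1 i2 m \<in> topspace (top_of M1))
      \<or> (m \<notin> i2 ` ball 0 1 \<and> into2 i1 i2 m = m \<and> m \<in> topspace (top_of M2))" if "m \<in> piece2 M2 i2" for m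
  proof (cases "m \<in> i2 ` ball 0 1")
    case True
    then obtain v where v: "norm v < 1" "m = i2 v" by auto
    then have "v \<in> ball 0 2" by auto
    then have va: "v \<in> annulus" using h2.i_in_P[of v] that v by (auto simp: annulus_def)
    then show ?thesis
      using v into2_in[OF \<open>v \<in> ball 0 2\<close>] h1.i_top[OF annulus_ball] inversion_annulus by auto
  next
    case False
    then show ?thesis using into2_out that by (auto simp: h2.P)
  qed
  have inv_eq: "v = w" if "v \<in> annulus" "w \<in> annulus" "inversion v = inversion w" for v w :: "real^'n"
    using that inversion_inversion annulus_nonzero by metis
  have j1: "inj_on (into1 i1 i2) (piece1 M1 i1)"
  proof (rule inj_onI)
    fix m m' assume m: "m \<in> piece1 M1 i1" "m' \<in> piece1 M1 i1" "into1 i1 i2 m = into1 i1 i2 m'"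
    have eq: "inversion v = inversion w" if "v \<in> annulus" "w \<in> annulus" "i2 (inversion v) = i2 (inversion w)" for v w
      using that h2.i_eq_iff[of "inversion v" "inversion w"] annulus_ball inversion_annulus by metis
    from c1[OF m(1)] show "m = m'"
    proof (elim disjE bexE conjE)
      fix v assume v: "v \<in> annulus" "m = i1 v" "into1 i1 i2 m = i2 (inversion v)" "into1 i1 i2 m \<in> topspace (top_of M2)"
      then obtain w where w: "w \<in> annulus" "m' = i1 w" "into1 i1 i2 m' = i2 (inversion w)"
        using c1[OF m(2)] m(3) disj by auto
      have "v = w" by (rule inv_eq[OF v(1) w(1) eq[OF v(1) w(1)]]) (use v(3) w(3) m(3) in simp)
      then show ?thesis using v w by simp
    next
      assume a: "into1 i1 i2 m = m" "m \<in> topspace (top_of M1)"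
      then have "into1 i1 i2 m' = m'" using c1[OF m(2)] m(3) disj by auto
      then show ?thesis using a m(3) by simp
    qed
  qed
  have j2: "inj_on (into2 i1 i2) (piece2 M2 i2)"
  proof (rule inj_onI)
    fix m m' assume m: "m \<in> piece2 M2 i2" "m' \<in> piece2 M2 i2" "into2 i1 i2 m = into2 i1 i2 m'"
    have eq: "inversion v = inversion w" if "v \<in> annulus" "w \<in> annulus" "i1 (inversion v) = i1 (inversion w)" for v w
      using that h1.i_eq_iff[of "inversion v" "inversion w"] annulus_ball inversion_annulus by metis
    from c2[OF m(1)] show "m = m'"
    proof (elim disjE bexE conjE)
      fix v assume v: "v \<in> annulus" "m = i2 v" "into2 i1 i2 m = i1 (inversion v)" "into2 i1 i2 m \<in> topspace (top_of M1)"
      then obtain w where w: "w \<in> annulus" "m' = i2 w" "into2 i1 i2 m' = i1 (inversion w)"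
        using c2[OF m(2)] m(3) disj by auto
      have "v = w" by (rule inv_eq[OF v(1) w(1) eq[OF v(1) w(1)]]) (use v(3) w(3) m(3) in simp)
      then show ?thesis using v w by simp
    next
      assume a: "into2 i1 i2 m = m" "m \<in> topspace (top_of M2)"
      then have "into2 i1 i2 m' = m'" using c2[OF m(2)] m(3) disj by auto
      then show ?thesis using a m(3) by simp
    qed
  qed
  have rel: "into1 i1 i2 m = into2 i1 i2 m' \<longleftrightarrow> (\<exists>v\<in>annulus. m = i1 v \<and> m' = i2 (inversion v))"
    if m: "m \<in> piece1 M1 i1" "m' \<in> piece2 M2 i2" for m m'
  proof
    assume eq: "into1 i1 i2 m = into2 i1 i2 m'"
    consider (a) v where "v \<in> annulus" "m = i1 v" "into1 i1 i2 m = i2 (inversion v)" "into1 i1 i2 m \<in> topspace (top_of M2)"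
      | (b) "into1 i1 i2 m = m" "m \<in> topspace (top_of M1)" using c1[OF m(1)] by blast
    then show "\<exists>v\<in>annulus. m = i1 v \<and> m' = i2 (inversion v)"
    proof cases
      case a
      then have "into2 i1 i2 m' = m'" using c2[OF m(2)] disj eq by auto
      then show ?thesis using a eq by auto
    next
      case b
      then obtain w where w: "w \<in> annulus" "m' = i2 w" "into2 i1 i2 m' = i1 (inversion w)"
        using c2[OF m(2)] disj eq by auto
      then show ?thesis using b eq inversion_annulus[of w] inversion_inversion[OF annulus_nonzero[OF w(1)]]
        by (intro bexI[of _ "inversion w"]) auto
    qed
  next
    assume "\<exists>v\<in>annulus. m = i1 v \<and> m' = i2 (inversion v)"
    then obtain v where v: "v \<in> annulus" "m = i1 v" "m' = i2 (inversion v)" by blast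
    have vb: "v \<in> ball 0 2" "inversion v \<in> ball 0 2" "v \<noteq> 0"
      using v annulus_ball inversion_annulus annulus_nonzero by blast+
    show "into1 i1 i2 m = into2 i1 i2 m'"
    proof (cases "norm v \<le> 1")
      case True
      then have "\<not> norm (inversion v) < 1" using vb(3) by (simp add: norm_inversion_iff)
      then have "m' \<notin> i2 ` ball 0 1" using h2.i_mem_iff[OF b1(2) vb(2)] v by simp
      then show ?thesis using into1_in[OF vb(1) True] into2_out v by simp
    next
      case False
      then have "norm (inversion v) < 1" using vb(3) by (simp add: norm_inversion_iff)
      moreover have "m \<notin> i1 ` cball 0 1" using h1.i_mem_iff[OF b1(1) vb(1)] v False by simp
      ultimately show ?thesis using into2_in[OF vb(2)] into1_out v inversion_inversion[OF vb(3)] by simp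
    qed
  qed
  have pts: "csum_points M1 i1 M2 i2 = into1 i1 i2 ` piece1 M1 i1 \<union> into2 i1 i2 ` piece2 M2 i2"
  proof
    show "csum_points M1 i1 M2 i2 \<subseteq> into1 i1 i2 ` piece1 M1 i1 \<union> into2 i1 i2 ` piece2 M2 i2"
    proof
      fix x assume "x \<in> csum_points M1 i1 M2 i2"
      then consider "x \<in> topspace (top_of M1)" "x \<notin> i1 ` cball 0 1" | "x \<in> topspace (top_of M2)" "x \<notin> i2 ` ball 0 1"
        by (auto simp: csum_points_def)
      then show "x \<in> into1 i1 i2 ` piece1 M1 i1 \<union> into2 i1 i2 ` piece2 M2 i2"
      proof cases
        case 1
        then have "x \<in> piece1 M1 i1" by (auto simp: piece1_def)
        then show ?thesis using into1_out[OF 1(2)] by (metis UnI1 imageI)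
      next
        case 2
        then have "x \<in> piece2 M2 i2" by (auto simp: piece2_def)
        then show ?thesis using into2_out[OF 2(2)] by (metis UnI2 imageI)
      qed
    qed
  next
    have "into1 i1 i2 m \<in> csum_points M1 i1 M2 i2" if m: "m \<in> piece1 M1 i1" for m
      using c1[OF m]
    proof (elim disjE bexE conjE)
      fix v assume v: "v \<in> annulus" "norm v \<le> 1" "into1 i1 i2 m = i2 (inversion v)" "into1 i1 i2 m \<in> topspace (top_of M2)"
      have "\<not> norm (inversion v) < 1" using v annulus_nonzero[OF v(1)] by (simp add: norm_inversion_iff)
      then have "i2 (inversion v) \<notin> i2 ` ball 0 1"
        using h2.i_mem_iff[OF b1(2), of "inversion v"] annulus_ball inversion_annulus v by auto
      then show ?thesis using v by (auto simp: csum_points_def)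
    qed (auto simp: csum_points_def)
    moreover have "into2 i1 i2 m \<in> csum_points M1 i1 M2 i2" if m: "m \<in> piece2 M2 i2" for m
      using c2[OF m]
    proof (elim disjE bexE conjE)
      fix v assume v: "v \<in> annulus" "norm v < 1" "into2 i1 i2 m = i1 (inversion v)" "into2 i1 i2 m \<in> topspace (top_of M1)"
      have "\<not> norm (inversion v) \<le> 1" using v annulus_nonzero[OF v(1)] by (simp add: norm_inversion_iff)
      then have "i1 (inversion v) \<notin> i1 ` cball 0 1"
        using h1.i_mem_iff[OF b1(1), of "inversion v"] annulus_ball inversion_annulus v by auto
      then show ?thesis using v by (auto simp: csum_points_def)
    qed (auto simp: csum_points_def)
    ultimately show "into1 i1 i2 ` piece1 M1 i1 \<union> into2 i1 i2 ` piece2 M2 i2 \<subseteq> csum_points M1 i1 M2 i2" by blast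
  qed
  show ?thesis
  proof
    show "openin (topology (csum_open M1 i1 M2 i2)) W \<longleftrightarrow> W \<subseteq> into1 i1 i2 ` piece1 M1 i1 \<union> into2 i1 i2 ` piece2 M2 i2 \<and>
      openin (top_of M1) {m \<in> piece1 M1 i1. into1 i1 i2 m \<in> W} \<and> openin (top_of M2) {m \<in> piece2 M2 i2. into2 i1 i2 m \<in> W}" for W
      unfolding topology_inverse'[OF istopology_csum_open] csum_open_def pts ..
  qed (rule j1 j2 rel, assumption?)+
qed

text \<open>Compatibility of charts is directed, so gluing isometries in both directions enter. The
  bound on the points yields disjointness from the next copy.\<close>

lemma isom_manifold_connected_sum:
  fixes M1 M2 :: "('a, 'n::finite) manifold"
  assumes n: "CARD('n) \<ge> 2" and M1: "isom_manifold G M1" and M2: "isom_manifold G M2"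
    and disj: "topspace (top_of M1) \<inter> topspace (top_of M2) = {}"
    and c1: "c1 \<in> atlas M1" "fst c1 = i1 ` ball 0 2" "\<And>v. v \<in> ball 0 2 \<Longrightarrow> snd c1 (i1 v) = a1 + v /\<^sub>R 4"
    and c2: "c2 \<in> atlas M2" "fst c2 = i2 ` ball 0 2" "\<And>v. v \<in> ball 0 2 \<Longrightarrow> snd c2 (i2 v) = a2 + v /\<^sub>R 4"
    and g1: "local_isometry G ((\<lambda>v. a1 + v /\<^sub>R 4) ` annulus) \<gamma>"
       "\<And>v. v \<in> annulus \<Longrightarrow> \<gamma> (a1 + v /\<^sub>R 4) = a2 + inversion v /\<^sub>R 4"
    and g2: "local_isometry G ((\<lambda>v. a2 + v /\<^sub>R 4) ` annulus) \<gamma>'"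
       "\<And>v. v \<in> annulus \<Longrightarrow> \<gamma>' (a2 + v /\<^sub>R 4) = a1 + inversion v /\<^sub>R 4"
  shows "isom_manifold G (connected_sum M1 i1 M2 i2)" "topspace (top_of (connected_sum M1 i1 M2 i2)) \<subseteq> topspace (top_of M1) \<union> topspace (top_of M2)"
proof -
  interpret glue "top_of M1" "top_of M2" "piece1 M1 i1" "piece2 M2 i2" i1 i2 "into1 i1 i2" "into2 i1 i2"
    "topology (csum_open M1 i1 M2 i2)"
    by (rule glue_connected_sum[OF glue_half_disc[OF M1 c1] glue_half_disc[OF M2 c2] disj])
  note m1 = isom_manifoldD[OF M1] and m2 = isom_manifoldD[OF M2]
  have top: "top_of (connected_sum M1 i1 M2 i2) = topology (csum_open M1 i1 M2 i2)"
    and atl: "atlas (connected_sum M1 i1 M2 i2) = push1 ` atlas M1 \<union> push2 ` atlas M2"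
    by (simp_all add: connected_sum_def)
  have sub1: "fst c \<subseteq> topspace (top_of M1)" if "c \<in> atlas M1" for c using m1(5) that by blast
  have sub2: "fst c \<subseteq> topspace (top_of M2)" if "c \<in> atlas M2" for c using m2(5) that by blast
  have ts: "topspace (topology (csum_open M1 i1 M2 i2)) = csum_points M1 i1 M2 i2"
  proof -
    have "csum_open M1 i1 M2 i2 W \<Longrightarrow> W \<subseteq> csum_points M1 i1 M2 i2" for W by (simp add: csum_open_def)
    then have "topspace (topology (csum_open M1 i1 M2 i2)) \<subseteq> csum_points M1 i1 M2 i2"
      by (metis istopology_csum_open openin_topspace topology_inverse')
    moreover have "csum_points M1 i1 M2 i2 \<subseteq> topspace (topology (csum_open M1 i1 M2 i2))"
      unfolding topspace_Y csum_points_def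
    proof (intro Un_mono)
      show "topspace (top_of M1) - i1 ` cball 0 1 \<subseteq> into1 i1 i2 ` piece1 M1 i1"
        using collar1(2) by (force simp: into1_def image_iff)
      have "topspace (top_of M2) - i2 ` ball 0 1 \<subseteq> piece2 M2 i2"
        unfolding piece2_def by (intro Diff_mono image_mono) auto
      then show "topspace (top_of M2) - i2 ` ball 0 1 \<subseteq> into2 i1 i2 ` piece2 M2 i2"
        by (force simp: into2_def image_iff)
    qed
    ultimately show ?thesis by blast
  qed
  show "topspace (top_of (connected_sum M1 i1 M2 i2)) \<subseteq> topspace (top_of M1) \<union> topspace (top_of M2)"
    unfolding top ts by (auto simp: csum_points_def)
  show "isom_manifold G (connected_sum M1 i1 M2 i2)"
    unfolding isom_manifold_def top atl
  proof (intro conjI ballI)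
    show "Hausdorff_space (topology (csum_open M1 i1 M2 i2))" by (rule Hausdorff_Y)
    show "compact_space (topology (csum_open M1 i1 M2 i2))" by (rule compact_Y)
    show "connected_space (topology (csum_open M1 i1 M2 i2))" by (rule connected_Y[OF n])
    show "is_chart (topology (csum_open M1 i1 M2 i2)) c" if "c \<in> push1 ` atlas M1 \<union> push2 ` atlas M2" for c
      using that chart1 glue.chart1[OF swap] m1(4) m2(4) by blast
    have "(\<Union>c\<in>push1 ` atlas M1. fst c) = into1 i1 i2 ` (topspace (top_of M1) \<inter> piece1 M1 i1)"
      unfolding m1(5)[symmetric] by (force simp: case_prod_beta)
    moreover have "(\<Union>c\<in>push2 ` atlas M2. fst c) = into2 i1 i2 ` (topspace (top_of M2) \<inter> piece2 M2 i2)"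
      unfolding m2(5)[symmetric] by (force simp: case_prod_beta)
    moreover have "topspace (top_of M1) \<inter> piece1 M1 i1 = piece1 M1 i1" "topspace (top_of M2) \<inter> piece2 M2 i2 = piece2 M2 i2"
      by (auto simp: piece1_def piece2_def)
    ultimately show "(\<Union>c\<in>push1 ` atlas M1 \<union> push2 ` atlas M2. fst c) = topspace (topology (csum_open M1 i1 M2 i2))"
      unfolding topspace_Y UN_Un by simp
    show "compat G c d" if cd: "c \<in> push1 ` atlas M1 \<union> push2 ` atlas M2" "d \<in> push1 ` atlas M1 \<union> push2 ` atlas M2" for c d
    proof -
      consider (a) c' d' where "c = push1 c'" "d = push1 d'" "c' \<in> atlas M1" "d' \<in> atlas M1"
        | (b) c' d' where "c = push2 c'" "d = push2 d'" "c' \<in> atlas M2" "d' \<in> atlas M2"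
        | (c) c' d' where "c = push1 c'" "d = push2 d'" "c' \<in> atlas M1" "d' \<in> atlas M2"
        | (d) c' d' where "c = push2 c'" "d = push1 d'" "c' \<in> atlas M2" "d' \<in> atlas M1"
        using cd by blast
      then show ?thesis
      proof cases
        case a then show ?thesis using compat1 m1(6) by simp
      next
        case b then show ?thesis using glue.compat1[OF swap] m2(6) by simp
      next
        case c
        show ?thesis unfolding c(1,2)
          by (rule compat12[OF m1(6)[OF c(3) c1(1)] m2(6)[OF c2(1) c(4)] sub1[OF c(3)] sub2[OF c(4)] c1(2,3) c2(2,3) g1])
      next
        case d
        show ?thesis unfolding d(1,2)
          by (rule glue.compat12[OF swap m2(6)[OF d(3) c2(1)] m1(6)[OF c1(1) d(4)] sub2[OF d(3)] sub1[OF d(4)] c2(2,3) c1(2,3) g2])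
      qed
    qed
    show "0 \<notin> snd c ` fst c" if "c \<in> push1 ` atlas M1 \<union> push2 ` atlas M2" for c
    proof -
      have "snd (push1 c) ` fst (push1 c) \<subseteq> snd c ` fst c" for c :: "('a, 'n) chart"
        by (cases c) (auto simp: inv1)
      moreover have "snd (push2 c) ` fst (push2 c) \<subseteq> snd c ` fst c" for c :: "('a, 'n) chart"
        by (cases c) (auto simp: glue.inv1[OF swap])
      ultimately show ?thesis using that m1(7) m2(7) by blast
    qed
  qed
qed

subsection \<open>The building block \<open>S\<^sup>1 \<times> S\<^sup>n\<^sup>-\<^sup>1\<close>\<close>

lemma isom_manifold_copy:
  fixes M :: "('a, 'n::finite) manifold"
  assumes "isom_manifold G M" shows "isom_manifold G (copy j M)"
proof -
  note m = isom_manifoldD[OF assms]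
  let ?X = "top_of M" and ?Y = "prod_topology (discrete_topology {j}) (top_of M)"
  have top: "top_of (copy j M) = ?Y" and atl: "atlas (copy j M) = (\<lambda>(U, \<phi>). ({j} \<times> U, \<phi> \<circ> snd)) ` atlas M"
    by (simp_all add: copy_def)
  have op: "openin ?Y ({j} \<times> V) \<longleftrightarrow> openin ?X V" for V
    by (auto simp: openin_prod_Times_iff)
  have chart: "is_chart ?Y ({j} \<times> U, \<phi> \<circ> snd)" if "is_chart ?X (U, \<phi>)" for U and \<phi> :: "'a \<Rightarrow> real^'n"
    using that unfolding is_chart_iff
  proof (elim conjE, intro conjI allI impI)
    assume c: "openin ?X U" "inj_on \<phi> U" "\<forall>V. openin ?X V \<and> V \<subseteq> U \<longrightarrow> open (\<phi> ` V)"
      "\<forall>W. open W \<longrightarrow> openin ?X {p \<in> U. \<phi> p \<in> W}"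
    show "openin ?Y ({j} \<times> U)" using c op by simp
    show "inj_on (\<phi> \<circ> snd) ({j} \<times> U)" using c(2) by (auto simp: inj_on_def)
    fix V assume V: "openin ?Y V \<and> V \<subseteq> {j} \<times> U"
    have "V = {j} \<times> (snd ` V)" using V by (auto simp: image_iff) force+
    then have "openin ?X (snd ` V)" using V op by metis
    moreover have "snd ` V \<subseteq> U" using V by auto
    ultimately show "open ((\<phi> \<circ> snd) ` V)" using c(3) by (metis image_comp)
  next
    fix W :: "(real^'n) set" assume c: "\<forall>W. open W \<longrightarrow> openin ?X {p \<in> U. \<phi> p \<in> W}" "open W"
    have "{p \<in> {j} \<times> U. (\<phi> \<circ> snd) p \<in> W} = {j} \<times> {p \<in> U. \<phi> p \<in> W}" by auto
    then show "openin ?Y {p \<in> {j} \<times> U. (\<phi> \<circ> snd) p \<in> W}" using c op by simp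
  qed
  have compat: "compat G ({j} \<times> U, \<phi> \<circ> snd) ({j} \<times> U', \<phi>' \<circ> snd)" if cp: "compat G (U, \<phi>) (U', \<phi>')" for U U' and \<phi> \<phi>' :: "'a \<Rightarrow> real^'n"
    unfolding compat_def
  proof
    fix p assume "p \<in> fst ({j} \<times> U, \<phi> \<circ> snd) \<inter> fst ({j} \<times> U', \<phi>' \<circ> snd)"
    then have "snd p \<in> fst (U, \<phi>) \<inter> fst (U', \<phi>')" by auto
    then obtain W \<sigma> where W: "local_isometry G W \<sigma>" "\<phi> (snd p) \<in> W"
      "\<And>q. q \<in> U \<Longrightarrow> \<phi> q \<in> W \<Longrightarrow> q \<in> U' \<and> \<phi>' q = \<sigma> (\<phi> q)"
      using bspec[OF cp[unfolded compat_def]] by fastforce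
    then show "\<exists>W \<sigma>. local_isometry G W \<sigma> \<and> snd ({j} \<times> U, \<phi> \<circ> snd) p \<in> W \<and>
      (\<forall>q\<in>fst ({j} \<times> U, \<phi> \<circ> snd). snd ({j} \<times> U, \<phi> \<circ> snd) q \<in> W \<longrightarrow>
        q \<in> fst ({j} \<times> U', \<phi>' \<circ> snd) \<and> snd ({j} \<times> U', \<phi>' \<circ> snd) q = \<sigma> (snd ({j} \<times> U, \<phi> \<circ> snd) q))"
      by (intro exI[of _ W] exI[of _ \<sigma>]) auto
  qed
  show ?thesis
    unfolding isom_manifold_def top atl
  proof (intro conjI ballI)
    show "Hausdorff_space ?Y" using m(1) by (simp add: Hausdorff_space_prod_topology)
    show "compact_space ?Y" using m(2) by (simp add: compact_space_prod_topology compact_space_discrete_topology)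
    show "connected_space ?Y" using m(3) by (auto simp: connected_space_prod_topology connected_space_discrete_topology)
    show "is_chart ?Y c" if "c \<in> (\<lambda>(U, \<phi>). ({j} \<times> U, \<phi> \<circ> snd)) ` atlas M" for c
      using that m(4) chart by force
    show "(\<Union>c\<in>(\<lambda>(U, \<phi>). ({j} \<times> U, \<phi> \<circ> snd)) ` atlas M. fst c) = topspace ?Y"
      using m(5) by (force simp: case_prod_beta)
    show "compat G c d" if "c \<in> (\<lambda>(U, \<phi>). ({j} \<times> U, \<phi> \<circ> snd)) ` atlas M" "d \<in> (\<lambda>(U, \<phi>). ({j} \<times> U, \<phi> \<circ> snd)) ` atlas M" for c d
      using that m(6) compat by force
    show "0 \<notin> snd c ` fst c" if "c \<in> (\<lambda>(U, \<phi>). ({j} \<times> U, \<phi> \<circ> snd)) ` atlas M" for c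
      using that m(7) by force
  qed
qed


section \<open>The covering of the product of a circle and a sphere\<close>

text \<open>The deck transformations of \<open>polar\<close> are the homotheties by integral powers
  of e^(2 pi), because the angle on the circle is ln |x|.\<close>

lemma polar_eq_iff:
  fixes x y :: "real^'n"
  assumes "x \<noteq> 0" "y \<noteq> 0"
  shows "polar x = polar y \<longleftrightarrow> (\<exists>k::int. y = exp (2 * pi * of_int k) *\<^sub>R x)"
proof
  assume "polar x = polar y"
  then have c: "cis (ln (norm x)) = cis (ln (norm y))" and s: "x /\<^sub>R norm x = y /\<^sub>R norm y"
    by (auto simp: polar_def)
  have "exp (\<i> * complex_of_real (ln (norm y))) = exp (\<i> * complex_of_real (ln (norm x)))" using c by (simp add: cis_conv_exp)
  then obtain k :: int where "\<i> * complex_of_real (ln (norm y)) = \<i> * complex_of_real (ln (norm x)) + of_int (2 * k) * pi * \<i>"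
    unfolding exp_eq by blast
  then have "complex_of_real (ln (norm y)) = complex_of_real (ln (norm x) + 2 * pi * of_int k)"
    by (simp add: complex_eq_iff)
  then have l: "ln (norm y) = ln (norm x) + 2 * pi * of_int k" unfolding of_real_eq_iff .
  have "norm y = exp (ln (norm y))" using assms by simp
  also have "\<dots> = norm x * exp (2 * pi * of_int k)" using assms by (simp add: l exp_add)
  finally have n: "norm y = norm x * exp (2 * pi * of_int k)" .
  have "y = norm y *\<^sub>R (y /\<^sub>R norm y)" using assms by simp
  also have "\<dots> = norm y *\<^sub>R (x /\<^sub>R norm x)" using s by simp
  also have "\<dots> = exp (2 * pi * of_int k) *\<^sub>R x" using assms by (simp add: n)
  finally show "\<exists>k::int. y = exp (2 * pi * of_int k) *\<^sub>R x" by blast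
next
  assume "\<exists>k::int. y = exp (2 * pi * of_int k) *\<^sub>R x"
  then obtain k :: int where y: "y = exp (2 * pi * of_int k) *\<^sub>R x" by blast
  have "ln (norm y) = ln (norm x) + 2 * pi * of_int k" using assms by (simp add: y ln_mult)
  moreover have "cis (2 * pi * of_int k) = 1" by (simp add: cis_multiple_2pi)
  ultimately have "cis (ln (norm y)) = cis (ln (norm x))" by (simp flip: cis_mult)
  then show "polar x = polar y" by (simp add: polar_def y)
qed

lemma polar_sphere: "x \<noteq> 0 \<Longrightarrow> polar x \<in> sphere 0 1 \<times> sphere 0 1"
  by (simp add: polar_def)

lemma continuous_on_polar: "continuous_on (- {0}) polar"
proof -
  have "continuous_on (- {0::real^'n}) (\<lambda>x. complex_of_real (cos (ln (norm x))) + \<i> * complex_of_real (sin (ln (norm x))))"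
    by (intro continuous_intros) auto
  then have "continuous_on (- {0::real^'n}) (\<lambda>x. cis (ln (norm x)))"
    by (rule continuous_on_eq) (simp add: complex_eq_iff)
  then show ?thesis unfolding polar_def by (intro continuous_intros) auto
qed

lemma polar_section:
  assumes "norm c = 1" "norm w = 1" "c * cis (- l) = cis \<theta>"
  shows "polar (exp (l + \<theta>) *\<^sub>R w) = (c, w)"
proof -
  have "c = cis l * (c * cis (- l))" by (simp add: mult.left_commute cis_mult)
  also have "\<dots> = cis (l + \<theta>)" by (simp add: assms(3) cis_mult)
  finally have "cis (l + \<theta>) = c" by simp
  then show ?thesis using assms(2) by (simp add: polar_def)
qed

text \<open>Near polar x the map \<open>s\<close> is a continuous right inverse of
  \<open>polar\<close>. Rotating the circle by - ln |x| first puts the point at 1, away from the cut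
  of \<open>Arg\<close>.\<close>

lemma open_polar:
  assumes "open V" "0 \<notin> V"
  shows "openin (top_of_set (sphere 0 1 \<times> sphere 0 1)) (polar ` (V :: (real^'n) set))"
  unfolding openin_subopen[of _ "polar ` V"]
proof
  fix p assume "p \<in> polar ` V"
  then obtain x where x: "x \<in> V" "p = polar x" by blast
  have x0: "x \<noteq> 0" using x assms(2) by auto
  let ?l = "ln (norm x)"
  define s where "s = (\<lambda>(c, w :: real^'n). exp (?l + Arg (c * cis (- ?l))) *\<^sub>R w)"
  define T where "T = (\<lambda>p :: complex \<times> (real^'n). fst p * cis (- ?l)) -` (- \<real>\<^sub>\<le>\<^sub>0)"
  have oT: "open T" unfolding T_def
    by (intro open_vimage open_Compl closed_nonpos_Reals_complex continuous_intros)
  have "continuous_on T s"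
    unfolding s_def case_prod_beta T_def by (intro continuous_intros) auto
  then have oN: "open (T \<inter> s -` V)" using continuous_open_preimage oT assms(1) by blast
  have px: "p = (cis ?l, x /\<^sub>R norm x)" by (simp add: x polar_def)
  have "fst p * cis (- ?l) = 1" by (simp add: px cis_mult)
  moreover have "s p = x" using x0 by (simp add: s_def px cis_mult)
  ultimately have "p \<in> T \<inter> s -` V" using x(1) by (simp add: T_def)
  moreover have "(sphere 0 1 \<times> sphere 0 1) \<inter> (T \<inter> s -` V) \<subseteq> polar ` V"
  proof
    fix q assume q: "q \<in> (sphere 0 1 \<times> sphere 0 1) \<inter> (T \<inter> s -` V)"
    obtain c w where cw: "q = (c, w)" by (cases q)
    have n: "norm c = 1" "norm w = 1" "s (c, w) \<in> V" using q by (auto simp: cw)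
    have nc: "norm (c * cis (- ?l)) = 1" using n by (simp add: norm_mult)
    then have "c * cis (- ?l) = cis (Arg (c * cis (- ?l)))"
      by (metis cis_Arg div_by_1 norm_zero of_real_1 sgn_eq zero_neq_one)
    then have "polar (s (c, w)) = q" unfolding s_def by (simp add: polar_section[OF n(1,2)] cw)
    then show "q \<in> polar ` V" using n(3) by force
  qed
  moreover have "openin (top_of_set (sphere 0 1 \<times> sphere 0 1)) ((sphere 0 1 \<times> sphere 0 1) \<inter> (T \<inter> s -` V))"
    using oN by (rule openin_open_Int)
  moreover have "p \<in> sphere 0 1 \<times> sphere 0 1" using polar_sphere[OF x0] x by simp
  ultimately show "\<exists>T. openin (top_of_set (sphere 0 1 \<times> sphere 0 1)) T \<and> p \<in> T \<and> T \<subseteq> polar ` V"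
    by (intro exI[of _ "(sphere 0 1 \<times> sphere 0 1) \<inter> (T \<inter> s -` V)"]) blast
qed

text \<open>Two charts differ near a common point by one deck transformation, so compatibility
  amounts to invariance of G under homotheties.\<close>

lemma isom_manifold_S1xS:
  fixes G :: "real^'n::finite \<Rightarrow> real^'n^'n"
  assumes n: "CARD('n) \<ge> 2"
    and hom: "\<And>(k::int) x. x \<noteq> 0 \<Longrightarrow> G x = pullback (\<lambda>x. exp (2 * pi * of_int k) *\<^sub>R x) G x"
  shows "isom_manifold G S1xS"
proof -
  let ?X = "top_of_set (sphere 0 1 \<times> sphere 0 1) :: (complex \<times> (real^'n)) topology"
  have top: "top_of S1xS = ?X" and atl: "atlas S1xS = {(polar ` V, inv_into V polar) | V :: (real^'n) set. open V \<and> 0 \<notin> V \<and> inj_on polar V}"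
    by (simp_all add: S1xS_def)
  have chart: "is_chart ?X (polar ` V, inv_into V polar)" if V: "open V" "0 \<notin> V" "inj_on polar V" for V :: "(real^'n) set"
    unfolding is_chart_iff
  proof (intro conjI allI impI)
    show "openin ?X (polar ` V)" by (rule open_polar[OF V(1,2)])
    show "inj_on (inv_into V polar) (polar ` V)" by (rule inj_on_inv_into) simp
    fix W :: "(complex \<times> (real^'n)) set" assume W: "openin ?X W \<and> W \<subseteq> polar ` V"
    then obtain T where T: "open T" "W = (sphere 0 1 \<times> sphere 0 1) \<inter> T" by (auto simp: openin_open)
    have "continuous_on V polar" by (rule continuous_on_subset[OF continuous_on_polar]) (use V in auto)
    then have "open (V \<inter> polar -` T)" using continuous_open_preimage V(1) T(1) by blast
    moreover have "inv_into V polar ` W = V \<inter> polar -` T"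
    proof (intro set_eqI iffI)
      fix x assume "x \<in> inv_into V polar ` W"
      then obtain p where p: "p \<in> W" "x = inv_into V polar p" by blast
      then obtain z where "z \<in> V" "p = polar z" using W by blast
      then show "x \<in> V \<inter> polar -` T" using p T V(3) by (simp add: inv_into_f_f)
    next
      fix x assume x: "x \<in> V \<inter> polar -` T"
      then have "polar x \<in> W" using polar_sphere[of x] V(2) T(2) by auto
      then show "x \<in> inv_into V polar ` W" using x V(3) by (metis IntE imageI inv_into_f_f)
    qed
    ultimately show "open (inv_into V polar ` W)" by simp
  next
    fix W :: "(real^'n) set" assume "open W"
    then have "openin ?X (polar ` (V \<inter> W))" using V by (intro open_polar) auto
    moreover have "{p \<in> polar ` V. inv_into V polar p \<in> W} = polar ` (V \<inter> W)"
      using V(3) by (auto simp: inv_into_f_f)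
    ultimately show "openin ?X {p \<in> polar ` V. inv_into V polar p \<in> W}" by simp
  qed
  have compat: "compat G (polar ` V, inv_into V polar) (polar ` V', inv_into V' polar)"
    if V: "open V" "0 \<notin> V" "inj_on polar V" and V': "open V'" "0 \<notin> V'" "inj_on polar V'" for V V' :: "(real^'n) set"
    unfolding compat_def
  proof
    fix p assume "p \<in> fst (polar ` V, inv_into V polar) \<inter> fst (polar ` V', inv_into V' polar)"
    then obtain x y where xy: "x \<in> V" "y \<in> V'" "p = polar x" "polar x = polar y" by auto
    then obtain k :: int where k: "y = exp (2 * pi * of_int k) *\<^sub>R x"
      using polar_eq_iff[of x y] V(2) V'(2) by metis
    let ?s = "\<lambda>x::real^'n. exp (2 * pi * of_int k) *\<^sub>R x"
    let ?W = "V \<inter> ?s -` V'"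
    have "continuous_on V ?s" by (intro continuous_intros)
    then have oW: "open ?W" using continuous_open_preimage V(1) V'(1) by blast
    have "smooth_on ?W ?s" by (rule smooth_on_linear[OF oW]) (rule bounded_linear_scaleR_right)
    moreover have "G z = pullback ?s G z" if "z \<in> ?W" for z
      by (rule hom) (use that V(2) in auto)
    ultimately have li: "local_isometry G ?W ?s" using oW by (simp add: local_isometry_def)
    have key: "polar z \<in> polar ` V' \<and> inv_into V' polar (polar z) = ?s z" if "z \<in> ?W" for z
    proof -
      have "z \<noteq> 0" using that V(2) by auto
      then have "polar z = polar (?s z)" by (subst polar_eq_iff) auto
      then show ?thesis using that V'(3) by (auto simp: inv_into_f_f)
    qed
    have ip: "inv_into V polar p = x" using inv_into_f_f[OF V(3) xy(1)] xy(3) by simp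
    show "\<exists>W \<sigma>. local_isometry G W \<sigma> \<and> snd (polar ` V, inv_into V polar) p \<in> W \<and>
      (\<forall>q\<in>fst (polar ` V, inv_into V polar). snd (polar ` V, inv_into V polar) q \<in> W \<longrightarrow>
        q \<in> fst (polar ` V', inv_into V' polar) \<and> snd (polar ` V', inv_into V' polar) q = \<sigma> (snd (polar ` V, inv_into V polar) q))"
      using li key xy(1,2) k ip by (intro exI[of _ ?W] exI[of _ ?s]) (auto simp: inv_into_f_f[OF V(3)])
  qed
  have cover: "\<exists>V. open V \<and> 0 \<notin> V \<and> inj_on polar V \<and> (c, w) \<in> polar ` V" if "norm c = 1" "norm w = 1" for c and w :: "real^'n"
  proof -
    have "c \<noteq> 0" using that(1) by auto
    then have "c * cis (- 0) = cis (Arg c)" using that(1) by (simp add: cis_Arg sgn_eq)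
    from polar_section[OF that this] have pc: "polar (exp (Arg c) *\<^sub>R w) = (c, w)" by simp
    let ?x = "exp (Arg c) *\<^sub>R w"
    \<comment> \<open>An open annulus with ratio of radii e^(2 pi): no two of its points differ by a
      non-trivial deck transformation.\<close>
    define V where "V = ball (0::real^'n) (exp (Arg c + pi)) - cball 0 (exp (Arg c - pi))"
    have "open V" unfolding V_def by (intro open_Diff open_ball closed_cball)
    moreover have "0 \<notin> V" by (simp add: V_def)
    moreover have "?x \<in> V" using that by (simp add: V_def not_le)
    moreover have "inj_on polar V"
    proof (rule inj_onI)
      fix y z assume yz: "y \<in> V" "z \<in> V" "polar y = polar z"
      have y0: "y \<noteq> 0" "z \<noteq> 0" using yz \<open>0 \<notin> V\<close> by auto
      then obtain k :: int where k: "z = exp (2 * pi * of_int k) *\<^sub>R y" using polar_eq_iff yz(3) by metis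
      have r: "Arg c - pi < ln (norm v) \<and> ln (norm v) < Arg c + pi" if "v \<in> V" "v \<noteq> 0" for v
      proof -
        have "norm v = exp (ln (norm v))" using that(2) by simp
        then obtain L where L: "norm v = exp L" by blast
        have "exp (Arg c - pi) < norm v" "norm v < exp (Arg c + pi)" using that by (auto simp: V_def)
        then show ?thesis by (simp add: L)
      qed
      have "ln (norm z) = ln (norm y) + 2 * pi * of_int k" using y0 by (simp add: k ln_mult)
      then have "\<bar>2 * pi * of_int k\<bar> < 2 * pi" using r[OF yz(1) y0(1)] r[OF yz(2) y0(2)] by linarith
      then have "\<bar>of_int k :: real\<bar> < 1" by (simp add: abs_mult)
      then have "k = 0" by linarith
      then show "y = z" using k by simp
    qed
    ultimately show ?thesis using pc by (metis imageI)
  qed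
  have dims: "2 \<le> DIM(complex)" "2 \<le> DIM(real^'n)" using n by simp_all
  show ?thesis
    unfolding isom_manifold_def top
  proof (intro conjI ballI)
    show "Hausdorff_space ?X" by (intro Hausdorff_space_subtopology Hausdorff_space_euclidean)
    show "compact_space ?X" by (intro compact_space_subtopology) (simp add: compact_Times)
    show "connected_space ?X"
      by (intro connected_space_subtopology) (simp add: connected_Times connected_sphere dims del: DIM_cart)
    show "is_chart ?X c" if "c \<in> atlas S1xS" for c using that chart unfolding atl by blast
    show "compat G c d" if "c \<in> atlas S1xS" "d \<in> atlas S1xS" for c d using that compat unfolding atl by blast
    show "0 \<notin> snd c ` fst c" if c: "c \<in> atlas S1xS" for c :: "(complex \<times> (real^'n), 'n) chart"
    proof -
      obtain V where V: "c = (polar ` V, inv_into V polar)" "0 \<notin> V" "inj_on polar V" using c unfolding atl by blast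
      have "snd c ` fst c \<subseteq> V" using V by (auto simp: inv_into_f_f)
      then show ?thesis using V(2) by blast
    qed
    show "(\<Union>c\<in>atlas S1xS. fst c) = topspace ?X"
    proof (intro set_eqI iffI)
      fix p :: "complex \<times> (real^'n)"
      assume "p \<in> (\<Union>c\<in>atlas S1xS. fst c)"
      then obtain V x where "0 \<notin> V" "x \<in> V" "p = polar x" unfolding atl by auto
      then show "p \<in> topspace ?X" using polar_sphere[of x] by auto
    next
      fix p assume "p \<in> topspace ?X"
      then obtain c w where cw: "p = (c, w)" "norm c = 1" "norm w = 1" by auto
      obtain V where "open V" "0 \<notin> V" "inj_on polar V" "p \<in> polar ` V" using cover[OF cw(2,3)] cw(1) by blast
      then show "p \<in> (\<Union>c\<in>atlas S1xS. fst c)"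
        unfolding atl by (intro UN_I[of "(polar ` V, inv_into V polar)"]) auto
    qed
  qed
qed

subsection \<open>The iterated connected sum\<close>

lemma norm_vec_1: "norm (vec 1 :: real^'n) = sqrt (real CARD('n))"
  by (simp add: norm_vec_def L2_set_def)

lemma norm_one_vec: "norm (1 :: real^'n) = sqrt (real CARD('n))"
  by (simp add: norm_vec_def L2_set_def)

lemma disc_bounds:
  fixes x :: "real^'n"
  assumes "CARD('n) \<ge> 3" "x \<in> ball (vec 1) (1/2) \<union> ball (- vec 1) (1/2)"
  shows "1 < norm x" "norm x < 2 * sqrt (real CARD('n))" "\<bar>norm x - sqrt (real CARD('n))\<bar> < 1/2"
proof -
  have "sqrt (real CARD('n)) > sqrt ((3/2)^2)"
    using assms(1) by (intro real_sqrt_less_mono) (simp add: power2_eq_square)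
  then have s: "sqrt (real CARD('n)) > 3/2" by simp
  show *: "\<bar>norm x - sqrt (real CARD('n))\<bar> < 1/2"
    using assms(2) norm_triangle_ineq3[of x "vec 1"] norm_triangle_ineq3[of x "- vec 1"]
    by (auto simp: norm_one_vec dist_norm norm_minus_commute)
  show "1 < norm x" "norm x < 2 * sqrt (real CARD('n))" using s * by linarith+
qed

text \<open>Norms in the discs differ from sqrt n by less than 1/2, and sqrt n > 3/2 for n \<ge> 3.
  So quotients of norms stay below 2 < e, and the only possible deck transformation is the
  identity.\<close>

lemma inj_on_polar_discs:
  assumes "CARD('n) \<ge> 3"
  shows "inj_on polar (ball (vec 1 :: real^'n) (1/2) \<union> ball (- vec 1) (1/2))"
proof (rule inj_onI)
  fix x y :: "real^'n" assume xy: "x \<in> ball (vec 1) (1/2) \<union> ball (- vec 1) (1/2)"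
    "y \<in> ball (vec 1) (1/2) \<union> ball (- vec 1) (1/2)" "polar x = polar y"
  note b = disc_bounds[OF assms xy(1)] disc_bounds[OF assms xy(2)]
  have "x \<noteq> 0" "y \<noteq> 0" using b by auto
  then obtain k :: int where k: "y = exp (2 * pi * of_int k) *\<^sub>R x" using polar_eq_iff xy(3) by metis
  have l: "ln (norm y) = ln (norm x) + 2 * pi * of_int k" using \<open>x \<noteq> 0\<close> by (simp add: k ln_mult)
  have s: "sqrt (real CARD('n)) > 3/2" using b(1,3) b(4) 
  proof -
    have "sqrt (real CARD('n)) > sqrt ((3/2)^2)"
      using assms(1) by (intro real_sqrt_less_mono) (simp add: power2_eq_square)
    then show ?thesis by simp
  qed
  have q: "norm u < 2 * norm v" if "\<bar>norm u - sqrt (real CARD('n))\<bar> < 1/2" "\<bar>norm v - sqrt (real CARD('n))\<bar> < 1/2" for u v :: "real^'n"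
    using that s by linarith
  have "ln (norm u) < ln (norm v) + 1" if "norm u < 2 * norm v" "u \<noteq> 0" "v \<noteq> 0" for u v :: "real^'n"
  proof -
    have "norm u < exp 1 * norm v"
      using that(1) exp_ge_add_one_self[of 1] mult_right_mono[of 2 "exp 1" "norm v"] by simp
    then have "ln (norm u) < ln (exp 1 * norm v)" using that by (subst ln_less_cancel_iff) auto
    then show ?thesis using that by (simp add: ln_mult)
  qed
  then have "\<bar>2 * pi * of_int k\<bar> < 1"
    using q[OF b(3,6)] q[OF b(6,3)] \<open>x \<noteq> 0\<close> \<open>y \<noteq> 0\<close> l by (smt (verit))
  moreover have "2 * pi > 1" using pi_gt3 by simp
  ultimately have "k = 0"
  proof -
    have "\<bar>of_int k :: real\<bar> < 1"
    proof (rule ccontr)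
      assume "\<not> \<bar>of_int k :: real\<bar> < 1"
      then have "2 * pi * 1 \<le> 2 * pi * \<bar>real_of_int k\<bar>" by (intro mult_left_mono) auto
      moreover have "\<bar>2 * pi * real_of_int k\<bar> = 2 * pi * \<bar>real_of_int k\<bar>" by (simp add: abs_mult)
      ultimately show False using \<open>\<bar>2 * pi * of_int k\<bar> < 1\<close> \<open>2 * pi > 1\<close> by linarith
    qed
    then show ?thesis by linarith
  qed
  then show "x = y" using k by simp
qed

lemma ball_quarter: "(\<lambda>v. a + v /\<^sub>R 4) ` ball 0 2 = ball (a :: real^'n) (1/2)"
proof (intro set_eqI iffI)
  fix x assume "x \<in> ball a (1/2)"
  then have "4 *\<^sub>R (x - a) \<in> ball 0 2" "x = a + (4 *\<^sub>R (x - a)) /\<^sub>R 4" by (auto simp: dist_norm norm_minus_commute)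
  then show "x \<in> (\<lambda>v. a + v /\<^sub>R 4) ` ball 0 2" by (rule rev_image_eqI)
qed (auto simp: dist_norm)

lemma disc_chart:
  fixes a :: "real^'n"
  assumes "CARD('n) \<ge> 3" "a = vec 1 \<or> a = - vec 1"
  shows "\<exists>c\<in>atlas (copy j (S1xS :: (_, 'n) manifold)). fst c = (\<lambda>v. (j, polar (a + v /\<^sub>R 4))) ` ball 0 2 \<and>
    (\<forall>v\<in>ball 0 2. snd c (j, polar (a + v /\<^sub>R 4)) = a + v /\<^sub>R 4)"
proof -
  let ?V = "ball a (1/2)"
  have sub: "?V \<subseteq> ball (vec 1) (1/2) \<union> ball (- vec 1) (1/2)" using assms(2) by auto
  have inj: "inj_on polar ?V" by (rule inj_on_subset[OF inj_on_polar_discs[OF assms(1)] sub])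
  have "0 \<notin> ?V"
  proof
    assume "0 \<in> ?V"
    then have "0 \<in> ball (vec 1) (1/2) \<union> ball (- vec 1 :: real^'n) (1/2)" using sub by blast
    from disc_bounds(1)[OF assms(1) this] show False by simp
  qed
  then have "(polar ` ?V, inv_into ?V polar) \<in> atlas S1xS" using inj by (auto simp: S1xS_def)
  then have "({j} \<times> polar ` ?V, inv_into ?V polar \<circ> snd) \<in> atlas (copy j S1xS)"
    by (force simp: copy_def)
  moreover have "{j} \<times> polar ` ?V = (\<lambda>v. (j, polar (a + v /\<^sub>R 4))) ` ball 0 2"
    unfolding ball_quarter[symmetric] by auto
  moreover have "inv_into ?V polar (polar (a + v /\<^sub>R 4)) = a + v /\<^sub>R 4" if "v \<in> ball 0 2" for v
    using that by (intro inv_into_f_f[OF inj]) (auto simp: ball_quarter[symmetric])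
  ultimately show ?thesis by (intro bexI[of _ "({j} \<times> polar ` ?V, inv_into ?V polar \<circ> snd)"]) auto
qed

text \<open>The induction carries along a chart on the outgoing disc of the last copy. In the next
  copy it persists unchanged, because the outgoing disc does not meet the incoming one and so is not
  touched by the gluing.\<close>

lemma isom_manifold_csum_upto:
  fixes G :: "real^'n::finite \<Rightarrow> real^'n^'n"
  assumes n: "CARD('n) \<ge> 3"
    and hom: "\<And>(k::int) x. x \<noteq> 0 \<Longrightarrow> G x = pullback (\<lambda>x. exp (2 * pi * of_int k) *\<^sub>R x) G x"
    and g1: "local_isometry G ((\<lambda>v. vec 1 + v /\<^sub>R 4) ` annulus) \<gamma>"
       "\<And>v. v \<in> annulus \<Longrightarrow> \<gamma> (vec 1 + v /\<^sub>R 4) = - vec 1 + inversion v /\<^sub>R 4"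
    and g2: "local_isometry G ((\<lambda>v. - vec 1 + v /\<^sub>R 4) ` annulus) \<gamma>'"
       "\<And>v. v \<in> annulus \<Longrightarrow> \<gamma>' (- vec 1 + v /\<^sub>R 4) = vec 1 + inversion v /\<^sub>R 4"
  shows "isom_manifold G (csum_upto m :: (_, 'n) manifold)"
proof -
  have "isom_manifold G (csum_upto m :: (_, 'n) manifold) \<and> topspace (top_of (csum_upto m :: (_, 'n) manifold)) \<subseteq> {..m} \<times> UNIV \<and>
    (\<exists>c\<in>atlas (csum_upto m :: (_, 'n) manifold). fst c = (\<lambda>v. (m, disc_out v)) ` ball 0 2 \<and>
       (\<forall>v\<in>ball 0 2. snd c (m, disc_out v) = vec 1 + v /\<^sub>R 4))"
  proof (induction m)
    case 0
    have "isom_manifold G (csum_upto 0 :: (_, 'n) manifold)"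
      using isom_manifold_copy[OF isom_manifold_S1xS[OF _ hom]] n by simp
    moreover have "topspace (top_of (csum_upto 0 :: (_, 'n) manifold)) \<subseteq> {..0} \<times> UNIV"
      by (auto simp: copy_def)
    ultimately show ?case using disc_chart[OF n, of "vec 1" 0] by (simp add: disc_out_def)
  next
    case (Suc m)
    let ?M1 = "csum_upto m :: (_, 'n) manifold" and ?M2 = "copy (Suc m) S1xS :: (_, 'n) manifold"
    let ?i1 = "\<lambda>v::real^'n. (m, disc_out v)" and ?i2 = "\<lambda>v::real^'n. (Suc m, disc_in v)"
    from Suc obtain c1 where c1: "c1 \<in> atlas ?M1" "fst c1 = ?i1 ` ball 0 2"
      "\<And>v. v \<in> ball 0 2 \<Longrightarrow> snd c1 (?i1 v) = vec 1 + v /\<^sub>R 4"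
      and M1: "isom_manifold G ?M1" and t1: "topspace (top_of ?M1) \<subseteq> {..m} \<times> UNIV" by blast
    have M2: "isom_manifold G ?M2" using isom_manifold_copy[OF isom_manifold_S1xS[OF _ hom]] n by simp
    have t2: "topspace (top_of ?M2) \<subseteq> {Suc m} \<times> UNIV" by (auto simp: copy_def)
    obtain c2 where c2: "c2 \<in> atlas ?M2" "fst c2 = ?i2 ` ball 0 2"
      "\<And>v. v \<in> ball 0 2 \<Longrightarrow> snd c2 (?i2 v) = - vec 1 + v /\<^sub>R 4"
      using disc_chart[OF n, of "- vec 1" "Suc m"] by (auto simp: disc_in_def)
    obtain c3 where c3: "c3 \<in> atlas ?M2" "fst c3 = (\<lambda>v. (Suc m, disc_out v)) ` ball 0 2"
      "\<And>v. v \<in> ball 0 2 \<Longrightarrow> snd c3 (Suc m, disc_out v) = vec 1 + v /\<^sub>R 4"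
      using disc_chart[OF n, of "vec 1" "Suc m"] by (auto simp: disc_out_def)
    have disj: "topspace (top_of ?M1) \<inter> topspace (top_of ?M2) = {}" using t1 t2 by fastforce
    have n2: "CARD('n) \<ge> 2" using n by simp
    note cs = isom_manifold_connected_sum[OF n2 M1 M2 disj c1 c2 g1 g2]
    have up: "csum_upto (Suc m) = connected_sum ?M1 ?i1 ?M2 ?i2" by simp
    interpret glue "top_of ?M1" "top_of ?M2" "piece1 ?M1 ?i1" "piece2 ?M2 ?i2" ?i1 ?i2 "into1 ?i1 ?i2" "into2 ?i1 ?i2"
      "topology (csum_open ?M1 ?i1 ?M2 ?i2)"
      by (rule glue_connected_sum[OF glue_half_disc[OF M1 c1] glue_half_disc[OF M2 c2] disj])
    \<comment> \<open>\<open>polar\<close> is injective on the union of the two coordinate discs,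
      whose centres have distance 2 sqrt n.\<close>
    have apart: "(Suc m, disc_out v) \<notin> ?i2 ` ball 0 2" if v: "v \<in> ball 0 2" for v
    proof
      assume "(Suc m, disc_out v) \<in> ?i2 ` ball 0 2"
      then obtain w where w: "w \<in> ball 0 2" "polar (vec 1 + v /\<^sub>R 4) = polar (- vec 1 + w /\<^sub>R 4)"
        by (auto simp: disc_out_def disc_in_def)
      have vw: "vec 1 + v /\<^sub>R 4 \<in> ball (vec 1) (1/2)" "- vec 1 + w /\<^sub>R 4 \<in> ball (- vec 1) (1/2)"
        using v w(1) unfolding ball_quarter[symmetric] by blast+
      then have eq: "vec 1 + v /\<^sub>R 4 = - vec 1 + w /\<^sub>R 4"
        using inj_onD[OF inj_on_polar_discs[OF n] w(2)] by blast
      have "dist (vec 1) (- vec 1 :: real^'n) < 1"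
        using vw(1) vw(2)[folded eq] dist_triangle[of "vec 1" "- vec 1" "vec 1 + v /\<^sub>R 4"]
        by (simp only: mem_ball dist_commute[of "- vec 1"])
      moreover have "vec 1 - - vec 1 = 2 *\<^sub>R (vec 1 :: real^'n)" by (simp only: scaleR_2 diff_minus_eq_add)
      ultimately have "2 * sqrt (real CARD('n)) < 1"
        by (simp only: dist_norm norm_scaleR norm_vec_1)
      moreover have "sqrt (real CARD('n)) \<ge> 1" using n by simp
      ultimately show False by linarith
    qed
    have far: "p \<notin> ?i2 ` ball 0 2" if p: "p \<in> fst c3" for p
    proof -
      obtain v where v: "v \<in> ball 0 2" "p = (Suc m, disc_out v)" using p unfolding c3(2) by (rule imageE)
      show ?thesis unfolding v(2) by (rule apart[OF v(1)])
    qed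
    have U: "fst c3 \<subseteq> piece2 ?M2 ?i2"
    proof
      fix p assume p: "p \<in> fst c3"
      have "cball 0 (1/2) \<subseteq> ball (0::real^'n) 2" by auto
      then have "?i2 ` cball 0 (1/2) \<subseteq> ?i2 ` ball 0 2" by (rule image_mono)
      then have "p \<notin> ?i2 ` cball 0 (1/2)" using far[OF p] by (rule contra_subsetD)
      moreover have "p \<in> topspace (top_of ?M2)"
        unfolding isom_manifoldD(5)[OF M2, symmetric] by (rule UN_I[of c3]) (rule c3(1), rule p)
      ultimately show "p \<in> piece2 ?M2 ?i2" unfolding piece2_def by (intro DiffI)
    qed
    have id: "into2 ?i1 ?i2 p = p" if "p \<in> fst c3" for p
    proof -
      have "ball 0 1 \<subseteq> ball (0::real^'n) 2" by auto
      then have "?i2 ` ball 0 1 \<subseteq> ?i2 ` ball 0 2" by (rule image_mono)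
      then have "p \<notin> ?i2 ` ball 0 1" using far[OF that] by (rule contra_subsetD)
      then show ?thesis unfolding into2_def by (rule if_not_P)
    qed
    let ?c = "push2 c3"
    have at: "?c \<in> atlas (csum_upto (Suc m))" using c3(1) unfolding up by (simp add: connected_sum_def)
    have f: "fst ?c = (\<lambda>v. (Suc m, disc_out v)) ` ball 0 2"
    proof -
      have "fst ?c = into2 ?i1 ?i2 ` (fst c3 \<inter> piece2 ?M2 ?i2)" by (cases c3) simp
      also have "\<dots> = into2 ?i1 ?i2 ` fst c3" using U by (simp add: Int_absorb2)
      also have "\<dots> = fst c3" using id by simp
      finally show ?thesis using c3(2) by simp
    qed
    have sn: "snd ?c (Suc m, disc_out v) = vec 1 + v /\<^sub>R 4" if "v \<in> ball 0 2" for v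
    proof -
      have p: "(Suc m, disc_out v) \<in> fst c3" using that unfolding c3(2) by (rule imageI)
      have "inv_into (piece2 ?M2 ?i2) (into2 ?i1 ?i2) (Suc m, disc_out v) = (Suc m, disc_out v)"
        using glue.inv1[OF swap, of "(Suc m, disc_out v)"] id[OF p] U p by auto
      moreover have "snd ?c p = snd c3 (inv_into (piece2 ?M2 ?i2) (into2 ?i1 ?i2) p)" for p by (cases c3) simp
      ultimately show ?thesis using c3(3)[OF that] by simp
    qed
    have tsub: "topspace (top_of (csum_upto (Suc m) :: (_, 'n) manifold)) \<subseteq> {..Suc m} \<times> UNIV"
    proof -
      have "{..m} \<times> UNIV \<subseteq> {..Suc m} \<times> (UNIV :: (complex \<times> (real^'n)) set)"
        "{Suc m} \<times> UNIV \<subseteq> {..Suc m} \<times> (UNIV :: (complex \<times> (real^'n)) set)" by auto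
      then show ?thesis using cs(2) t1 t2 unfolding up by (meson Un_least subset_trans)
    qed
    show ?case
      using cs(1)[folded up] tsub
    proof (intro conjI)
      show "\<exists>c\<in>atlas (csum_upto (Suc m) :: (_, 'n) manifold). fst c = (\<lambda>v. (Suc m, disc_out v)) ` ball 0 2 \<and>
       (\<forall>v\<in>ball 0 2. snd c (Suc m, disc_out v) = vec 1 + v /\<^sub>R 4)"
        by (rule bexI[of _ ?c]) (intro conjI ballI f sn, assumption, rule at)
    qed
  qed
  then show ?thesis by blast
qed

section \<open>The profile of the metric\<close>

text \<open>The functions x^(-k) e^(-1/x), extended by 0. Differentiation stays within the span of
  this family, so C^n for all k follows by induction on n.\<close>

definition flat :: "nat \<Rightarrow> real \<Rightarrow> real" where
  "flat k x = (if x > 0 then (1 / x) ^ k * exp (- (1 / x)) else 0)"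

lemma flat_tendsto: "(flat k \<longlongrightarrow> 0) (at 0)"
proof -
  have "((\<lambda>y::real. y ^ k / exp y) \<longlongrightarrow> 0) at_top" by (rule tendsto_power_div_exp_0)
  then have "((\<lambda>x::real. inverse x ^ k / exp (inverse x)) \<longlongrightarrow> 0) (at_right 0)"
    using filterlim_compose filterlim_inverse_at_top_right by blast
  then have "(flat k \<longlongrightarrow> 0) (at_right 0)"
    by (rule Lim_transform_eventually)
      (auto simp: flat_def eventually_at_filter exp_minus divide_inverse intro!: always_eventually)
  moreover have "(flat k \<longlongrightarrow> 0) (at_left 0)"
    by (rule Lim_transform_eventually[OF tendsto_const]) (auto simp: flat_def eventually_at_filter intro!: always_eventually)
  ultimately show ?thesis by (simp add: filterlim_at_split)
qed

lemma flat_deriv: "(flat k has_real_derivative (flat (k + 2) x - real k * flat (k + 1) x)) (at x)"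
proof (cases "x = 0")
  case True
  have "((\<lambda>h. (flat k (0 + h) - flat k 0) / h) \<longlongrightarrow> 0) (at 0)"
    by (rule Lim_transform_eventually[OF flat_tendsto[of "k + 1"]])
      (auto simp: flat_def eventually_at_filter field_simps intro!: always_eventually)
  then show ?thesis unfolding DERIV_def True by (simp add: flat_def)
next
  case False
  show ?thesis
  proof (cases "x > 0")
    case True
    have "((\<lambda>x. (1 / x) ^ k * exp (- (1 / x))) has_real_derivative flat (k + 2) x - real k * flat (k + 1) x) (at x)"
      using True by (auto intro!: derivative_eq_intros simp: flat_def)
        (cases k; simp add: field_simps power2_eq_square)
    then show ?thesis
      by (rule has_field_derivative_transform_within_open[where S = "{0<..}"]) (use True in \<open>auto simp: flat_def\<close>)
  next
    case f: False
    have "((\<lambda>x::real. 0) has_real_derivative 0) (at x)" by simp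
    then have "(flat k has_real_derivative 0) (at x)"
      by (rule has_field_derivative_transform_within_open[where S = "{..<0}"]) (use f False in \<open>auto simp: flat_def\<close>)
    then show ?thesis using f by (simp add: flat_def)
  qed
qed

lemma smooth_on_flat: "smooth_on UNIV (flat k)"
proof -
  have "Ck_on n UNIV (flat k)" for n
  proof (induction n arbitrary: k)
    case 0
    show ?case using flat_deriv by (auto intro!: continuous_at_imp_continuous_on DERIV_isCont)
  next
    case (Suc n)
    show ?case
    proof (rule Ck_on_SucI[OF open_UNIV])
      show "(flat k has_derivative (\<lambda>v. v * (flat (k + 2) x + (- real k) * flat (k + 1) x))) (at x)" for x
        using flat_deriv[of k x] by (simp add: has_field_derivative_def mult_commute_abs)
      show "Ck_on n UNIV (\<lambda>x. v * (flat (k + 2) x + (- real k) * flat (k + 1) x))" for v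
        by (intro Ck_on_bounded_linear[OF open_UNIV bounded_linear_mult_right] Ck_on_add open_UNIV Suc.IH)
    qed
  qed
  then show ?thesis by (simp add: smooth_on_def)
qed

text \<open>Integrals start at a point left of both 0 and x; subtracting the value at 0 makes the
  result independent of that point, so local pieces fit together on the whole line.\<close>

lemma antiderivative_exists:
  fixes f :: "real \<Rightarrow> real"
  assumes "continuous_on UNIV f"
  shows "\<exists>F. F 0 = 0 \<and> (\<forall>x. (F has_real_derivative f x) (at x))"
proof -
  let ?I = "\<lambda>a x. integral {- a..x} f - integral {- a..0} f"
  define F where "F = (\<lambda>x. ?I (\<bar>x\<bar> + 1) x)"
  have int: "f integrable_on {a..b}" for a b
    using assms by (intro integrable_continuous_real) (auto intro: continuous_on_subset)
  have F: "F x = ?I a x" if "a > 0" "\<bar>x\<bar> < a" for a x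
  proof -
    have shift: "?I a x = ?I b x" if "0 < a" "\<bar>x\<bar> < a" "a \<le> b" for a b
    proof -
      have "integral {- b..- a} f + integral {- a..x} f = integral {- b..x} f"
        "integral {- b..- a} f + integral {- a..0} f = integral {- b..0} f"
        using that by (auto intro!: Henstock_Kurzweil_Integration.integral_combine int)
      then show ?thesis by simp
    qed
    show ?thesis unfolding F_def
      using shift[of a "\<bar>x\<bar> + 1"] shift[of "\<bar>x\<bar> + 1" a] that by (cases "a \<le> \<bar>x\<bar> + 1") auto
  qed
  have "(F has_real_derivative f x) (at x)" for x
  proof -
    let ?a = "\<bar>x\<bar> + 1"
    have "((\<lambda>u. integral {- ?a..u} f) has_real_derivative f x) (at x within {- ?a..?a})"
      using assms by (intro integral_has_real_derivative) (auto intro: continuous_on_subset)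
    then have "((\<lambda>u. integral {- ?a..u} f) has_real_derivative f x) (at x within {- ?a<..<?a})"
      by (rule has_field_derivative_subset) auto
    then have "((\<lambda>u. integral {- ?a..u} f) has_real_derivative f x) (at x)"
      by (subst (asm) at_within_open) auto
    then have "(?I ?a has_real_derivative f x) (at x)"
      by (auto intro!: derivative_eq_intros)
    then show ?thesis
      by (rule has_field_derivative_transform_within_open[where S = "{- ?a<..<?a}"]) (use F[of ?a] in auto)
  qed
  moreover have "F 0 = 0" by (simp add: F_def)
  ultimately show ?thesis by blast
qed

lemma smooth_antiderivative:
  fixes f :: "real \<Rightarrow> real"
  assumes "smooth_on UNIV f"
  obtains F where "F 0 = 0" "\<And>x. (F has_real_derivative f x) (at x)" "smooth_on UNIV F"
proof -
  obtain F where F: "F 0 = 0" "\<And>x. (F has_real_derivative f x) (at x)"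
    using antiderivative_exists[OF smooth_on_continuous[OF assms]] by blast
  have "smooth_on UNIV F" by (rule smooth_on_real_derivI[OF open_UNIV F(2) assms])
  then show ?thesis using that F by blast
qed

lemma zero_deriv_const:
  fixes f :: "real \<Rightarrow> real"
  assumes "\<And>z. z \<in> {a..b} \<Longrightarrow> (f has_real_derivative 0) (at z)" "a \<le> b"
  shows "f b = f a"
proof (cases "a = b")
  case False
  then have "\<exists>z>a. z < b \<and> f b - f a = (b - a) * 0"
    using assms by (intro MVT2) auto
  then show ?thesis by auto
qed simp

text \<open>The normalised integral of a bump supported in [0, 1]. The bump is symmetric under x ->
  1 - x, and this gives the symmetry of \<open>st\<close>.\<close>

lemma smooth_step_exists:
  obtains st st' :: "real \<Rightarrow> real" where "smooth_on UNIV st" "\<And>x. (st has_real_derivative st' x) (at x)"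
    "\<And>x. st' x \<ge> 0" "\<And>x. x \<le> 0 \<Longrightarrow> st x = 0" "\<And>x. x \<ge> 1 \<Longrightarrow> st x = 1" "\<And>x. 0 \<le> st x" "\<And>x. st x \<le> 1"
    "\<And>x. st (1 - x) = 1 - st x"
proof -
  define b where "b = (\<lambda>x. flat 0 x * flat 0 (1 - x))"
  have smb: "smooth_on UNIV b"
    unfolding b_def by (intro smooth_on_mult smooth_on_flat smooth_on_compose[OF _ _ _ _ smooth_on_flat]
        smooth_on_diff smooth_on_const smooth_on_ident) auto
  obtain B where B: "B 0 = 0" "\<And>x. (B has_real_derivative b x) (at x)" "smooth_on UNIV B"
    using smooth_antiderivative[OF smb] by blast
  have b0: "b x \<ge> 0" for x by (simp add: b_def flat_def)
  have mono: "B x \<le> B y" if "x \<le> y" for x y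
    using DERIV_nonneg_imp_nondecreasing[OF that] B(2) b0 by blast
  have neg: "B x = 0" if "x \<le> 0" for x
    using zero_deriv_const[of x 0 B] B(1,2) that by (metis atLeastAtMost_iff b_def flat_def mult_zero_left not_less)
  have big: "B x = B 1" if "x \<ge> 1" for x
  proof (rule zero_deriv_const[of 1 x B])
    fix z :: real assume "z \<in> {1..x}"
    then have "b z = 0" by (simp add: b_def flat_def)
    then show "(B has_real_derivative 0) (at z)" using B(2)[of z] by simp
  qed (rule that)
  have pos: "B 1 > 0"
  proof -
    have "\<exists>z>0. z < 1 \<and> B 1 - B 0 = (1 - 0) * b z" by (intro MVT2 B(2)) auto
    then show ?thesis using B(1) by (auto simp: b_def flat_def)
  qed
  have sym: "B (1 - x) = B 1 - B x" for x
  proof -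
    have d: "((\<lambda>x. B (1 - x) + B x) has_real_derivative 0) (at x)" for x
    proof -
      have "((\<lambda>x. B (1 - x) + B x) has_real_derivative (b (1 - x) * (- 1) + b x)) (at x)"
        by (intro DERIV_add DERIV_chain2[OF B(2)] B(2)) (auto intro!: derivative_eq_intros)
      then show ?thesis by (simp add: b_def mult.commute)
    qed
    have "B (1 - x) + B x = B (1 - 0) + B 0"
      using zero_deriv_const[of 0 x "\<lambda>x. B (1 - x) + B x"] zero_deriv_const[of x 0 "\<lambda>x. B (1 - x) + B x"] d
      by (cases "x \<le> 0") auto
    then show ?thesis using B(1) by simp
  qed
  show ?thesis
  proof (rule that[of "\<lambda>x. B x / B 1" "\<lambda>x. b x / B 1"])
    show "smooth_on UNIV (\<lambda>x. B x / B 1)" using pos by (intro smooth_on_divide B smooth_on_const) auto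
    show "((\<lambda>x. B x / B 1) has_real_derivative b x / B 1) (at x)" for x by (rule DERIV_cdivide[OF B(2)])
    show "b x / B 1 \<ge> 0" for x using b0 pos by simp
    show "0 \<le> B x / B 1" for x using mono[of 0 x] neg[of x] B(1) pos by (cases "x \<le> 0") auto
    show "B x / B 1 \<le> 1" for x using mono[of x 1] big[of x] pos by (cases "x \<le> 1") auto
    show "B (1 - x) / B 1 = 1 - B x / B 1" for x using pos by (simp add: sym diff_divide_distrib)
    show "B x / B 1 = 0" if "x \<le> 0" for x using neg[OF that] by simp
    show "B x / B 1 = 1" if "x \<ge> 1" for x using big[OF that] pos by (metis divide_self less_irrefl)
  qed
qed

text \<open>The symmetry of the step about 1/2 becomes oddness after rescaling. Oddness of this step
  makes the stretching around a disc centre commute with inversion.\<close>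

lemma odd_step_exists:
  obtains q q' :: "real \<Rightarrow> real" where "smooth_on UNIV q" "\<And>x. (q has_real_derivative q' x) (at x)"
    "\<And>x. q' x \<ge> 0" "\<And>x. x \<le> - 1 \<Longrightarrow> q x = - 1" "\<And>x. x \<ge> 1 \<Longrightarrow> q x = 1" "\<And>x. q (- x) = - q x"
proof -
  obtain st st' :: "real \<Rightarrow> real" where st: "smooth_on UNIV st" "\<And>x. (st has_real_derivative st' x) (at x)"
    "\<And>x. st' x \<ge> 0" "\<And>x. x \<le> 0 \<Longrightarrow> st x = 0" "\<And>x. x \<ge> 1 \<Longrightarrow> st x = 1" "\<And>x. st (1 - x) = 1 - st x"
    using smooth_step_exists by metis
  show ?thesis
  proof (rule that[of "\<lambda>x. 2 * st ((x + 1) / 2) - 1" "\<lambda>x. st' ((x + 1) / 2)"])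
    show "smooth_on UNIV (\<lambda>x. 2 * st ((x + 1) / 2) - 1)"
      by (intro smooth_on_diff smooth_on_mult smooth_on_const smooth_on_compose[OF _ _ _ _ st(1)]
          smooth_on_divide smooth_on_add smooth_on_ident) auto
    show "((\<lambda>x. 2 * st ((x + 1) / 2) - 1) has_real_derivative st' ((x + 1) / 2)) (at x)" for x
      by (auto intro!: derivative_eq_intros DERIV_chain2[OF st(2)])
    show "2 * st ((- x + 1) / 2) - 1 = - (2 * st ((x + 1) / 2) - 1)" for x
    proof -
      have "(- x + 1) / 2 = 1 - (x + 1) / 2" by (simp add: field_simps)
      then show ?thesis by (simp only: st(6)) simp
    qed
  qed (use st in auto)
qed

section \<open>The neck profile\<close>

lemma smooth_on_tanh: "smooth_on UNIV (tanh :: real \<Rightarrow> real)"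
proof (rule smooth_on_bootstrap[where f' = "\<lambda>x. 1 + (- 1) * (tanh x * tanh x)"])
  show "(tanh has_real_derivative 1 + (- 1) * (tanh x * tanh x)) (at x)" for x :: real
    by (auto intro!: derivative_eq_intros simp: power2_eq_square)
  show "Ck_on k UNIV (\<lambda>x::real. 1 + (- 1) * (tanh x * tanh x))" if "Ck_on k UNIV (tanh :: real \<Rightarrow> real)" for k
    by (intro Ck_on_add Ck_on_const Ck_on_bounded_bilinear[OF _ bounded_bilinear_mult] that open_UNIV)
qed auto

text \<open>In the warped product \<open>ds\<^sup>2 + V(s)\<^sup>-\<^sup>2 g\<close> conformal to a cylinder, \<open>V'/V = tanh \<theta>\<close>, the
  curvature conditions read \<open>- \<epsilon> < \<theta>' \<le> 1\<close>; round spheres are the solutions of \<open>\<theta>' = 1\<close>.\<close>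

lemma log_profile_exists:
  assumes "0 < \<epsilon>" "\<epsilon> < 1" "S0 \<ge> 0"
  obtains V \<theta> m :: "real \<Rightarrow> real" and T C a :: real where
    "smooth_on UNIV V" "smooth_on UNIV \<theta>" "\<And>t. V t > 0" "\<And>t. V (- t) = V t"
    "\<And>t. (V has_real_derivative V t * tanh (\<theta> t)) (at t)" "\<And>t. (\<theta> has_real_derivative m t) (at t)"
    "\<And>t. - \<epsilon> \<le> m t" "\<And>t. m t \<le> 1" "C > 0" "a \<ge> 0" "T \<ge> a + S0" "\<And>t. t \<ge> a \<Longrightarrow> V t = C * cosh (t - T)"
proof -
  obtain st st' :: "real \<Rightarrow> real" where st: "smooth_on UNIV st" "\<And>x. x \<le> 0 \<Longrightarrow> st x = 0" "\<And>x. x \<ge> 1 \<Longrightarrow> st x = 1"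
    "\<And>x. 0 \<le> st x" "\<And>x. st x \<le> 1"
    using smooth_step_exists by metis
  \<comment> \<open>Long enough for \<theta>, falling with slope -\<epsilon>/2, to reach -(S0 + 1).
    The transition interval of length 1 that follows raises it by at most 1, so that \<theta> a
    \<le> -S0.\<close>
  define t1 where "t1 = 2 * (S0 + 1) / \<epsilon>"
  have t1: "t1 > 0" "\<epsilon> * t1 / 2 = S0 + 1" using assms by (simp_all add: t1_def)
  \<comment> \<open>Even, equal to -\<epsilon>/2 for |t| \<le> t1 and to 1 for |t| \<ge> t1 +
    1.\<close>
  define m where "m = (\<lambda>t. (1 + \<epsilon> / 2) * (st (t - t1) + st (- t - t1)) - \<epsilon> / 2)"
  have smm: "smooth_on UNIV m"
    unfolding m_def by (intro smooth_on_diff smooth_on_mult smooth_on_add smooth_on_minus smooth_on_const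
        smooth_on_compose[OF _ _ _ _ st(1)] smooth_on_ident) auto
  obtain \<theta> where \<theta>: "\<theta> 0 = 0" "\<And>x. (\<theta> has_real_derivative m x) (at x)" "smooth_on UNIV \<theta>"
    using smooth_antiderivative[OF smm] by blast
  have smt: "smooth_on UNIV (\<lambda>t. tanh (\<theta> t))"
    by (rule smooth_on_compose[OF _ _ _ \<theta>(3) smooth_on_tanh]) auto
  obtain L where L: "L 0 = 0" "\<And>x. (L has_real_derivative tanh (\<theta> x)) (at x)" "smooth_on UNIV L"
    using smooth_antiderivative[OF smt] by blast
  \<comment> \<open>At most one of the two steps is nonzero, since t1 > 0.\<close>
  have sum1: "st (t - t1) + st (- t - t1) \<in> {0..1}" for t
    using st(2)[of "t - t1"] st(2)[of "- t - t1"] st(4,5)[of "t - t1"] st(4,5)[of "- t - t1"] t1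
    by (cases "t \<ge> 0") auto
  have m_lo: "- \<epsilon> \<le> m t" for t
  proof -
    have "(1 + \<epsilon> / 2) * (st (t - t1) + st (- t - t1)) \<ge> 0" using sum1[of t] assms by (intro mult_nonneg_nonneg) auto
    then show ?thesis using assms by (simp add: m_def)
  qed
  have m_hi: "m t \<le> 1" for t
  proof -
    have "(1 + \<epsilon> / 2) * (st (t - t1) + st (- t - t1)) \<le> (1 + \<epsilon> / 2) * 1"
      using sum1[of t] assms by (intro mult_left_mono) auto
    then show ?thesis by (simp add: m_def)
  qed
  have m_even: "m (- t) = m t" for t by (simp add: m_def add.commute)
  have \<theta>_odd: "\<theta> (- t) = - \<theta> t" for t
  proof -
    have d: "((\<lambda>t. \<theta> (- t) + \<theta> t) has_real_derivative 0) (at t)" for t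
    proof -
      have "((\<lambda>t. \<theta> (- t) + \<theta> t) has_real_derivative (m (- t) * (- 1) + m t)) (at t)"
        by (intro DERIV_add DERIV_chain2[OF \<theta>(2)] \<theta>(2)) (auto intro!: derivative_eq_intros)
      then show ?thesis by (simp add: m_even)
    qed
    have "\<theta> (- t) + \<theta> t = \<theta> (- 0) + \<theta> 0"
      using zero_deriv_const[of 0 t "\<lambda>t. \<theta> (- t) + \<theta> t"] zero_deriv_const[of t 0 "\<lambda>t. \<theta> (- t) + \<theta> t"] d
      by (cases "t \<le> 0") auto
    then show ?thesis using \<theta>(1) by simp
  qed
  have L_even: "L (- t) = L t" for t
  proof -
    have d: "((\<lambda>t. L (- t) - L t) has_real_derivative 0) (at t)" for t
    proof -
      have "((\<lambda>t. L (- t) - L t) has_real_derivative (tanh (\<theta> (- t)) * (- 1) - tanh (\<theta> t))) (at t)"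
        by (intro DERIV_diff DERIV_chain2[OF L(2)] L(2)) (auto intro!: derivative_eq_intros)
      then show ?thesis by (simp add: \<theta>_odd)
    qed
    have "L (- t) - L t = L (- 0) - L 0"
      using zero_deriv_const[of 0 t "\<lambda>t. L (- t) - L t"] zero_deriv_const[of t 0 "\<lambda>t. L (- t) - L t"] d
      by (cases "t \<le> 0") auto
    then show ?thesis using L(1) by simp
  qed
  define a where "a = t1 + 1"
  \<comment> \<open>The line \<theta> = t - T vanishes at t = T: this is the equator of the sphere,
    where its radius is maximal.\<close>
  define T where "T = a - \<theta> a"
  have \<theta>_line: "\<theta> t = t - T" if "t \<ge> a" for t
  proof -
    have "((\<lambda>t. \<theta> t - t) has_real_derivative 0) (at z)" if "z \<in> {a..t}" for z
    proof -
      have "m z = 1" using that t1 st(3)[of "z - t1"] st(2)[of "- z - t1"] by (simp add: m_def a_def)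
      then show ?thesis using DERIV_diff[OF \<theta>(2)[of z] DERIV_ident] by simp
    qed
    from zero_deriv_const[OF this that] show ?thesis by (simp add: T_def)
  qed
  have TS: "T \<ge> a + S0"
  proof -
    have "\<exists>z>0. z < t1 \<and> \<theta> t1 - \<theta> 0 = (t1 - 0) * m z" using t1 by (intro MVT2 \<theta>(2)) auto
    then obtain z where z: "0 < z" "z < t1" "\<theta> t1 = t1 * m z" using \<theta>(1) by auto
    have "m z = - \<epsilon> / 2" using z st(2)[of "z - t1"] st(2)[of "- z - t1"] by (simp add: m_def)
    then have 1: "\<theta> t1 = - (S0 + 1)" using z(3) t1(2) by (simp add: mult.commute)
    have "\<exists>z>t1. z < a \<and> \<theta> a - \<theta> t1 = (a - t1) * m z" by (intro MVT2 \<theta>(2)) (auto simp: a_def)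
    then obtain z where "\<theta> a - \<theta> t1 = m z" by (auto simp: a_def)
    then have "\<theta> a \<le> \<theta> t1 + 1" using m_hi[of z] by linarith
    then show ?thesis using 1 by (simp add: T_def)
  qed
  define V where "V = (\<lambda>t. exp (L t))"
  have VD: "(V has_real_derivative V t * tanh (\<theta> t)) (at t)" for t
    unfolding V_def by (auto intro!: derivative_eq_intros L(2))
  have Vpos: "V t > 0" for t by (simp add: V_def)
  define C where "C = V a / cosh (a - T)"
  have V_cosh: "V t = C * cosh (t - T)" if "t \<ge> a" for t
  proof -
    have "((\<lambda>t. V t / cosh (t - T)) has_real_derivative 0) (at z)" if "z \<in> {a..t}" for z
    proof -
      have "\<theta> z = z - T" using that \<theta>_line by simp
      then have "((\<lambda>t. V t / cosh (t - T)) has_real_derivative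
          (V z * tanh (z - T) * cosh (z - T) - V z * sinh (z - T)) / (cosh (z - T))\<^sup>2) (at z)"
        using VD[of z] by (auto intro!: derivative_eq_intros simp: power2_eq_square)
      then show ?thesis by (simp add: tanh_def)
    qed
    from zero_deriv_const[OF this that] have "V t / cosh (t - T) = C" by (simp add: C_def)
    then show ?thesis by (simp add: field_simps)
  qed
  show ?thesis
  proof (rule that[of V \<theta> m C a T])
    show "smooth_on UNIV V" unfolding V_def by (intro smooth_on_exp L(3) open_UNIV)
    show "V (- t) = V t" for t by (simp add: V_def L_even)
    show "C > 0" using Vpos by (simp add: C_def)
    show "a \<ge> 0" using t1 by (simp add: a_def)
  qed (use \<theta> VD Vpos m_lo m_hi TS V_cosh in auto)
qed

lemma cosh_split: "cosh (s - T) = (exp s * exp (- T) + exp (- s) * exp T) / 2" for s T :: real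
  by (simp add: cosh_def flip: exp_add)

text \<open>With t = ln |z|, r = e^(2t) and U(r) = e^t V(t), the metric U^(-2) |dz|^2 becomes V^(-2)
  (dt^2 + g_S) on the cylinder, where g_S is the round metric of the unit sphere. Evenness of V
  turns into the rule for U(1/r).\<close>

lemma profile_exists:
  assumes "0 < \<epsilon>" "\<epsilon> < 1" "S0 \<ge> 0"
  obtains U :: "real \<Rightarrow> real" and T C :: real where
    "smooth_on UNIV U" "C > 0" "T \<ge> S0"
    "\<And>r. r \<ge> 0 \<Longrightarrow> U r > 0"
    "\<And>r. r \<ge> 0 \<Longrightarrow> deriv U r * (U r - r * deriv U r) > 0"
    "\<And>r. r \<ge> 0 \<Longrightarrow> deriv (deriv U) r \<le> 0"
    "\<And>r. r \<ge> 0 \<Longrightarrow> r * U r * deriv (deriv U) r \<ge> - (1 + \<epsilon>) * (deriv U r * (U r - r * deriv U r))"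
    "\<And>r. r > 0 \<Longrightarrow> U (1 / r) = U r / r"
    "\<And>r. r \<ge> exp (2 * (T - S0)) \<Longrightarrow> U r = C * (1 + exp (- (2 * T)) * r)"
proof -
  obtain V \<theta> m :: "real \<Rightarrow> real" and T C a :: real where V:
    "smooth_on UNIV V" "smooth_on UNIV \<theta>" "\<And>t. V t > 0" "\<And>t. V (- t) = V t"
    "\<And>t. (V has_real_derivative V t * tanh (\<theta> t)) (at t)" "\<And>t. (\<theta> has_real_derivative m t) (at t)"
    "\<And>t. - \<epsilon> \<le> m t" "\<And>t. m t \<le> 1" "C > 0" "a \<ge> 0" "T \<ge> a + S0" "\<And>t. t \<ge> a \<Longrightarrow> V t = C * cosh (t - T)"
    using log_profile_exists[OF assms] by metis
  define W where "W = (\<lambda>r. exp (ln r / 2) * V (ln r / 2))"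
  define \<delta> where "\<delta> = exp (- (2 * a))"
  define A B where "A = C / 2 * exp T" and "B = C / 2 * exp (- T)"
  \<comment> \<open>The formula for W breaks down at r = 0. For t \<le> -a, however, V is C cosh(t +
    T), so e^t V(t) is affine in r and can be continued to all smaller r; this fills in the centre
    of the first sphere.\<close>
  define U where "U = (\<lambda>r. if r \<ge> \<delta> then W r else A * r + B)"
  have \<delta>: "\<delta> > 0" by (simp add: \<delta>_def)
  have AB: "A > 0" "B > 0" using V(9) by (simp_all add: A_def B_def)
  have low: "W r = A * r + B" if "0 < r" "r \<le> \<delta>" for r
  proof -
    have "ln r \<le> - (2 * a)" using that \<delta> by (metis \<delta>_def ln_exp ln_le_cancel_iff)
    then have "- (ln r / 2) \<ge> a" by simp
    then have "V (ln r / 2) = C * cosh (- (ln r / 2) - T)" using V(4)[of "ln r / 2"] V(12) by metis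
    also have "\<dots> = C / 2 * (exp (ln r / 2) * exp T + exp (- (ln r / 2)) * exp (- T))"
      unfolding cosh_split by (simp add: algebra_simps)
    finally have "W r = C / 2 * (exp (ln r / 2) * exp (ln r / 2) * exp T + exp (ln r / 2) * exp (- (ln r / 2)) * exp (- T))"
      by (simp add: W_def algebra_simps)
    also have "exp (ln r / 2) * exp (ln r / 2) = r" using that by (simp flip: exp_add)
    also have "exp (ln r / 2) * exp (- (ln r / 2)) = 1" by (simp flip: exp_add)
    finally show ?thesis by (simp add: A_def B_def algebra_simps)
  qed
  have UW: "U r = W r" if "r > 0" for r using low that by (simp add: U_def)
  have Ulin: "U r = A * r + B" if "r \<le> \<delta>" for r using low[of \<delta>] \<delta> that by (auto simp: U_def)
  have high: "U r = C * (1 + exp (- (2 * T)) * r) * exp T / 2" if "r \<ge> exp (2 * a)" for r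
  proof -
    have r: "r > 0" using that by (meson exp_gt_zero less_le_trans)
    have "2 * a \<le> ln r" using that r by (metis exp_gt_zero ln_exp ln_le_cancel_iff)
    then have "V (ln r / 2) = C * cosh (ln r / 2 - T)" using V(12) by simp
    also have "\<dots> = C / 2 * (exp (ln r / 2) * exp (- T) + exp (- (ln r / 2)) * exp T)"
      unfolding cosh_split by (simp add: algebra_simps)
    finally have "W r = C / 2 * (exp (ln r / 2) * exp (ln r / 2) * exp (- T) + exp (ln r / 2) * exp (- (ln r / 2)) * exp T)"
      by (simp add: W_def algebra_simps)
    also have "exp (ln r / 2) * exp (ln r / 2) = r" using r by (simp flip: exp_add)
    also have "exp (ln r / 2) * exp (- (ln r / 2)) = 1" by (simp flip: exp_add)
    also have "exp (- T) = exp (- (2 * T)) * exp T" by (simp flip: exp_add)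
    finally show ?thesis using UW[OF r] by (simp add: algebra_simps)
  qed
  have dW: "(W has_real_derivative exp (- (ln r / 2)) * V (ln r / 2) * (1 + tanh (\<theta> (ln r / 2))) / 2) (at r)" if "r > 0" for r
  proof -
    have e: "exp (ln r / 2) / r = exp (- (ln r / 2))"
    proof -
      have "exp (ln r / 2) = exp (- (ln r / 2)) * exp (ln r)" by (simp flip: exp_add)
      then show ?thesis using that by simp
    qed
    have "(W has_real_derivative (exp (ln r / 2) / r) * V (ln r / 2) * (1 + tanh (\<theta> (ln r / 2))) / 2) (at r)"
      unfolding W_def using that
      by (auto intro!: derivative_eq_intros DERIV_chain2[OF V(5)] simp: field_simps)
    then show ?thesis unfolding e .
  qed
  have dU: "deriv U r = exp (- (ln r / 2)) * V (ln r / 2) * (1 + tanh (\<theta> (ln r / 2))) / 2" if "r > 0" for r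
    by (rule DERIV_imp_deriv, rule has_field_derivative_transform_within_open[OF dW[OF that], where S = "{0<..}"])
      (use that UW in auto)
  have ddU: "deriv (deriv U) r = - (exp (- (3 * (ln r / 2))) * V (ln r / 2) * (1 - (tanh (\<theta> (ln r / 2)))\<^sup>2) * (1 - m (ln r / 2)) / 4)"
    if "r > 0" for r
  proof -
    have e: "exp (- (ln r / 2)) / r = exp (- (3 * (ln r / 2)))"
    proof -
      have "exp (- (ln r / 2)) = exp (- (3 * (ln r / 2))) * exp (ln r)" by (simp flip: exp_add)
      then show ?thesis using that by simp
    qed
    have "((\<lambda>r. exp (- (ln r / 2)) * V (ln r / 2) * (1 + tanh (\<theta> (ln r / 2))) / 2) has_real_derivative
        - ((exp (- (ln r / 2)) / r) * V (ln r / 2) * (1 - (tanh (\<theta> (ln r / 2)))\<^sup>2) * (1 - m (ln r / 2)) / 4)) (at r)"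
      using that
      by (auto intro!: derivative_eq_intros DERIV_chain2[OF V(5)] DERIV_chain2[OF V(6)] simp: field_simps power2_eq_square)
    then have "(deriv U has_real_derivative
        - ((exp (- (ln r / 2)) / r) * V (ln r / 2) * (1 - (tanh (\<theta> (ln r / 2)))\<^sup>2) * (1 - m (ln r / 2)) / 4)) (at r)"
      by (rule has_field_derivative_transform_within_open[where S = "{0<..}"]) (use that dU in auto)
    then show ?thesis unfolding e by (rule DERIV_imp_deriv)
  qed
  have dlin: "deriv U r = A" if "r < \<delta>" for r
  proof (rule DERIV_imp_deriv)
    have "((\<lambda>r. A * r + B) has_real_derivative A) (at r)" by (auto intro!: derivative_eq_intros)
    then show "(U has_real_derivative A) (at r)"
      by (rule has_field_derivative_transform_within_open[where S = "{..<\<delta>}"]) (use that Ulin in auto)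
  qed
  have ddlin: "deriv (deriv U) r = 0" if "r < \<delta>" for r
  proof (rule DERIV_imp_deriv)
    have "((\<lambda>r. A) has_real_derivative 0) (at r)" by simp
    then show "(deriv U has_real_derivative 0) (at r)"
      by (rule has_field_derivative_transform_within_open[where S = "{..<\<delta>}"]) (use that dlin in auto)
  qed
  have smU: "smooth_on UNIV U"
  proof (rule smooth_on_local)
    fix x :: real
    have "smooth_on {0<..} W" unfolding W_def
      by (intro smooth_on_mult smooth_on_exp smooth_on_divide smooth_on_const smooth_on_compose[OF _ _ _ _ V(1)]
          smooth_on_ln_real) auto
    then have 1: "smooth_on {0<..} U" by (rule smooth_on_cong[rotated 2]) (auto simp: UW)
    have "smooth_on {..<\<delta>} (\<lambda>r. A * r + B)"
      by (intro smooth_on_add smooth_on_mult smooth_on_const smooth_on_ident) auto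
    then have 2: "smooth_on {..<\<delta>} U" by (rule smooth_on_cong[rotated 2]) (auto simp: Ulin)
    show "\<exists>W. open W \<and> x \<in> W \<and> smooth_on W U"
    proof (cases "x > 0")
      case True then show ?thesis using 1 by (intro exI[of _ "{0<..}"]) auto
    next
      case False then show ?thesis using 2 \<delta> by (intro exI[of _ "{..<\<delta>}"]) auto
    qed
  qed
  \<comment> \<open>Up to the factor 4, the tangential curvature is V^2 / cosh(\<theta>)^2 / 4. The
    next computation gives m - 1 times this for r U U'', so m is the ratio of radial to tangential
    curvature.\<close>
  have bval: "deriv U r * (U r - r * deriv U r) = (V (ln r / 2))\<^sup>2 * (1 - (tanh (\<theta> (ln r / 2)))\<^sup>2) / 4" if "r > 0" for r
  proof -
    have e: "r * exp (- (ln r / 2)) = exp (ln r / 2)" "exp (- (ln r / 2)) * exp (ln r / 2) = 1"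
    proof -
      have "exp (ln r) * exp (- (ln r / 2)) = exp (ln r / 2)" by (simp flip: exp_add)
      then show "r * exp (- (ln r / 2)) = exp (ln r / 2)" using that by simp
      show "exp (- (ln r / 2)) * exp (ln r / 2) = 1" by (simp flip: exp_add)
    qed
    have "U r - r * deriv U r = exp (ln r / 2) * V (ln r / 2) - (r * exp (- (ln r / 2))) * V (ln r / 2) * (1 + tanh (\<theta> (ln r / 2))) / 2"
      by (simp add: UW[OF that] dU[OF that] W_def)
    also have "\<dots> = exp (ln r / 2) * V (ln r / 2) * (1 - tanh (\<theta> (ln r / 2))) / 2"
      unfolding e by (simp add: algebra_simps)
    finally have d: "U r - r * deriv U r = exp (ln r / 2) * V (ln r / 2) * (1 - tanh (\<theta> (ln r / 2))) / 2" .
    have "deriv U r * (U r - r * deriv U r) =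
      (exp (- (ln r / 2)) * exp (ln r / 2)) * (V (ln r / 2))\<^sup>2 * (1 - (tanh (\<theta> (ln r / 2)))\<^sup>2) / 4"
      unfolding d unfolding dU[OF that] power2_eq_square by (simp add: algebra_simps)
    then show ?thesis unfolding e by simp
  qed
  have eval: "r * U r * deriv (deriv U) r = - ((V (ln r / 2))\<^sup>2 * (1 - (tanh (\<theta> (ln r / 2)))\<^sup>2) * (1 - m (ln r / 2)) / 4)" if "r > 0" for r
  proof -
    have "exp (ln r) * exp (ln r / 2) * exp (- (3 * (ln r / 2))) = 1" by (simp flip: exp_add)
    then have e: "r * exp (ln r / 2) * exp (- (3 * (ln r / 2))) = 1" using that by simp
    have "r * U r * deriv (deriv U) r = - ((r * exp (ln r / 2) * exp (- (3 * (ln r / 2)))) * ((V (ln r / 2))\<^sup>2 * (1 - (tanh (\<theta> (ln r / 2)))\<^sup>2) * (1 - m (ln r / 2)) / 4))"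
      by (simp add: UW[OF that] ddU[OF that] W_def power2_eq_square)
    then show ?thesis unfolding e by simp
  qed
  have sech: "1 - (tanh s)\<^sup>2 > 0" for s :: real
    using tanh_real_bounds[of s] by (simp add: abs_square_less_1 abs_less_iff)
  show ?thesis
  \<comment> \<open>For t \<ge> a one has e^t C cosh(t - T) = (C e^T / 2) (1 + e^(-2T) r), which
    gives the new constant.\<close>
  proof (rule that[of U "C * exp T / 2" T])
    show "smooth_on UNIV U" by (rule smU)
    show "C * exp T / 2 > 0" "T \<ge> S0" using V(9,10,11) by auto
    show "U r > 0" if "r \<ge> 0" for r
      using that UW[of r] Ulin[of r] AB V(3) \<delta> by (cases "r > 0") (auto simp: W_def)
    show "deriv U r * (U r - r * deriv U r) > 0" if "r \<ge> 0" for r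
    proof (cases "r > 0")
      case True
      have "V (ln r / 2) \<noteq> 0" using V(3)[of "ln r / 2"] by simp
      then show ?thesis unfolding bval[OF True] using sech by simp
    next
      case False
      then have "r < \<delta>" "r = 0" using that \<delta> by auto
      then show ?thesis using dlin[of r] Ulin[of r] AB by simp
    qed
    show "deriv (deriv U) r \<le> 0" if "r \<ge> 0" for r
    proof (cases "r > 0")
      case True
      then show ?thesis unfolding ddU[OF True] using V(3)[of "ln r / 2"] sech[of "\<theta> (ln r / 2)"] V(8)[of "ln r / 2"]
        by (auto intro!: divide_nonneg_nonneg mult_nonneg_nonneg)
    next
      case False
      then show ?thesis using that \<delta> ddlin[of r] by simp
    qed
    show "r * U r * deriv (deriv U) r \<ge> - (1 + \<epsilon>) * (deriv U r * (U r - r * deriv U r))" if "r \<ge> 0" for r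
    proof (cases "r > 0")
      case True
      let ?X = "(V (ln r / 2))\<^sup>2 * (1 - (tanh (\<theta> (ln r / 2)))\<^sup>2) / 4"
      have "?X * (1 - m (ln r / 2)) \<le> ?X * (1 + \<epsilon>)"
        using V(7)[of "ln r / 2"] sech[of "\<theta> (ln r / 2)"] by (intro mult_left_mono) auto
      moreover have "- b * X \<le> - (X * a)" if "X * a \<le> X * b" for X a b :: real
        using that by (simp add: mult.commute)
      ultimately have "- (1 + \<epsilon>) * ?X \<le> - (?X * (1 - m (ln r / 2)))" by blast
      also have "\<dots> = r * U r * deriv (deriv U) r" unfolding eval[OF True] by simp
      finally show ?thesis unfolding bval[OF True] .
    next
      case False
      then have "r = 0" "0 < \<delta>" using that \<delta> by auto
      then show ?thesis using dlin[of 0] Ulin[of 0] AB assms by (simp add: mult_nonpos_nonneg)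
    qed
    show "U (1 / r) = U r / r" if "r > 0" for r
    proof -
      have "exp (- (ln r / 2)) = exp (ln r / 2) / exp (ln r)" by (simp flip: exp_diff)
      then have "exp (- (ln r / 2)) = exp (ln r / 2) / r" using that by simp
      then show ?thesis using that UW[of r] UW[of "1 / r"] V(4)[of "ln r / 2"] by (simp add: W_def ln_div)
    qed
    show "U r = C * exp T / 2 * (1 + exp (- (2 * T)) * r)" if "r \<ge> exp (2 * (T - S0))" for r
    proof -
      have "exp (2 * a) \<le> exp (2 * (T - S0))" using V(11) by simp
      then have "exp (2 * a) \<le> r" using that by linarith
      from high[OF this] show ?thesis by (simp add: mult_ac)
    qed
  qed
qed

section \<open>Conformal maps\<close>

lemma jacobian_apply:
  assumes "(f has_derivative f') (at x)" shows "jacobian f x *v v = f' v"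
  by (simp add: jacobian_mult[OF differentiableI[OF assms]] frechet_derivative_at[OF assms, symmetric])

text \<open>By polarisation it suffices that the derivative scales all lengths equally.\<close>

lemma pullback_conformal:
  fixes f :: "real^'n::finite \<Rightarrow> real^'n"
  assumes "(f has_derivative f') (at x)" "\<And>v. f' v \<bullet> f' v = c * (v \<bullet> v)" "h (f x) = a *\<^sub>R mat 1"
  shows "pullback f h x = (c * a) *\<^sub>R mat 1"
proof (rule matrix_eqI_inner)
  have J: "jacobian f x *v v = f' v" for v
    by (rule jacobian_apply[OF assms(1)])
  have lin: "linear f'" using assms(1) has_derivative_linear by blast
  have pol: "f' X \<bullet> f' Y = c * (X \<bullet> Y)" for X Y
  proof -
    have "f' (X + Y) \<bullet> f' (X + Y) = c * ((X + Y) \<bullet> (X + Y))" by (rule assms(2))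
    then have "f' X \<bullet> f' X + 2 * (f' X \<bullet> f' Y) + f' Y \<bullet> f' Y = c * (X \<bullet> X) + 2 * (c * (X \<bullet> Y)) + c * (Y \<bullet> Y)"
      unfolding linear_add[OF lin] by (simp add: inner_simps inner_commute algebra_simps)
    then show ?thesis by (simp add: assms(2))
  qed
  show "X \<bullet> (pullback f h x *v Y) = X \<bullet> (((c * a) *\<^sub>R mat 1) *v Y)" for X Y
    unfolding inner_pullback J assms(3)
    by (simp add: scaleR_matrix_vector_assoc[symmetric] pol)
qed

lemma jacobian_scaleR: "jacobian (\<lambda>x::real^'n::finite. c *\<^sub>R x) x = c *\<^sub>R mat 1"
proof (rule jacobian_eqI)
  have "((\<lambda>x::real^'n. c *\<^sub>R x) has_derivative (\<lambda>x. c *\<^sub>R x)) (at x)"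
    by (auto intro!: derivative_eq_intros)
  moreover have "(*v) (c *\<^sub>R mat 1) = (\<lambda>x::real^'n. c *\<^sub>R x)"
    by (simp add: fun_eq_iff scaleR_matrix_vector_assoc[symmetric])
  ultimately show "((\<lambda>x::real^'n. c *\<^sub>R x) has_derivative (*v) (c *\<^sub>R mat 1)) (at x)" by simp
qed

lemma mat_scaleR_mult: "B ** (a *\<^sub>R mat 1) = a *\<^sub>R (B :: real^'n^'m)"
  by (simp add: vec_eq_iff matrix_matrix_mult_def mat_def if_distrib[of "\<lambda>t. t * _"]
      if_distrib[of "\<lambda>t. _ * t"] mult.commute cong: if_cong)

lemma pullback_scaleR: "pullback (\<lambda>x. c *\<^sub>R x) h x = c\<^sup>2 *\<^sub>R h (c *\<^sub>R (x :: real^'n::finite))"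
  by (simp add: pullback_def jacobian_scaleR transpose_scalar transpose_mat scaleR_mat_mult mat_scaleR_mult power2_eq_square)

lemma scaleR_differentiable: "(\<lambda>x::real^'n. c *\<^sub>R x) differentiable (at x)"
  by (intro bounded_linear_imp_differentiable bounded_linear_scaleR_right)

lemma pullback_minus: "pullback uminus h x = h (- (x :: real^'n::finite))"
  using pullback_scaleR[of "- 1" h x] by simp

lemma pullback_translate:
  assumes "f differentiable (at (x + a))"
  shows "pullback (\<lambda>x. f (x + a)) h x = pullback f h (x + a :: real^'n::finite)"
proof -
  have d: "((\<lambda>x. x + a) has_derivative (\<lambda>v. v)) (at x)" by (auto intro!: derivative_eq_intros)
  moreover have "(*v) (mat 1) = (\<lambda>v::real^'n. v)" by (simp add: fun_eq_iff)
  ultimately have "jacobian (\<lambda>x. x + a) x = mat 1" by (intro jacobian_eqI) simp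
  then show ?thesis
    using jacobian_compose[of "\<lambda>x. x + a" x f] assms differentiableI[OF d] by (simp add: pullback_def)
qed

lemma inversion_has_derivative:
  fixes x :: "real^'n"
  assumes "x \<noteq> 0"
  shows "(inversion has_derivative (\<lambda>v. (1 / (x \<bullet> x)) *\<^sub>R v - (2 * (x \<bullet> v) / (x \<bullet> x)\<^sup>2) *\<^sub>R x)) (at x)"
proof -
  have "((\<lambda>x::real^'n. (1 / (x \<bullet> x)) *\<^sub>R x) has_derivative (\<lambda>v. (1 / (x \<bullet> x)) *\<^sub>R v - (2 * (x \<bullet> v) / (x \<bullet> x)\<^sup>2) *\<^sub>R x)) (at x)"
    using assms by (auto intro!: derivative_eq_intros simp: inner_commute power2_eq_square divide_simps algebra_simps)
  moreover have "inversion = (\<lambda>x::real^'n. (1 / (x \<bullet> x)) *\<^sub>R x)"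
    by (simp add: inversion_def fun_eq_iff dot_square_norm divide_inverse)
  ultimately show ?thesis by simp
qed

lemma pullback_inversion:
  assumes "x \<noteq> 0" "h (inversion x) = a *\<^sub>R mat 1"
  shows "pullback inversion h x = (a / (x \<bullet> x)\<^sup>2) *\<^sub>R mat 1"
proof -
  have "(1 / (x \<bullet> x)\<^sup>2 * a) *\<^sub>R mat 1 = (a / (x \<bullet> x)\<^sup>2) *\<^sub>R (mat 1 :: real^'a^'a)" by simp
  moreover have "pullback inversion h x = (1 / (x \<bullet> x)\<^sup>2 * a) *\<^sub>R mat 1"
  proof (rule pullback_conformal[where f = inversion and x = x and h = h and a = a, OF inversion_has_derivative[OF assms(1)] _ assms(2)])
    fix v
    have "x \<bullet> x \<noteq> 0" using assms by simp
    then show "((1 / (x \<bullet> x)) *\<^sub>R v - (2 * (x \<bullet> v) / (x \<bullet> x)\<^sup>2) *\<^sub>R x) \<bullet> ((1 / (x \<bullet> x)) *\<^sub>R v - (2 * (x \<bullet> v) / (x \<bullet> x)\<^sup>2) *\<^sub>R x)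
      = 1 / (x \<bullet> x)\<^sup>2 * (v \<bullet> v)"
      by (simp add: inner_diff_left inner_diff_right inner_commute[of v x] power2_eq_square divide_simps)
  qed
  ultimately show ?thesis by simp
qed

lemma smooth_on_inversion: "smooth_on (- {0}) (inversion :: real^'n \<Rightarrow> real^'n)"
proof -
  have "inversion = (\<lambda>x::real^'n. (1 / (x \<bullet> x)) *\<^sub>R x)"
    by (simp add: inversion_def fun_eq_iff dot_square_norm divide_inverse)
  moreover have "smooth_on (- {0}) (\<lambda>x::real^'n. (1 / (x \<bullet> x)) *\<^sub>R x)"
    by (intro smooth_on_scaleR smooth_on_divide smooth_on_inner smooth_on_const smooth_on_ident) auto
  ultimately show ?thesis by simp
qed

subsection \<open>Radial stretching\<close>

text \<open>Keeps directions and acts on the logarithmic radius by t -> t + g(t).\<close>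

definition stretch :: "(real \<Rightarrow> real) \<Rightarrow> real^'n \<Rightarrow> real^'n" where
  "stretch g v = exp (g (ln (norm v))) *\<^sub>R v"

lemma smooth_on_stretch:
  assumes "smooth_on UNIV g" shows "smooth_on (- {0}) (stretch g)"
  unfolding stretch_def
  by (intro smooth_on_scaleR smooth_on_exp smooth_on_compose[OF _ _ _ _ assms] smooth_on_ln_norm smooth_on_ident) auto

lemma det_nonzeroI:
  assumes "\<And>w. jacobian f x *v w = 0 \<Longrightarrow> w = 0" shows "det (jacobian f x) \<noteq> 0"
  using assms matrix_left_invertible_ker[of "jacobian f x"] invertible_det_nz invertible_left_inverse by blast

text \<open>Pairing the kernel equation with w gives |w|^2 plus a multiple of g' (v \<bullet> w)^2,
  which is nonnegative for nondecreasing g; hence w = 0.\<close>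

lemma det_stretch:
  fixes v :: "real^'n::finite"
  assumes "v \<noteq> 0" "\<And>t. (g has_real_derivative g' t) (at t)" "\<And>t. g' t \<ge> 0"
  shows "det (jacobian (stretch g) v) \<noteq> 0"
proof -
  let ?D = "\<lambda>w. exp (g (ln (norm v))) *\<^sub>R w + (exp (g (ln (norm v))) * (g' (ln (norm v)) * ((v \<bullet> w) / (v \<bullet> v)))) *\<^sub>R v"
  have "((\<lambda>v::real^'n. ln (v \<bullet> v) / 2) has_derivative (\<lambda>w. (v \<bullet> w) / (v \<bullet> v))) (at v)"
    using assms(1) by (auto intro!: derivative_eq_intros simp: inner_commute field_simps)
  then have l: "((\<lambda>v::real^'n. ln (norm v)) has_derivative (\<lambda>w. (v \<bullet> w) / (v \<bullet> v))) (at v)"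
    by (rule has_derivative_transform_within_open[where s = "- {0}"])
      (use assms(1) in \<open>simp_all add: dot_square_norm ln_realpow open_Compl\<close>)
  have "((\<lambda>t. exp (g t)) has_derivative (\<lambda>h. exp (g (ln (norm v))) * g' (ln (norm v)) * h)) (at (ln (norm v)))"
    using DERIV_chain2[OF DERIV_exp assms(2)] by (simp add: has_field_derivative_def)
  from diff_chain_at[OF l this]
  have "((\<lambda>v. exp (g (ln (norm v)))) has_derivative (\<lambda>w. exp (g (ln (norm v))) * g' (ln (norm v)) * ((v \<bullet> w) / (v \<bullet> v)))) (at v)"
    by (simp add: o_def)
  from has_derivative_scaleR[OF this has_derivative_ident]
  have d: "(stretch g has_derivative ?D) (at v)"
    by (simp add: stretch_def[abs_def] mult.assoc)
  have J: "jacobian (stretch g) v *v w = ?D w" for w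
    by (rule jacobian_apply[OF d])
  show ?thesis
  proof (rule det_nonzeroI)
    fix w assume "jacobian (stretch g) v *v w = 0"
    then have "?D w = 0" by (simp only: J)
    then have "exp (g (ln (norm v))) *\<^sub>R (w + (g' (ln (norm v)) * ((v \<bullet> w) / (v \<bullet> v))) *\<^sub>R v) = 0"
      by (simp add: scaleR_add_right)
    then have "w + (g' (ln (norm v)) * ((v \<bullet> w) / (v \<bullet> v))) *\<^sub>R v = 0" by simp
    then have "w \<bullet> (w + (g' (ln (norm v)) * ((v \<bullet> w) / (v \<bullet> v))) *\<^sub>R v) = 0" by simp
    then have "w \<bullet> w + g' (ln (norm v)) * ((v \<bullet> w)\<^sup>2 / (v \<bullet> v)) = 0"
      by (simp add: inner_add_right inner_commute power2_eq_square)
    moreover have "g' (ln (norm v)) * ((v \<bullet> w)\<^sup>2 / (v \<bullet> v)) \<ge> 0" using assms(3) by simp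
    ultimately show "w = 0" by (metis add_nonneg_eq_0_iff inner_eq_zero_iff inner_ge_zero)
  qed
qed

lemma stretch_minus: "stretch g (- v) = - stretch g v"
  by (simp add: stretch_def)

lemma stretch_nonzero: "v \<noteq> 0 \<Longrightarrow> stretch g v \<noteq> 0"
  by (simp add: stretch_def)

text \<open>On the logarithmic radius inversion is t -> -t, which commutes with t + g(t) when g is
  odd.\<close>

lemma stretch_inversion:
  assumes "v \<noteq> 0" "\<And>t. g (- t) = - g t"
  shows "stretch g (inversion v) = inversion (stretch g v)"
proof -
  have "ln (norm (inversion v)) = - ln (norm v)" using assms(1) by (simp add: norm_inversion ln_div)
  then show ?thesis using assms
    by (simp add: stretch_def inversion_def power_mult_distrib exp_minus power2_eq_square)
qed

subsection \<open>Moebius isometries of the round sphere\<close>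

text \<open>\<open>moebius k a\<close> is the translation of the sphere of curvature \<open>4k\<close>, in stereographic coordinates,
  that moves \<open>0\<close> to \<open>a\<close>; it is a Euclidean translation for \<open>k = 0\<close>.\<close>

definition moebius_den :: "real \<Rightarrow> real^'n \<Rightarrow> real^'n \<Rightarrow> real" where
  "moebius_den k a y = 1 - 2 * k * (a \<bullet> y) + k\<^sup>2 * (a \<bullet> a) * (y \<bullet> y)"

definition moebius_num :: "real \<Rightarrow> real^'n \<Rightarrow> real^'n \<Rightarrow> real^'n" where
  "moebius_num k a y = (1 - 2 * k * (a \<bullet> y) - k * (y \<bullet> y)) *\<^sub>R a + (1 + k * (a \<bullet> a)) *\<^sub>R y"

definition moebius :: "real \<Rightarrow> real^'n \<Rightarrow> real^'n \<Rightarrow> real^'n" where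
  "moebius k a y = (1 / moebius_den k a y) *\<^sub>R moebius_num k a y"

text \<open>For k > 0 and nonzero c, a round sphere of curvature 4 k / c^2 in stereographic
  coordinates.\<close>

definition round :: "real \<Rightarrow> real \<Rightarrow> real^'n \<Rightarrow> real^'n^'n" where
  "round c k x = (c / (1 + k * (x \<bullet> x)))\<^sup>2 *\<^sub>R mat 1"

lemma inner_combination:
  fixes a y v :: "'a::real_inner"
  shows "(\<alpha> *\<^sub>R a + \<beta> *\<^sub>R y) \<bullet> (\<alpha> *\<^sub>R a + \<beta> *\<^sub>R y) = \<alpha>\<^sup>2 * (a \<bullet> a) + 2 * \<alpha> * \<beta> * (a \<bullet> y) + \<beta>\<^sup>2 * (y \<bullet> y)"
  by (simp add: inner_add_left inner_add_right inner_commute[of y a] power2_eq_square algebra_simps)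

text \<open>The factor (1 + k |a|^2) / \<open>moebius_den k a y\<close> gained here is also the one
  by which the derivative scales lengths, so the two cancel and the round metric is
  preserved.\<close>

lemma moebius_norm:
  assumes "moebius_den k a y \<noteq> 0"
  shows "1 + k * (moebius k a y \<bullet> moebius k a y) = (1 + k * (a \<bullet> a)) * (1 + k * (y \<bullet> y)) / moebius_den k a y"
proof -
  define n s r d where "n = a \<bullet> a" "s = a \<bullet> y" "r = y \<bullet> y" "d = moebius_den k a y"
  note defs = this
  have d: "d = 1 - 2 * k * s + k\<^sup>2 * n * r" by (simp add: defs moebius_den_def)
  have NN: "moebius_num k a y \<bullet> moebius_num k a y =
    (1 - 2 * k * s - k * r)\<^sup>2 * n + 2 * (1 - 2 * k * s - k * r) * (1 + k * n) * s + (1 + k * n)\<^sup>2 * r"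
    unfolding moebius_num_def inner_combination defs ..
  have "d\<^sup>2 + k * (moebius_num k a y \<bullet> moebius_num k a y) = (1 + k * n) * (1 + k * r) * d"
    unfolding d NN by (simp add: power2_eq_square algebra_simps)
  then have "1 + k * ((moebius_num k a y \<bullet> moebius_num k a y) / d\<^sup>2) = (1 + k * n) * (1 + k * r) / d"
    using assms unfolding defs(4)[symmetric] by (simp add: field_simps power2_eq_square)
  then show ?thesis
    by (simp add: moebius_def defs(4)[symmetric] defs(1,3)[symmetric] power2_eq_square)
qed

lemma moebius_has_derivative:
  fixes a y :: "real^'n"
  assumes "moebius_den k a y \<noteq> 0"
  shows "(moebius k a has_derivative
    (\<lambda>v. (1 / (moebius_den k a y)\<^sup>2) *\<^sub>R (moebius_den k a y *\<^sub>R ((- 2 * k * (a \<bullet> v) - 2 * k * (y \<bullet> v)) *\<^sub>R a + (1 + k * (a \<bullet> a)) *\<^sub>R v)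
       - (- 2 * k * (a \<bullet> v) + 2 * k\<^sup>2 * (a \<bullet> a) * (y \<bullet> v)) *\<^sub>R moebius_num k a y))) (at y)"
proof -
  have den: "(moebius_den k a has_derivative (\<lambda>v. - 2 * k * (a \<bullet> v) + 2 * k\<^sup>2 * (a \<bullet> a) * (y \<bullet> v))) (at y)"
    unfolding moebius_den_def[abs_def] by (auto intro!: derivative_eq_intros simp: inner_commute algebra_simps)
  have num: "(moebius_num k a has_derivative (\<lambda>v. (- 2 * k * (a \<bullet> v) - 2 * k * (y \<bullet> v)) *\<^sub>R a + (1 + k * (a \<bullet> a)) *\<^sub>R v)) (at y)"
    unfolding moebius_num_def[abs_def] by (auto intro!: derivative_eq_intros simp: inner_commute algebra_simps)
  have inv: "((\<lambda>y. 1 / moebius_den k a y) has_derivative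
     (\<lambda>v. - (- 2 * k * (a \<bullet> v) + 2 * k\<^sup>2 * (a \<bullet> a) * (y \<bullet> v)) / (moebius_den k a y)\<^sup>2)) (at y)"
    using assms by (auto intro!: derivative_eq_intros den simp: power2_eq_square)
  have D: "((\<lambda>y. (1 / moebius_den k a y) *\<^sub>R moebius_num k a y) has_derivative
    (\<lambda>v. (1 / moebius_den k a y) *\<^sub>R ((- 2 * k * (a \<bullet> v) - 2 * k * (y \<bullet> v)) *\<^sub>R a + (1 + k * (a \<bullet> a)) *\<^sub>R v)
      + (- (- 2 * k * (a \<bullet> v) + 2 * k\<^sup>2 * (a \<bullet> a) * (y \<bullet> v)) / (moebius_den k a y)\<^sup>2) *\<^sub>R moebius_num k a y)) (at y)"
    by (rule has_derivative_scaleR[OF inv num])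
  have gen: "(1 / d) *\<^sub>R p + (- q / d\<^sup>2) *\<^sub>R u = (1 / d\<^sup>2) *\<^sub>R (d *\<^sub>R p - q *\<^sub>R u)" if "d \<noteq> 0" for d q and p u :: "real^'n"
    using that by (simp add: scaleR_diff_right power2_eq_square)
  show ?thesis
    unfolding moebius_def[abs_def] by (rule has_derivative_eq_rhs[OF D], rule ext, rule gen[OF assms])
qed

text \<open>The vector w is the derivative times the square of the denominator. Decomposed along a,
  v and y, its squared length is a polynomial in the six inner products of a, y and v, and the claim
  is a polynomial identity.\<close>

lemma moebius_derivative_norm:
  fixes a y v :: "real^'n" and k :: real
  defines "d \<equiv> moebius_den k a y"
  defines "w \<equiv> d *\<^sub>R ((- 2 * k * (a \<bullet> v) - 2 * k * (y \<bullet> v)) *\<^sub>R a + (1 + k * (a \<bullet> a)) *\<^sub>R v)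
       - (- 2 * k * (a \<bullet> v) + 2 * k\<^sup>2 * (a \<bullet> a) * (y \<bullet> v)) *\<^sub>R moebius_num k a y"
  shows "w \<bullet> w = (1 + k * (a \<bullet> a))\<^sup>2 * d\<^sup>2 * (v \<bullet> v)"
proof -
  define n s r p q c where "n = a \<bullet> a" "s = a \<bullet> y" "r = y \<bullet> y" "p = a \<bullet> v" "q = y \<bullet> v" "c = v \<bullet> v"
  note defs = this
  define A where "A = d * (- 2 * k * p - 2 * k * q) - (- 2 * k * p + 2 * k\<^sup>2 * n * q) * (1 - 2 * k * s - k * r)"
  define B where "B = - (- 2 * k * p + 2 * k\<^sup>2 * n * q)"
  have d: "d = 1 - 2 * k * s + k\<^sup>2 * n * r" by (simp add: defs d_def moebius_den_def)
  have w: "w = A *\<^sub>R a + (1 + k * n) *\<^sub>R (d *\<^sub>R v + B *\<^sub>R y)"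
    unfolding w_def A_def B_def moebius_num_def defs
    by (simp add: algebra_simps)
  let ?u = "d *\<^sub>R v + B *\<^sub>R y"
  have "w \<bullet> w = A\<^sup>2 * n + 2 * A * (1 + k * n) * (a \<bullet> ?u) + (1 + k * n)\<^sup>2 * (?u \<bullet> ?u)"
    unfolding w defs(1) by (rule inner_combination)
  also have "a \<bullet> ?u = d * p + B * s" by (simp add: inner_add_right defs)
  also have "?u \<bullet> ?u = d\<^sup>2 * c + 2 * d * B * q + B\<^sup>2 * r"
    unfolding inner_combination inner_commute[of v y] defs ..
  also have "A\<^sup>2 * n + 2 * A * (1 + k * n) * (d * p + B * s) + (1 + k * n)\<^sup>2 * (d\<^sup>2 * c + 2 * d * B * q + B\<^sup>2 * r)
    = (1 + k * n)\<^sup>2 * d\<^sup>2 * c"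
  proof -
    \<comment> \<open>The coefficient of a also contains the factor 1 + k n that is explicit in the
      other two. After dividing it out, all terms except the one with c cancel.\<close>
    have "A = (1 + k * n) * (- 2 * k * q + 2 * k\<^sup>2 * (2 * s * q - p * r))"
      unfolding A_def d by (simp add: power2_eq_square algebra_simps)
    moreover have "(- 2 * k * q + 2 * k\<^sup>2 * (2 * s * q - p * r))\<^sup>2 * n
      + 2 * (- 2 * k * q + 2 * k\<^sup>2 * (2 * s * q - p * r)) * (d * p + B * s) + (2 * d * B * q + B\<^sup>2 * r) = 0"
      unfolding B_def d by (simp add: power2_eq_square algebra_simps)
    moreover have "(e * z)\<^sup>2 * n + 2 * (e * z) * e * (d * p + B * s) + e\<^sup>2 * (d\<^sup>2 * c + 2 * d * B * q + B\<^sup>2 * r)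
       = e\<^sup>2 * (z\<^sup>2 * n + 2 * z * (d * p + B * s) + (2 * d * B * q + B\<^sup>2 * r)) + e\<^sup>2 * d\<^sup>2 * c" for e z
      by (simp add: power2_eq_square algebra_simps)
    ultimately show ?thesis by simp
  qed
  finally show ?thesis unfolding defs .
qed

lemma pullback_moebius_round:
  assumes "moebius_den k a y \<noteq> 0" "1 + k * (a \<bullet> a) \<noteq> 0"
  shows "pullback (moebius k a) (round c k) y = round c k y"
proof -
  let ?d = "moebius_den k a y"
  have "pullback (moebius k a) (round c k) y =
    ((1 + k * (a \<bullet> a))\<^sup>2 / ?d\<^sup>2 * (c / (1 + k * (moebius k a y \<bullet> moebius k a y)))\<^sup>2) *\<^sub>R mat 1"
  proof (rule pullback_conformal[where f = "moebius k a" and x = y, OF moebius_has_derivative[OF assms(1)]])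
    fix v
    let ?w = "?d *\<^sub>R ((- 2 * k * (a \<bullet> v) - 2 * k * (y \<bullet> v)) *\<^sub>R a + (1 + k * (a \<bullet> a)) *\<^sub>R v)
       - (- 2 * k * (a \<bullet> v) + 2 * k\<^sup>2 * (a \<bullet> a) * (y \<bullet> v)) *\<^sub>R moebius_num k a y"
    have "((1 / ?d\<^sup>2) *\<^sub>R ?w) \<bullet> ((1 / ?d\<^sup>2) *\<^sub>R ?w) = (1 / ?d\<^sup>2)\<^sup>2 * (?w \<bullet> ?w)"
      by (simp only: inner_scaleR_left inner_scaleR_right power2_eq_square mult.assoc)
    also have "\<dots> = (1 / ?d\<^sup>2)\<^sup>2 * ((1 + k * (a \<bullet> a))\<^sup>2 * ?d\<^sup>2 * (v \<bullet> v))" by (simp only: moebius_derivative_norm)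
    also have "\<dots> = (1 + k * (a \<bullet> a))\<^sup>2 / ?d\<^sup>2 * (v \<bullet> v)" using assms(1) by (simp add: field_simps power2_eq_square)
    finally show "((1 / ?d\<^sup>2) *\<^sub>R ?w) \<bullet> ((1 / ?d\<^sup>2) *\<^sub>R ?w) = (1 + k * (a \<bullet> a))\<^sup>2 / ?d\<^sup>2 * (v \<bullet> v)" .
  qed (simp add: round_def)
  moreover have "(1 + k * (a \<bullet> a))\<^sup>2 / ?d\<^sup>2 * (c / (1 + k * (moebius k a y \<bullet> moebius k a y)))\<^sup>2 = (c / (1 + k * (y \<bullet> y)))\<^sup>2"
    unfolding moebius_norm[OF assms(1)] using assms by (simp add: power_divide power_mult_distrib)
  ultimately show ?thesis by (simp add: round_def)
qed

subsection \<open>Moving the centre of the sphere\<close>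

text \<open>The squared radii are 36/100 = (3/5)^2 and 49/100 = (7/10)^2. Both exceed the radius 1/2
  of the discs, which leaves room for overlaps outside them.\<close>

definition bump :: "(real \<Rightarrow> real) \<Rightarrow> real^'n \<Rightarrow> real" where
  "bump st y = 1 - st ((y \<bullet> y - 36 / 100) / (13 / 100))"

text \<open>The Moebius translation to \<open>\<plusminus>a\<close> near \<open>\<plusminus>a\<close> and the identity elsewhere. Pulling back by it turns
  the round metric centred at \<open>0\<close> into the one centred at \<open>\<plusminus>a\<close> near \<open>\<plusminus>a\<close>.\<close>

definition warp :: "(real \<Rightarrow> real) \<Rightarrow> real \<Rightarrow> real^'n \<Rightarrow> real^'n \<Rightarrow> real^'n" where
  "warp st k a x = x + bump st (x - a) *\<^sub>R (moebius k a (x - a) - x)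
     - bump st (- x - a) *\<^sub>R (moebius k a (- x - a) + x)"

lemma warp_minus: "warp st k a (- x) = - warp st k a x"
  by (simp add: warp_def algebra_simps)

lemma bump_eq_1: "(\<And>x. x \<le> 0 \<Longrightarrow> st x = 0) \<Longrightarrow> norm y \<le> 3/5 \<Longrightarrow> bump st y = 1"
  and bump_eq_0: "(\<And>x. x \<ge> 1 \<Longrightarrow> st x = 1) \<Longrightarrow> norm y \<ge> 7/10 \<Longrightarrow> bump st y = 0"
proof -
  assume st: "\<And>x. x \<le> 0 \<Longrightarrow> st x = 0" and y: "norm y \<le> 3/5"
  have "(norm y)\<^sup>2 \<le> (3/5)\<^sup>2" using y by (intro power_mono) auto
  then have "y \<bullet> y \<le> 36 / 100" by (simp add: dot_square_norm power2_eq_square)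
  then show "bump st y = 1" by (simp add: bump_def st)
next
  assume st: "\<And>x. x \<ge> 1 \<Longrightarrow> st x = 1" and y: "norm y \<ge> 7/10"
  have "(7/10)\<^sup>2 \<le> (norm y)\<^sup>2" using y by (intro power_mono) auto
  then have "y \<bullet> y \<ge> 49 / 100" by (simp add: dot_square_norm power2_eq_square)
  then show "bump st y = 0" by (simp add: bump_def st)
qed

lemma moebius_0: "moebius 0 a y = a + y"
  by (simp add: moebius_def moebius_den_def moebius_num_def)

text \<open>At k = 0 the Moebius map takes x - a to x, so \<open>warp\<close> is the identity and
  the three conditions hold strictly on the closed ball of radius 3/4. They are open in (k, x), so
  by compactness some k > 0 serves for the whole ball: the sphere is chosen large compared with the
  discs.\<close>

lemma warp_parameter_exists:
  fixes a :: "real^'n::finite"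
  assumes st: "smooth_on UNIV st" "\<And>x. x \<ge> 1 \<Longrightarrow> st x = 1"
    and a: "norm a \<ge> 3/2" and \<rho>: "\<rho> < norm a - 3/4"
  obtains k where "k > 0" "\<And>x. norm (x - a) \<le> 3/4 \<Longrightarrow> moebius_den k a (x - a) > 0"
    "\<And>x. norm (x - a) \<le> 3/4 \<Longrightarrow> det (jacobian (warp st k a) x) \<noteq> 0"
    "\<And>x. norm (x - a) \<le> 3/4 \<Longrightarrow> norm (warp st k a x) > \<rho>"
proof -
  let ?den = "\<lambda>p::real \<times> (real^'n). moebius_den (fst p) a (snd p - a)"
  \<comment> \<open>\<open>warp\<close> as a function of k and x jointly. The second cut-off is left
    out, since it vanishes within distance 4/5 of a.\<close>
  define H where "H = (\<lambda>p::real \<times> (real^'n). snd p + bump st (snd p - a) *\<^sub>R (moebius (fst p) a (snd p - a) - snd p))"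
  define \<Omega> where "\<Omega> = ?den -` {0<..}"
  have smfs: "smooth_on S (fst :: real \<times> (real^'n) \<Rightarrow> real)" "smooth_on S (snd :: real \<times> (real^'n) \<Rightarrow> real^'n)" if "open S" for S
    using that by (auto intro: smooth_on_linear bounded_linear_fst bounded_linear_snd)
  have smden: "smooth_on S ?den" if "open S" for S
    unfolding moebius_den_def
    by (intro smooth_on_add smooth_on_diff smooth_on_mult smooth_on_inner smooth_on_power smooth_on_const smfs that)
  have o\<Omega>: "open \<Omega>" unfolding \<Omega>_def
    by (rule open_vimage[OF _ smooth_on_continuous[OF smden]]) auto
  have smH: "smooth_on \<Omega> H"
    unfolding H_def moebius_def moebius_num_def bump_def
    by (intro smooth_on_add smooth_on_diff smooth_on_mult smooth_on_inner smooth_on_power smooth_on_const smfs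
        smooth_on_scaleR smooth_on_divide smden o\<Omega> smooth_on_compose[OF _ _ _ _ st(1)] open_UNIV)
      (auto simp: \<Omega>_def)
  define A where "A = (\<lambda>p. (\<chi> i j. frechet_derivative H (at p) (0, axis j 1) $ i) :: real^'n^'n)"
  have smA: "smooth_on \<Omega> A"
    unfolding A_def by (intro smooth_on_vec smooth_on_nth smooth_on_frechet_derivative smH o\<Omega>)
  define S where "S = (\<Omega> \<inter> (\<lambda>p. det (A p)) -` (- {0})) \<inter> (\<Omega> \<inter> (\<lambda>p. norm (H p)) -` {\<rho><..})"
  have oS: "open S" unfolding S_def
    by (intro open_Int continuous_open_preimage[OF smooth_on_continuous[OF smooth_on_det[OF o\<Omega> smA]] o\<Omega>]
        continuous_open_preimage[OF continuous_on_norm[OF smooth_on_continuous[OF smH]] o\<Omega>]) auto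
  have partial: "((\<lambda>x. H (k, x)) has_derivative (\<lambda>v. frechet_derivative H (at (k, x)) (0, v))) (at x)"
    if "(k, x) \<in> \<Omega>" for k x
  proof -
    have "((\<lambda>x. (k, x)) has_derivative (\<lambda>v. (0, v))) (at x)"
      by (intro has_derivative_Pair has_derivative_const has_derivative_ident)
    from diff_chain_at[OF this smooth_onD[OF smH that]] show ?thesis unfolding o_def .
  qed
  have A_mult: "A p *v v = frechet_derivative H (at p) (0, v)" if "p \<in> \<Omega>" for p v
  proof -
    obtain k x where p: "p = (k, x)" by (cases p)
    have lin: "linear (\<lambda>v. frechet_derivative H (at p) (0, v))"
      using partial[of k x] that has_derivative_linear p by blast
    have "A p = matrix (\<lambda>v. frechet_derivative H (at p) (0, v))" by (simp add: A_def matrix_def)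
    then show ?thesis using lin by simp
  qed
  have sub: "{0} \<times> cball a (3/4) \<subseteq> S"
  proof
    fix p :: "real \<times> (real^'n)" assume "p \<in> {0} \<times> cball a (3/4)"
    then obtain x where p: "p = (0, x)" "norm (x - a) \<le> 3/4" by (auto simp: dist_norm norm_minus_commute)
    have in\<Omega>: "p \<in> \<Omega>" by (simp add: \<Omega>_def p moebius_den_def)
    have H0: "H (0, x) = x" for x by (simp add: H_def moebius_0)
    have "A p *v v = v" for v
    proof -
      have "((\<lambda>x::real^'n. x) has_derivative (\<lambda>v. frechet_derivative H (at (0, x)) (0, v))) (at x)"
        using partial[of 0 x] in\<Omega> by (simp add: H0 p)
      from has_derivative_unique[OF this has_derivative_ident] show ?thesis
        using A_mult[OF in\<Omega>, of v] p by metis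
    qed
    then have "A p = mat 1" by (simp add: matrix_eq)
    moreover have "norm (H p) > \<rho>"
      using norm_triangle_ineq2[of a "a - x"] p \<rho> by (simp add: H0 norm_minus_commute)
    ultimately show "p \<in> S" using in\<Omega> by (simp add: S_def)
  qed
  have "compact ({0::real} \<times> cball a (3/4))" by (intro compact_Times) auto
  moreover have "{0::real} \<times> cball a (3/4) \<noteq> {}" by auto
  ultimately obtain e where e: "e > 0" "{p. infdist p ({0} \<times> cball a (3/4)) \<le> e} \<subseteq> S"
    using compact_in_open_separated[OF _ _ oS sub] by blast
  have inS: "(e, x) \<in> S" if "norm (x - a) \<le> 3/4" for x
  proof -
    have "infdist (e, x) ({0} \<times> cball a (3/4)) \<le> dist (e, x) (0, x)"
      using that by (intro infdist_le) (auto simp: dist_norm norm_minus_commute)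
    then show ?thesis using e by (auto simp: dist_Pair_Pair)
  qed
  have warpH: "warp st e a x = H (e, x)" if "x \<in> ball a (4/5)" for x
  proof -
    have "norm (- x - a) \<ge> norm (2 *\<^sub>R a) - norm (x - a)"
      using norm_triangle_ineq2[of "2 *\<^sub>R a" "a - x"] by (simp add: norm_minus_commute scaleR_2 algebra_simps)
    then have "norm (- x - a) \<ge> 7/10" using a that by (simp add: dist_norm norm_minus_commute)
    then show ?thesis using bump_eq_0[where st = st and y = "- x - a", OF st(2)] by (simp add: warp_def H_def)
  qed
  show ?thesis
  proof (rule that[OF e(1)])
    fix x assume x: "norm (x - a) \<le> 3/4"
    have xb: "x \<in> ball a (4/5)" using x by (simp add: dist_norm norm_minus_commute)
    have \<Omega>x: "(e, x) \<in> \<Omega>" using inS[OF x] by (simp add: S_def)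
    then show "moebius_den e a (x - a) > 0" by (simp add: \<Omega>_def)
    show "norm (warp st e a x) > \<rho>" using inS[OF x] by (simp add: S_def warpH[OF xb])
    have "(warp st e a has_derivative (\<lambda>v. frechet_derivative H (at (e, x)) (0, v))) (at x)"
      by (rule has_derivative_transform_within_open[OF partial[OF \<Omega>x] _ xb]) (auto simp: warpH)
    from jacobian_apply[OF this] have "jacobian (warp st e a) x = A (e, x)"
      by (simp add: matrix_eq A_mult[OF \<Omega>x])
    then show "det (jacobian (warp st e a) x) \<noteq> 0" using inS[OF x] by (simp add: S_def)
  qed
qed

section \<open>The invariant metric\<close>

lemma exp_quarter: "exp (1/4 :: real) \<le> 3/2"
  using exp_bound[of "1/4"] by (simp add: power2_eq_square)

text \<open>On the neck side of its equator |z| = e^T the second sphere stays round over the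
  logarithmic width S0. The bound S0 \<ge> pi gives T \<ge> pi, so that the stretching
  \<open>g0\<close> is nondecreasing; the second bound gives roundness for |x| \<ge> 1/4 after
  rescaling; the third one keeps the inner side of the seam in the round part of the first
  sphere.\<close>

locale neck_metric =
  fixes U st q q' :: "real \<Rightarrow> real" and T C S0 k :: real and a :: "real^'n::finite"
  assumes smU: "smooth_on UNIV U" and Upos: "\<And>r. r \<ge> 0 \<Longrightarrow> U r > 0"
    and Uinv: "\<And>r. r > 0 \<Longrightarrow> U (1 / r) = U r / r"
    and Uround: "\<And>r. r \<ge> exp (2 * (T - S0)) \<Longrightarrow> U r = C * (1 + exp (- (2 * T)) * r)"
    and C: "C > 0" and T: "T \<ge> S0" and S0: "S0 \<ge> pi" "exp (- S0) \<le> sqrt k / 4" "sqrt k * norm a * exp 1 \<le> exp S0"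
    and k: "k > 0"
    and st: "smooth_on UNIV st" "\<And>x. x \<le> 0 \<Longrightarrow> st x = 0" "\<And>x. x \<ge> 1 \<Longrightarrow> st x = 1"
    and q: "smooth_on UNIV q" "\<And>x. (q has_real_derivative q' x) (at x)" "\<And>x. q' x \<ge> 0"
      "\<And>x. x \<le> - 1 \<Longrightarrow> q x = - 1" "\<And>x. x \<ge> 1 \<Longrightarrow> q x = 1" "\<And>x. q (- x) = - q x"
    and a: "norm a \<ge> 3/2"
    and den: "\<And>x. norm (x - a) \<le> 3/4 \<Longrightarrow> moebius_den k a (x - a) > 0"
    and detw: "\<And>x. norm (x - a) \<le> 3/4 \<Longrightarrow> det (jacobian (warp st k a) x) \<noteq> 0"
    and bigw: "\<And>x. norm (x - a) \<le> 3/4 \<Longrightarrow> norm (warp st k a x) > norm a * exp (- (5/4))"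
begin

definition hN :: "real^'n \<Rightarrow> real^'n^'n" where
  "hN x = (1 / (U (x \<bullet> x))\<^sup>2) *\<^sub>R mat 1"

sublocale radial_conformal U hN
  by unfold_locales (rule smU, rule Upos, assumption, rule hN_def)

text \<open>Chosen so that 4 e^K1 = \<open>c\<close>, where x -> c x carries the equator |x| =
  k^(-1/2) of the large sphere to |z| = e^T.\<close>

definition "K1 = T + ln k / 2 - ln 4"
definition "g1 s = K1 * q (4 * s)"
text \<open>The step takes place for ln |x| - ln |a| between -13/4 and -5/4, that is between the
  inner seam and the discs. Its height 2 (T - pi) lets ln |z| gain 2 T, the distance between the two
  equators in logarithmic radius, while ln |x| gains 2 pi.\<close>

definition "g0 s = pi + ln k / 2 + (T - pi) * q (s - ln (norm a) + 9/4)"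
definition "c = exp T * sqrt k"
definition "F = warp st k a"
text \<open>\<open>PA\<close> and \<open>PA'\<close> carry coordinates centred at a and -a across
  the neck; \<open>g1\<close> vanishes at 0, so the gluing sphere |x - a| = 1/4 goes to the middle
  |z| = 1. \<open>PB\<close> serves outside the discs.\<close>

definition "PA x = stretch g1 (4 *\<^sub>R (x - a))"
definition "PA' x = stretch g1 (4 *\<^sub>R (x + a))"
definition "PB x = stretch g0 (F x)"

lemma sqrtk: "sqrt k = exp (ln k / 2)"
  using k exp_ln[of "sqrt k"] unfolding ln_sqrt[OF less_imp_le[OF k]] by simp

lemma bump0: "norm y \<ge> 7/10 \<Longrightarrow> bump st (y :: real^'n) = 0" and bump1: "norm y \<le> 3/5 \<Longrightarrow> bump st (y :: real^'n) = 1"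
  using bump_eq_0[where st = st and y = y] bump_eq_1[where st = st and y = y] st(2,3) by blast+

lemma norm_swap: "norm (- x - a) = norm (x + a)"
  by (metis minus_add_distrib norm_minus_cancel uminus_add_conv_diff add.commute)

lemma K1_nonneg: "K1 \<ge> 0"
proof -
  have "exp (- S0) \<le> exp (ln k / 2 - ln 4)" using S0(2) by (simp add: sqrtk exp_diff)
  then show ?thesis using T by (simp add: K1_def)
qed

lemma T_pi: "T \<ge> pi" using T S0(1) by simp

lemma exp_K1: "4 * exp K1 = c"
  by (simp add: K1_def c_def sqrtk exp_diff exp_add)

lemma hN_minus: "hN (- z) = hN z" by (simp add: hN_def)

text \<open>The radius 1/4 corresponds to |z| = e^T sqrt k / 4 \<ge> e^(T - S0), where the model is
  a round sphere.\<close>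

lemma pull_round:
  assumes "norm x \<ge> 1/4" shows "pullback (\<lambda>x. c *\<^sub>R x) hN x = round (c / C) k x"
proof -
  have "(sqrt k / 4)\<^sup>2 \<le> (sqrt k * norm x)\<^sup>2" using assms k by (intro power_mono) auto
  moreover have "(exp (- S0))\<^sup>2 \<le> (sqrt k / 4)\<^sup>2" using S0(2) by (intro power_mono) auto
  moreover have "(sqrt k * norm x)\<^sup>2 = k * (x \<bullet> x)" using k by (simp add: power_mult_distrib dot_square_norm)
  ultimately have kx: "(exp (- S0))\<^sup>2 \<le> k * (x \<bullet> x)" by linarith
  have cc: "(c *\<^sub>R x) \<bullet> (c *\<^sub>R x) = exp (2 * T) * (k * (x \<bullet> x))"
    using k by (simp add: c_def exp_double power2_eq_square)
  have "exp (2 * (T - S0)) = exp (2 * T) * (exp (- S0))\<^sup>2" by (simp flip: exp_add exp_double)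
  also have "\<dots> \<le> exp (2 * T) * (k * (x \<bullet> x))" using kx by (intro mult_left_mono) auto
  finally have "U (exp (2 * T) * (k * (x \<bullet> x))) = C * (1 + exp (- (2 * T)) * (exp (2 * T) * (k * (x \<bullet> x))))"
    by (rule Uround)
  also have "exp (- (2 * T)) * (exp (2 * T) * (k * (x \<bullet> x))) = k * (x \<bullet> x)"
    by (simp add: exp_minus)
  finally have "hN (c *\<^sub>R x) = (1 / (C * (1 + k * (x \<bullet> x)))\<^sup>2) *\<^sub>R mat 1" by (simp only: hN_def cc)
  then show ?thesis by (simp add: pullback_scaleR round_def power_divide power_mult_distrib)
qed

section \<open>The radial stretchings\<close>

lemma g1_odd: "g1 (- s) = - g1 s" by (simp add: g1_def q(6))

lemma smooth_g1: "smooth_on UNIV g1"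
  unfolding g1_def[abs_def]
  by (intro smooth_on_mult smooth_on_const smooth_on_compose[OF _ _ _ _ q(1)] smooth_on_ident) auto

lemma smooth_g0: "smooth_on UNIV g0"
  unfolding g0_def[abs_def]
  by (intro smooth_on_add smooth_on_diff smooth_on_mult smooth_on_const smooth_on_compose[OF _ _ _ _ q(1)] smooth_on_ident) auto

lemma g1_deriv: "(g1 has_real_derivative K1 * (q' (4 * s) * 4)) (at s)"
  unfolding g1_def[abs_def] by (intro DERIV_cmult DERIV_chain2[OF q(2)]) (auto intro!: derivative_eq_intros)

lemma g0_deriv: "(g0 has_real_derivative (T - pi) * q' (s - ln (norm a) + 9/4)) (at s)"
proof -
  have "((\<lambda>s. q (s - ln (norm a) + 9/4)) has_real_derivative q' (s - ln (norm a) + 9/4) * 1) (at s)"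
    by (intro DERIV_chain2[OF q(2)]) (auto intro!: derivative_eq_intros)
  then show ?thesis unfolding g0_def[abs_def]
    by (auto intro!: derivative_eq_intros)
qed

text \<open>The step in \<open>g1\<close> is complete at logarithmic radius 1/4, and e^(1/4) \<le>
  3/2. For v = 4 (x - a) the radius 3/2 means |x - a| = 3/8, which lies inside the disc of radius
  1/2.\<close>

lemma stretch1_far: "norm v \<ge> 3/2 \<Longrightarrow> stretch g1 v = exp K1 *\<^sub>R v"
proof -
  assume v: "norm v \<ge> 3/2"
  have "exp (1/4) \<le> norm v" using exp_quarter v by linarith
  moreover have "norm v > 0" using v by linarith
  then have "norm v = exp (ln (norm v))" by simp
  ultimately have "1/4 \<le> ln (norm v)" by (metis exp_le_cancel_iff)
  then show ?thesis by (simp add: stretch_def g1_def q(5))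
qed

lemma stretch1_near: "norm v \<le> 2/3 \<Longrightarrow> stretch g1 v = exp (- K1) *\<^sub>R v"
proof (cases "v = 0")
  case False
  assume v: "norm v \<le> 2/3"
  have "exp (1/4) * norm v \<le> 3/2 * (2/3)" using exp_quarter v by (intro mult_mono) auto
  then have "norm v \<le> exp (- (1/4))" by (simp add: exp_minus field_simps)
  moreover have "norm v = exp (ln (norm v))" using False by auto
  ultimately have "ln (norm v) \<le> - (1/4)" by (metis exp_le_cancel_iff)
  then show ?thesis by (simp add: stretch_def g1_def q(4))
qed (simp add: stretch_def)

lemma smooth_stretch1: "smooth_on UNIV (stretch g1 :: real^'n \<Rightarrow> real^'n)"
proof (rule smooth_on_local)
  fix x :: "real^'n"
  show "\<exists>W. open W \<and> x \<in> W \<and> smooth_on W (stretch g1 :: real^'n \<Rightarrow> real^'n)"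
  proof (cases "x = 0")
    case True
    have "smooth_on (ball 0 (2/3)) (\<lambda>v::real^'n. exp (- K1) *\<^sub>R v)"
      by (intro smooth_on_linear bounded_linear_scaleR_right) auto
    then have "smooth_on (ball 0 (2/3)) (stretch g1 :: real^'n \<Rightarrow> real^'n)"
      by (rule smooth_on_cong[rotated 2]) (auto simp: stretch1_near)
    then show ?thesis using True by (intro exI[of _ "ball 0 (2/3)"]) auto
  next
    case False
    then show ?thesis using smooth_on_stretch[OF smooth_g1] by (intro exI[of _ "- {0}"]) auto
  qed
qed

lemma det_stretch1: "det (jacobian (stretch g1) (x :: real^'n)) \<noteq> 0"
proof (cases "x = 0")
  case True
  have "jacobian (stretch g1) x = jacobian (\<lambda>v. exp (- K1) *\<^sub>R v) x"
    unfolding jacobian_def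
    by (subst frechet_derivative_cong[of "ball 0 (2/3)" x "stretch g1" "\<lambda>v. exp (- K1) *\<^sub>R v"])
      (auto simp: True stretch1_near)
  then have J: "jacobian (stretch g1) x = exp (- K1) *\<^sub>R mat 1" by (simp add: jacobian_scaleR)
  show ?thesis by (rule det_nonzeroI) (simp add: J scaleR_matrix_vector_assoc[symmetric])
next
  case False
  show ?thesis by (rule det_stretch[OF False g1_deriv]) (use K1_nonneg q(3) in auto)
qed

lemma smooth_PA: "smooth_on UNIV PA" and smooth_PA': "smooth_on UNIV PA'"
proof -
  have "smooth_on UNIV (\<lambda>x::real^'n. 4 *\<^sub>R (x + b))" for b
    by (intro smooth_on_scaleR smooth_on_add smooth_on_const smooth_on_ident) auto
  then have 1: "smooth_on UNIV (\<lambda>x::real^'n. stretch g1 (4 *\<^sub>R (x + b)))" for b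
    by (intro smooth_on_compose[OF _ _ _ _ smooth_stretch1]) auto
  show "smooth_on UNIV PA" "smooth_on UNIV PA'"
    using 1[of "- a"] 1[of a] by (simp_all add: PA_def[abs_def] PA'_def[abs_def])
qed

lemma jacobian_stretch1_comp:
  "jacobian (\<lambda>x::real^'n. stretch g1 (4 *\<^sub>R (x + b))) x = 4 *\<^sub>R jacobian (stretch g1) (4 *\<^sub>R (x + b))"
proof -
  have d: "((\<lambda>x::real^'n. 4 *\<^sub>R (x + b)) has_derivative (\<lambda>v. 4 *\<^sub>R v)) (at x)"
    by (auto intro!: derivative_eq_intros)
  moreover have "(*v) (4 *\<^sub>R mat 1) = (\<lambda>v::real^'n. 4 *\<^sub>R v)"
    by (simp add: fun_eq_iff scaleR_matrix_vector_assoc[symmetric])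
  ultimately have "jacobian (\<lambda>x::real^'n. 4 *\<^sub>R (x + b)) x = 4 *\<^sub>R mat 1" by (intro jacobian_eqI) simp
  then show ?thesis
    using jacobian_compose[OF differentiableI[OF d] smooth_on_differentiable[OF smooth_stretch1 UNIV_I]]
    by (simp add: mat_scaleR_mult)
qed

lemma det_PA: "det (jacobian PA x) \<noteq> 0" and det_PA': "det (jacobian PA' x) \<noteq> 0"
proof -
  have "det (jacobian (\<lambda>x::real^'n. stretch g1 (4 *\<^sub>R (x + b))) x) \<noteq> 0" for b x
  proof (rule det_nonzeroI)
    fix w assume "jacobian (\<lambda>x::real^'n. stretch g1 (4 *\<^sub>R (x + b))) x *v w = 0"
    then have "jacobian (stretch g1) (4 *\<^sub>R (x + b)) *v w = 0"
      by (simp add: jacobian_stretch1_comp scaleR_matrix_vector_assoc[symmetric])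
    then show "w = 0"
      by (metis det_stretch1 matrix_inv_mult(2) matrix_vector_mul_assoc matrix_vector_mul_lid matrix_vector_mult_0_right)
  qed
  from this[of "- a" x] this[of a x] show "det (jacobian PA x) \<noteq> 0" "det (jacobian PA' x) \<noteq> 0"
    by (simp_all add: PA_def[abs_def] PA'_def[abs_def])
qed

lemma PA'_eq: "PA' x = - PA (- x)"
proof -
  have "4 *\<^sub>R (- x - a) = - (4 *\<^sub>R (x + a))" by (simp add: algebra_simps)
  then show ?thesis by (simp only: PA_def PA'_def stretch_minus minus_minus)
qed

lemma F_minus: "F (- x) = - F x" by (simp add: F_def warp_minus)

lemma PB_minus: "PB (- x) = - PB x" by (simp add: PB_def F_minus stretch_minus)

text \<open>The model is invariant under z -> -z, so everything about -a follows from a by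
  reflection.\<close>

lemma pullback_odd:
  fixes f g :: "real^'n \<Rightarrow> real^'n"
  assumes "\<And>x. g x = - f (- x)" "f differentiable (at (- x))"
  shows "pullback g hN x = pullback f hN (- x)"
proof -
  have g: "g = (\<lambda>x. - f (- x))" using assms(1) by auto
  have um: "uminus differentiable (at x)" for x :: "real^'n"
    by (rule differentiableI[OF has_derivative_minus[OF has_derivative_ident]])
  have fm: "(\<lambda>x. f (- x)) differentiable (at x)"
    using differentiable_chain_at[OF um assms(2)] by (simp add: o_def)
  have "pullback g hN x = pullback (\<lambda>x. f (- x)) (pullback uminus hN) x"
    unfolding g by (rule pullback_compose[OF fm um])
  also have "pullback uminus hN = hN" by (simp add: fun_eq_iff pullback_minus hN_minus)
  also have "pullback (\<lambda>x. f (- x)) hN x = pullback uminus (pullback f hN) x"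
    by (rule pullback_compose[OF um assms(2)])
  finally show ?thesis by (simp add: pullback_minus)
qed

lemma norm_minus_far: "norm (x - a) < 4/5 \<Longrightarrow> norm (x + a) > 7/10"
  and norm_plus_far: "norm (x + a) < 4/5 \<Longrightarrow> norm (x - a) > 7/10"
proof -
  have "norm (2 *\<^sub>R a) \<le> norm (x - a) + norm (x + a)"
    using norm_triangle_ineq4[of "x + a" "x - a"] by (simp add: scaleR_2)
  then show "norm (x - a) < 4/5 \<Longrightarrow> norm (x + a) > 7/10" "norm (x + a) < 4/5 \<Longrightarrow> norm (x - a) > 7/10"
    using a by auto
qed

section \<open>The warping map\<close>

lemma F_id: 
  assumes "norm (x - a) \<ge> 7/10" "norm (x + a) \<ge> 7/10" shows "F x = x"
proof -
  show ?thesis using assms bump0[of "x - a"] bump0[of "- x - a"] by (simp add: F_def warp_def norm_swap)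
qed

lemma F_moebius:
  assumes "norm (x - a) \<le> 3/5" shows "F x = moebius k a (x - a)"
proof -
  have "norm (x + a) > 7/10" using norm_minus_far[of x] assms by simp
  then show ?thesis using bump0[of "- x - a"] bump1[of "x - a"] assms
    by (simp add: F_def warp_def norm_swap)
qed

lemma cover3:
  fixes x :: "real^'n"
  obtains "norm (x - a) < 3/4" | "norm (x + a) < 3/4" | "norm (x - a) > 7/10" "norm (x + a) > 7/10"
  by fastforce

lemma open_norm_conditions:
  "open {x :: real^'n. norm (x + b) < r}" "open {x :: real^'n. norm (x + b) > r}"
  by (intro open_Collect_less continuous_intros)+

lemma smooth_F_near: "smooth_on {x. norm (x - a) < 3/4} F"
proof -
  have o: "open {x. norm (x - a) < 3/4}" using open_norm_conditions(1)[of "- a" "3/4"] by simp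
  have "smooth_on {x. norm (x - a) < 3/4} (\<lambda>x. x + bump st (x - a) *\<^sub>R (moebius k a (x - a) - x))"
    unfolding bump_def moebius_def moebius_num_def moebius_den_def
  proof (intro smooth_on_add smooth_on_diff smooth_on_mult smooth_on_inner smooth_on_const smooth_on_ident
      smooth_on_scaleR smooth_on_divide o smooth_on_compose[OF _ _ _ _ st(1)] open_UNIV)
    fix x assume "x \<in> {x. norm (x - a) < 3/4}"
    then show "1 - 2 * k * (a \<bullet> (x - a)) + k\<^sup>2 * (a \<bullet> a) * ((x - a) \<bullet> (x - a)) \<noteq> 0"
      using den[of x] by (simp add: moebius_den_def)
  qed auto
  then show ?thesis
  proof (rule smooth_on_cong[OF o, rotated])
    fix x assume x: "x \<in> {x. norm (x - a) < 3/4}"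
    have "bump st (- x - a) = 0" using norm_minus_far[of x] x bump0[of "- x - a"] by (simp add: norm_swap)
    then show "x + bump st (x - a) *\<^sub>R (moebius k a (x - a) - x) = F x" by (simp add: F_def warp_def)
  qed
qed

lemma smooth_F: "smooth_on UNIV F"
proof (rule smooth_on_local)
  fix x :: "real^'n"
  show "\<exists>W. open W \<and> x \<in> W \<and> smooth_on W F"
  proof (cases rule: cover3[of x])
    case 1
    then show ?thesis using smooth_F_near open_norm_conditions(1)[of "- a" "3/4"]
      by (intro exI[of _ "{x. norm (x - a) < 3/4}"]) simp
  next
    case 2
    let ?W = "{x. norm (x + a) < 3/4}"
    have o: "open ?W" by (rule open_norm_conditions)
    have "smooth_on ?W (\<lambda>x. - F (- x))"
    proof (intro smooth_on_minus o smooth_on_compose[OF o _ _ _ smooth_F_near] smooth_on_ident)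
      show "open {x. norm (x - a) < 3/4}" using open_norm_conditions(1)[of "- a" "3/4"] by simp
      show "uminus ` ?W \<subseteq> {x. norm (x - a) < 3/4}"
        by (auto simp: norm_swap)
    qed
    then have "smooth_on ?W F" by (rule smooth_on_cong[OF o, rotated]) (simp add: F_minus)
    then show ?thesis using 2 o by (intro exI[of _ ?W]) simp
  next
    case 3
    let ?W = "{x. norm (x + (- a)) > 7/10} \<inter> {x. norm (x + a) > 7/10}"
    have o: "open ?W" by (intro open_Int open_norm_conditions)
    have "smooth_on ?W F"
      by (rule smooth_on_cong[OF o _ smooth_on_ident[OF o]]) (simp add: F_id)
    then show ?thesis using 3 o by (intro exI[of _ ?W]) simp
  qed
qed

lemma F_differentiable: "F differentiable (at x)"
  by (rule smooth_on_differentiable[OF smooth_F UNIV_I])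

lemma jacobian_F_minus: "jacobian F (- x) = jacobian F x"
proof -
  have um: "uminus differentiable (at x)" for x :: "real^'n"
    by (rule differentiableI[OF has_derivative_minus[OF has_derivative_ident]])
  have ju: "jacobian uminus x = (- 1) *\<^sub>R mat 1" for x :: "real^'n"
    using jacobian_scaleR[of "- 1" x] by simp
  have neg: "- mat 1 ** A = - A" "A ** (- mat 1) = - A" for A :: "real^'n^'n"
    using scaleR_mat_mult[of "- 1" A] mat_scaleR_mult[of A "- 1"] by simp_all
  have "jacobian (\<lambda>x. - F x) x = - jacobian F x"
    using jacobian_compose[OF F_differentiable um, of x] by (simp add: ju neg)
  moreover have "jacobian (\<lambda>x. F (- x)) x = - jacobian F (- x)"
    using jacobian_compose[OF um F_differentiable, of x] by (simp add: ju neg)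
  ultimately show ?thesis by (simp add: F_minus)
qed

lemma det_F: "det (jacobian F x) \<noteq> 0"
proof (cases rule: cover3[of x])
  case 1 then show ?thesis using detw[of x] by (simp add: F_def)
next
  case 2
  show ?thesis using detw[of "- x"] 2 jacobian_F_minus[of x] by (simp add: F_def norm_swap)
next
  case 3
  let ?W = "{x. norm (x + (- a)) > 7/10} \<inter> {x. norm (x + a) > 7/10}"
  have o: "open ?W" by (intro open_Int open_norm_conditions)
  have "frechet_derivative F (at x) = frechet_derivative (\<lambda>x. x) (at x)"
    by (rule frechet_derivative_cong[OF o]) (use 3 in \<open>auto simp: F_id\<close>)
  then have "jacobian F x = mat 1" by (simp add: jacobian_def matrix_def mat_def axis_def vec_eq_iff)
  then show ?thesis by simp
qed

text \<open>The threshold |a| e^(-5/4), beyond which \<open>stretch g0\<close> is multiplication by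
  \<open>c\<close>, lies in the range |x| \<ge> 1/4 where that multiplication yields a round
  metric.\<close>

lemma quarter_bound: "1/4 \<le> norm a * exp (- (5/4))" "norm a * exp (- (5/4)) \<le> norm a / 2"
proof -
  have "exp (5/4 :: real) = exp 1 * exp (1/4)" by (simp flip: exp_add)
  also have "\<dots> \<le> 3 * (3/2)" using exp_quarter exp_le by (intro mult_mono) auto
  finally have e: "exp (5/4 :: real) \<le> 9/2" by simp
  then have "exp (5/4) * (1/4) \<le> norm a" using a by linarith
  then show "1/4 \<le> norm a * exp (- (5/4))" by (simp add: exp_minus field_simps)
  have "exp (5/4 :: real) \<ge> 2" using exp_ge_add_one_self[of "5/4::real"] by linarith
  then have "norm a * 2 \<le> norm a * exp (5/4)" by (intro mult_left_mono) auto
  then show "norm a * exp (- (5/4)) \<le> norm a / 2" by (simp add: exp_minus field_simps)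
qed

lemma F_nonzero: "x \<noteq> 0 \<Longrightarrow> F x \<noteq> 0"
proof (cases rule: cover3[of x])
  case 1
  then show ?thesis using bigw[of x] quarter_bound(1) by (auto simp: F_def)
next
  case 2
  have "norm (F (- x)) > norm a * exp (- (5/4))" using bigw[of "- x"] 2 by (simp add: F_def norm_swap)
  then show ?thesis using quarter_bound(1) by (auto simp: F_minus)
next
  case 3 then show "x \<noteq> 0 \<Longrightarrow> ?thesis" by (simp add: F_id)
qed

lemma smooth_PB: "smooth_on (- {0}) PB"
  unfolding PB_def[abs_def]
proof (rule smooth_on_compose[OF _ _ _ smooth_on_subset[OF smooth_F] smooth_on_stretch[OF smooth_g0]])
  show "F ` (- {0}) \<subseteq> - {0}" using F_nonzero by (intro image_subsetI) simp
qed auto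

lemma stretch0_differentiable: "y \<noteq> 0 \<Longrightarrow> (stretch g0 :: real^'n \<Rightarrow> real^'n) differentiable (at y)"
  by (rule smooth_on_differentiable[OF smooth_on_stretch[OF smooth_g0]]) simp

lemma det_PB: "x \<noteq> 0 \<Longrightarrow> det (jacobian PB x) \<noteq> 0"
proof -
  assume x: "x \<noteq> 0"
  have "jacobian PB x = jacobian (stretch g0) (F x) ** jacobian F x"
    unfolding PB_def[abs_def] by (rule jacobian_compose[OF F_differentiable stretch0_differentiable[OF F_nonzero[OF x]]])
  moreover have "det (jacobian (stretch g0) (F x)) \<noteq> 0"
    by (rule det_stretch[OF F_nonzero[OF x] g0_deriv]) (use T_pi q(3) in simp)
  ultimately show ?thesis using det_F by (simp add: det_mul)
qed

section \<open>Agreement of the pulled back metrics around the discs\<close>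

lemma stretch0_right:
  assumes "norm x > norm a * exp (- (5/4))" shows "stretch g0 x = c *\<^sub>R x"
proof -
  have a0: "norm a > 0" using a by linarith
  have x0: "norm x > 0" using assms a0 by (smt (verit) exp_gt_zero mult_pos_pos)
  have "norm a * exp (- (5/4)) = exp (ln (norm a) - 5/4)" using exp_add[of "ln (norm a)" "- (5/4)"] a0 by simp
  then have "exp (ln (norm a) - 5/4) < exp (ln (norm x))" using assms x0 by (simp only: exp_ln)
  then have "ln (norm a) - 5/4 < ln (norm x)" by (simp only: exp_less_cancel_iff)
  then have "q (ln (norm x) - ln (norm a) + 9/4) = 1" by (intro q(5)) simp
  then have "g0 (ln (norm x)) = T + ln k / 2" by (simp add: g0_def)
  then show ?thesis by (simp only: stretch_def c_def sqrtk exp_add)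
qed

lemma stretch0_left:
  assumes "x \<noteq> 0" "ln (norm x) < ln (norm a) - 13/4" shows "stretch g0 x = (exp (2 * pi - T) * sqrt k) *\<^sub>R x"
proof -
  have "q (ln (norm x) - ln (norm a) + 9/4) = - 1" using assms by (intro q(4)) simp
  then have "g0 (ln (norm x)) = 2 * pi - T + ln k / 2" by (simp add: g0_def)
  then show ?thesis by (simp only: stretch_def sqrtk exp_add)
qed

lemma pullback_stretch0:
  assumes "norm x > norm a * exp (- (5/4))" shows "pullback (stretch g0) hN x = round (c / C) k x"
proof -
  have "pullback (stretch g0) hN x = pullback (\<lambda>x. c *\<^sub>R x) hN x"
    by (rule pullback_cong_fun[where S = "{x. norm (x + 0) > norm a * exp (- (5/4))}"])
      (use assms stretch0_right open_norm_conditions(2)[of _ 0] in auto)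
  also have "\<dots> = round (c / C) k x" using quarter_bound assms by (intro pull_round) linarith
  finally show ?thesis .
qed

lemma pullback_PA_round:
  assumes "norm (x - a) > 3/8" shows "pullback PA hN x = round (c / C) k (x - a)"
proof -
  have "pullback PA hN x = pullback (\<lambda>x. c *\<^sub>R (x + - a)) hN x"
  proof (rule pullback_cong_fun[where S = "{x. norm (x + - a) > 3/8}"])
    show "open {x. norm (x + - a) > 3/8}" by (rule open_norm_conditions)
    fix y assume "y \<in> {x. norm (x + - a) > 3/8}"
    then have "norm (4 *\<^sub>R (y - a)) \<ge> 3/2" by simp
    from stretch1_far[OF this] show "PA y = c *\<^sub>R (y + - a)"
      by (simp add: PA_def exp_K1[symmetric] mult.commute)
  qed (use assms in simp)
  also have "\<dots> = pullback (\<lambda>x. c *\<^sub>R x) hN (x + - a)"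
    by (rule pullback_translate[OF scaleR_differentiable])
  also have "\<dots> = round (c / C) k (x - a)" using assms pull_round[of "x + - a"] by simp
  finally show ?thesis .
qed

text \<open>Close to a the map \<open>F\<close> is a Moebius translation, an isometry of the round
  metric that moves the centre from 0 to a. The metric made for the centre 0 thus takes around a the
  form that \<open>PA\<close> produces for |x - a| > 3/8, and the two fit together.\<close>

lemma pullback_PB_round:
  assumes "norm (x - a) < 3/5" shows "pullback PB hN x = round (c / C) k (x - a)"
proof -
  have x: "norm (F x) > norm a * exp (- (5/4))" using bigw[of x] assms by (simp add: F_def)
  then have Fx: "F x \<noteq> 0" by (smt (verit) exp_ge_zero mult_nonneg_nonneg norm_ge_zero norm_zero)
  have d: "moebius_den k a (x - a) \<noteq> 0" using den[of x] assms by simp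
  have "pullback PB hN x = pullback F (pullback (stretch g0) hN) x"
    unfolding PB_def[abs_def] by (rule pullback_compose[OF F_differentiable stretch0_differentiable[OF Fx]])
  also have "\<dots> = pullback F (round (c / C) k) x" by (simp add: pullback_def[of F] pullback_stretch0[OF x])
  also have "\<dots> = pullback (\<lambda>x. moebius k a (x + - a)) (round (c / C) k) x"
    by (rule pullback_cong_fun[OF open_norm_conditions(1)[of "- a" "3/5"]]) (use assms F_moebius in auto)
  also have "\<dots> = pullback (moebius k a) (round (c / C) k) (x + - a)"
    by (rule pullback_translate) (use moebius_has_derivative d in \<open>auto intro: differentiableI\<close>)
  also have "\<dots> = round (c / C) k (x - a)"
  proof -
    have "1 + k * (a \<bullet> a) > 0" using k by (simp add: add_pos_nonneg)
    then show ?thesis using pullback_moebius_round[OF d] by simp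
  qed
  finally show ?thesis .
qed

lemma pullback_PA_PB: "3/8 < norm (x - a) \<Longrightarrow> norm (x - a) < 3/5 \<Longrightarrow> pullback PA hN x = pullback PB hN x"
  by (simp add: pullback_PA_round pullback_PB_round)

lemma pullback_PA'_PB:
  assumes "3/8 < norm (x + a)" "norm (x + a) < 3/5" shows "pullback PA' hN x = pullback PB hN x"
proof -
  have x0: "- x \<noteq> 0"
  proof
    assume "- x = 0" then show False using assms a by simp
  qed
  have "pullback PA' hN x = pullback PA hN (- x)"
    by (rule pullback_odd[OF PA'_eq smooth_on_differentiable[OF smooth_PA UNIV_I]])
  also have "\<dots> = pullback PB hN (- x)" using assms norm_swap by (intro pullback_PA_PB) auto
  also have "\<dots> = pullback PB hN x"
    by (rule pullback_odd[symmetric]) (use PB_minus x0 smooth_on_differentiable[OF smooth_PB] in auto)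
  finally show ?thesis .
qed

end

context neck_metric
begin

section \<open>The tensor field invariant under homotheties\<close>

text \<open>Inversion contributes the factor |z|^(-4), which the rule U(1/r) = U(r)/r cancels
  exactly.\<close>

lemma hN_inversion: "z \<noteq> 0 \<Longrightarrow> pullback inversion hN z = hN z"
proof -
  assume z: "z \<noteq> 0"
  then have r: "z \<bullet> z > 0" by simp
  have i: "inversion z \<bullet> inversion z = 1 / (z \<bullet> z)"
    by (simp add: dot_square_norm norm_inversion power_divide)
  have "hN (inversion z) = (1 / (U (z \<bullet> z) / (z \<bullet> z))\<^sup>2) *\<^sub>R mat 1"
    by (simp only: hN_def i Uinv[OF r])
  from pullback_inversion[of z hN, OF z this] show ?thesis using r
    by (simp add: hN_def power_divide)
qed

text \<open>In t = ln |z| the two round parts are given by V proportional to cosh(t + T) and to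
  cosh(t - T) with the same constant, so the homothety by e^(2T) is an isometry from one to the
  other. The hypotheses place z in the first round part and its image in the second.\<close>

lemma hN_seam:
  assumes "exp (- (2 * T) - 2 * S0) \<le> z \<bullet> z" "z \<bullet> z \<le> exp (- (2 * (T - S0)))"
  shows "hN (exp (2 * T) *\<^sub>R z) = (1 / (exp (2 * T))\<^sup>2) *\<^sub>R hN z"
proof -
  define r where "r = z \<bullet> z"
  have r: "r > 0" using assms(1) exp_gt_zero[of "- (2 * T) - 2 * S0"] unfolding r_def by linarith
  have zz: "(exp (2 * T) *\<^sub>R z) \<bullet> (exp (2 * T) *\<^sub>R z) = exp (4 * T) * r"
  proof -
    have "exp (4 * T) = exp (2 * T) * exp (2 * T)" by (simp flip: exp_add)
    then show ?thesis by (simp add: r_def)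
  qed
  have "exp (2 * (T - S0)) = exp (4 * T) * exp (- (2 * T) - 2 * S0)" by (simp flip: exp_add)
  also have "\<dots> \<le> exp (4 * T) * r" using assms(1) by (simp add: r_def)
  finally have 1: "U (exp (4 * T) * r) = C * (1 + exp (- (2 * T)) * (exp (4 * T) * r))" by (rule Uround)
  have "exp (2 * (T - S0)) * r \<le> exp (2 * (T - S0)) * exp (- (2 * (T - S0)))"
    using assms(2) by (intro mult_left_mono) (auto simp: r_def)
  then have "exp (2 * (T - S0)) * r \<le> 1" by (simp flip: exp_add)
  then have "exp (2 * (T - S0)) \<le> 1 / r" using r by (simp add: field_simps)
  from Uround[OF this] have 2: "U r = r * (C * (1 + exp (- (2 * T)) / r))"
    using Uinv[OF r] r by (simp add: field_simps)
  have "exp (- (2 * T)) * exp (4 * T) = exp (2 * T)" "exp (2 * T) * exp (- (2 * T)) = 1"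
    by (simp_all flip: exp_add)
  then have "U (exp (4 * T) * r) = exp (2 * T) * U r"
    unfolding 1 2 using r by (simp add: field_simps)
  then have "hN (exp (2 * T) *\<^sub>R z) = (1 / (exp (2 * T) * U r)\<^sup>2) *\<^sub>R mat 1" by (simp only: hN_def zz)
  then show ?thesis by (simp add: hN_def power_mult_distrib flip: r_def)
qed

definition "G0 x = (if norm (x - a) < 1/2 then pullback PA hN x
  else if norm (x + a) < 1/2 then pullback PA' hN x else pullback PB hN x)"
text \<open>The integer m for which e^(-2 pi m) x lies in the fundamental domain 1 - 2 pi \<le> ln
  |x| - ln |a| < 1.\<close>

definition period :: "real^'n \<Rightarrow> int" where
  "period x = \<lfloor>(ln (norm x) - ln (norm a) - 1) / (2 * pi)\<rfloor> + 1"
definition "rescale x = exp (- (2 * pi * of_int (period x)))"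
text \<open>Extends \<open>G0\<close> from the fundamental domain to punctured space by
  homotheties.\<close>

definition "G x = (rescale x)\<^sup>2 *\<^sub>R G0 (rescale x *\<^sub>R x)"
text \<open>An open set that exceeds the fundamental domain by 1/2 in logarithmic radius at its
  inner end, so that smoothness across the seam can be seen inside it.\<close>

definition "shell = {x :: real^'n. norm (x + 0) > norm a * exp (1/2 - 2 * pi)} \<inter> {x. norm (x + 0) < norm a * exp 1}"

lemma norm_a_pos: "norm a > 0" using a by linarith

lemma open_shell: "open shell"
  unfolding shell_def by (intro open_Int open_norm_conditions)

lemma shell_iff: "x \<in> shell \<longleftrightarrow> x \<noteq> 0 \<and> 1/2 - 2 * pi < ln (norm x) - ln (norm a) \<and> ln (norm x) - ln (norm a) < 1"
proof (cases "x = 0")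
  case True
  have "norm a * exp (1/2 - 2 * pi) > 0" using norm_a_pos by simp
  then show ?thesis using True by (simp add: shell_def)
next
  case False
  have e: "norm a * exp t = exp (ln (norm a) + t)" for t using norm_a_pos by (simp add: exp_add)
  have x: "norm x = exp (ln (norm x))" using False by simp
  have "norm x > norm a * exp t \<longleftrightarrow> ln (norm x) > ln (norm a) + t" for t unfolding e by (subst x) (rule exp_less_cancel_iff)
  moreover have "norm x < norm a * exp t \<longleftrightarrow> ln (norm x) < ln (norm a) + t" for t unfolding e by (subst x) (rule exp_less_cancel_iff)
  ultimately show ?thesis using False by (auto simp: shell_def)
qed

lemma period_scale: "x \<noteq> 0 \<Longrightarrow> period (exp (2 * pi * of_int m) *\<^sub>R x) = period x + m"
proof -
  assume x: "x \<noteq> 0"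
  have "(ln (norm (exp (2 * pi * of_int m) *\<^sub>R x)) - ln (norm a) - 1) / (2 * pi)
      = (ln (norm x) - ln (norm a) - 1) / (2 * pi) + of_int m"
    using x by (simp add: ln_mult field_simps)
  then show ?thesis by (simp add: period_def)
qed

lemma G_homothety: "x \<noteq> 0 \<Longrightarrow> G x = pullback (\<lambda>x. exp (2 * pi * of_int m) *\<^sub>R x) G x"
proof -
  assume x: "x \<noteq> 0"
  have r: "rescale (exp (2 * pi * of_int m) *\<^sub>R x) * exp (2 * pi * of_int m) = rescale x"
    unfolding rescale_def period_scale[OF x] exp_add[symmetric] by (simp add: algebra_simps)
  define e where "e = exp (2 * pi * of_int m)"
  have r: "rescale (e *\<^sub>R x) * e = rescale x" using r by (simp only: e_def)
  have "e\<^sup>2 *\<^sub>R G (e *\<^sub>R x) = (rescale (e *\<^sub>R x) * e)\<^sup>2 *\<^sub>R G0 ((rescale (e *\<^sub>R x) * e) *\<^sub>R x)"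
    by (simp add: G_def power_mult_distrib mult.commute)
  then have "e\<^sup>2 *\<^sub>R G (e *\<^sub>R x) = G x" unfolding r by (simp only: G_def)
  then show ?thesis unfolding pullback_scaleR e_def by (rule sym)
qed

lemma period_eq:
  assumes "2 * pi * (of_int m - 1) \<le> ln (norm x) - ln (norm a) - 1" "ln (norm x) - ln (norm a) - 1 < 2 * pi * of_int m"
  shows "period x = m"
proof -
  have "of_int (m - 1) \<le> (ln (norm x) - ln (norm a) - 1) / (2 * pi)"
    "(ln (norm x) - ln (norm a) - 1) / (2 * pi) < of_int (m - 1) + 1"
    using assms by (simp_all add: pos_le_divide_eq pos_divide_less_eq mult.commute)
  then have "\<lfloor>(ln (norm x) - ln (norm a) - 1) / (2 * pi)\<rfloor> = m - 1" unfolding floor_eq_iff by simp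
  then show ?thesis by (simp add: period_def)
qed

lemma exp_small: "exp (1 - 2 * pi) \<le> 1/2"
proof -
  have "exp (1 - 2 * pi) \<le> exp (- 1)" using pi_gt3 by simp
  also have "\<dots> \<le> 1/2" using exp_ge_add_one_self[of "1::real"] by (simp add: exp_minus field_simps)
  finally show ?thesis .
qed

text \<open>On both sides of the seam the radius differs from |a| by at least 3/4, as e^(1 - 2 pi)
  \<le> 1/2 and e^(1/2) \<ge> 3/2. There the warping map is the identity.\<close>

lemma far:
  assumes "norm x \<le> norm a * exp (1 - 2 * pi) \<or> norm x \<ge> norm a * exp (1/2)"
  shows "norm (x - a) > 7/10" "norm (x + a) > 7/10"
proof -
  have "norm a * exp (1 - 2 * pi) \<le> norm a * (1/2)" by (intro mult_left_mono exp_small) auto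
  moreover have "norm a * exp (1/2) \<ge> norm a * (3/2)"
    using exp_ge_add_one_self[of "1/2::real"] by (intro mult_left_mono) auto
  ultimately have "\<bar>norm x - norm a\<bar> \<ge> 3/4" using a assms by auto
  then show "norm (x - a) > 7/10" "norm (x + a) > 7/10"
    using norm_triangle_ineq3[of x a] norm_triangle_ineq3[of x "- a"] by auto
qed

lemma near: "norm (x - a) < 1/2 \<Longrightarrow> x \<in> shell" "norm (x + a) < 1/2 \<Longrightarrow> x \<in> shell"
proof -
  have "exp (1/2 - 2 * pi) \<le> exp (1 - 2 * pi)" by simp
  then have "exp (1/2 - 2 * pi) \<le> 1/2" using exp_small by linarith
  then have "norm a * exp (1/2 - 2 * pi) \<le> norm a * (1/2)" by (intro mult_left_mono) auto
  moreover have "norm a * exp 1 \<ge> norm a * 2"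
    using exp_ge_add_one_self[of "1::real"] by (intro mult_left_mono) auto
  ultimately show "norm (x - a) < 1/2 \<Longrightarrow> x \<in> shell" "norm (x + a) < 1/2 \<Longrightarrow> x \<in> shell"
    using norm_triangle_ineq3[of x a] norm_triangle_ineq3[of x "- a"] a by (auto simp: shell_def)
qed

lemma PB_right: assumes "norm x > norm a * exp (1/2)" shows "pullback PB hN x = c\<^sup>2 *\<^sub>R hN (c *\<^sub>R x)"
proof -
  have "norm a * exp (- (5/4)) \<le> norm a * exp (1/2)" by (intro mult_left_mono) auto
  then have "PB y = c *\<^sub>R y" if "norm y > norm a * exp (1/2)" for y
    using that F_id[of y] far[of y] stretch0_right[of y] by (simp add: PB_def)
  then have "pullback PB hN x = pullback (\<lambda>x. c *\<^sub>R x) hN x"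
    using assms open_norm_conditions(2)[of _ 0] by (intro pullback_cong_fun[where S = "{x. norm (x + 0) > norm a * exp (1/2)}"]) auto
  then show ?thesis by (simp add: pullback_scaleR)
qed

lemma PB_left:
  fixes x defines "c' \<equiv> exp (2 * pi - T) * sqrt k"
  assumes "x \<noteq> 0" "norm x < norm a * exp (1 - 2 * pi)" shows "pullback PB hN x = c'\<^sup>2 *\<^sub>R hN (c' *\<^sub>R x)"
proof -
  have "PB y = c' *\<^sub>R y" if "y \<noteq> 0" "norm y < norm a * exp (1 - 2 * pi)" for y
  proof -
    have "norm a * exp (1 - 2 * pi) = exp (ln (norm a) + (1 - 2 * pi))" using norm_a_pos by (simp only: exp_add exp_ln)
    then have "exp (ln (norm y)) < exp (ln (norm a) + (1 - 2 * pi))" using that by simp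
    then have "ln (norm y) < ln (norm a) + (1 - 2 * pi)" by (simp only: exp_less_cancel_iff)
    then have "ln (norm y) < ln (norm a) - 13/4" using pi_gt3 by linarith
    then show ?thesis using that F_id[of y] far[of y] stretch0_left[of y] by (simp add: PB_def c'_def)
  qed
  moreover have "open ({x. norm (x + 0) < norm a * exp (1 - 2 * pi)} - {0 :: real^'n})"
    by (intro open_Diff open_norm_conditions closed_singleton)
  ultimately have "pullback PB hN x = pullback (\<lambda>x. c' *\<^sub>R x) hN x"
    using assms by (intro pullback_cong_fun[where S = "{x. norm (x + 0) < norm a * exp (1 - 2 * pi)} - {0}"]) auto
  then show ?thesis by (simp add: pullback_scaleR)
qed

text \<open>Only the extra collar needs an argument: there \<open>G\<close> is read off from e^(2
  pi) x at the outer end. At both ends the metric is a scaled copy of the model, once from the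
  second and once from the first sphere, and the seam isometry identifies them.\<close>

lemma G_shell:
  assumes x: "x \<in> shell" shows "G x = G0 x"
proof (cases "ln (norm x) - ln (norm a) \<ge> 1 - 2 * pi")
  case True
  then have "period x = 0" using x by (intro period_eq) (auto simp: shell_iff)
  then show ?thesis by (simp add: G_def rescale_def)
next
  case False
  define l where "l = exp (2 * pi)"
  define c' where "c' = exp (2 * pi - T) * sqrt k"
  have exps: "exp (2 * pi - T) * exp (1/2 - 2 * pi) = exp (- T) * exp (1/2)"
    "exp (2 * pi - T) * exp (1 - 2 * pi) = exp (- T) * exp 1" "exp T * exp (2 * pi) = exp (2 * T) * exp (2 * pi - T)"
    by (simp_all flip: exp_add)
  have sq: "(exp A * exp B)\<^sup>2 = exp (2 * A + 2 * B)" for A B :: real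
    by (simp add: exp_add power_mult_distrib exp_double)
  \<comment> \<open>Both sides are e^(T + 2 pi) sqrt k; the inner value of \<open>g0\<close> is
    chosen for this.\<close>
  have lc: "l * c = exp (2 * T) * c'" unfolding c_def c'_def l_def using exps(3) by algebra
  have x0: "x \<noteq> 0" and s: "1/2 - 2 * pi < ln (norm x) - ln (norm a)" using x by (auto simp: shell_iff)
  have e: "norm a * exp t = exp (ln (norm a) + t)" for t using norm_a_pos by (simp add: exp_add)
  have ex: "norm x = exp (ln (norm x))" using x0 by simp
  have nx: "norm x < norm a * exp (1 - 2 * pi)" "norm x > norm a * exp (1/2 - 2 * pi)"
    using False s unfolding e by (subst ex, simp)+
  have "norm (l *\<^sub>R x) = l * norm x" by (simp add: l_def)
  also have "l * norm x > l * (norm a * exp (1/2 - 2 * pi))" using nx(2) by (simp add: l_def)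
  also have "l * (norm a * exp (1/2 - 2 * pi)) = norm a * exp (1/2)" 
    by (simp add: l_def mult.left_commute[of "exp _" "norm a"] flip: exp_add)
  finally have nl: "norm (l *\<^sub>R x) > norm a * exp (1/2)" .
  have "period x = - 1" using False s pi_gt3 by (intro period_eq) auto
  then have "G x = l\<^sup>2 *\<^sub>R G0 (l *\<^sub>R x)" by (simp add: G_def rescale_def l_def)
  also have "G0 (l *\<^sub>R x) = pullback PB hN (l *\<^sub>R x)" using far[of "l *\<^sub>R x"] nl by (simp add: G0_def)
  also have "\<dots> = c\<^sup>2 *\<^sub>R hN (c *\<^sub>R l *\<^sub>R x)" by (rule PB_right[OF nl])
  also have "c *\<^sub>R l *\<^sub>R x = exp (2 * T) *\<^sub>R (c' *\<^sub>R x)"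
  proof -
    have "c * l = exp (2 * T) * c'" using lc by (simp only: mult.commute)
    then show ?thesis by (simp only: scaleR_scaleR)
  qed
  also have "hN (exp (2 * T) *\<^sub>R (c' *\<^sub>R x)) = (1 / (exp (2 * T))\<^sup>2) *\<^sub>R hN (c' *\<^sub>R x)"
  proof (rule hN_seam)
    have c': "c' > 0" using k by (simp add: c'_def)
    have zz: "(c' *\<^sub>R x) \<bullet> (c' *\<^sub>R x) = (c' * norm x)\<^sup>2" by (simp add: dot_square_norm power_mult_distrib power2_eq_square)
    have "c' * norm x \<ge> c' * (norm a * exp (1/2 - 2 * pi))" using nx c' by (intro mult_left_mono) auto
    also have "c' * (norm a * exp (1/2 - 2 * pi)) = exp (- T) * (sqrt k * (norm a * exp (1/2)))"
      unfolding c'_def using exps(1) by algebra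
    also have "sqrt k * (norm a * exp (1/2)) \<ge> sqrt k / 4"
    proof -
      have "norm a * exp (1/2) \<ge> norm a * 1" by (intro mult_left_mono) auto
      then have "norm a * exp (1/2) \<ge> 1/4" using a by linarith
      then show ?thesis using k mult_left_mono[of "1/4" "norm a * exp (1/2)" "sqrt k"] by simp
    qed
    then have "exp (- T) * (sqrt k * (norm a * exp (1/2))) \<ge> exp (- T) * exp (- S0)" using S0(2) by (intro mult_left_mono) auto
    finally have "(exp (- T) * exp (- S0))\<^sup>2 \<le> (c' * norm x)\<^sup>2" by (intro power_mono) auto
    then show "exp (- (2 * T) - 2 * S0) \<le> (c' *\<^sub>R x) \<bullet> (c' *\<^sub>R x)"
      unfolding zz sq by simp
    have "c' * norm x \<le> c' * (norm a * exp (1 - 2 * pi))" using nx c' by (intro mult_left_mono) auto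
    also have "c' * (norm a * exp (1 - 2 * pi)) = exp (- T) * (sqrt k * norm a * exp 1)"
      unfolding c'_def using exps(2) by algebra
    also have "\<dots> \<le> exp (- T) * exp S0" using S0(3) by (intro mult_left_mono) auto
    finally have "(c' * norm x)\<^sup>2 \<le> (exp (- T) * exp S0)\<^sup>2" using c' by (intro power_mono) auto
    then show "(c' *\<^sub>R x) \<bullet> (c' *\<^sub>R x) \<le> exp (- (2 * (T - S0)))"
      unfolding zz sq by (simp add: algebra_simps)
  qed
  also have "l\<^sup>2 *\<^sub>R c\<^sup>2 *\<^sub>R (1 / (exp (2 * T))\<^sup>2) *\<^sub>R hN (c' *\<^sub>R x) = c'\<^sup>2 *\<^sub>R hN (c' *\<^sub>R x)"
  proof -
    from lc have "(l * c)\<^sup>2 = (exp (2 * T) * c')\<^sup>2" by simp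
    then have "l\<^sup>2 * (c\<^sup>2 * (1 / (exp (2 * T))\<^sup>2)) = c'\<^sup>2" by (simp add: power_mult_distrib)
    then show ?thesis by (simp only: scaleR_scaleR)
  qed
  also have "\<dots> = pullback PB hN x" unfolding c'_def by (rule PB_left[symmetric, OF x0 nx(1)])
  also have "\<dots> = G0 x" using far[of x] nx by (simp add: G0_def)
  finally show ?thesis .
qed

lemma G_near: "norm (x - a) < 1/2 \<Longrightarrow> G x = pullback PA hN x" "norm (x + a) < 1/2 \<Longrightarrow> G x = pullback PA' hN x"
  using norm_plus_far[of x] by (auto simp: G_shell near G0_def)

lemma G_between:
  assumes "x \<in> shell" "norm (x - a) > 3/8" "norm (x + a) > 3/8" shows "G x = pullback PB hN x"
  using assms pullback_PA_PB[of x] pullback_PA'_PB[of x] by (auto simp: G_shell G0_def)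

section \<open>Local diffeomorphisms to the model\<close>

text \<open>A local diffeomorphism to the model that pulls \<open>hN\<close> back to
  \<open>G\<close>. Smoothness, positivity, curvature and conformal flatness of \<open>G\<close> are
  all read off from such maps.\<close>

definition "flat_chart W \<Phi> \<longleftrightarrow> open W \<and> 0 \<notin> W \<and> smooth_on W \<Phi> \<and>
  (\<forall>y\<in>W. det (jacobian \<Phi> y) \<noteq> 0 \<and> G y = pullback \<Phi> hN y)"

lemma flat_chart_shell:
  assumes x: "x \<in> shell" shows "\<exists>W \<Phi>. x \<in> W \<and> flat_chart W \<Phi>"
proof -
  have 0: "0 \<notin> shell" by (simp add: shell_iff)
  consider "norm (x - a) < 1/2" | "norm (x + a) < 1/2" | "norm (x - a) > 3/8" "norm (x + a) > 3/8" by linarith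
  then show ?thesis
  proof cases
    case 1
    have "open {x. norm (x - a) < 1/2}" using open_norm_conditions(1)[of "- a" "1/2"] by simp
    moreover have "0 \<notin> {x. norm (x - a) < 1/2}" using a by simp
    ultimately have "flat_chart {x. norm (x - a) < 1/2} PA"
      using G_near(1) det_PA smooth_on_subset[OF smooth_PA subset_UNIV] by (simp add: flat_chart_def)
    then show ?thesis using 1 by (intro exI[of _ "{x. norm (x - a) < 1/2}"] exI[of _ PA]) simp
  next
    case 2
    have "0 \<notin> {x. norm (x + a) < 1/2}" using a by simp
    then have "flat_chart {x. norm (x + a) < 1/2} PA'"
      using G_near(2) det_PA' smooth_on_subset[OF smooth_PA' subset_UNIV] open_norm_conditions(1)[of a "1/2"]
      by (simp add: flat_chart_def)
    then show ?thesis using 2 by (intro exI[of _ "{x. norm (x + a) < 1/2}"] exI[of _ PA']) simp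
  next
    case 3
    let ?W = "shell \<inter> ({x. norm (x + - a) > 3/8} \<inter> {x. norm (x + a) > 3/8})"
    have o: "open ?W" by (intro open_Int open_norm_conditions open_shell)
    have "flat_chart ?W PB"
      unfolding flat_chart_def
    proof (intro conjI ballI o)
      show "0 \<notin> ?W" using 0 by simp
      show "smooth_on ?W PB" by (rule smooth_on_subset[OF smooth_PB]) (use 0 in auto)
      fix y assume "y \<in> ?W"
      then show "det (jacobian PB y) \<noteq> 0" "G y = pullback PB hN y"
        using det_PB[of y] G_between[of y] 0 by auto
    qed
    then show ?thesis using 3 x by (intro exI[of _ ?W] exI[of _ PB]) simp
  qed
qed

text \<open>The homothety that moves x into the shell preserves \<open>G\<close>, so it can be
  composed with a map found there.\<close>

lemma flat_chart_exists:
  assumes x: "x \<noteq> 0" obtains W \<Phi> where "x \<in> W" "flat_chart W \<Phi>"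
proof -
  define l where "l = rescale x"
  have l: "l > 0" by (simp add: l_def rescale_def)
  have l': "l = exp (2 * pi * of_int (- period x))" by (simp add: l_def rescale_def)
  have per: "period (l *\<^sub>R x) = 0" unfolding l' period_scale[OF x] by simp
  have "l *\<^sub>R x \<in> shell"
  proof -
    have f: "\<lfloor>(ln (norm (l *\<^sub>R x)) - ln (norm a) - 1) / (2 * pi)\<rfloor> = - 1" using per by (simp add: period_def)
    then have "- 1 \<le> (ln (norm (l *\<^sub>R x)) - ln (norm a) - 1) / (2 * pi)" "(ln (norm (l *\<^sub>R x)) - ln (norm a) - 1) / (2 * pi) < 0"
      unfolding floor_eq_iff by auto
    then have "- (2 * pi) \<le> ln (norm (l *\<^sub>R x)) - ln (norm a) - 1" "ln (norm (l *\<^sub>R x)) - ln (norm a) - 1 < 0"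
      using pi_gt_zero by (simp_all add: pos_le_divide_eq pos_divide_less_eq)
    then show ?thesis using x l unfolding shell_iff by simp
  qed
  then obtain W \<Phi> where W: "l *\<^sub>R x \<in> W" "flat_chart W \<Phi>" using flat_chart_shell by metis
  let ?s = "\<lambda>y::real^'n. l *\<^sub>R y"
  let ?W = "?s -` W"
  have oW: "open W" "0 \<notin> W" "smooth_on W \<Phi>" using W(2) by (auto simp: flat_chart_def)
  have o: "open ?W" by (intro open_vimage oW continuous_intros)
  have sms: "smooth_on ?W ?s" by (intro smooth_on_linear o bounded_linear_scaleR_right)
  have "flat_chart ?W (\<lambda>y. \<Phi> (?s y))"
    unfolding flat_chart_def
  proof (intro conjI ballI o)
    show "0 \<notin> ?W" using oW by simp
    show "smooth_on ?W (\<lambda>y. \<Phi> (?s y))" by (rule smooth_on_compose[OF o oW(1) _ sms oW(3)]) auto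
    fix y assume y: "y \<in> ?W"
    then have y': "l *\<^sub>R y \<in> W" by simp
    then have y0: "y \<noteq> 0" using oW by auto
    have d: "\<Phi> differentiable (at (l *\<^sub>R y))" by (rule smooth_on_differentiable[OF oW(3) y'])
    have D: "det (jacobian \<Phi> (l *\<^sub>R y)) \<noteq> 0" "G (l *\<^sub>R y) = pullback \<Phi> hN (l *\<^sub>R y)"
      using W(2) y' by (auto simp: flat_chart_def)
    have "det (jacobian ?s y) \<noteq> 0"
      by (rule det_nonzeroI) (use l in \<open>simp add: jacobian_scaleR scaleR_matrix_vector_assoc[symmetric]\<close>)
    then show "det (jacobian (\<lambda>y. \<Phi> (?s y)) y) \<noteq> 0"
      using D jacobian_compose[OF scaleR_differentiable d] by (simp add: det_mul)
    have "G y = pullback ?s G y" unfolding l' by (rule G_homothety[OF y0])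
    also have "\<dots> = pullback ?s (pullback \<Phi> hN) y" using D by (simp add: pullback_def[of ?s])
    also have "\<dots> = pullback (\<lambda>y. \<Phi> (?s y)) hN y" by (rule pullback_compose[OF scaleR_differentiable d, symmetric])
    finally show "G y = pullback (\<lambda>y. \<Phi> (?s y)) hN y" .
  qed
  then show ?thesis using that[of ?W] W(1) by simp
qed

end

context neck_metric
begin

section \<open>Gluing isometries and properties of the metric\<close>

text \<open>In the stretched coordinates around the two centres the gluing map is the inversion of
  the model, because \<open>g1\<close> is odd; and inversion preserves \<open>hN\<close>. The
  centres are -b and -b', so one statement covers both directions.\<close>

lemma gamma_isometry:
  fixes b b' :: "real^'n"
  assumes G: "\<And>x. norm (x + b) < 1/2 \<Longrightarrow> G x = pullback (\<lambda>x. stretch g1 (4 *\<^sub>R (x + b))) hN x"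
    "\<And>x. norm (x + b') < 1/2 \<Longrightarrow> G x = pullback (\<lambda>x. stretch g1 (4 *\<^sub>R (x + b'))) hN x"
  shows "local_isometry G ((\<lambda>v. - b + v /\<^sub>R 4) ` annulus) (\<lambda>x. - b' + inversion (4 *\<^sub>R (x + b)) /\<^sub>R 4)"
proof -
  let ?f = "\<lambda>x::real^'n. 4 *\<^sub>R (x + b)" and ?P = "\<lambda>b x::real^'n. stretch g1 (4 *\<^sub>R (x + b))"
  let ?\<gamma> = "\<lambda>x. - b' + inversion (?f x) /\<^sub>R 4"
  define W where "W = ?f -` annulus"
  have eq: "(\<lambda>v. - b + v /\<^sub>R 4) ` annulus = W"
  proof (intro set_eqI iffI)
    fix x assume "x \<in> W"
    then have "?f x \<in> annulus" "x = - b + ?f x /\<^sub>R 4" by (simp_all add: W_def)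
    then show "x \<in> (\<lambda>v. - b + v /\<^sub>R 4) ` annulus" by (rule rev_image_eqI)
  qed (auto simp: W_def)
  have oW: "open W" unfolding W_def by (intro open_vimage open_annulus continuous_intros)
  have smf: "smooth_on W ?f" by (intro smooth_on_scaleR smooth_on_add smooth_on_const smooth_on_ident oW)
  have smi: "smooth_on W (\<lambda>x. inversion (?f x))"
    by (rule smooth_on_compose[OF oW _ _ smf smooth_on_inversion]) (auto simp: W_def dest: annulus_nonzero)
  have sm: "smooth_on W ?\<gamma>"
    by (intro smooth_on_add smooth_on_scaleR smooth_on_const smi oW)
  have smP: "smooth_on UNIV (?P b)" for b
    by (rule smooth_on_compose[OF _ _ _ _ smooth_stretch1])
      (auto intro!: smooth_on_scaleR smooth_on_add smooth_on_const smooth_on_ident)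
  have iso: "G x = pullback ?\<gamma> G x" if x: "x \<in> W" for x
  proof -
    have an: "?f x \<in> annulus" using x by (simp add: W_def)
    have "norm (?f x) < 2" using an by (simp add: annulus_def del: norm_scaleR)
    then have n: "norm (x + b) < 1/2" by simp
    have "inversion (?f x) \<in> annulus" using an by (simp only: inversion_annulus)
    then have "norm (inversion (?f x)) < 2" by (simp add: annulus_def)
    then have n': "norm (?\<gamma> x + b') < 1/2" by simp
    have P0: "?P b x \<noteq> 0" by (rule stretch_nonzero[OF annulus_nonzero[OF an]])
    have "pullback ?\<gamma> G x = pullback ?\<gamma> (pullback (?P b') hN) x" using G(2)[OF n'] by (simp only: pullback_def[of ?\<gamma>])
    also have "\<dots> = pullback (\<lambda>x. ?P b' (?\<gamma> x)) hN x"
      by (rule pullback_compose[OF smooth_on_differentiable[OF sm x] smooth_on_differentiable[OF smP UNIV_I], symmetric])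
    also have "\<dots> = pullback (\<lambda>x. inversion (?P b x)) hN x"
    proof (rule pullback_cong_fun[OF oW x])
      fix y assume "y \<in> W"
      then have y: "?f y \<noteq> 0" by (intro annulus_nonzero) (simp add: W_def)
      have "4 *\<^sub>R (?\<gamma> y + b') = inversion (?f y)" by simp
      then have "?P b' (?\<gamma> y) = stretch g1 (inversion (?f y))" by (simp only:)
      also have "\<dots> = inversion (?P b y)" by (rule stretch_inversion[where g = g1, OF y g1_odd])
      finally show "?P b' (?\<gamma> y) = inversion (?P b y)" .
    qed
    also have "\<dots> = pullback (?P b) (pullback inversion hN) x"
      by (rule pullback_compose[OF smooth_on_differentiable[OF smP UNIV_I] smooth_on_differentiable[OF smooth_on_inversion]])
        (use P0 in simp)
    also have "\<dots> = pullback (?P b) hN x" using hN_inversion[OF P0] by (simp only: pullback_def[of "?P b"])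
    also have "\<dots> = G x" by (rule G(1)[OF n, symmetric])
    finally show ?thesis by (rule sym)
  qed
  show ?thesis unfolding local_isometry_def eq using oW sm iso by blast
qed

lemma gamma_isometries:
  "local_isometry G ((\<lambda>v. a + v /\<^sub>R 4) ` annulus) (\<lambda>x. - a + inversion (4 *\<^sub>R (x - a)) /\<^sub>R 4)"
  "local_isometry G ((\<lambda>v. - a + v /\<^sub>R 4) ` annulus) (\<lambda>x. a + inversion (4 *\<^sub>R (x + a)) /\<^sub>R 4)"
  using gamma_isometry[of "- a" a] gamma_isometry[of a "- a"] G_near
  by (simp_all add: PA_def[abs_def] PA'_def[abs_def])

lemma flat_chart_pullback_metric: "flat_chart W \<Phi> \<Longrightarrow> pullback_metric W UNIV \<Phi> hN G"
  by unfold_locales (auto simp: flat_chart_def metric_h)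

lemma smooth_G: "smooth_on (- {0}) G"
proof (rule smooth_on_local)
  fix x :: "real^'n" assume "x \<in> - {0}"
  then obtain W \<Phi> where W: "x \<in> W" "flat_chart W \<Phi>" using flat_chart_exists[of x] by auto
  then have "metric_on W G" using pullback_metric.mh[OF flat_chart_pullback_metric] by metis
  then show "\<exists>W. open W \<and> x \<in> W \<and> smooth_on W G" using W(1) by (auto simp: metric_on_def)
qed

lemma pos_def_G: "x \<noteq> 0 \<Longrightarrow> pos_def (G x)"
proof -
  assume "x \<noteq> 0"
  then obtain W \<Phi> where W: "x \<in> W" "flat_chart W \<Phi>" by (rule flat_chart_exists)
  then have mG: "metric_on W G" using pullback_metric.mh[OF flat_chart_pullback_metric] by metis
  have G: "G x = pullback \<Phi> hN x" and D: "det (jacobian \<Phi> x) \<noteq> 0" using W by (auto simp: flat_chart_def)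
  have "v \<bullet> (G x *v v) > 0" if "v \<noteq> 0" for v
  proof -
    have "jacobian \<Phi> x *v v \<noteq> 0"
      using that D by (metis matrix_inv_mult(2) matrix_vector_mul_assoc matrix_vector_mul_lid matrix_vector_mult_0_right)
    moreover have "v \<bullet> (G x *v v) = (1 / (U (\<Phi> x \<bullet> \<Phi> x))\<^sup>2) * ((jacobian \<Phi> x *v v) \<bullet> (jacobian \<Phi> x *v v))"
      unfolding G inner_pullback hN_def by (simp add: scaleR_matrix_vector_assoc[symmetric])
    moreover have "U (\<Phi> x \<bullet> \<Phi> x) > 0" by (intro Upos) simp
    ultimately show ?thesis by simp
  qed
  then show ?thesis using metric_onD(3)[OF mG W(1)] by (simp add: pos_def_def)
qed

lemma pos_def_ein_G:
  assumes "x \<noteq> 0" "\<And>y. pos_def (scal hN y *\<^sub>R hN y - \<kappa> *\<^sub>R ricci hN y)"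
  shows "pos_def (scal G x *\<^sub>R G x - \<kappa> *\<^sub>R ricci G x)"
proof -
  obtain W \<Phi> where W: "x \<in> W" "flat_chart W \<Phi>" using assms(1) by (rule flat_chart_exists)
  show ?thesis by (rule pullback_metric.pos_def_ein_pullback[OF flat_chart_pullback_metric[OF W(2)] W(1) assms(2)])
qed

lemma scal_G:
  assumes "x \<noteq> 0" "\<And>y. scal hN y > 0" shows "scal G x > 0"
proof -
  obtain W \<Phi> where W: "x \<in> W" "flat_chart W \<Phi>" using assms(1) by (rule flat_chart_exists)
  show ?thesis using pullback_metric.scal_pullback[OF flat_chart_pullback_metric[OF W(2)] W(1)] assms(2) by simp
qed

text \<open>The model has conformal factor e^(2f) with f = - ln U(|z|^2), so any local
  diffeomorphism to it serves, shrunk until it is injective with smooth inverse.\<close>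

lemma conformally_flat_G:
  assumes x: "x \<noteq> 0" and S: "open S" "x \<in> S"
  shows "\<exists>W (F :: real^'n \<Rightarrow> real^'n) (f :: real^'n \<Rightarrow> real). open W \<and> x \<in> W \<and> W \<subseteq> S \<and>
    inj_on F W \<and> open (F ` W) \<and> smooth_on W F \<and> smooth_on (F ` W) (inv_into W F) \<and> smooth_on W f \<and>
    (\<forall>y\<in>W. G y = exp (2 * f y) *\<^sub>R (transpose (jacobian F y) ** jacobian F y))"
proof -
  obtain V \<Phi> where V: "x \<in> V" "flat_chart V \<Phi>" using x by (rule flat_chart_exists)
  have oVS: "open (V \<inter> S)" using V S by (auto simp: flat_chart_def)
  have smV: "smooth_on V \<Phi>" using V(2) by (simp add: flat_chart_def)
  have sm: "smooth_on (V \<inter> S) \<Phi>" by (rule smooth_on_subset[OF smV]) simp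
  have D: "det (jacobian \<Phi> x) \<noteq> 0" using V by (simp add: flat_chart_def)
  have "x \<in> V \<inter> S" using V(1) S(2) by simp
  from smooth_inverse_function[OF oVS sm this D] obtain W where W: "open W" "x \<in> W" "W \<subseteq> V \<inter> S" "inj_on \<Phi> W" "open (\<Phi> ` W)" "smooth_on (\<Phi> ` W) (inv_into W \<Phi>)"
    by (elim exE conjE)
  define f where "f = (\<lambda>y. - ln (U (\<Phi> y \<bullet> \<Phi> y)))"
  have smW: "smooth_on W \<Phi>" by (rule smooth_on_subset[OF sm W(3)])
  have "smooth_on W (\<lambda>y. U (\<Phi> y \<bullet> \<Phi> y))"
    by (rule smooth_on_compose[OF W(1) open_UNIV _ smooth_on_inner[OF W(1) smW smW] smU]) simp
  then have smf: "smooth_on W f"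
    unfolding f_def by (intro smooth_on_minus smooth_on_ln W(1) Upos) auto
  have "G y = exp (2 * f y) *\<^sub>R (transpose (jacobian \<Phi> y) ** jacobian \<Phi> y)" if y: "y \<in> W" for y
  proof -
    have u: "U (\<Phi> y \<bullet> \<Phi> y) > 0" by (intro Upos) simp
    have "exp (2 * f y) = (exp (f y))\<^sup>2" by (rule exp_double)
    also have "\<dots> = 1 / (U (\<Phi> y \<bullet> \<Phi> y))\<^sup>2" using u by (simp add: f_def exp_minus power_inverse divide_inverse)
    finally have e: "exp (2 * f y) = 1 / (U (\<Phi> y \<bullet> \<Phi> y))\<^sup>2" .
    have "G y = pullback \<Phi> hN y" using V(2) y W(3) by (auto simp: flat_chart_def)
    also have "\<dots> = exp (2 * f y) *\<^sub>R (transpose (jacobian \<Phi> y) ** jacobian \<Phi> y)"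
      unfolding e pullback_def hN_def mat_scaleR_mult by (simp only: scalar_matrix_assoc)
    finally show ?thesis .
  qed
  then show ?thesis using W smW smf by (intro exI[of _ W] exI[of _ \<Phi>] exI[of _ f]) auto
qed

end

section \<open>Choice of the parameters and conclusion\<close>

text \<open>A finite set of values k is treated at once, so one metric serves for both extremal
  quantities. The choices are not circular: \<epsilon> depends on K, the sphere parameter k on a
  alone (with a fixed step function), S0 on k and a, and finally U, T, C on \<epsilon> and
  S0.\<close>

theorem invariant_metric_exists:
  fixes K :: "real set"
  assumes n: "CARD('n::finite) \<ge> 3" and K: "finite K" "\<And>k. k \<in> K \<Longrightarrow> k < real CARD('n) - 1"
  obtains G :: "real^'n \<Rightarrow> real^'n^'n" where
    "\<And>m. isom_manifold G (csum_upto m :: (_, 'n) manifold)" "smooth_on (- {0}) G"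
    "\<And>x. x \<noteq> 0 \<Longrightarrow> pos_def (G x)" "\<And>x. x \<noteq> 0 \<Longrightarrow> scal G x > 0"
    "\<And>x k. x \<noteq> 0 \<Longrightarrow> k \<in> K \<Longrightarrow> pos_def (scal G x *\<^sub>R G x - k *\<^sub>R ricci G x)"
    "\<And>x S. x \<noteq> 0 \<Longrightarrow> open S \<Longrightarrow> x \<in> S \<Longrightarrow> \<exists>W (F :: real^'n \<Rightarrow> real^'n) (f :: real^'n \<Rightarrow> real). open W \<and> x \<in> W \<and> W \<subseteq> S \<and>
      inj_on F W \<and> open (F ` W) \<and> smooth_on W F \<and> smooth_on (F ` W) (inv_into W F) \<and> smooth_on W f \<and>
      (\<forall>y\<in>W. G y = exp (2 * f y) *\<^sub>R (transpose (jacobian F y) ** jacobian F y))"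
proof -
  let ?n = "real CARD('n)" and ?a = "vec 1 :: real^'n"
  have n3: "?n \<ge> 3" using n by simp
  \<comment> \<open>At \<epsilon> = 0 the inequalities are strict because k < n - 1 and n > 2, and
    finitely many of them persist for small \<epsilon>. The value 0 is added for the scalar
    curvature.\<close>
  have "\<exists>\<epsilon>>0. \<epsilon> < 1 \<and> (\<forall>k\<in>insert 0 K. \<epsilon> * (2 * ?n - 2 - k) < (?n - 2) * (?n - 1 - k) \<and> \<epsilon> * (2 - k) < ?n - 2)"
  proof -
    have small: "eventually (\<lambda>\<epsilon>::real. \<epsilon> * A < B) (at_right 0)" if "B > 0" for A B
    proof -
      have "((\<lambda>\<epsilon>. \<epsilon> * A) \<longlongrightarrow> 0 * A) (at_right (0::real))" by (intro tendsto_intros)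
      then show ?thesis using that by (intro order_tendstoD(2)[of _ "0 * A"]) auto
    qed
    have "eventually (\<lambda>\<epsilon>. \<epsilon> * (2 * ?n - 2 - k) < (?n - 2) * (?n - 1 - k) \<and> \<epsilon> * (2 - k) < ?n - 2) (at_right (0::real))"
      if "k \<in> insert 0 K" for k
    proof (intro eventually_conj small)
      have "?n - 1 - k > 0" using that K(2)[of k] n3 by auto
      then show "(?n - 2) * (?n - 1 - k) > 0" using n3 by (intro mult_pos_pos) auto
    qed (use n3 in simp)
    then have "eventually (\<lambda>\<epsilon>. \<forall>k\<in>insert 0 K. \<epsilon> * (2 * ?n - 2 - k) < (?n - 2) * (?n - 1 - k) \<and> \<epsilon> * (2 - k) < ?n - 2) (at_right (0::real))"
      using K(1) by (intro eventually_ball_finite) auto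
    moreover have "eventually (\<lambda>\<epsilon>::real. \<epsilon> > 0 \<and> \<epsilon> < 1) (at_right 0)"
      unfolding eventually_at_right_field by (intro exI[of _ 1]) auto
    ultimately have "eventually (\<lambda>\<epsilon>. (\<forall>k\<in>insert 0 K. \<epsilon> * (2 * ?n - 2 - k) < (?n - 2) * (?n - 1 - k) \<and> \<epsilon> * (2 - k) < ?n - 2)
      \<and> \<epsilon> > 0 \<and> \<epsilon> < 1) (at_right (0::real))"
      by (rule eventually_conj)
    from eventually_happens[OF this] show ?thesis by auto
  qed
  then obtain \<epsilon> where \<epsilon>: "\<epsilon> > 0" "\<epsilon> < 1"
    and \<epsilon>k: "\<And>k. k \<in> insert 0 K \<Longrightarrow> \<epsilon> * (2 * ?n - 2 - k) < (?n - 2) * (?n - 1 - k) \<and> \<epsilon> * (2 - k) < ?n - 2" by metis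
  have "(3/2)\<^sup>2 \<le> ?n" using n3 by (simp add: power2_eq_square)
  then have a: "norm ?a \<ge> 3/2" unfolding norm_vec_1 by (rule real_le_rsqrt)
  obtain st st' :: "real \<Rightarrow> real" where st: "smooth_on UNIV st" "\<And>x. (st has_real_derivative st' x) (at x)"
    "\<And>x. st' x \<ge> 0" "\<And>x. x \<le> 0 \<Longrightarrow> st x = 0" "\<And>x. x \<ge> 1 \<Longrightarrow> st x = 1" "\<And>x. 0 \<le> st x" "\<And>x. st x \<le> 1"
    "\<And>x. st (1 - x) = 1 - st x" by (rule smooth_step_exists, rule that, assumption+)
  obtain q q' :: "real \<Rightarrow> real" where q: "smooth_on UNIV q" "\<And>x. (q has_real_derivative q' x) (at x)"
    "\<And>x. q' x \<ge> 0" "\<And>x. x \<le> - 1 \<Longrightarrow> q x = - 1" "\<And>x. x \<ge> 1 \<Longrightarrow> q x = 1" "\<And>x. q (- x) = - q x"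
    by (rule odd_step_exists, rule that, assumption+)
  have \<rho>: "norm ?a * exp (- (5/4)) < norm ?a - 3/4"
  proof -
    have "exp (5/4 :: real) > 2" using exp_ge_add_one_self[of "5/4::real"] by linarith
    then have "exp (- (5/4)) < (1/2 :: real)" by (simp add: exp_minus field_simps)
    then have "norm ?a * exp (- (5/4)) < norm ?a * (1/2)" using a by (intro mult_strict_left_mono) auto
    then show ?thesis using a by linarith
  qed
  obtain k where k: "k > 0" "\<And>x. norm (x - ?a) \<le> 3/4 \<Longrightarrow> moebius_den k ?a (x - ?a) > 0"
    "\<And>x. norm (x - ?a) \<le> 3/4 \<Longrightarrow> det (jacobian (warp st k ?a) x) \<noteq> 0"
    "\<And>x. norm (x - ?a) \<le> 3/4 \<Longrightarrow> norm (warp st k ?a x) > norm ?a * exp (- (5/4))"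
    by (rule warp_parameter_exists[OF st(1) st(5) a \<rho>], assumption, rule that, assumption+)
  \<comment> \<open>The three entries correspond to the three bounds on \<open>S0\<close> in
    \<open>neck_metric\<close>.\<close>
  define S0 where "S0 = Max {pi, - ln (sqrt k / 4), ln (sqrt k * norm ?a * exp 1)}"
  have S0: "S0 \<ge> pi" "S0 \<ge> - ln (sqrt k / 4)" "S0 \<ge> ln (sqrt k * norm ?a * exp 1)" by (simp_all add: S0_def)
  have pos: "sqrt k / 4 > 0" "sqrt k * norm ?a * exp 1 > 0"
  proof -
    have "norm ?a > 0" using a by linarith
    then show "sqrt k / 4 > 0" "sqrt k * norm ?a * exp 1 > 0" using k(1) by (auto intro!: mult_pos_pos)
  qed
  have S0': "exp (- S0) \<le> sqrt k / 4" "sqrt k * norm ?a * exp 1 \<le> exp S0"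
  proof -
    have "exp (- S0) \<le> exp (ln (sqrt k / 4))" using S0(2) by simp
    then show "exp (- S0) \<le> sqrt k / 4" by (simp only: exp_ln[OF pos(1)])
    have "exp (ln (sqrt k * norm ?a * exp 1)) \<le> exp S0" using S0(3) by (simp only: exp_le_cancel_iff)
    then show "sqrt k * norm ?a * exp 1 \<le> exp S0" by (simp only: exp_ln[OF pos(2)])
  qed
  have S00: "S0 \<ge> 0" using S0(1) pi_gt_zero by linarith
  obtain U T C where U: "smooth_on UNIV U" "C > 0" "T \<ge> S0"
    "\<And>r. r \<ge> 0 \<Longrightarrow> U r > 0"
    "\<And>r. r \<ge> 0 \<Longrightarrow> deriv U r * (U r - r * deriv U r) > 0"
    "\<And>r. r \<ge> 0 \<Longrightarrow> deriv (deriv U) r \<le> 0"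
    "\<And>r. r \<ge> 0 \<Longrightarrow> r * U r * deriv (deriv U) r \<ge> - (1 + \<epsilon>) * (deriv U r * (U r - r * deriv U r))"
    "\<And>r. r > 0 \<Longrightarrow> U (1 / r) = U r / r"
    "\<And>r. r \<ge> exp (2 * (T - S0)) \<Longrightarrow> U r = C * (1 + exp (- (2 * T)) * r)"
    by (rule profile_exists[OF \<epsilon> S00], rule that, assumption+)
  interpret neck_metric U st q q' T C S0 k ?a
    by (unfold_locales; (rule U st q k a S0 S0'; assumption?))
  have ein: "pos_def (scal hN y *\<^sub>R hN y - k *\<^sub>R ricci hN y)" if "k \<in> insert 0 K" for k y
  proof (rule pos_def_ein)
    show "k < ?n - 1" using that K(2) n3 by auto
  qed (use \<epsilon> \<epsilon>k[OF that] n3 U(5-7) in auto)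
  have sc: "scal hN y > 0" for y
    by (rule scal_pos) (use \<epsilon> \<epsilon>k[of 0] n3 U(5-7) in auto)
  show ?thesis
  proof (rule that)
    show "isom_manifold G (csum_upto m :: (_, 'n) manifold)" for m
      by (rule isom_manifold_csum_upto[OF n G_homothety gamma_isometries(1) _ gamma_isometries(2)]) simp_all
    show "smooth_on (- {0}) G" by (rule smooth_G)
    show "pos_def (G x)" if "x \<noteq> 0" for x by (rule pos_def_G[OF that])
    show "scal G x > 0" if "x \<noteq> 0" for x by (rule scal_G[OF that sc])
    show "pos_def (scal G x *\<^sub>R G x - k *\<^sub>R ricci G x)" if "x \<noteq> 0" "k \<in> K" for x k
      by (rule pos_def_ein_G[OF that(1) ein]) (use that(2) in simp)
  qed (rule conformally_flat_G)
qed

theorem corollaryC: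
  fixes p :: nat and k1 k2 :: real
  assumes "CARD('n::finite) \<ge> 3" and "p \<ge> 1"
    and "0 \<le> k1" and "k1 < real CARD('n) - 1" and "k2 \<le> 0"
  shows "\<exists>(g1 :: (nat \<times> complex \<times> (real^'n), 'n) tensor2)
             (g2 :: (nat \<times> complex \<times> (real^'n), 'n) tensor2).
           riemannian_metric (csum_S1xS p) g1 \<and> locally_conformally_flat (csum_S1xS p) g1 \<and>
           Ein_sup (csum_S1xS p) g1 > k1 \<and>
           riemannian_metric (csum_S1xS p) g2 \<and> locally_conformally_flat (csum_S1xS p) g2 \<and>
           ein_inf (csum_S1xS p) g2 < ereal k2"
proof -
  let ?n = "real CARD('n)"
  \<comment> \<open>Strictly between k1 and n - 1, so that a supremum which is at least K1 exceeds
    k1; the choice of K2 below k2 plays the same role for the infimum.\<close>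
  define K1 where "K1 = (k1 + (?n - 1)) / 2"
  define K2 where "K2 = k2 - 1"
  have n3: "?n \<ge> 3" using assms(1) by simp
  have K1: "k1 < K1" "K1 < ?n - 1" using assms(4) by (simp_all add: K1_def)
  have K2: "K2 < k2" "K2 < ?n - 1" using assms(5) n3 by (simp_all add: K2_def)
  have fin: "finite {K1, K2}" by simp
  have less: "k < ?n - 1" if "k \<in> {K1, K2}" for k using that K1 K2 by auto
  obtain G :: "real^'n \<Rightarrow> real^'n^'n" where G:
    "\<And>m. isom_manifold G (csum_upto m :: (_, 'n) manifold)" "smooth_on (- {0}) G"
    "\<And>x. x \<noteq> 0 \<Longrightarrow> pos_def (G x)" "\<And>x. x \<noteq> 0 \<Longrightarrow> scal G x > 0"
    "\<And>x k. x \<noteq> 0 \<Longrightarrow> k \<in> {K1, K2} \<Longrightarrow> pos_def (scal G x *\<^sub>R G x - k *\<^sub>R ricci G x)"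
    "\<And>x S. x \<noteq> 0 \<Longrightarrow> open S \<Longrightarrow> x \<in> S \<Longrightarrow> \<exists>W (F :: real^'n \<Rightarrow> real^'n) (f :: real^'n \<Rightarrow> real). open W \<and> x \<in> W \<and> W \<subseteq> S \<and>
      inj_on F W \<and> open (F ` W) \<and> smooth_on W F \<and> smooth_on (F ` W) (inv_into W F) \<and> smooth_on W f \<and>
      (\<forall>y\<in>W. G y = exp (2 * f y) *\<^sub>R (transpose (jacobian F y) ** jacobian F y))"
    by (rule invariant_metric_exists[OF assms(1) fin less], assumption, rule that, assumption+)
  let ?M = "csum_S1xS p :: (nat \<times> complex \<times> (real^'n), 'n) manifold"
  define g where "g = (\<lambda>c :: (nat \<times> complex \<times> (real^'n), 'n) chart. G)"
  have M: "isom_manifold G ?M" unfolding csum_S1xS_def by (rule G(1))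
  have x0: "x \<noteq> 0" if "c \<in> atlas ?M" "x \<in> snd c ` fst c" for c x
    using isom_manifoldD(7)[OF M] that by metis
  have rm: "riemannian_metric ?M g" unfolding g_def by (rule isom_manifold_riemannian_metric[OF M G(2,3)])
  have op: "open (snd c ` fst c)" if "c \<in> atlas ?M" for c
    using rm that by (fastforce simp: riemannian_metric_def closed_connected_manifold_def is_chart_def split: prod.splits)
  have lcf: "locally_conformally_flat ?M g"
    unfolding locally_conformally_flat_def g_def by (intro ballI G(6) op x0)
  have sc: "pos_scal ?M g" unfolding pos_scal_def g_def by (intro ballI G(4) x0)
  have ein: "pos_tensor ?M (Ein_tensor k g)" if "k \<in> {K1, K2}" for k
    unfolding pos_tensor_def Ein_tensor_def g_def by (intro ballI G(5) x0 that)
  \<comment> \<open>Membership of K1 needs 0 < K1, which follows from 0 \<le> k1 < K1; the set is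
    bounded above by n.\<close>
  have "K1 \<le> Sup {k. 0 < k \<and> k < ?n \<and> pos_tensor ?M (Ein_tensor k g)}"
    by (rule cSup_upper) (use ein assms(3) K1 in \<open>auto intro!: bdd_aboveI[of _ ?n]\<close>)
  then have 1: "Ein_sup ?M g > k1" using K1 by (simp add: Ein_sup_def sc)
  have "ein_inf ?M g \<le> ereal K2"
    unfolding ein_inf_def if_P[OF sc] by (rule Inf_lower) (use ein K2 assms(5) in auto)
  also have "\<dots> < ereal k2" using K2 by simp
  finally show ?thesis using rm lcf 1 by blast
qed

end
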